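(* Let $\mathfrak g$ be a complex semisimple Lie algebra, let $v$ be a Vogan diagram for $\mathfrak g$, and let $G$, $G_v$, $N$, $B$, $X\cong G/B$ and the Poisson structure $\Pi_v$ on $X$ be as defined in the context. Then each $G_v$-orbit in $X$, as well as each Bruhat cell (i.e. $N$-orbit) in $X$, is a Poisson submanifold with respect to $\Pi_v$.
   Context: For an involution $\sigma$ on a set $V$, $V^\sigma$ denotes its fixed point set; for a real-linear involution $\sigma$ of a vector space $V$, $V^{-\sigma}=\{x\in V:\sigma(x)=-x\}$. Data for $\mathfrak g$. $\mathfrak g$ is a complex semisimple Lie algebra with Killing form $\ll\,,\,\gg$, $\mathfrak h$ is a Cartan subalgebra, $\Delta$ the root system of $(\mathfrak g,\mathfrak h)$, $\Delta^+$ a choice of positive roots, $\Sigma$ the simple roots. For $\alpha\in\Delta$, $H_\alpha\in\mathfrak h$ is defined by $\ll H,H_\alpha\gg=\alpha(H)$ for all $H\in\mathfrak h$. Root vectors $E_\alpha$ ($\alpha\in\Delta$) are chosen such that $[E_\alpha,E_{-\alpha}]=H_\alpha$ for $\alpha\in\Delta^+$, the numbers $m_{\alpha,\beta}$ given by $[E_\alpha,E_\beta]=m_{\alpha,\beta}E_{\alpha+\beta}$ (for $\alpha+\beta\in\Delta$) are real, and $\mathfrak k=\mathrm{span}_{\mathbb R}\{iH_\alpha,\ E_\alpha-E_{-\alpha},\ i(E_\alpha+E_{-\alpha})\}$ is a compact real form of $\mathfrak g$. Let $\theta$ be the complex conjugation of $\mathfrak g$ with fixed point set $\mathfrak k$.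 Vogan diagrams and real forms. A Vogan diagram for $\mathfrak g$ is a triple $v=(D(\mathfrak g),d,\mathcal I)$, where $D(\mathfrak g)$ is the Dynkin diagram, $d$ is an automorphism of $D(\mathfrak g)$ with $d^2=1$ (possibly $d=1$), and $\mathcal I$ is a set of vertices (the painted vertices) with $d(\alpha)=\alpha$ for each $\alpha\in\mathcal I$. Let $\gamma_d$ be the unique automorphism of $\mathfrak g$ with $\gamma_d(H_\alpha)=H_{d(\alpha)}$, $\gamma_d(E_\alpha)=E_{d(\alpha)}$ for all simple $\alpha$. Let $t_v$ be the unique element of the adjoint group of $\mathfrak g$ acting trivially on $\mathfrak h$ with $\mathrm{Ad}_{t_v}E_\alpha=-E_\alpha$ for $\alpha\in\mathcal I$ and $\mathrm{Ad}_{t_v}E_\alpha=E_\alpha$ for simple $\alpha\notin\mathcal I$. Put $\tau_v=\mathrm{Ad}_{t_v}\circ\gamma_d\circ\theta$, a conjugate-linear involution, and $\mathfrak g_v=\mathfrak g^{\tau_v}$, a real form of $\mathfrak g$. Groups. $G$ is the connected and simply connected Lie group with Lie algebra $\mathfrak g$; the lift of $\tau_v$ to $G$ is also denoted $\tau_v$; $G_v=G^{\tau_v}$. $\mathfrak n$ is the span of the positive root vectors, $\mathfrak b=\mathfrak h+\mathfrak n$, and $H,N,B=HN$ are the connected subgroups of $G$ with Lie algebras $\mathfrak h,\mathfrak n,\mathfrak b$. $X$ is the variety of Borel subalgebras of $\mathfrak g$, identified with $G/B$ by $gB\leftrightarrow\mathrm{Ad}_g\mathfrak b$. The Bruhat cells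 in $X$ are the $N$-orbits. The Poisson structure $\Pi_v$. Let $\langle\,,\,\rangle=\mathrm{Im}\ll\,,\,\gg$ and $\mathfrak l_d=\mathfrak h^{-\tau_v}+\mathfrak n$. Then $\mathfrak g=\mathfrak g_v+\mathfrak l_d$ is a Lagrangian splitting: a direct sum of real Lie subalgebras, each of real dimension $\dim_{\mathbb C}\mathfrak g$ and isotropic for $\langle\,,\,\rangle$. Let $\{y_i\}$ be a basis of $\mathfrak g_v$, $\{\xi_i\}$ the basis of $\mathfrak l_d$ dual to it under $\langle\,,\,\rangle$, and $R=\sum_i\xi_i\wedge y_i\in\wedge^2_{\mathbb R}\mathfrak g$ (independent of the choice of basis). Let $\kappa$ be the map sending $x\in\mathfrak g$ to the vector field on $X$ with value $\frac{d}{dt}\big|_{t=0}\exp(tx)\cdot p$ at $p$, extended to $\wedge^2_{\mathbb R}\mathfrak g$. Then $\Pi_v=\frac12\kappa(R)$ is a (real, smooth) Poisson bivector field on $X$ (equivalently, it is obtained by identifying $X\cong G/B$ $G$-equivariantly with the $G$-orbit of the Lagrangian subalgebra $\mathrm{span}_{\mathbb R}\{iH_\alpha:\alpha\in\Sigma\}+\mathfrak n$ in the Grassmannian of real subspaces of $\mathfrak g$ of dimension $\dim_{\mathbb C}\mathfrak g$). A submanifold is a Poisson submanifold if the Poisson bivector field is tangent to it at each of its points. *)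

theory Defs
  imports
    "HOL-Analysis.Analysis"
    "HOL-Algebra.Generated_Groups"
    "HOL-Library.Function_Algebras"
begin

section \<open>Complex semisimple Lie algebras\<close>

text \<open>
  A complex Lie algebra of dimension \<open>CARD('n)\<close> is given by its bracket \<open>br\<close> on the
  coordinate space \<open>complex ^ 'n\<close>. The complex vector space structure is the one of \<open>(*s)\<close>
  (so \<open>vec.span\<close>, \<open>vec.subspace\<close> are complex notions), while \<open>span\<close>, \<open>subspace\<close>, \<open>independent\<close>
  and \<open>linear\<close> refer to the underlying real vector space.
\<close>

type_synonym 'n brkt = "complex ^ 'n \<Rightarrow> complex ^ 'n \<Rightarrow> complex ^ 'n"
type_synonym 'n functional = "complex ^ 'n \<Rightarrow> complex"
type_synonym 'n endo = "(complex ^ 'n) \<Rightarrow>\<^sub>L (complex ^ 'n)"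

definition complex_lie_algebra :: "('n::finite) brkt \<Rightarrow> bool" where
  "complex_lie_algebra br \<longleftrightarrow>
     (\<forall>x. Vector_Spaces.linear (*s) (*s) (\<lambda>y. br x y)) \<and>
     (\<forall>y. Vector_Spaces.linear (*s) (*s) (\<lambda>x. br x y)) \<and>
     (\<forall>x. br x x = 0) \<and>
     (\<forall>x y z. br x (br y z) + br y (br z x) + br z (br x y) = 0)"

primrec derived_series :: "('n::finite) brkt \<Rightarrow> nat \<Rightarrow> (complex ^ 'n) set \<Rightarrow> (complex ^ 'n) set" where
  "derived_series br 0 V = V"
| "derived_series br (Suc k) V =
     vec.span {br x y | x y. x \<in> derived_series br k V \<and> y \<in> derived_series br k V}"

primrec lower_central_series ::
  "('n::finite) brkt \<Rightarrow> nat \<Rightarrow> (complex ^ 'n) set \<Rightarrow> (complex ^ 'n) set" where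
  "lower_central_series br 0 V = V"
| "lower_central_series br (Suc k) V =
     vec.span {br x y | x y. x \<in> V \<and> y \<in> lower_central_series br k V}"

definition lie_ideal :: "('n::finite) brkt \<Rightarrow> (complex ^ 'n) set \<Rightarrow> bool" where
  "lie_ideal br J \<longleftrightarrow> vec.subspace J \<and> (\<forall>x. \<forall>y\<in>J. br x y \<in> J)"

definition semisimple_lie_algebra :: "('n::finite) brkt \<Rightarrow> bool" where
  "semisimple_lie_algebra br \<longleftrightarrow> complex_lie_algebra br \<and>
     (\<forall>J. lie_ideal br J \<and> (\<exists>k. derived_series br k J = {0}) \<longrightarrow> J = {0})"

definition killing :: "('n::finite) brkt \<Rightarrow> complex ^ 'n \<Rightarrow> complex ^ 'n \<Rightarrow> complex" where
  "killing br x y = trace (matrix (\<lambda>z. br x (br y z)))"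

definition cartan_subalgebra :: "('n::finite) brkt \<Rightarrow> (complex ^ 'n) set \<Rightarrow> bool" where
  "cartan_subalgebra br h \<longleftrightarrow>
     vec.subspace h \<and> (\<forall>x\<in>h. \<forall>y\<in>h. br x y \<in> h) \<and>
     (\<exists>k. lower_central_series br k h = {0}) \<and>
     {x. \<forall>y\<in>h. br x y \<in> h} = h"

section \<open>Roots, root vectors and the compact real form\<close>

text \<open>
  A functional on \<open>h\<close> is represented by a function vanishing outside \<open>h\<close>, so that pointwise
  sums and negatives represent sums and negatives of functionals. The eigenvector condition
  forces a root to be linear on \<open>h\<close>.
\<close>

definition roots :: "('n::finite) brkt \<Rightarrow> (complex ^ 'n) set \<Rightarrow> 'n functional set" where
  "roots br h = {\<alpha>. (\<forall>x. x \<notin> h \<longrightarrow> \<alpha> x = 0) \<and> (\<exists>x\<in>h. \<alpha> x \<noteq> 0) \<and>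
                    (\<exists>e. e \<noteq> 0 \<and> (\<forall>x\<in>h. br x e = \<alpha> x *s e))}"

definition positive_system :: "('n::finite) functional set \<Rightarrow> 'n functional set \<Rightarrow> bool" where
  "positive_system \<Delta> P \<longleftrightarrow> P \<subseteq> \<Delta> \<and>
     (\<forall>\<alpha>\<in>\<Delta>. (\<alpha> \<in> P) \<noteq> (- \<alpha> \<in> P)) \<and>
     (\<forall>\<alpha>\<in>P. \<forall>\<beta>\<in>P. \<alpha> + \<beta> \<in> \<Delta> \<longrightarrow> \<alpha> + \<beta> \<in> P)"

definition simple_roots :: "('n::finite) functional set \<Rightarrow> 'n functional set" where
  "simple_roots P = {\<alpha> \<in> P. \<not> (\<exists>\<beta>\<in>P. \<exists>\<gamma>\<in>P. \<alpha> = \<beta> + \<gamma>)}"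

text \<open>\<open>Hc \<alpha>\<close> plays the role of the vector $H_\alpha$; it is determined by this condition.\<close>

definition root_coordinates ::
  "('n::finite) brkt \<Rightarrow> (complex ^ 'n) set \<Rightarrow> ('n functional \<Rightarrow> complex ^ 'n) \<Rightarrow> bool" where
  "root_coordinates br h Hc \<longleftrightarrow>
     (\<forall>\<alpha>\<in>roots br h. Hc \<alpha> \<in> h \<and> (\<forall>x\<in>h. killing br x (Hc \<alpha>) = \<alpha> x))"

definition real_form :: "('n::finite) brkt \<Rightarrow> (complex ^ 'n) set \<Rightarrow> bool" where
  "real_form br K \<longleftrightarrow>
     subspace K \<and> (\<forall>x\<in>K. \<forall>y\<in>K. br x y \<in> K) \<and>
     K \<inter> (\<lambda>x. \<i> *s x) ` K = {0} \<and> {x + \<i> *s y | x y. x \<in> K \<and> y \<in> K} = UNIV"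

text \<open>The Killing form of a real form is the restriction of the one of the complex algebra.\<close>

definition compact_real_form :: "('n::finite) brkt \<Rightarrow> (complex ^ 'n) set \<Rightarrow> bool" where
  "compact_real_form br K \<longleftrightarrow> real_form br K \<and>
     (\<forall>x\<in>K. x \<noteq> 0 \<longrightarrow> killing br x x \<in> \<real> \<and> Re (killing br x x) < 0)"

definition compact_span ::
  "('n::finite) functional set \<Rightarrow> ('n functional \<Rightarrow> complex ^ 'n) \<Rightarrow>
   ('n functional \<Rightarrow> complex ^ 'n) \<Rightarrow> (complex ^ 'n) set" where
  "compact_span \<Delta> Hc E = span (\<Union>\<alpha>\<in>\<Delta>.
     {\<i> *s Hc \<alpha>, E \<alpha> - E (- \<alpha>), \<i> *s (E \<alpha> + E (- \<alpha>))})"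

definition weyl_root_vectors ::
  "('n::finite) brkt \<Rightarrow> (complex ^ 'n) set \<Rightarrow> 'n functional set \<Rightarrow>
   ('n functional \<Rightarrow> complex ^ 'n) \<Rightarrow> ('n functional \<Rightarrow> complex ^ 'n) \<Rightarrow> bool" where
  "weyl_root_vectors br h P Hc E \<longleftrightarrow>
     (\<forall>\<alpha>\<in>roots br h. E \<alpha> \<noteq> 0 \<and> (\<forall>x\<in>h. br x (E \<alpha>) = \<alpha> x *s E \<alpha>)) \<and>
     (\<forall>\<alpha>\<in>P. br (E \<alpha>) (E (- \<alpha>)) = Hc \<alpha>) \<and>
     (\<forall>\<alpha>\<in>roots br h. \<forall>\<beta>\<in>roots br h. \<alpha> + \<beta> \<in> roots br h \<longrightarrow>
        (\<exists>m::real. br (E \<alpha>) (E \<beta>) = complex_of_real m *s E (\<alpha> + \<beta>))) \<and>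
     compact_real_form br (compact_span (roots br h) Hc E)"

definition complex_conjugation :: "(complex ^ ('n::finite)) set \<Rightarrow> (complex ^ 'n \<Rightarrow> complex ^ 'n) \<Rightarrow> bool" where
  "complex_conjugation K \<theta> \<longleftrightarrow>
     (\<forall>x y. \<theta> (x + y) = \<theta> x + \<theta> y) \<and> (\<forall>c x. \<theta> (c *s x) = cnj c *s \<theta> x) \<and>
     (\<forall>x. \<theta> (\<theta> x) = x) \<and> {x. \<theta> x = x} = K"

definition pos_nilradical ::
  "('n::finite) functional set \<Rightarrow> ('n functional \<Rightarrow> complex ^ 'n) \<Rightarrow> (complex ^ 'n) set" where
  "pos_nilradical P E = vec.span (E ` P)"

definition std_borel ::
  "(complex ^ 'n) set \<Rightarrow> ('n::finite) functional set \<Rightarrow> ('n functional \<Rightarrow> complex ^ 'n) \<Rightarrow>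
   (complex ^ 'n) set" where
  "std_borel h P E = {x + y | x y. x \<in> h \<and> y \<in> pos_nilradical P E}"

section \<open>The simply connected group\<close>

definition exp_ad :: "('n::finite) brkt \<Rightarrow> complex ^ 'n \<Rightarrow> 'n endo" where
  "exp_ad br x = Blinfun (\<lambda>z. \<Sum>k. (br x ^^ k) z /\<^sub>R fact k)"

text \<open>The adjoint group: the connected subgroup of the automorphism group with Lie algebra
  \<open>ad\<close>, i.e. the group generated by the \<open>exp_ad br x\<close>; these are closed under inversion.\<close>

inductive_set adjoint_group :: "('n::finite) brkt \<Rightarrow> 'n endo set" for br :: "'n brkt" where
  one: "id_blinfun \<in> adjoint_group br"
| step: "\<phi> \<in> adjoint_group br \<Longrightarrow> exp_ad br x o\<^sub>L \<phi> \<in> adjoint_group br"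

text \<open>
  The connected and simply connected group with the given semisimple Lie algebra is the
  universal covering group of the adjoint group. It is realized as the group of homotopy
  classes (with fixed end points) of paths in the adjoint group issuing from the identity,
  multiplied pointwise; the covering map \<open>Ad\<close> takes the end point of a path. The topology of
  the adjoint group is the one induced by the operator norm: for semisimple algebras the
  adjoint group is the identity component of the automorphism group, hence closed in the
  general linear group.
\<close>

definition path_class :: "('n::finite) brkt \<Rightarrow> (real \<Rightarrow> 'n endo) \<Rightarrow> (real \<Rightarrow> 'n endo) set" where
  "path_class br p = {q. homotopic_paths (adjoint_group br) p q}"

definition sc_group :: "('n::finite) brkt \<Rightarrow> (real \<Rightarrow> 'n endo) set monoid" where
  "sc_group br = \<lparr>
     carrier = {path_class br p | p. path p \<and> path_image p \<subseteq> adjoint_group br \<and>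
                                     pathstart p = id_blinfun},
     monoid.mult = (\<lambda>C D. {r. \<exists>p\<in>C. \<exists>q\<in>D.
                      homotopic_paths (adjoint_group br) (\<lambda>s. p s o\<^sub>L q s) r}),
     one = path_class br (\<lambda>s. id_blinfun) \<rparr>"

definition Ad :: "(real \<Rightarrow> ('n::finite) endo) set \<Rightarrow> 'n endo" where
  "Ad C = pathfinish (SOME p. p \<in> C)"

definition exp_G :: "('n::finite) brkt \<Rightarrow> complex ^ 'n \<Rightarrow> (real \<Rightarrow> 'n endo) set" where
  "exp_G br x = path_class br (\<lambda>s. exp_ad br (s *\<^sub>R x))"

text \<open>A real Lie algebra automorphism \<open>\<tau>\<close> acts on the adjoint group by conjugation, and on
  the covering group by conjugation of paths; this lift has differential \<open>\<tau>\<close>.\<close>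

definition conj_by :: "(complex ^ ('n::finite) \<Rightarrow> complex ^ 'n) \<Rightarrow> 'n endo \<Rightarrow> 'n endo" where
  "conj_by \<tau> \<phi> = Blinfun (\<lambda>x. \<tau> (\<phi> (inv_into UNIV \<tau> x)))"

definition lift_to_G ::
  "('n::finite) brkt \<Rightarrow> (complex ^ 'n \<Rightarrow> complex ^ 'n) \<Rightarrow>
   (real \<Rightarrow> 'n endo) set \<Rightarrow> (real \<Rightarrow> 'n endo) set" where
  "lift_to_G br \<tau> C = {q. \<exists>p\<in>C. homotopic_paths (adjoint_group br) (conj_by \<tau> \<circ> p) q}"

definition fixed_subgroup ::
  "('n::finite) brkt \<Rightarrow> (complex ^ 'n \<Rightarrow> complex ^ 'n) \<Rightarrow> (real \<Rightarrow> 'n endo) set set" where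
  "fixed_subgroup br \<tau> = {C \<in> carrier (sc_group br). lift_to_G br \<tau> C = C}"

text \<open>The connected Lie subgroup with the given Lie algebra, which is generated by
  exponentials.\<close>

definition connected_subgroup ::
  "('n::finite) brkt \<Rightarrow> (complex ^ 'n) set \<Rightarrow> (real \<Rightarrow> 'n endo) set set" where
  "connected_subgroup br s = generate (sc_group br) (exp_G br ` s)"

definition act :: "(real \<Rightarrow> ('n::finite) endo) set \<Rightarrow> (complex ^ 'n) set \<Rightarrow> (complex ^ 'n) set" where
  "act C V = Ad C ` V"

definition orbit ::
  "(real \<Rightarrow> ('n::finite) endo) set set \<Rightarrow> (complex ^ 'n) set \<Rightarrow> (complex ^ 'n) set set" where
  "orbit K V = {act C V | C. C \<in> K}"

text \<open>The variety of Borel subalgebras, i.e. of the conjugates of \<open>b\<close>: the coset \<open>gB\<close>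
  corresponds to the conjugate of \<open>b\<close> by \<open>g\<close>.\<close>

definition flag_variety :: "('n::finite) brkt \<Rightarrow> (complex ^ 'n) set \<Rightarrow> (complex ^ 'n) set set" where
  "flag_variety br b = orbit (carrier (sc_group br)) b"

section \<open>Vogan diagrams\<close>

text \<open>
  The Dynkin diagram has the simple roots as vertices; two distinct vertices are joined by as
  many edges as the product of the two Cartan integers says, with an arrow from the longer to
  the shorter root. The inner product of the roots $\alpha$ and $\beta$ is
  \<open>killing br (Hc \<alpha>) (Hc \<beta>)\<close>, which is real.
\<close>

definition root_inner ::
  "('n::finite) brkt \<Rightarrow> ('n functional \<Rightarrow> complex ^ 'n) \<Rightarrow> 'n functional \<Rightarrow> 'n functional \<Rightarrow> real" where
  "root_inner br Hc \<alpha> \<beta> = Re (killing br (Hc \<alpha>) (Hc \<beta>))"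

definition cartan_number ::
  "('n::finite) brkt \<Rightarrow> ('n functional \<Rightarrow> complex ^ 'n) \<Rightarrow> 'n functional \<Rightarrow> 'n functional \<Rightarrow> real" where
  "cartan_number br Hc \<alpha> \<beta> = 2 * root_inner br Hc \<alpha> \<beta> / root_inner br Hc \<beta> \<beta>"

definition dynkin_edges ::
  "('n::finite) brkt \<Rightarrow> ('n functional \<Rightarrow> complex ^ 'n) \<Rightarrow> 'n functional \<Rightarrow> 'n functional \<Rightarrow> real" where
  "dynkin_edges br Hc \<alpha> \<beta> = cartan_number br Hc \<alpha> \<beta> * cartan_number br Hc \<beta> \<alpha>"

definition dynkin_arrow ::
  "('n::finite) brkt \<Rightarrow> ('n functional \<Rightarrow> complex ^ 'n) \<Rightarrow> 'n functional \<Rightarrow> 'n functional \<Rightarrow> bool" where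
  "dynkin_arrow br Hc \<alpha> \<beta> \<longleftrightarrow> dynkin_edges br Hc \<alpha> \<beta> \<noteq> 0 \<and>
     root_inner br Hc \<alpha> \<alpha> > root_inner br Hc \<beta> \<beta>"

definition dynkin_automorphism ::
  "('n::finite) brkt \<Rightarrow> ('n functional \<Rightarrow> complex ^ 'n) \<Rightarrow> 'n functional set \<Rightarrow>
   ('n functional \<Rightarrow> 'n functional) \<Rightarrow> bool" where
  "dynkin_automorphism br Hc S d \<longleftrightarrow> bij_betw d S S \<and>
     (\<forall>\<alpha>\<in>S. \<forall>\<beta>\<in>S. \<alpha> \<noteq> \<beta> \<longrightarrow>
        dynkin_edges br Hc (d \<alpha>) (d \<beta>) = dynkin_edges br Hc \<alpha> \<beta> \<and>
        (dynkin_arrow br Hc (d \<alpha>) (d \<beta>) \<longleftrightarrow> dynkin_arrow br Hc \<alpha> \<beta>))"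

definition vogan_diagram ::
  "('n::finite) brkt \<Rightarrow> ('n functional \<Rightarrow> complex ^ 'n) \<Rightarrow> 'n functional set \<Rightarrow>
   ('n functional \<Rightarrow> 'n functional) \<Rightarrow> 'n functional set \<Rightarrow> bool" where
  "vogan_diagram br Hc S d I \<longleftrightarrow> dynkin_automorphism br Hc S d \<and>
     (\<forall>\<alpha>\<in>S. d (d \<alpha>) = \<alpha>) \<and> I \<subseteq> S \<and> (\<forall>\<alpha>\<in>I. d \<alpha> = \<alpha>)"

definition lie_automorphism :: "('n::finite) brkt \<Rightarrow> (complex ^ 'n \<Rightarrow> complex ^ 'n) \<Rightarrow> bool" where
  "lie_automorphism br f \<longleftrightarrow> Vector_Spaces.linear (*s) (*s) f \<and> bij f \<and>
     (\<forall>x y. f (br x y) = br (f x) (f y))"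

definition diagram_automorphism_lift ::
  "('n::finite) brkt \<Rightarrow> ('n functional \<Rightarrow> complex ^ 'n) \<Rightarrow> ('n functional \<Rightarrow> complex ^ 'n) \<Rightarrow>
   'n functional set \<Rightarrow> ('n functional \<Rightarrow> 'n functional) \<Rightarrow> (complex ^ 'n \<Rightarrow> complex ^ 'n) \<Rightarrow> bool" where
  "diagram_automorphism_lift br Hc E S d \<gamma> \<longleftrightarrow> lie_automorphism br \<gamma> \<and>
     (\<forall>\<alpha>\<in>S. \<gamma> (Hc \<alpha>) = Hc (d \<alpha>) \<and> \<gamma> (E \<alpha>) = E (d \<alpha>))"

definition painting_element ::
  "('n::finite) brkt \<Rightarrow> (complex ^ 'n) set \<Rightarrow> ('n functional \<Rightarrow> complex ^ 'n) \<Rightarrow>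
   'n functional set \<Rightarrow> 'n functional set \<Rightarrow> 'n endo \<Rightarrow> bool" where
  "painting_element br h E S I t \<longleftrightarrow> t \<in> adjoint_group br \<and> (\<forall>x\<in>h. t x = x) \<and>
     (\<forall>\<alpha>\<in>I. t (E \<alpha>) = - E \<alpha>) \<and> (\<forall>\<alpha>\<in>S - I. t (E \<alpha>) = E \<alpha>)"

definition vogan_involution ::
  "('n::finite) endo \<Rightarrow> (complex ^ 'n \<Rightarrow> complex ^ 'n) \<Rightarrow> (complex ^ 'n \<Rightarrow> complex ^ 'n) \<Rightarrow>
   complex ^ 'n \<Rightarrow> complex ^ 'n" where
  "vogan_involution t \<gamma> \<theta> = blinfun_apply t \<circ> \<gamma> \<circ> \<theta>"

definition lagrangian_complement ::
  "(complex ^ 'n) set \<Rightarrow> ('n::finite) functional set \<Rightarrow> ('n functional \<Rightarrow> complex ^ 'n) \<Rightarrow>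
   (complex ^ 'n \<Rightarrow> complex ^ 'n) \<Rightarrow> (complex ^ 'n) set" where
  "lagrangian_complement h P E \<tau> = {x + y | x y. x \<in> h \<and> \<tau> x = - x \<and> y \<in> pos_nilradical P E}"

section \<open>Immersed submanifolds of a finite-dimensional real vector space\<close>

text \<open>\<open>Ck_on k U f\<close>: all iterated directional derivatives of \<open>f\<close> up to order \<open>k\<close> exist and are
  continuous on the open set \<open>U\<close>.\<close>

primrec Ck_on :: "nat \<Rightarrow> 'a::real_normed_vector set \<Rightarrow> ('a \<Rightarrow> 'b::real_normed_vector) \<Rightarrow> bool" where
  "Ck_on 0 U f \<longleftrightarrow> continuous_on U f"
| "Ck_on (Suc k) U f \<longleftrightarrow> continuous_on U f \<and> (\<forall>x\<in>U. f differentiable (at x)) \<and>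
     (\<forall>v. Ck_on k U (\<lambda>x. frechet_derivative f (at x) v))"

definition smooth_on :: "'a::real_normed_vector set \<Rightarrow> ('a \<Rightarrow> 'b::real_normed_vector) \<Rightarrow> bool" where
  "smooth_on U f \<longleftrightarrow> (\<forall>k. Ck_on k U f)"

definition embedded_submanifold :: "nat \<Rightarrow> 'e::real_normed_vector set \<Rightarrow> bool" where
  "embedded_submanifold k S \<longleftrightarrow>
     (\<forall>p\<in>S. \<exists>U \<Phi> \<Psi> B. open U \<and> p \<in> U \<and> open (\<Phi> ` U) \<and>
        smooth_on U (\<Phi> :: 'e \<Rightarrow> 'e) \<and> smooth_on (\<Phi> ` U) (\<Psi> :: 'e \<Rightarrow> 'e) \<and> (\<forall>x\<in>U. \<Psi> (\<Phi> x) = x) \<and>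
        finite B \<and> card B = k \<and> independent B \<and> \<Phi> ` (U \<inter> S) = \<Phi> ` U \<inter> span B)"

text \<open>
  An injectively immersed submanifold is a subset with a second countable topology of its own
  that has a cover by open subsets each of which is, with its induced topology, an embedded
  submanifold. The tangent space consists of the velocities of curves continuous in that
  topology.
\<close>

definition immersed_submanifold :: "nat \<Rightarrow> 'e::real_normed_vector set \<Rightarrow> 'e topology \<Rightarrow> bool" where
  "immersed_submanifold k S T \<longleftrightarrow> topspace T = S \<and>
     (\<exists>\<B>. countable \<B> \<and> (\<forall>V\<in>\<B>. openin T V) \<and>
          (\<forall>W x. openin T W \<and> x \<in> W \<longrightarrow> (\<exists>V\<in>\<B>. x \<in> V \<and> V \<subseteq> W))) \<and>
     (\<forall>p\<in>S. \<exists>V. openin T V \<and> p \<in> V \<and> embedded_submanifold k V \<and>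
                 subtopology T V = top_of_set V)"

definition tangent_space :: "'e::real_normed_vector topology \<Rightarrow> 'e \<Rightarrow> 'e set" where
  "tangent_space T p =
     {u. \<exists>\<gamma>. continuous_map (top_of_set {-1<..<1}) T \<gamma> \<and> \<gamma> 0 = p \<and>
             (\<gamma> has_vector_derivative u) (at 0)}"

text \<open>Bivectors are represented by the alternating bilinear forms on the dual space that they
  induce. \<open>bivectors W\<close> is the second exterior power of a subspace \<open>W\<close>, inside the one of the
  ambient space.\<close>

type_synonym 'e bivector = "('e \<Rightarrow>\<^sub>L real) \<Rightarrow> ('e \<Rightarrow>\<^sub>L real) \<Rightarrow> real"

definition wedge :: "'e::real_normed_vector \<Rightarrow> 'e \<Rightarrow> 'e bivector" where
  "wedge u w = (\<lambda>\<alpha> \<beta>. blinfun_apply \<alpha> u * blinfun_apply \<beta> w - blinfun_apply \<alpha> w * blinfun_apply \<beta> u)"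

definition bivectors :: "'e::real_normed_vector set \<Rightarrow> 'e bivector set" where
  "bivectors W = {\<omega>. \<exists>(k::nat) u w. (\<forall>i<k. u i \<in> W \<and> w i \<in> W) \<and>
                      \<omega> = (\<lambda>\<alpha> \<beta>. \<Sum>i<k. wedge (u i) (w i) \<alpha> \<beta>)}"

section \<open>The Poisson structure\<close>

text \<open>
  The smooth structure of a Grassmannian is the one of its standard embedding, which sends a
  subspace to the orthogonal projection onto it; the flag variety is a closed submanifold of
  the Grassmannian, and its submanifolds are the submanifolds of the ambient space of
  endomorphisms that are contained in it.
\<close>

definition orth_proj :: "(complex ^ ('n::finite)) set \<Rightarrow> 'n endo" where
  "orth_proj V = Blinfun (closest_point V)"

definition fundamental_field :: "('n::finite) brkt \<Rightarrow> complex ^ 'n \<Rightarrow> (complex ^ 'n) set \<Rightarrow> 'n endo" where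
  "fundamental_field br x p =
     vector_derivative (\<lambda>t::real. orth_proj (act (exp_G br (t *\<^sub>R x)) p)) (at 0)"

definition real_basis :: "nat \<Rightarrow> (nat \<Rightarrow> 'e::real_vector) \<Rightarrow> 'e set \<Rightarrow> bool" where
  "real_basis m y V \<longleftrightarrow> inj_on y {..<m} \<and> independent (y ` {..<m}) \<and> span (y ` {..<m}) = V"

definition dual_families ::
  "('n::finite) brkt \<Rightarrow> nat \<Rightarrow> (nat \<Rightarrow> complex ^ 'n) \<Rightarrow> (nat \<Rightarrow> complex ^ 'n) \<Rightarrow> bool" where
  "dual_families br m \<xi> y \<longleftrightarrow>
     (\<forall>i<m. \<forall>j<m. Im (killing br (\<xi> i) (y j)) = (if i = j then 1 else 0))"

text \<open>Half the image under the infinitesimal action of $\sum_i \xi_i \wedge y_i$.\<close>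

definition poisson_bivector ::
  "('n::finite) brkt \<Rightarrow> nat \<Rightarrow> (nat \<Rightarrow> complex ^ 'n) \<Rightarrow> (nat \<Rightarrow> complex ^ 'n) \<Rightarrow>
   (complex ^ 'n) set \<Rightarrow> ('n endo) bivector" where
  "poisson_bivector br m \<xi> y p = (\<lambda>\<alpha> \<beta>.
     1 / 2 * (\<Sum>i<m. wedge (fundamental_field br (\<xi> i) p) (fundamental_field br (y i) p) \<alpha> \<beta>))"

definition poisson_submanifold ::
  "(complex ^ ('n::finite)) set set \<Rightarrow> ((complex ^ 'n) set \<Rightarrow> ('n endo) bivector) \<Rightarrow>
   (complex ^ 'n) set set \<Rightarrow> bool" where
  "poisson_submanifold X bv S \<longleftrightarrow> S \<subseteq> X \<and>
     (\<exists>k T. immersed_submanifold k (orth_proj ` S) T \<and>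
            (\<forall>p\<in>S. bv p \<in> bivectors (tangent_space T (orth_proj p))))"

end

theory Submission
  imports Defs "HOL-Computational_Algebra.Polynomial"
begin

text \<open>
  Let \<open>q = \<phi> \<bb>\<close> be a point of the flag variety, let \<open>\<kappa>\<close> denote the infinitesimal action at \<open>q\<close>, and let
  \<open>s\<close> be the Lie algebra of the group whose orbit is considered, that is, the real form \<open>\<gg>\<^sub>\<tau>\<close> or the
  nilradical \<open>\<nn>\<close>.

  The first half of the argument is linear algebra. A bivector lies in the second exterior power of the
  subspace \<open>\<kappa>(s)\<close> as soon as its contraction with every covector \<open>\<alpha>\<close> that vanishes on \<open>\<kappa>(s)\<close> is zero
  (\<open>bivector_in_subspace\<close>). The form \<open>\<langle>u,w\<rangle> = Im K u w\<close> is nondegenerate, so \<open>\<alpha> \<circ> \<kappa> = \<langle>z, \<sqdot>\<rangle>\<close>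
  for some \<open>z\<close>. As \<open>\<kappa>\<close> kills \<open>q\<close>, this \<open>z\<close> is orthogonal to the Borel subalgebra \<open>q\<close>; it therefore lies in the
  nilradical \<open>\<phi> \<nn>\<close> of \<open>q\<close>, and in particular \<open>\<kappa> z = 0\<close>. The splitting of the Lie algebra into \<open>\<gg>\<^sub>\<tau>\<close> and \<open>\<ll>\<close>
  is Lagrangian, so \<open>z\<close> is the sum of \<open>\<Sum> \<langle>z,\<xi>\<^sub>i\<rangle> y\<^sub>i\<close> in \<open>\<gg>\<^sub>\<tau>\<close> and \<open>\<Sum> \<langle>z,y\<^sub>i\<rangle> \<xi>\<^sub>i\<close> in \<open>\<ll>\<close>, and the
  contraction is half of the difference of the images of these two components under \<open>\<kappa>\<close>. If \<open>\<alpha>\<close> vanishes on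
  \<open>\<kappa>(\<gg>\<^sub>\<tau>)\<close>, then \<open>z\<close> is orthogonal to \<open>\<gg>\<^sub>\<tau>\<close> and hence in \<open>\<gg>\<^sub>\<tau>\<close>; if it vanishes on \<open>\<kappa>(\<nn>)\<close>, then \<open>z\<close> is in
  \<open>\<bb> \<inter> \<phi> \<nn>\<close>, which is contained in \<open>\<nn>\<close> and so in \<open>\<ll>\<close>. In both cases one of the components is \<open>z\<close>, the other
  one is \<open>0\<close>, and the contraction is \<open>\<plusminus> \<kappa> z / 2 = 0\<close> (\<open>poisson_bivector_tangent\<close>). The inclusion
  \<open>\<bb> \<inter> \<phi> \<nn> \<subseteq> \<nn>\<close> holds because the elements of \<open>\<phi> \<nn>\<close> are ad-nilpotent, while an ad-nilpotent element of
  \<open>\<bb> = h + \<nn>\<close> has no component in \<open>h\<close> (\<open>bb_inter_nilradical\<close>).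

  The second half shows that the orbits are immersed submanifolds and that \<open>\<kappa>(s)\<close> consists of velocities of curves in
  them (\<open>orbit_immersed_submanifold\<close>, \<open>orbit_velocity_tangent\<close>). This is done for a group \<open>L\<close> of operators
  such that a small \<open>C\<close> belongs to its Lie algebra \<open>l\<close> whenever \<open>exp C\<close> belongs to \<open>L\<close>. The orbit carries the
  quotient topology of \<open>L\<close>, and near a point it is parametrized by \<open>exp\<close> on a complement of the stabilizer in \<open>l\<close>.
  In the Grassmannian, which is embedded by orthogonal projections, this parametrization is smooth and the inverse function
  theorem straightens it. Both groups of the theorem have the required property: an
  automorphism \<open>exp C\<close> with \<open>C\<close> small comes from a derivation \<open>C\<close>, and derivations are inner (\<open>adjoint_log\<close>);
  that \<open>exp C\<close> commutes with \<open>\<tau>\<close>, or that \<open>exp C - 1\<close> raises weights by sums of positive roots, is inherited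
  by \<open>C\<close>.

  The structure theory is derived from the compact real form, which makes the Killing form nondegenerate and the
  inner products of roots real and positive definite. The Vogan diagram enters through \<open>\<tau>\<close>: it is a conjugate-linear
  automorphism, and it is an involution on \<open>h\<close> because it sends \<open>Hc \<alpha>\<close>
  to \<open>- Hc (d \<alpha>)\<close> for simple \<open>\<alpha>\<close>; this is what makes \<open>\<ll>\<close> a maximal isotropic subspace (\<open>ll_maximal_isotropic\<close>).
\<close>

section \<open>Calculus of $C^k$ maps\<close>

lemmas compose_FDERIV = bounded_bilinear.FDERIV[OF bounded_bilinear_blinfun_compose]
lemmas compose_bounded_linear_left = bounded_bilinear.bounded_linear_left[OF bounded_bilinear_blinfun_compose]
lemmas compose_bounded_linear_right = bounded_bilinear.bounded_linear_right[OF bounded_bilinear_blinfun_compose]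
lemmas compose_minus_left = bounded_bilinear.minus_left[OF bounded_bilinear_blinfun_compose]
lemmas compose_minus_right = bounded_bilinear.minus_right[OF bounded_bilinear_blinfun_compose]
lemmas compose_scaleR_left = bounded_bilinear.scaleR_left[OF bounded_bilinear_blinfun_compose]
lemmas compose_scaleR_right = bounded_bilinear.scaleR_right[OF bounded_bilinear_blinfun_compose]

lemma Ck_on_continuous: "Ck_on k U f \<Longrightarrow> continuous_on U f"
  by (cases k) auto

lemma Ck_on_SucD:
  assumes "Ck_on (Suc k) U f"
  shows "\<And>x. x \<in> U \<Longrightarrow> (f has_derivative frechet_derivative f (at x)) (at x)"
    and "\<And>v. Ck_on k U (\<lambda>x. frechet_derivative f (at x) v)"
  using assms by (auto simp: frechet_derivative_works)

lemma Ck_on_subset: "Ck_on k U f \<Longrightarrow> V \<subseteq> U \<Longrightarrow> Ck_on k V f"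
  by (induction k arbitrary: f) (auto intro: continuous_on_subset)

lemma Ck_on_pred: "Ck_on (Suc k) U f \<Longrightarrow> Ck_on k U f"
  by (induction k arbitrary: f) auto

lemma Ck_on_cong:
  assumes "open U" "\<And>x. x \<in> U \<Longrightarrow> f x = g x" "Ck_on k U f"
  shows "Ck_on k U g"
  using assms(2,3)
proof (induction k arbitrary: f g)
  case 0
  then show ?case by (simp cong: continuous_on_cong)
next
  case (Suc k)
  have fg: "(g has_derivative frechet_derivative f (at x)) (at x)" if "x \<in> U" for x
    using has_derivative_transform_within_open[OF Ck_on_SucD(1)[OF Suc.prems(2) that] assms(1) that]
      Suc.prems(1) by auto
  have eq: "frechet_derivative f (at x) = frechet_derivative g (at x)" if "x \<in> U" for x
    using fg[OF that] by (rule frechet_derivative_at)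
  have c: "continuous_on U f" using Suc.prems(2) by simp
  have "continuous_on U g"
    using c Suc.prems(1) continuous_on_cong[of U U f g] by auto
  moreover have "Ck_on k U (\<lambda>x. frechet_derivative g (at x) v)" for v
    using Suc.IH[of "\<lambda>x. frechet_derivative f (at x) v" "\<lambda>x. frechet_derivative g (at x) v"]
      eq Ck_on_SucD(2)[OF Suc.prems(2)] by auto
  ultimately show ?case using fg by (auto simp: differentiable_def)
qed

lemma Ck_on_SucI:
  assumes "open U" "\<And>x. x \<in> U \<Longrightarrow> (f has_derivative f' x) (at x)"
    and "\<And>v. Ck_on k U (\<lambda>x. f' x v)"
  shows "Ck_on (Suc k) U f"
proof -
  have eq: "f' x = frechet_derivative f (at x)" if "x \<in> U" for x
    using frechet_derivative_at[OF assms(2)[OF that]] .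
  have "continuous_on U f"
    using assms(2) by (meson continuous_at_imp_continuous_on has_derivative_continuous)
  moreover have "Ck_on k U (\<lambda>x. frechet_derivative f (at x) v)" for v
    by (rule Ck_on_cong[OF assms(1) _ assms(3)[of v]]) (simp add: eq)
  ultimately show ?thesis using assms(2) by (auto simp: differentiable_def)
qed

lemma Ck_on_const: "open U \<Longrightarrow> Ck_on k U (\<lambda>x. c)"
proof (induction k arbitrary: c)
  case (Suc k)
  show ?case by (rule Ck_on_SucI[where f'="\<lambda>x v. 0"]) (use Suc in \<open>auto intro!: derivative_eq_intros\<close>)
qed auto

lemma Ck_on_bounded_linear_comp:
  assumes "open U" "bounded_linear L" "Ck_on k U f"
  shows "Ck_on k U (\<lambda>x. L (f x))"
  using assms(3)
proof (induction k arbitrary: f)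
  case 0
  then show ?case using bounded_linear.continuous_on[OF assms(2)] by auto
next
  case (Suc k)
  show ?case
    by (rule Ck_on_SucI[OF assms(1) bounded_linear.has_derivative[OF assms(2) Ck_on_SucD(1)[OF Suc.prems]]])
      (use Suc.IH Ck_on_SucD(2)[OF Suc.prems] in auto)
qed

lemma Ck_on_bounded_linear:
  assumes "open U" "bounded_linear L"
  shows "Ck_on k U L"
proof (cases k)
  case 0
  then show ?thesis using assms(2) by (simp add: linear_continuous_on)
next
  case (Suc j)
  show ?thesis unfolding Suc
    by (rule Ck_on_SucI[OF assms(1), where f'="\<lambda>x v. L v"])
      (use assms bounded_linear_imp_has_derivative Ck_on_const in auto)
qed

lemma Ck_on_add:
  assumes "open U" "Ck_on k U f" "Ck_on k U g"
  shows "Ck_on k U (\<lambda>x. f x + g x)"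
  using assms(2,3)
proof (induction k arbitrary: f g)
  case 0
  then show ?case by (auto intro: continuous_on_add)
next
  case (Suc k)
  show ?case
    by (rule Ck_on_SucI[OF assms(1), where f'="\<lambda>x v. frechet_derivative f (at x) v + frechet_derivative g (at x) v"])
      (use Suc.IH Ck_on_SucD[OF Suc.prems(1)] Ck_on_SucD[OF Suc.prems(2)] has_derivative_add in auto)
qed

lemma Ck_on_sum:
  assumes "open U" "\<And>i. i \<in> A \<Longrightarrow> Ck_on k U (f i)"
  shows "Ck_on k U (\<lambda>x. \<Sum>i\<in>A. f i x)"
  using assms(2)
  by (induction A rule: infinite_finite_induct) (auto intro!: Ck_on_add Ck_on_const assms(1))

lemma Ck_on_minus:
  assumes "open U" "Ck_on k U f"
  shows "Ck_on k U (\<lambda>x. - f x)"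
  using Ck_on_bounded_linear_comp[OF assms(1) _ assms(2), of uminus]
  by (simp add: bounded_linear_minus bounded_linear_ident)

lemma Ck_on_diff:
  assumes "open U" "Ck_on k U f" "Ck_on k U g"
  shows "Ck_on k U (\<lambda>x. f x - g x)"
  using Ck_on_add[OF assms(1,2) Ck_on_minus[OF assms(1,3)]] by simp

text \<open>The product rule reduces order \<open>k + 1\<close> to order \<open>k\<close> for both factors and their derivatives; this
  is why the induction is over all pairs of maps.\<close>

lemma Ck_on_bilinear:
  assumes "open U" "bounded_bilinear b" "Ck_on k U f" "Ck_on k U g"
  shows "Ck_on k U (\<lambda>x. b (f x) (g x))"
  using assms(3,4)
proof (induction k arbitrary: f g)
  case 0
  then show ?case by (auto intro: bounded_bilinear.continuous_on[OF assms(2)])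
next
  case (Suc k)
  show ?case
  proof (rule Ck_on_SucI[OF assms(1), where f'="\<lambda>x v. b (f x) (frechet_derivative g (at x) v)
      + b (frechet_derivative f (at x) v) (g x)"])
    fix x assume "x \<in> U"
    then show "((\<lambda>x. b (f x) (g x)) has_derivative (\<lambda>v. b (f x) (frechet_derivative g (at x) v)
      + b (frechet_derivative f (at x) v) (g x))) (at x)"
      using bounded_bilinear.FDERIV[OF assms(2) Ck_on_SucD(1)[OF Suc.prems(1)] Ck_on_SucD(1)[OF Suc.prems(2)]]
      by auto
  next
    fix v
    show "Ck_on k U (\<lambda>x. b (f x) (frechet_derivative g (at x) v) + b (frechet_derivative f (at x) v) (g x))"
      by (intro Ck_on_add[OF assms(1)] Suc.IH Ck_on_SucD(2) Suc.prems Ck_on_pred)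
  qed
qed

text \<open>From \<open>g y - g x = - g y (f y - f x) g x\<close> the norms \<open>norm (g y)\<close> stay bounded near \<open>x\<close>, and then
  the same identity gives convergence.\<close>

lemma operator_inverse_continuous:
  fixes f :: "'x::real_normed_vector \<Rightarrow> 'a::real_normed_vector \<Rightarrow>\<^sub>L 'b::real_normed_vector"
  assumes f: "continuous_on U f"
    and inv: "\<And>x. x \<in> U \<Longrightarrow> f x o\<^sub>L g x = id_blinfun" "\<And>x. x \<in> U \<Longrightarrow> g x o\<^sub>L f x = id_blinfun"
  shows "continuous_on U g"
  unfolding continuous_on_def
proof
  fix x assume x: "x \<in> U"
  define G where "G = norm (g x)"
  let ?F = "at x within U"
  have d: "((\<lambda>y. norm (f y - f x)) \<longlongrightarrow> 0) ?F"
    using f x unfolding continuous_on_def by (auto simp: tendsto_norm_zero_iff LIM_zero_iff)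
  then have d2: "((\<lambda>y. G * norm (f y - f x)) \<longlongrightarrow> 0) ?F" "((\<lambda>y. 2 * G * norm (f y - f x) * G) \<longlongrightarrow> 0) ?F"
    using tendsto_mult_left[OF d, of G] tendsto_mult_left[OF d, of "2*G*G"] by (auto simp: mult_ac)
  have ev: "\<forall>\<^sub>F y in ?F. G * norm (f y - f x) < 1/2"
    using order_tendstoD(2)[OF d2(1), of "1/2"] by simp
  have evU: "\<forall>\<^sub>F y in ?F. y \<in> U" by (simp add: eventually_at_filter)
  have key: "\<forall>\<^sub>F y in ?F. norm (g y - g x) \<le> 2 * G * norm (f y - f x) * G"
    using ev evU
  proof eventually_elim
    case (elim y)
    have "blinfun_apply (g y - g x) v = blinfun_apply (- (g y o\<^sub>L (f y - f x) o\<^sub>L g x)) v" for v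
    proof -
      have "g y (f y (g x v)) = g x v" "g y (f x (g x v)) = g y v"
        using inv(2)[OF elim(2)] inv(1)[OF x]
        by (metis blinfun_apply_blinfun_compose blinfun_apply_id_blinfun)+
      then show ?thesis by (simp add: blinfun.bilinear_simps)
    qed
    then have eq: "g y - g x = - (g y o\<^sub>L (f y - f x) o\<^sub>L g x)" by (rule blinfun_eqI)
    have n: "norm (g y - g x) \<le> norm (g y) * norm (f y - f x) * G"
      unfolding eq norm_minus_cancel G_def
      by (meson mult_right_mono norm_blinfun_compose norm_ge_zero order_trans)
    have "norm (g y) \<le> norm (g x) + norm (g y - g x)" by (metis add_diff_cancel_left' diff_add_cancel norm_triangle_ineq)
    also have "\<dots> \<le> G + norm (g y) * (G * norm (f y - f x))" using n by (simp add: G_def mult_ac)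
    also have "\<dots> \<le> G + norm (g y) * (1/2)"
      using elim(1) by (intro add_left_mono mult_left_mono) auto
    finally have "norm (g y) \<le> 2 * G" by simp
    then have "norm (g y) * norm (f y - f x) * G \<le> 2 * G * norm (f y - f x) * G"
      by (intro mult_right_mono) (auto simp: G_def)
    with n show ?case by linarith
  qed
  have "((\<lambda>y. g y - g x) \<longlongrightarrow> 0) ?F"
    by (rule Lim_null_comparison[OF key d2(2)])
  then show "(g \<longlongrightarrow> g x) ?F" by (simp add: LIM_zero_iff)
qed

lemma operator_inverse_has_derivative:
  fixes f :: "'x::real_normed_vector \<Rightarrow> 'a::real_normed_vector \<Rightarrow>\<^sub>L 'b::real_normed_vector"
  assumes U: "open U" and x: "x \<in> U" and f: "continuous_on U f" "(f has_derivative f') (at x)"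
    and inv: "\<And>x. x \<in> U \<Longrightarrow> f x o\<^sub>L g x = id_blinfun" "\<And>x. x \<in> U \<Longrightarrow> g x o\<^sub>L f x = id_blinfun"
  shows "(g has_derivative (\<lambda>v. - (g x o\<^sub>L f' v o\<^sub>L g x))) (at x)"
proof -
  have g: "continuous_on U g" by (rule operator_inverse_continuous[OF f(1) inv])
  have gx: "(g \<longlongrightarrow> g x) (at x)"
    using g U x by (metis continuous_on_eq_continuous_at isCont_def)
  have bl: "bounded_linear f'" using f(2) has_derivative_bounded_linear by blast
  \<comment> \<open>Write \<open>g y - g x = - g y (f y - f x) g x\<close> and use continuity of \<open>g\<close>.\<close>
  have eq: "g y - g x = - (g y o\<^sub>L (f y - f x) o\<^sub>L g x)" if "y \<in> U" for y
  proof (rule blinfun_eqI)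
    fix v
    have "g y (f y (g x v)) = g x v" "g y (f x (g x v)) = g y v"
      using inv(2)[OF that] inv(1)[OF x]
      by (metis blinfun_apply_blinfun_compose blinfun_apply_id_blinfun)+
    then show "blinfun_apply (g y - g x) v = blinfun_apply (- (g y o\<^sub>L (f y - f x) o\<^sub>L g x)) v"
      by (simp add: blinfun.bilinear_simps)
  qed
  let ?B = "\<lambda>A. - (A o\<^sub>L g x)"
  have blB: "bounded_linear (\<lambda>A::'a \<Rightarrow>\<^sub>L 'b. (C::'b \<Rightarrow>\<^sub>L 'a) o\<^sub>L A o\<^sub>L g x)" for C
    by (intro bounded_linear_compose[OF compose_bounded_linear_left
        compose_bounded_linear_right])
  obtain K where K: "\<And>v. norm (f' v) \<le> norm v * K" "K > 0" using bounded_linear.pos_bounded[OF bl] by blast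
  have rem: "((\<lambda>y. (1 / norm (y - x)) *\<^sub>R (f y - (f x + f' (y - x)))) \<longlongrightarrow> 0) (at x)"
    using f(2) by (simp add: has_derivative_at_within divide_inverse diff_diff_eq)
  have lim1: "((\<lambda>y. - (g y o\<^sub>L ((1 / norm (y - x)) *\<^sub>R (f y - (f x + f' (y - x)))) o\<^sub>L g x)) \<longlongrightarrow> - (g x o\<^sub>L 0 o\<^sub>L g x)) (at x)"
    by (intro tendsto_intros gx rem)
  have lim2: "((\<lambda>y. - ((g y - g x) o\<^sub>L ((1 / norm (y - x)) *\<^sub>R f' (y - x)) o\<^sub>L g x)) \<longlongrightarrow> 0) (at x)"
  proof (rule Lim_null_comparison)
    show "\<forall>\<^sub>F y in at x. norm (- ((g y - g x) o\<^sub>L ((1 / norm (y - x)) *\<^sub>R f' (y - x)) o\<^sub>L g x)) \<le> norm (g y - g x) * (K * norm (g x))"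
      unfolding eventually_at_filter
    proof (rule always_eventually, intro allI impI)
      fix y assume "y \<noteq> x"
      then have "norm ((1 / norm (y - x)) *\<^sub>R f' (y - x)) \<le> K"
        using K(1)[of "y - x"] by (simp add: field_simps)
      have "norm ((g y - g x) o\<^sub>L ((1 / norm (y - x)) *\<^sub>R f' (y - x)) o\<^sub>L g x)
        \<le> norm (g y - g x) * norm ((1 / norm (y - x)) *\<^sub>R f' (y - x)) * norm (g x)"
        by (meson mult_right_mono norm_blinfun_compose norm_ge_zero order_trans)
      also have "\<dots> \<le> norm (g y - g x) * K * norm (g x)"
        by (intro mult_right_mono mult_left_mono) (use \<open>_ \<le> K\<close> in auto)
      finally show "norm (- ((g y - g x) o\<^sub>L ((1 / norm (y - x)) *\<^sub>R f' (y - x)) o\<^sub>L g x)) \<le> norm (g y - g x) * (K * norm (g x))"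
        by (simp add: mult.assoc)
    qed
    have "((\<lambda>y. norm (g y - g x)) \<longlongrightarrow> 0) (at x)" using gx by (auto simp: tendsto_norm_zero_iff LIM_zero_iff)
    then show "((\<lambda>y. norm (g y - g x) * (K * norm (g x))) \<longlongrightarrow> 0) (at x)"
      by (rule tendsto_mult_left_zero)
  qed
  have lim: "((\<lambda>y. (1 / norm (y - x)) *\<^sub>R (g y - (g x + - (g x o\<^sub>L f' (y - x) o\<^sub>L g x)))) \<longlongrightarrow> 0) (at x)"
  proof (rule Lim_transform_eventually)
    show "((\<lambda>y. - (g y o\<^sub>L ((1 / norm (y - x)) *\<^sub>R (f y - (f x + f' (y - x)))) o\<^sub>L g x)
         + - ((g y - g x) o\<^sub>L ((1 / norm (y - x)) *\<^sub>R f' (y - x)) o\<^sub>L g x)) \<longlongrightarrow> 0) (at x)"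
      using tendsto_add[OF lim1 lim2] by simp
    have "\<forall>\<^sub>F y in at x. y \<in> U" using U x eventually_at_in_open' by blast
    then show "\<forall>\<^sub>F y in at x. - (g y o\<^sub>L ((1 / norm (y - x)) *\<^sub>R (f y - (f x + f' (y - x)))) o\<^sub>L g x)
         + - ((g y - g x) o\<^sub>L ((1 / norm (y - x)) *\<^sub>R f' (y - x)) o\<^sub>L g x)
       = (1 / norm (y - x)) *\<^sub>R (g y - (g x + - (g x o\<^sub>L f' (y - x) o\<^sub>L g x)))"
    proof eventually_elim
      case (elim y)
      have "g y (f y (g x v)) = g x v" "g y (f x (g x v)) = g y v" for v
        using inv(2)[OF elim] inv(1)[OF x]
        by (metis blinfun_apply_blinfun_compose blinfun_apply_id_blinfun)+
      then show ?case
        by (intro blinfun_eqI) (simp add: blinfun.bilinear_simps algebra_simps)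
    qed
  qed
  show ?thesis
    using lim bounded_linear_minus[OF bounded_linear_compose[OF blB bl]]
    by (simp add: has_derivative_at_within divide_inverse diff_diff_eq diff_diff_eq2 algebra_simps)
qed

text \<open>The derivative of the inverse is \<open>- g (f' v) g\<close>, which again contains only \<open>g\<close> and a derivative of
  \<open>f\<close>, so regularity of \<open>f\<close> passes to \<open>g\<close> one order at a time.\<close>

lemma Ck_on_operator_inverse:
  fixes f :: "'x::real_normed_vector \<Rightarrow> 'a::real_normed_vector \<Rightarrow>\<^sub>L 'b::real_normed_vector"
  assumes U: "open U" and f: "Ck_on k U f"
    and inv: "\<And>x. x \<in> U \<Longrightarrow> f x o\<^sub>L g x = id_blinfun" "\<And>x. x \<in> U \<Longrightarrow> g x o\<^sub>L f x = id_blinfun"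
  shows "Ck_on k U g"
  using f
proof (induction k)
  case 0
  then show ?case using operator_inverse_continuous[OF _ inv] by auto
next
  case (Suc k)
  have g: "Ck_on k U g" using Suc.IH Ck_on_pred[OF Suc.prems] by blast
  show ?case
    by (rule Ck_on_SucI[OF U operator_inverse_has_derivative[OF U _ _ Ck_on_SucD(1)[OF Suc.prems] inv]])
      (use Suc.prems in \<open>auto intro!: Ck_on_minus Ck_on_bilinear[OF U bounded_bilinear_blinfun_compose] g
          U Ck_on_SucD(2)\<close>)
qed

section \<open>Finite-dimensional normed spaces\<close>

text \<open>Spaces of operators carry the operator norm, so they are not Euclidean spaces; a linear
  homeomorphism \<open>J\<close> with a Euclidean space transports the finite-dimensional results to them.\<close>

locale fin_dim_normed =
  fixes J :: "'e::real_normed_vector \<Rightarrow> 'a::euclidean_space" and J' :: "'a \<Rightarrow> 'e"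
  assumes blJ: "bounded_linear J" and blJ': "bounded_linear J'"
    and JJ' [simp]: "J (J' a) = a" and J'J [simp]: "J' (J x) = x"
begin

lemma linear_imp_bounded_linear:
  fixes f :: "'e \<Rightarrow> 'b::real_normed_vector"
  assumes "linear f"
  shows "bounded_linear f"
proof -
  have "linear (f \<circ> J')" using assms blJ' bounded_linear.linear linear_compose by blast
  then have "bounded_linear (f \<circ> J')" by (simp add: linear_conv_bounded_linear)
  then have "bounded_linear (\<lambda>x. (f \<circ> J') (J x))" using blJ by (rule bounded_linear_compose)
  then show ?thesis by simp
qed

lemma expand: "(\<Sum>b\<in>Basis. (J x \<bullet> b) *\<^sub>R J' b) = x"
proof -
  have "(\<Sum>b\<in>Basis. (J x \<bullet> b) *\<^sub>R J' b) = J' (\<Sum>b\<in>Basis. (J x \<bullet> b) *\<^sub>R b)"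
    using bounded_linear.linear[OF blJ'] by (simp add: linear_sum linear_scale)
  then show ?thesis by (simp add: euclidean_representation)
qed

lemma linear_expand:
  assumes "linear f"
  shows "(\<Sum>b\<in>Basis. (J x \<bullet> b) *\<^sub>R f (J' b)) = f x"
proof -
  have "f x = f (\<Sum>b\<in>Basis. (J x \<bullet> b) *\<^sub>R J' b)" by (simp add: expand)
  also have "\<dots> = (\<Sum>b\<in>Basis. (J x \<bullet> b) *\<^sub>R f (J' b))"
    using assms by (simp add: linear_sum linear_scale)
  finally show ?thesis ..
qed

lemma bounded_linear_coordinate: "bounded_linear (\<lambda>x. J x \<bullet> b)"
  using bounded_linear_compose[OF bounded_linear_inner_left blJ] .

text \<open>In the chain rule, expanding the inner derivative in a basis separates it from the outer one: the
  partial derivatives of \<open>f\<close>, composed with \<open>g\<close>, are compositions of the same kind, and the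
  coordinates of the derivative of \<open>g\<close> are scalar factors.\<close>

lemma Ck_on_compose:
  fixes g :: "'x::real_normed_vector \<Rightarrow> 'e" and f :: "'e \<Rightarrow> 'y::real_normed_vector"
  assumes "open U" "open V" "g ` U \<subseteq> V" "Ck_on k U g" "Ck_on k V f"
  shows "Ck_on k U (\<lambda>x. f (g x))"
  using assms(4,5)
proof (induction k arbitrary: f)
  case 0
  then show ?case using assms(3) by (auto intro: continuous_on_compose2)
next
  case (Suc k)
  have df: "(f has_derivative frechet_derivative f (at (g x))) (at (g x))" if "x \<in> U" for x
    using Ck_on_SucD(1)[OF Suc.prems(2)] assms(3) that by blast
  show ?case
  proof (rule Ck_on_SucI[OF assms(1)])
    fix x assume x: "x \<in> U"
    have "((f \<circ> g) has_derivative (frechet_derivative f (at (g x)) \<circ> frechet_derivative g (at x))) (at x)"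
      by (rule diff_chain_at[OF Ck_on_SucD(1)[OF Suc.prems(1) x] df[OF x]])
    moreover have "frechet_derivative f (at (g x)) \<circ> frechet_derivative g (at x)
       = (\<lambda>v. \<Sum>b\<in>Basis. (J (frechet_derivative g (at x) v) \<bullet> b) *\<^sub>R frechet_derivative f (at (g x)) (J' b))"
      by (rule ext) (simp add: linear_expand[OF has_derivative_linear[OF df[OF x]]])
    ultimately show "((\<lambda>x. f (g x)) has_derivative (\<lambda>v. \<Sum>b\<in>Basis. (J (frechet_derivative g (at x) v) \<bullet> b) *\<^sub>R
          frechet_derivative f (at (g x)) (J' b))) (at x)"
      by (simp add: o_def)
  next
    fix v
    show "Ck_on k U (\<lambda>x. \<Sum>b\<in>Basis. (J (frechet_derivative g (at x) v) \<bullet> b) *\<^sub>R frechet_derivative f (at (g x)) (J' b))"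
      by (intro Ck_on_sum Ck_on_bilinear[OF assms(1) bounded_bilinear_scaleR]
            Ck_on_bounded_linear_comp[OF assms(1) bounded_linear_coordinate]
            Suc.IH Ck_on_pred[OF Suc.prems(1)] Ck_on_SucD(2) Suc.prems assms(1))
  qed
qed

definition derivative_op :: "('e \<Rightarrow> 'e) \<Rightarrow> 'e \<Rightarrow> 'e \<Rightarrow>\<^sub>L 'e" where
  "derivative_op f x = Blinfun (frechet_derivative f (at x))"

lemma derivative_op_apply:
  assumes "(f has_derivative f') (at x)"
  shows "blinfun_apply (derivative_op f x) = f'"
  using assms frechet_derivative_at[OF assms] has_derivative_bounded_linear[OF assms]
  by (simp add: derivative_op_def bounded_linear_Blinfun_apply)

lemma Ck_on_derivative_op:
  assumes "open U" "Ck_on (Suc k) U f"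
  shows "Ck_on k U (derivative_op f)"
proof -
  define T where "T b w = blinfun_scaleR_left w o\<^sub>L (blinfun_inner_left b o\<^sub>L Blinfun J)" for b and w :: 'e
  have T: "blinfun_apply (T b w) v = (J v \<bullet> b) *\<^sub>R w" for b w v
    by (simp add: T_def bounded_linear_Blinfun_apply blJ blinfun_inner_left.rep_eq)
  have blT: "bounded_linear (T b)" for b
    unfolding T_def
    by (rule bounded_linear_compose[OF compose_bounded_linear_left
          bounded_linear_blinfun_scaleR_left])
  have "Ck_on k U (\<lambda>x. \<Sum>b\<in>Basis. T b (frechet_derivative f (at x) (J' b)))"
    by (rule Ck_on_sum[OF assms(1) Ck_on_bounded_linear_comp[OF assms(1) blT Ck_on_SucD(2)[OF assms(2)]]])
  moreover have eq: "(\<Sum>b\<in>Basis. T b (frechet_derivative f (at x) (J' b))) = derivative_op f x" if "x \<in> U" for x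
  proof (rule blinfun_eqI)
    fix v
    have d: "(f has_derivative frechet_derivative f (at x)) (at x)" by (rule Ck_on_SucD(1)[OF assms(2) that])
    show "blinfun_apply (\<Sum>b\<in>Basis. T b (frechet_derivative f (at x) (J' b))) v = blinfun_apply (derivative_op f x) v"
      unfolding blinfun.sum_left T derivative_op_apply[OF d] linear_expand[OF has_derivative_linear[OF d]] ..
  qed
  ultimately show ?thesis using Ck_on_cong[OF assms(1) eq] by simp
qed

lemma inverse_function:
  fixes f :: "'e \<Rightarrow> 'e"
  assumes "open U" "\<And>x. x \<in> U \<Longrightarrow> (f has_derivative blinfun_apply (f' x)) (at x)"
    and "continuous_on U f'" "x0 \<in> U" "invf o\<^sub>L f' x0 = id_blinfun"
  obtains U' V g g' where "open U'" "U' \<subseteq> U" "x0 \<in> U'" "open V" "f x0 \<in> V" "homeomorphism U' V f g"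
    "\<And>y. y \<in> V \<Longrightarrow> (g has_derivative blinfun_apply (g' y)) (at y)"
    "\<And>y. y \<in> V \<Longrightarrow> f' (g y) o\<^sub>L g' y = id_blinfun"
    "\<And>y. y \<in> V \<Longrightarrow> g' y o\<^sub>L f' (g y) = id_blinfun"
proof -
  define bJ bJ' where "bJ = Blinfun J" and "bJ' = Blinfun J'"
  have [simp]: "blinfun_apply bJ = J" "blinfun_apply bJ' = J'"
    by (simp_all add: bJ_def bJ'_def blJ blJ' bounded_linear_Blinfun_apply)
  let ?F = "\<lambda>a. J (f (J' a))"
  let ?F' = "\<lambda>a. bJ o\<^sub>L f' (J' a) o\<^sub>L bJ'"
  have cJ: "continuous_on S J" "continuous_on T J'" for S T
    using blJ blJ' linear_continuous_on by auto
  have op: "open (J' -` A)" if "open A" for A using that cJ(2) by (simp add: open_vimage continuous_on_eq_continuous_at)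
  have opJ: "open (J -` A)" if "open A" for A using that cJ(1) by (simp add: open_vimage continuous_on_eq_continuous_at)
  obtain U1 V1 g1 g1' where 1: "open U1" "U1 \<subseteq> J' -` U" "J x0 \<in> U1" "open V1" "?F (J x0) \<in> V1"
    "homeomorphism U1 V1 ?F g1" "\<And>y. y \<in> V1 \<Longrightarrow> (g1 has_derivative (g1' y)) (at y)"
    "\<And>y. y \<in> V1 \<Longrightarrow> g1' y = inv_into UNIV (blinfun_apply (?F' (g1 y)))"
    "\<And>y. y \<in> V1 \<Longrightarrow> bij (blinfun_apply (?F' (g1 y)))"
  proof (rule inverse_function_theorem[of "J' -` U" ?F ?F' "J x0" "bJ o\<^sub>L invf o\<^sub>L bJ'"])
    show "open (J' -` U)" by (rule op[OF assms(1)])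
    show "J x0 \<in> J' -` U" using assms(4) by simp
    show "continuous_on (J' -` U) ?F'"
      by (intro continuous_intros continuous_on_compose2[OF assms(3) cJ(2)]) auto
    show "(?F has_derivative blinfun_apply (?F' x)) (at x)" if "x \<in> J' -` U" for x
    proof -
      have "((J \<circ> (f \<circ> J')) has_derivative (J \<circ> (blinfun_apply (f' (J' x)) \<circ> J'))) (at x)"
        by (intro diff_chain_at bounded_linear_imp_has_derivative blJ blJ' assms(2)) (use that in auto)
      then show ?thesis by (simp add: o_def blinfun_compose.rep_eq)
    qed
    have "blinfun_apply invf (blinfun_apply (f' x0) v) = v" for v
      using assms(5) by (metis blinfun_apply_blinfun_compose blinfun_apply_id_blinfun)
    then show "bJ o\<^sub>L invf o\<^sub>L bJ' o\<^sub>L ?F' (J x0) = id_blinfun"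
      by (intro blinfun_eqI) simp
  qed blast
  let ?g = "\<lambda>y. J' (g1 (J y))"
  let ?g' = "\<lambda>y. bJ' o\<^sub>L Blinfun (g1' (J y)) o\<^sub>L bJ"
  have bg: "blinfun_apply (Blinfun (g1' y)) = g1' y" if "y \<in> V1" for y
    using 1(7)[OF that] has_derivative_bounded_linear bounded_linear_Blinfun_apply by blast
  show thesis
  proof (rule that[of "J -` U1" "J -` V1" ?g ?g'])
    show "open (J -` U1)" "open (J -` V1)" using opJ 1 by auto
    show "J -` U1 \<subseteq> U" using 1(2) by auto
    show "x0 \<in> J -` U1" "f x0 \<in> J -` V1" using 1 by auto
    have h: "\<And>x. x \<in> U1 \<Longrightarrow> g1 (?F x) = x" "\<And>y. y \<in> V1 \<Longrightarrow> ?F (g1 y) = y" "?F ` U1 = V1" "g1 ` V1 = U1"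
      "continuous_on V1 g1" "continuous_on U1 ?F"
      using 1(6) unfolding homeomorphism_def by auto
    show "homeomorphism (J -` U1) (J -` V1) f ?g"
    proof (rule homeomorphismI)
      have "continuous_on (J -` U1) (\<lambda>x. J' (?F (J x)))"
        by (intro continuous_on_compose2[OF cJ(2)] continuous_on_compose2[OF h(6) cJ(1)]) auto
      then show "continuous_on (J -` U1) f" by simp
      show "continuous_on (J -` V1) ?g"
        by (intro continuous_on_compose2[OF cJ(2)] continuous_on_compose2[OF h(5) cJ(1)]) auto
      show "f ` (J -` U1) \<subseteq> J -` V1" using h(3) by (auto simp: image_iff) (metis J'J imageI)
      show "?g ` (J -` V1) \<subseteq> J -` U1" using h(4) by auto
      show "?g (f x) = x" if "x \<in> J -` U1" for x using that h(1)[of "J x"] by simp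
      show "f (?g y) = y" if "y \<in> J -` V1" for y using that h(2)[of "J y"] by (metis J'J vimage_eq)
    qed
    fix y assume y: "y \<in> J -` V1"
    have "((J' \<circ> (g1 \<circ> J)) has_derivative (J' \<circ> (g1' (J y) \<circ> J))) (at y)"
      by (intro diff_chain_at bounded_linear_imp_has_derivative blJ blJ' 1(7)) (use y in auto)
    then show "(?g has_derivative blinfun_apply (?g' y)) (at y)"
      using y by (simp add: o_def blinfun_compose.rep_eq bg)
    have bij: "bij (\<lambda>v. J (f' (J' (g1 (J y))) (J' v)))" and
      inv: "g1' (J y) = inv_into UNIV (\<lambda>v. J (f' (J' (g1 (J y))) (J' v)))"
      using 1(8,9)[of "J y"] y by (simp_all add: blinfun_compose.rep_eq o_def)
    let ?A = "\<lambda>v. J (f' (J' (g1 (J y))) (J' v))"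
    have bgy: "blinfun_apply (Blinfun (g1' (J y))) = inv_into UNIV ?A"
      using bg[of "J y"] inv y by simp
    have "?A (inv_into UNIV ?A w) = w" for w by (rule surj_f_inv_f[OF bij_is_surj[OF bij]])
    then have "J' (?A (inv_into UNIV ?A (J w))) = w" for w by (metis J'J)
    then have "f' (?g y) (J' (inv_into UNIV ?A (J w))) = w" for w unfolding J'J by blast
    then show "f' (?g y) o\<^sub>L ?g' y = id_blinfun"
      using y by (intro blinfun_eqI) (simp add: bgy)
    have "inv_into UNIV ?A (?A w) = w" for w by (rule inv_f_f[OF bij_is_inj[OF bij]])
    then have "J' (inv_into UNIV ?A (?A (J w))) = w" for w by (metis J'J)
    then show "?g' y o\<^sub>L f' (?g y) = id_blinfun"
      using y by (intro blinfun_eqI) (simp add: bgy)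
  qed
qed

text \<open>If the local inverse \<open>g\<close> is of class $C^k$, then so is the operator \<open>(f' \<circ> g)\<^sup>-\<^sup>1\<close>, which is the
  derivative of \<open>g\<close>; hence \<open>g\<close> is of class $C^{k+1}$.\<close>

lemma smooth_inverse_function:
  fixes f :: "'e \<Rightarrow> 'e"
  assumes "open U" "smooth_on U f" "x0 \<in> U" "(f has_derivative D) (at x0)" "linear D'" "\<And>v. D' (D v) = v"
  obtains U' V g where "open U'" "U' \<subseteq> U" "x0 \<in> U'" "open V" "homeomorphism U' V f g" "smooth_on V g"
proof -
  have C: "Ck_on k U f" for k using assms(2) by (simp add: smooth_on_def)
  let ?M = "derivative_op f"
  have CM: "Ck_on k U ?M" for k by (rule Ck_on_derivative_op[OF assms(1) C])
  have D: "(f has_derivative blinfun_apply (?M x)) (at x)" if "x \<in> U" for x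
    using Ck_on_SucD(1)[OF C[of "Suc 0"] that] derivative_op_apply by metis
  have inv0: "Blinfun D' o\<^sub>L ?M x0 = id_blinfun"
    by (intro blinfun_eqI) (simp add: derivative_op_apply[OF assms(4)] assms(6)
        bounded_linear_Blinfun_apply linear_imp_bounded_linear[OF assms(5)])
  obtain U' V g g' where 1: "open U'" "U' \<subseteq> U" "x0 \<in> U'" "open V" "f x0 \<in> V" "homeomorphism U' V f g"
    "\<And>y. y \<in> V \<Longrightarrow> (g has_derivative blinfun_apply (g' y)) (at y)"
    "\<And>y. y \<in> V \<Longrightarrow> ?M (g y) o\<^sub>L g' y = id_blinfun"
    "\<And>y. y \<in> V \<Longrightarrow> g' y o\<^sub>L ?M (g y) = id_blinfun"
    using inverse_function[OF assms(1) D Ck_on_continuous[OF CM[of 0]] assms(3) inv0] by metis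
  have gV: "g ` V \<subseteq> U" using 1(2,6) by (auto simp: homeomorphism_def)
  have "Ck_on k V g" for k
  proof (induction k)
    case 0
    then show ?case using 1(6) by (simp add: homeomorphism_def)
  next
    case (Suc k)
    have "Ck_on k V (\<lambda>y. ?M (g y))" by (rule Ck_on_compose[OF 1(4) assms(1) gV Suc CM])
    then have "Ck_on k V g'" by (rule Ck_on_operator_inverse[OF 1(4)]) (use 1(8,9) in auto)
    then have "Ck_on k V (\<lambda>y. blinfun_apply (g' y) v)" for v
      by (rule Ck_on_bounded_linear_comp[OF 1(4) blinfun.bounded_linear_left])
    then show ?case using Ck_on_SucI[OF 1(4) 1(7)] by blast
  qed
  then show thesis using that[OF 1(1-4,6)] by (simp add: smooth_on_def)
qed

lemma closed_subspace_fin_dim: "subspace W \<Longrightarrow> closed W" for W :: "'e set"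
proof -
  assume W: "subspace W"
  have lin: "linear J" using blJ bounded_linear.linear by blast
  have "closed (J ` W)" using W lin by (intro closed_subspace linear_subspace_image)
  then have "closed (J -` (J ` W))"
    using linear_continuous_at[OF blJ] by (intro closed_vimage) (auto simp: continuous_on_eq_continuous_at)
  moreover have "J -` (J ` W) = W" by (auto simp: image_iff) (metis J'J)
  ultimately show "closed W" by simp
qed

lemma independent_finite: "independent B \<Longrightarrow> finite B" for B :: "'e set"
proof -
  assume B: "independent B"
  have "linear J" using blJ bounded_linear.linear by blast
  moreover have inj: "inj J" by (metis J'J injI)
  ultimately have "independent (J ` B)" using B by (metis linear_independent_injective_image inj_on_subset subset_UNIV)
  then have "finite (J ` B)" by (rule independent_imp_finite)
  then show "finite B" using inj by (metis finite_imageD inj_on_subset subset_UNIV)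
qed

lemma projection_exists:
  fixes W :: "'e set"
  assumes "subspace W"
  obtains p where "bounded_linear p" "range p \<subseteq> W" "\<And>x. x \<in> W \<Longrightarrow> p x = x"
proof -
  have "\<exists>g\<in>{g. linear g}. range g \<subseteq> W \<and> (\<forall>v\<in>W. g v = v)"
    using linear_exists_left_inverse_on[of "\<lambda>x::'e. x" W] assms
    by (auto simp: linear_id[unfolded id_def])
  then obtain g where "linear g" "range g \<subseteq> W" "\<forall>v\<in>W. g v = v" by auto
  then show thesis by (intro that[of g] linear_imp_bounded_linear) auto
qed

text \<open>A map that is injective on a subspace only can be completed to an isomorphism of the whole space;
  the left inverse \<open>D''\<close> is what the inverse function theorem asks for.\<close>

lemma extend_injective:
  fixes D :: "'e \<Rightarrow> 'e"
  assumes "linear D" "subspace W" "inj_on D W"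
  obtains D' D'' where "linear D'" "\<And>x. x \<in> W \<Longrightarrow> D' x = D x" "linear D''" "\<And>x. D'' (D' x) = x"
proof -
  have lin: "linear J" "linear J'" using blJ blJ' bounded_linear.linear by blast+
  have injJ: "inj J" "inj J'" by (metis J'J injI) (metis JJ' injI)
  obtain B where B: "B \<subseteq> W" "independent B" "W \<subseteq> span B"
    using basis_exists[of W] by metis
  have "span B = W" using B assms(2) by (simp add: span_minimal subset_antisym)
  let ?d = "\<lambda>a. J (D (J' a))"
  have "linear ?d" using linear_compose[OF linear_compose[OF lin(2) assms(1)] lin(1)] by (simp add: o_def)
  have indB: "independent (J ` B)"
    using B(2) lin(1) injJ(1) by (metis linear_independent_injective_image inj_on_subset subset_UNIV)
  have injd: "inj_on ?d (span (J ` B))"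
  proof (rule inj_onI)
    fix x y assume xy: "x \<in> span (J ` B)" "y \<in> span (J ` B)" "?d x = ?d y"
    have "J' x \<in> W" "J' y \<in> W"
      using xy \<open>span B = W\<close> by (auto simp: linear_span_image[OF lin(1)])
    moreover have "D (J' x) = D (J' y)" using xy(3) injJ(1) by (simp add: inj_eq)
    ultimately have "J' x = J' y" using assms(3) by (meson inj_onD)
    then show "x = y" by (metis JJ')
  qed
  have "independent (?d ` (J ` B))"
    by (rule linear_independent_injective_image[OF \<open>linear ?d\<close> indB injd])
  moreover have "inj_on ?d (J ` B)" using injd by (meson inj_on_subset span_superset)
  ultimately obtain g where g: "linear g" "inj g" "\<forall>x\<in>J ` B. g x = ?d x"
    using eucl.linear_independent_extend_inj[OF indB, of ?d] by auto
  obtain h where h: "linear h" "h \<circ> g = id" using linear_injective_left_inverse[OF g(1,2)] by blast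
  show thesis
  proof (rule that[of "\<lambda>x. J' (g (J x))" "\<lambda>x. J' (h (J x))"])
    show l1: "linear (\<lambda>x. J' (g (J x)))"
      using linear_compose[OF linear_compose[OF lin(1) g(1)] lin(2)] by (simp add: o_def)
    show "linear (\<lambda>x. J' (h (J x)))"
      using linear_compose[OF linear_compose[OF lin(1) h(1)] lin(2)] by (simp add: o_def)
    show "J' (h (J (J' (g (J x))))) = x" for x using h(2) by (simp add: fun_eq_iff)
    fix x assume "x \<in> W"
    then have "x \<in> span B" using B(3) by blast
    then show "J' (g (J x)) = D x"
      by (rule linear_eq_on_span[OF l1 assms(1), rotated]) (use g(3) in simp)
  qed
qed

lemma second_countable_base:
  fixes L :: "'e set"
  obtains \<B> where "countable \<B>" "\<And>B. B \<in> \<B> \<Longrightarrow> openin (top_of_set L) B"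
    "\<And>W x. openin (top_of_set L) W \<Longrightarrow> x \<in> W \<Longrightarrow> \<exists>B\<in>\<B>. x \<in> B \<and> B \<subseteq> W"
proof -
  obtain \<A> :: "'a set set" where A: "countable \<A>" "\<And>C. C \<in> \<A> \<Longrightarrow> open C"
    "\<And>S. open S \<Longrightarrow> \<exists>U. U \<subseteq> \<A> \<and> S = \<Union>U"
    using Elementary_Topology.univ_second_countable by metis
  have cJ: "continuous_on UNIV J" "continuous_on UNIV J'"
    using blJ blJ' linear_continuous_on by auto
  show thesis
  proof (rule that[of "(\<lambda>C. L \<inter> J -` C) ` \<A>"])
    show "countable ((\<lambda>C. L \<inter> J -` C) ` \<A>)" using A by simp
    show "openin (top_of_set L) B" if "B \<in> (\<lambda>C. L \<inter> J -` C) ` \<A>" for B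
    proof -
      from that obtain C where "C \<in> \<A>" "B = L \<inter> J -` C" by (rule imageE)
      then show ?thesis using open_vimage[OF A(2) cJ(1)] by (auto simp: openin_open)
    qed
    fix W x assume W: "openin (top_of_set L) W" "x \<in> W"
    then obtain S where S: "open S" "W = L \<inter> S" by (auto simp: openin_open)
    have "open (J' -` S)" using S cJ(2) open_vimage by blast
    then obtain U where U: "U \<subseteq> \<A>" "J' -` S = \<Union>U" using A(3) by metis
    have "J x \<in> J' -` S" using W S by simp
    then obtain C where C: "C \<in> U" "J x \<in> C" using U by auto
    moreover have "L \<inter> J -` C \<subseteq> W"
    proof
      fix z assume "z \<in> L \<inter> J -` C"
      then have "z \<in> L" "J z \<in> J' -` S" using U C by auto
      then show "z \<in> W" using S by simp
    qed
    ultimately show "\<exists>B\<in>(\<lambda>C. L \<inter> J -` C) ` \<A>. x \<in> B \<and> B \<subseteq> W"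
      using U W S by (intro bexI[of _ "L \<inter> J -` C"]) auto
  qed
qed

end

section \<open>Entire power series\<close>

text \<open>A homogeneous polynomial map of degree \<open>n\<close> with constant \<open>C\<close>, encoded through its iterated
  directional derivatives: each of them is homogeneous of one degree less, with constant multiplied
  by the degree. The encoding avoids multilinear forms and makes the class of convergent sums of
  such maps closed under directional derivatives.\<close>

primrec homogeneous :: "nat \<Rightarrow> real \<Rightarrow> ('x::real_normed_vector \<Rightarrow> 'y::real_normed_vector) \<Rightarrow> bool" where
  "homogeneous 0 C f \<longleftrightarrow> (\<exists>v. norm v \<le> C \<and> f = (\<lambda>_. v))"
| "homogeneous (Suc n) C f \<longleftrightarrow> 0 \<le> C \<and> (\<forall>A. norm (f A) \<le> C * norm A ^ Suc n) \<and>
     (\<exists>f'. (\<forall>A. (f has_derivative f' A) (at A)) \<and> (\<forall>v. homogeneous n (real (Suc n) * C * norm v) (\<lambda>A. f' A v)))"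

lemma homogeneous_nonneg: "homogeneous n C f \<Longrightarrow> 0 \<le> C"
  by (cases n) (auto intro: order_trans[OF norm_ge_zero])

lemma homogeneous_bound: "homogeneous n C f \<Longrightarrow> norm (f A) \<le> C * norm A ^ n"
  by (cases n) auto

lemma homogeneous_zero: "0 \<le> C \<Longrightarrow> homogeneous n C (\<lambda>_::'x::real_normed_vector. 0::'y::real_normed_vector)"
proof (induction n arbitrary: C)
  case (Suc n)
  have "homogeneous n (real (Suc n) * C * norm v) (\<lambda>A::'x. 0::'y)" for v :: 'x
    by (rule Suc.IH) (use Suc.prems in simp)
  then show ?case using Suc.prems by (auto intro!: exI[of _ "\<lambda>_ _. 0"])
qed (auto intro!: exI[of _ 0])

lemma homogeneous_add:
  "homogeneous n C f \<Longrightarrow> homogeneous n D g \<Longrightarrow> homogeneous n (C + D) (\<lambda>A. f A + g A)"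
proof (induction n arbitrary: C D f g)
  case 0
  then obtain v w where "norm v \<le> C" "f = (\<lambda>_. v)" "norm w \<le> D" "g = (\<lambda>_. w)" by auto
  then show ?case by (auto intro!: exI[of _ "v + w"] norm_triangle_le)
next
  case (Suc n)
  obtain f' where f': "\<And>A. (f has_derivative f' A) (at A)"
    "\<And>v. homogeneous n (real (Suc n) * C * norm v) (\<lambda>A. f' A v)" using Suc.prems(1) by auto
  obtain g' where g': "\<And>A. (g has_derivative g' A) (at A)"
    "\<And>v. homogeneous n (real (Suc n) * D * norm v) (\<lambda>A. g' A v)" using Suc.prems(2) by auto
  have "homogeneous n (real (Suc n) * C * norm v + real (Suc n) * D * norm v) (\<lambda>A. f' A v + g' A v)" for v
    by (rule Suc.IH[OF f'(2) g'(2)])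
  then have "homogeneous n (real (Suc n) * (C + D) * norm v) (\<lambda>A. f' A v + g' A v)" for v
    by (simp add: algebra_simps)
  moreover have "norm (f A + g A) \<le> (C + D) * norm A ^ Suc n" for A
    using homogeneous_bound[OF Suc.prems(1), of A] homogeneous_bound[OF Suc.prems(2), of A]
      norm_triangle_ineq[of "f A" "g A"] by (simp add: algebra_simps)
  moreover have "((\<lambda>A. f A + g A) has_derivative (\<lambda>v. f' A v + g' A v)) (at A)" for A
    by (rule has_derivative_add[OF f'(1) g'(1)])
  ultimately show ?case
    using homogeneous_nonneg[OF Suc.prems(1)] homogeneous_nonneg[OF Suc.prems(2)]
    by (auto intro!: exI[of _ "\<lambda>A v. f' A v + g' A v"])
qed

lemma homogeneous_derivative:
  assumes "homogeneous n C f"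
  obtains f' where "\<And>A. (f has_derivative f' A) (at A)" "n = 0 \<Longrightarrow> f' = (\<lambda>_ _. 0)"
    "\<And>v. 0 < n \<Longrightarrow> homogeneous (n - 1) (real n * C * norm v) (\<lambda>A. f' A v)"
proof (cases n)
  case 0
  then show thesis using assms by (intro that[of "\<lambda>_ _. 0"]) auto
next
  case (Suc m)
  then obtain f' where "\<And>A. (f has_derivative f' A) (at A)"
    "\<And>v. homogeneous m (real (Suc m) * C * norm v) (\<lambda>A. f' A v)" using assms by auto
  then show thesis using Suc by (intro that[of f']) auto
qed

text \<open>By the product rule the constants of the two derivative terms add up to \<open>(n + m) C D\<close>, which is
  exactly the constant that degree \<open>n + m\<close> demands. In degree 0 the derivative term vanishes, and
  the zero map is homogeneous of every degree.\<close>

lemma homogeneous_mult: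
  fixes b :: "'y::real_normed_vector \<Rightarrow> 'z::real_normed_vector \<Rightarrow> 'w::real_normed_vector"
  assumes b: "bounded_bilinear b" and b1: "\<And>x y. norm (b x y) \<le> norm x * norm y"
  shows "homogeneous n C f \<Longrightarrow> homogeneous m D g \<Longrightarrow> homogeneous (n + m) (C * D) (\<lambda>A. b (f A) (g A))"
proof (induction "n + m" arbitrary: n m C D f g)
  case 0
  then obtain v w where vw: "norm v \<le> C" "f = (\<lambda>_. v)" "norm w \<le> D" "g = (\<lambda>_. w)" by auto
  have "norm (b v w) \<le> C * D"
    by (rule order_trans[OF b1 mult_mono[OF vw(1,3) order_trans[OF norm_ge_zero vw(1)] norm_ge_zero]])
  then show ?case using 0 vw by auto
next
  case (Suc N)
  obtain f' where f': "\<And>A. (f has_derivative f' A) (at A)" "n = 0 \<Longrightarrow> f' = (\<lambda>_ _. 0)"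
    "\<And>v. 0 < n \<Longrightarrow> homogeneous (n - 1) (real n * C * norm v) (\<lambda>A. f' A v)"
    using homogeneous_derivative[OF Suc.prems(1)] by blast
  obtain g' where g': "\<And>A. (g has_derivative g' A) (at A)" "m = 0 \<Longrightarrow> g' = (\<lambda>_ _. 0)"
    "\<And>v. 0 < m \<Longrightarrow> homogeneous (m - 1) (real m * D * norm v) (\<lambda>A. g' A v)"
    using homogeneous_derivative[OF Suc.prems(2)] by blast
  have CD: "0 \<le> C" "0 \<le> D" using Suc.prems homogeneous_nonneg by auto
  have bound: "norm (b (f A) (g A)) \<le> C * D * norm A ^ Suc N" for A
  proof -
    have "norm (b (f A) (g A)) \<le> (C * norm A ^ n) * (D * norm A ^ m)"
      by (rule order_trans[OF b1 mult_mono]) (use CD homogeneous_bound Suc.prems in auto)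
    then show ?thesis using Suc.hyps(2) by (simp add: power_add mult_ac)
  qed
  have t1: "homogeneous N (real n * C * norm v * D) (\<lambda>A. b (f' A v) (g A))" for v
  proof (cases "n = 0")
    case True
    then show ?thesis using homogeneous_zero[of 0 N] f'(2) by (simp add: bounded_bilinear.zero_left[OF b])
  next
    case False
    then show ?thesis using Suc.hyps(1)[OF _ f'(3) Suc.prems(2)] Suc.hyps(2)
      by (metis add_eq_if bot_nat_0.not_eq_extremum diff_Suc_1)
  qed
  have t2: "homogeneous N (C * (real m * D * norm v)) (\<lambda>A. b (f A) (g' A v))" for v
  proof (cases "m = 0")
    case True
    then show ?thesis using homogeneous_zero[of 0 N] g'(2) by (simp add: bounded_bilinear.zero_right[OF b])
  next
    case False
    then have "N = n + (m - 1)" using Suc.hyps(2) by simp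
    then show ?thesis using Suc.hyps(1)[OF _ Suc.prems(1) g'(3)] False by blast
  qed
  have "homogeneous N (real (Suc N) * (C * D) * norm v) (\<lambda>A. b (f A) (g' A v) + b (f' A v) (g A))" for v
  proof -
    have "C * (real m * D * norm v) + real n * C * norm v * D = real (Suc N) * (C * D) * norm v"
      unfolding Suc.hyps(2) by (simp add: algebra_simps)
    then show ?thesis using homogeneous_add[OF t2[of v] t1[of v]] by (simp only:)
  qed
  moreover have "((\<lambda>A. b (f A) (g A)) has_derivative (\<lambda>v. b (f A) (g' A v) + b (f' A v) (g A))) (at A)" for A
    by (rule bounded_bilinear.FDERIV[OF b f'(1) g'(1)])
  ultimately show ?case
    unfolding Suc.hyps(2)[symmetric] using bound CD
    by (auto intro!: exI[of _ "\<lambda>A v. b (f A) (g' A v) + b (f' A v) (g A)"])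
qed

definition entire_series :: "(nat \<Rightarrow> 'x::real_normed_vector \<Rightarrow> 'y::banach) \<Rightarrow> (nat \<Rightarrow> real) \<Rightarrow> bool" where
  "entire_series g c \<longleftrightarrow> (\<forall>n. homogeneous n (c n) (g n)) \<and> (\<forall>R\<ge>0. summable (\<lambda>n. c n * R ^ n))"

text \<open>Termwise differentiation multiplies the coefficients by \<open>n\<close>; enlarging the radius absorbs this
  factor.\<close>

lemma derivative_coefficient_bound:
  assumes "0 \<le> (R::real)"
  shows "real n * R ^ (n - 1) \<le> (2 * (R + 1)) ^ n"
proof -
  have "R ^ (n - 1) \<le> (R + 1) ^ (n - 1)" using assms by (intro power_mono) auto
  also have "\<dots> \<le> (R + 1) ^ n" using assms by (intro power_increasing) auto
  finally have "real n * R ^ (n - 1) \<le> 2 ^ n * (R + 1) ^ n"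
    using assms of_nat_less_two_power[of n, where 'a=real] by (intro mult_mono) auto
  then show ?thesis by (simp only: power_mult_distrib)
qed

text \<open>Termwise differentiation is legitimate because the derived series converges uniformly on balls.
  The directional derivative drops the constant term and is again an entire series, which is the
  step of the induction for all orders.\<close>

lemma entire_series_has_derivative:
  fixes g :: "nat \<Rightarrow> 'x::real_normed_vector \<Rightarrow> 'y::banach"
  assumes "entire_series g c"
  obtains g' where "\<And>n A. (g n has_derivative g' n A) (at A)"
    "\<And>A. ((\<lambda>A. \<Sum>n. g n A) has_derivative (\<lambda>v. \<Sum>n. g' n A v)) (at A)"
    "\<And>A v. summable (\<lambda>n. g' n A v)"
    "\<And>v. entire_series (\<lambda>n A. g' (Suc n) A v) (\<lambda>n. real (Suc n) * c (Suc n) * norm v)"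
    "\<And>A. g' 0 A = (\<lambda>_. 0)"
proof -
  have h: "homogeneous n (c n) (g n)" for n using assms by (simp add: entire_series_def)
  have sm: "summable (\<lambda>n. c n * R ^ n)" if "R \<ge> 0" for R using assms that by (simp add: entire_series_def)
  have c0: "0 \<le> c n" for n using homogeneous_nonneg[OF h] .
  have "\<forall>n. \<exists>g'. (\<forall>A. (g n has_derivative g' A) (at A)) \<and> (n = 0 \<longrightarrow> g' = (\<lambda>_ _. 0)) \<and>
    (\<forall>v. 0 < n \<longrightarrow> homogeneous (n - 1) (real n * c n * norm v) (\<lambda>A. g' A v))"
    using homogeneous_derivative[OF h] by metis
  then obtain g' where g': "\<And>n A. (g n has_derivative g' n A) (at A)" "g' 0 = (\<lambda>_ _. 0)"
    "\<And>n v. 0 < n \<Longrightarrow> homogeneous (n - 1) (real n * c n * norm v) (\<lambda>A. g' n A v)" by metis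
  have bd: "norm (g' n A v) \<le> c n * (2 * (R + 1)) ^ n * norm v" if "norm A \<le> R" "0 \<le> R" for n A v R
  proof (cases "n = 0")
    case True
    then show ?thesis using g'(2) c0 by simp
  next
    case False
    have "norm (g' n A v) \<le> real n * c n * norm v * norm A ^ (n - 1)"
      using homogeneous_bound[OF g'(3)] False by blast
    also have "\<dots> \<le> real n * c n * norm v * R ^ (n - 1)"
      using that c0 by (intro mult_left_mono power_mono) auto
    also have "\<dots> = c n * norm v * (real n * R ^ (n - 1))" by (simp add: mult_ac)
    also have "\<dots> \<le> c n * norm v * (2 * (R + 1)) ^ n"
      using that c0 by (intro mult_left_mono derivative_coefficient_bound) auto
    finally show ?thesis by (simp add: mult_ac)
  qed
  have smv: "summable (\<lambda>n. c n * (2 * (R + 1)) ^ n * norm v)" if "0 \<le> R" for R and v :: 'x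
    using sm[of "2 * (R + 1)"] that by (intro summable_mult2) auto
  have sg': "summable (\<lambda>n. g' n A v)" for A v
    by (rule summable_comparison_test'[OF smv[of "norm A" v] bd]) auto
  have sg: "summable (\<lambda>n. g n A)" for A
    by (rule summable_comparison_test'[OF sm[of "norm A"]]) (use homogeneous_bound[OF h] in auto)
  have D: "((\<lambda>A. \<Sum>n. g n A) has_derivative (\<lambda>v. \<Sum>n. g' n A v)) (at A)" for A
  proof -
    define R where "R = norm A + 1"
    have A: "A \<in> ball (0::'x) R" by (simp add: R_def)
    define M where "M n = c n * (2 * (R + 1)) ^ n" for n
    have sM: "summable M" unfolding M_def using sm[of "2*(R+1)"] by (simp add: R_def)
    have M: "norm (g' n x v) \<le> M n * norm v" if "x \<in> ball (0::'x) R" for n x v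
      using bd[of x R n v] that by (simp add: M_def R_def)
    have unif: "\<forall>\<^sub>F n in sequentially. \<forall>x\<in>ball (0::'x) R. \<forall>v::'x. norm ((\<Sum>i<n. g' i x v) - (\<Sum>i. g' i x v)) \<le> e * norm v"
      if e: "e > 0" for e
    proof -
      obtain N where N: "\<And>n. n \<ge> N \<Longrightarrow> \<bar>\<Sum>i. M (i + n)\<bar> < e"
        using suminf_exist_split[OF e sM] by (auto simp: real_norm_def)
      show ?thesis
        unfolding eventually_sequentially
      proof (intro exI[of _ N] allI impI ballI)
        fix n and x v :: 'x assume n: "N \<le> n" and x: "x \<in> ball (0::'x) R"
        have sMn: "summable (\<lambda>i. M (i + n) * norm v)" using sM by (intro summable_mult2) (simp add: summable_iff_shift)
        have "(\<Sum>i<n. g' i x v) - (\<Sum>i. g' i x v) = - (\<Sum>i. g' (i + n) x v)"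
          by (simp add: suminf_minus_initial_segment[OF sg'])
        moreover have "norm (\<Sum>i. g' (i + n) x v) \<le> (\<Sum>i. M (i + n) * norm v)"
          by (rule norm_suminf_le[OF M[OF x] sMn])
        moreover have "(\<Sum>i. M (i + n) * norm v) = (\<Sum>i. M (i + n)) * norm v"
          using sM by (intro suminf_mult2[symmetric]) (simp add: summable_iff_shift)
        moreover have "(\<Sum>i. M (i + n)) * norm v \<le> e * norm v"
          using N[OF n] by (intro mult_right_mono) (auto simp: abs_less_iff)
        ultimately show "norm ((\<Sum>i<n. g' i x v) - (\<Sum>i. g' i x v)) \<le> e * norm v" by simp
      qed
    qed
    obtain G where G: "\<And>x. x \<in> ball (0::'x) R \<Longrightarrow> (\<lambda>n. g n x) sums G x"
      "\<And>x. x \<in> ball (0::'x) R \<Longrightarrow> (G has_derivative (\<lambda>v. \<Sum>n. g' n x v)) (at x within ball 0 R)"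
      using has_derivative_series[OF convex_ball has_derivative_at_withinI[OF g'(1)] unif A summable_sums[OF sg]]
      by blast
    have "(G has_derivative (\<lambda>v. \<Sum>n. g' n A v)) (at A)"
      using G(2)[OF A] at_within_open[OF A open_ball] by simp
    then show ?thesis
      by (rule has_derivative_transform_within_open[OF _ open_ball A]) (use G(1) in \<open>simp add: sums_iff\<close>)
  qed
  have E: "entire_series (\<lambda>n A. g' (Suc n) A v) (\<lambda>n. real (Suc n) * c (Suc n) * norm v)" for v
    unfolding entire_series_def
  proof (intro conjI allI impI)
    show "homogeneous n (real (Suc n) * c (Suc n) * norm v) (\<lambda>A. g' (Suc n) A v)" for n
      using g'(3)[of "Suc n" v] by simp
    fix R :: real assume R: "0 \<le> R"
    have s: "summable (\<lambda>n. c (Suc n) * (2 * (R + 1)) ^ Suc n * norm v)"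
      using smv[OF R, of v] by (subst summable_Suc_iff)
    have "norm (real (Suc n) * c (Suc n) * norm v * R ^ n) \<le> c (Suc n) * (2 * (R + 1)) ^ Suc n * norm v" for n
    proof -
      have "norm (real (Suc n) * c (Suc n) * norm v * R ^ n) = c (Suc n) * norm v * (real (Suc n) * R ^ n)"
        using c0[of "Suc n"] R by (simp add: abs_mult mult_ac)
      also have "\<dots> \<le> c (Suc n) * norm v * (2 * (R + 1)) ^ Suc n"
        using derivative_coefficient_bound[OF R, of "Suc n"] c0 by (intro mult_left_mono) auto
      finally show ?thesis by (simp add: mult_ac)
    qed
    then show "summable (\<lambda>n. real (Suc n) * c (Suc n) * norm v * R ^ n)"
      by (intro summable_comparison_test'[OF s]) auto
  qed
  show thesis by (rule that[OF g'(1) D sg' E]) (simp add: g'(2))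
qed

lemma entire_series_Ck_on: "entire_series g c \<Longrightarrow> Ck_on k UNIV (\<lambda>A. \<Sum>n. g n A)"
proof (induction k arbitrary: g c)
  case 0
  show ?case
    unfolding Ck_on.simps
    by (rule entire_series_has_derivative[OF 0])
      (blast intro: continuous_at_imp_continuous_on has_derivative_continuous)
next
  case (Suc k)
  obtain g' where g0: "\<And>n A. (g n has_derivative g' n A) (at A)"
    and g': "\<And>A. ((\<lambda>A. \<Sum>n. g n A) has_derivative (\<lambda>v. \<Sum>n. g' n A v)) (at A)"
    "\<And>A v. summable (\<lambda>n. g' n A v)"
    "\<And>v. entire_series (\<lambda>n A. g' (Suc n) A v) (\<lambda>n. real (Suc n) * c (Suc n) * norm v)"
    "\<And>A. g' 0 A = (\<lambda>_. 0)"
    by (rule entire_series_has_derivative[OF Suc.prems]) (rule that)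
  have "(\<Sum>n. g' n A v) = (\<Sum>n. g' (Suc n) A v)" for A v
    using suminf_split_head[OF g'(2)] g'(4) by simp
  then have "Ck_on k UNIV (\<lambda>A. \<Sum>n. g' n A v)" for v using Suc.IH[OF g'(3)] by simp
  then show ?case by (intro Ck_on_SucI[OF open_UNIV g'(1)])
qed

section \<open>The exponential of operators\<close>

lemma blinfun_compose_assoc: "(A o\<^sub>L B) o\<^sub>L C = A o\<^sub>L (B o\<^sub>L C)"
  by (rule blinfun_eqI) simp

lemma blinfun_compose_id [simp]: "id_blinfun o\<^sub>L A = A" "A o\<^sub>L id_blinfun = A"
  by (rule blinfun_eqI, simp)+

primrec op_power :: "('v::real_normed_vector \<Rightarrow>\<^sub>L 'v) \<Rightarrow> nat \<Rightarrow> 'v \<Rightarrow>\<^sub>L 'v" where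
  "op_power A 0 = id_blinfun"
| "op_power A (Suc n) = A o\<^sub>L op_power A n"

definition op_exp :: "('v::banach \<Rightarrow>\<^sub>L 'v) \<Rightarrow> 'v \<Rightarrow>\<^sub>L 'v" where
  "op_exp A = (\<Sum>n. (1 / fact n) *\<^sub>R op_power A n)"

lemma op_power_apply: "blinfun_apply (op_power A n) x = (blinfun_apply A ^^ n) x"
  by (induction n arbitrary: x) auto

lemma op_power_commute: "A o\<^sub>L op_power A n = op_power A n o\<^sub>L A"
proof (induction n)
  case (Suc n)
  have "A o\<^sub>L (A o\<^sub>L op_power A n) = A o\<^sub>L (op_power A n o\<^sub>L A)" using Suc by (rule arg_cong)
  then show ?case by (simp only: op_power.simps blinfun_compose_assoc)
qed (auto intro: blinfun_eqI)

lemma op_power_scale: "op_power (t *\<^sub>R A) n = (t ^ n) *\<^sub>R op_power A n"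
  by (induction n) (auto intro!: blinfun_eqI simp: blinfun.bilinear_simps)

lemma homogeneous_op_power: "homogeneous n 1 (\<lambda>A. op_power A n)"
proof (induction n)
  case 0
  then show ?case by (auto simp: norm_blinfun_id_le intro!: exI[of _ id_blinfun])
next
  case (Suc n)
  have "homogeneous 1 1 (\<lambda>A::'a \<Rightarrow>\<^sub>L 'a. A)"
    by (auto intro!: exI[of _ "\<lambda>_ v. v"] exI derivative_eq_intros)
  from homogeneous_mult[OF bounded_bilinear_blinfun_compose norm_blinfun_compose this Suc]
  show ?case by simp
qed

lemma entire_series_op_exp:
  "entire_series (\<lambda>n A. (1 / fact n) *\<^sub>R op_power (A::'v::banach \<Rightarrow>\<^sub>L 'v) n) (\<lambda>n. 1 / fact n)"
  unfolding entire_series_def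
proof (intro conjI allI impI)
  show "homogeneous n (1 / fact n) (\<lambda>A::'v \<Rightarrow>\<^sub>L 'v. (1 / fact n) *\<^sub>R op_power A n)" for n
  proof -
    have "homogeneous 0 (1 / fact n) (\<lambda>_::'v \<Rightarrow>\<^sub>L 'v. 1 / fact n :: real)"
      by (auto intro!: exI[of _ "1 / fact n"])
    from homogeneous_mult[OF bounded_bilinear_scaleR _ this homogeneous_op_power]
    show ?thesis by simp
  qed
  show "summable (\<lambda>n. 1 / fact n * R ^ n)" for R :: real
    using summable_exp[of R] by (simp add: field_simps)
qed

lemma op_exp_Ck_on: "Ck_on k UNIV (op_exp :: ('v::banach \<Rightarrow>\<^sub>L 'v) \<Rightarrow> _)"
  using entire_series_Ck_on[OF entire_series_op_exp] by (simp add: op_exp_def[abs_def])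

lemma op_exp_summable: "summable (\<lambda>n. (1 / fact n) *\<^sub>R op_power (A::'v::banach \<Rightarrow>\<^sub>L 'v) n)"
proof (rule summable_comparison_test'[of "\<lambda>n. 1 / fact n * norm A ^ n"])
  show "summable (\<lambda>n. 1 / fact n * norm A ^ n)"
    using summable_exp[of "norm A"] by (simp add: field_simps)
  show "norm ((1 / fact n) *\<^sub>R op_power A n) \<le> 1 / fact n * norm A ^ n" if "0 \<le> n" for n
    using homogeneous_bound[OF homogeneous_op_power, of A n] by (simp add: divide_right_mono)
qed

lemma op_exp_sums: "(\<lambda>n. (1 / fact n) *\<^sub>R op_power A n) sums op_exp A"
  unfolding op_exp_def by (rule summable_sums[OF op_exp_summable])

lemma op_exp_apply_sums: "(\<lambda>n. (blinfun_apply A ^^ n) x /\<^sub>R fact n) sums blinfun_apply (op_exp A) x"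
  using bounded_linear.sums[OF blinfun.bounded_linear_left op_exp_sums, of A x]
  by (simp add: blinfun.bilinear_simps op_power_apply divide_inverse)

lemma op_exp_zero [simp]: "op_exp 0 = id_blinfun"
proof -
  have "op_power 0 n = (0 :: 'a \<Rightarrow>\<^sub>L 'a)" if "n \<noteq> 0" for n
    using that by (cases n) (auto intro: blinfun_eqI)
  then have "op_exp (0 :: 'a \<Rightarrow>\<^sub>L 'a) = (\<Sum>n\<in>{0}. (1 / fact n) *\<^sub>R op_power 0 n)"
    unfolding op_exp_def by (intro suminf_finite) auto
  then show ?thesis by simp
qed

lemma op_exp_commute: "A o\<^sub>L op_exp A = op_exp A o\<^sub>L A"
proof -
  have "(\<lambda>n. A o\<^sub>L ((1 / fact n) *\<^sub>R op_power A n)) sums (A o\<^sub>L op_exp A)"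
    by (rule bounded_linear.sums[OF compose_bounded_linear_right op_exp_sums])
  moreover have "(\<lambda>n. ((1 / fact n) *\<^sub>R op_power A n) o\<^sub>L A) sums (op_exp A o\<^sub>L A)"
    by (rule bounded_linear.sums[OF compose_bounded_linear_left op_exp_sums])
  moreover have "A o\<^sub>L ((1 / fact n) *\<^sub>R op_power A n) = ((1 / fact n) *\<^sub>R op_power A n) o\<^sub>L A" for n
    using op_power_commute[of A n]
    by (simp add: compose_scaleR_left
        compose_scaleR_right)
  ultimately show ?thesis using sums_unique2 by simp
qed

text \<open>Along a line the \<open>n\<close>-th term of the series is \<open>t ^ n\<close> times a fixed operator, so the derived
  series is the original one multiplied by \<open>A\<close>.\<close>

lemma op_exp_vector_derivative:
  "((\<lambda>t. op_exp (t *\<^sub>R A)) has_vector_derivative (A o\<^sub>L op_exp (t *\<^sub>R A))) (at t within S)"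
proof -
  obtain g' where g': "\<And>n B. ((\<lambda>B::'a \<Rightarrow>\<^sub>L 'a. (1 / fact n) *\<^sub>R op_power B n) has_derivative g' n B) (at B)"
    "\<And>B. (op_exp has_derivative (\<lambda>v. \<Sum>n. g' n B v)) (at B)"
    "\<And>B v. summable (\<lambda>n. g' n B v)"
    "\<And>v. entire_series (\<lambda>n A. g' (Suc n) A v) (\<lambda>n. real (Suc n) * (1 / fact (Suc n)) * norm v)"
    "\<And>B. g' 0 B = (\<lambda>_. 0)"
    by (rule entire_series_has_derivative[OF entire_series_op_exp, folded op_exp_def]) (rule that)
  have tA: "((\<lambda>t. t *\<^sub>R A) has_vector_derivative A) (at t)" by (auto intro!: derivative_eq_intros)
  have chain: "((\<lambda>t. f (t *\<^sub>R A)) has_vector_derivative f' A) (at t)"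
    if "(f has_derivative f') (at (t *\<^sub>R A))" for f :: "('a \<Rightarrow>\<^sub>L 'a) \<Rightarrow> 'a \<Rightarrow>\<^sub>L 'a" and f'
    using vector_derivative_diff_chain_within[OF tA has_derivative_at_withinI[OF that]] by (simp add: o_def)
  have t: "g' (Suc n) (t *\<^sub>R A) A = A o\<^sub>L ((1 / fact n) *\<^sub>R op_power (t *\<^sub>R A) n)" for n
  proof -
    have "((\<lambda>t. (t ^ Suc n / fact (Suc n)) *\<^sub>R op_power A (Suc n)) has_vector_derivative
        (t ^ n / fact n) *\<^sub>R op_power A (Suc n)) (at t)"
    proof -
      have "((\<lambda>t::real. t ^ Suc n / fact (Suc n)) has_field_derivative (t ^ n / fact n)) (at t)"
        using DERIV_cdivide[OF DERIV_pow[of "Suc n" t UNIV], of "fact (Suc n)"] by (simp del: of_nat_Suc)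
      then have "((\<lambda>t. t ^ Suc n / fact (Suc n)) has_vector_derivative (t ^ n / fact n)) (at t)"
        by (simp only: has_real_derivative_iff_has_vector_derivative)
      from bounded_linear.has_vector_derivative[OF bounded_linear_scaleR_left this]
      show ?thesis .
    qed
    moreover have "((\<lambda>t. (t ^ Suc n / fact (Suc n)) *\<^sub>R op_power A (Suc n)) has_vector_derivative g' (Suc n) (t *\<^sub>R A) A) (at t)"
      using chain[OF g'(1)[of "Suc n"]] by (simp add: op_power_scale del: op_power.simps)
    ultimately have "g' (Suc n) (t *\<^sub>R A) A = (t ^ n / fact n) *\<^sub>R op_power A (Suc n)"
      using vector_derivative_unique_at by blast
    then show ?thesis by (simp add: op_power_scale compose_scaleR_right)
  qed
  have "(\<Sum>n. g' n (t *\<^sub>R A) A) = (\<Sum>n. g' (Suc n) (t *\<^sub>R A) A)"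
    using suminf_split_head[OF g'(3)] g'(5) by simp
  also have "\<dots> = A o\<^sub>L op_exp (t *\<^sub>R A)"
    unfolding t using bounded_linear.sums[OF compose_bounded_linear_right op_exp_sums]
    by (metis sums_unique)
  finally show ?thesis using chain[OF g'(2)] by (metis has_vector_derivative_at_within)
qed

text \<open>The product of \<open>exp (- t A)\<close> and \<open>exp ((s + t) A)\<close> has derivative zero in \<open>t\<close>, hence equals its
  value at \<open>t = 0\<close>.\<close>

lemma op_exp_add: "op_exp ((s + t) *\<^sub>R A) = op_exp (t *\<^sub>R A) o\<^sub>L op_exp (s *\<^sub>R A)"
proof -
  note d = op_exp_vector_derivative
  have dm: "((\<lambda>t. op_exp (- t *\<^sub>R A)) has_vector_derivative - (A o\<^sub>L op_exp (- t *\<^sub>R A))) (at t within S)" for t S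
    using op_exp_vector_derivative[of "- A" t S]
    by (simp add: compose_minus_left)
  have ds: "((\<lambda>t. op_exp ((s + t) *\<^sub>R A)) has_vector_derivative A o\<^sub>L op_exp ((s + t) *\<^sub>R A)) (at t)" for s t
  proof -
    have "((\<lambda>t. s + t) has_vector_derivative 1) (at t)" by (auto intro!: derivative_eq_intros)
    from vector_diff_chain_at[OF this d] show ?thesis by (simp add: o_def)
  qed
  have z: "((\<lambda>t. op_exp (- t *\<^sub>R A) o\<^sub>L op_exp ((s + t) *\<^sub>R A)) has_vector_derivative 0) (at t within UNIV)" for s t
  proof -
    have "((\<lambda>t. op_exp (- t *\<^sub>R A) o\<^sub>L op_exp ((s + t) *\<^sub>R A)) has_vector_derivative
        (op_exp (- t *\<^sub>R A) o\<^sub>L (A o\<^sub>L op_exp ((s + t) *\<^sub>R A))) +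
        ((- (A o\<^sub>L op_exp (- t *\<^sub>R A))) o\<^sub>L op_exp ((s + t) *\<^sub>R A))) (at t)"
      using bounded_bilinear.has_vector_derivative[OF bounded_bilinear_blinfun_compose dm[of t UNIV] ds[of s t]] .
    moreover have "op_exp (- t *\<^sub>R A) o\<^sub>L A = A o\<^sub>L op_exp (- t *\<^sub>R A)"
    proof (cases "t = 0")
      case False
      have "(- t *\<^sub>R A) o\<^sub>L op_exp (- t *\<^sub>R A) = op_exp (- t *\<^sub>R A) o\<^sub>L (- t *\<^sub>R A)" by (rule op_exp_commute)
      then have "(- t) *\<^sub>R (A o\<^sub>L op_exp (- t *\<^sub>R A)) = (- t) *\<^sub>R (op_exp (- t *\<^sub>R A) o\<^sub>L A)"
        by (simp only: compose_scaleR_left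
            compose_scaleR_right)
      then show ?thesis using False by simp
    qed (auto intro: blinfun_eqI)
    ultimately show ?thesis
      by (simp add: blinfun_compose_assoc[symmetric] compose_minus_left)
  qed
  have c: "op_exp (- t *\<^sub>R A) o\<^sub>L op_exp ((s + t) *\<^sub>R A) = op_exp (s *\<^sub>R A)" for s t
  proof -
    obtain c where c: "\<And>t. t \<in> UNIV \<Longrightarrow> op_exp (- t *\<^sub>R A) o\<^sub>L op_exp ((s + t) *\<^sub>R A) = c"
      using has_vector_derivative_zero_constant[OF convex_UNIV z] by blast
    have "op_exp (- t *\<^sub>R A) o\<^sub>L op_exp ((s + t) *\<^sub>R A) = c" by (rule c) simp
    also have "c = op_exp (s *\<^sub>R A)" using c[of 0] by simp
    finally show ?thesis .
  qed
  have "op_exp (t *\<^sub>R A) o\<^sub>L op_exp (- t *\<^sub>R A) = id_blinfun"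
    using c[of "- t" 0] by simp
  then have "op_exp ((s + t) *\<^sub>R A) = op_exp (t *\<^sub>R A) o\<^sub>L (op_exp (- t *\<^sub>R A) o\<^sub>L op_exp ((s + t) *\<^sub>R A))"
    by (metis blinfun_compose_assoc blinfun_compose_id(1))
  then show ?thesis unfolding c .
qed


lemma op_exp_inverse [simp]: "op_exp A o\<^sub>L op_exp (- A) = id_blinfun" "op_exp (- A) o\<^sub>L op_exp A = id_blinfun"
  using op_exp_add[of "-1" 1 A] op_exp_add[of 1 "-1" A] by simp_all

lemma op_exp_inverse_apply [simp]:
  "blinfun_apply (op_exp A) (blinfun_apply (op_exp (- A)) x) = x"
  "blinfun_apply (op_exp (- A)) (blinfun_apply (op_exp A) x) = x"
  using op_exp_inverse[of A] by (metis blinfun_apply_blinfun_compose blinfun_apply_id_blinfun)+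

lemma op_exp_has_derivative_zero: "(op_exp has_derivative (\<lambda>v. v)) (at (0::'v::banach \<Rightarrow>\<^sub>L 'v))"
proof -
  let ?D = "frechet_derivative op_exp (at (0::'v \<Rightarrow>\<^sub>L 'v))"
  have D: "(op_exp has_derivative ?D) (at 0)"
    using Ck_on_SucD(1)[OF op_exp_Ck_on] by blast
  have "?D v = v" for v
  proof -
    have "((\<lambda>t. t *\<^sub>R v) has_vector_derivative v) (at 0)" by (auto intro!: derivative_eq_intros)
    from vector_derivative_diff_chain_within[OF this, of op_exp ?D]
    have "((\<lambda>t. op_exp (t *\<^sub>R v)) has_vector_derivative ?D v) (at 0)"
      using D by (simp add: o_def has_derivative_at_withinI)
    moreover have "((\<lambda>t. op_exp (t *\<^sub>R v)) has_vector_derivative v) (at 0)"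
      using op_exp_vector_derivative[of v 0 UNIV] by simp
    ultimately show ?thesis by (rule vector_derivative_unique_at)
  qed
  then show ?thesis using D by (metis (no_types, lifting) ext)
qed

lemma op_exp_conjugate:
  assumes "S' o\<^sub>L S = id_blinfun"  "S o\<^sub>L S' = id_blinfun"
  shows "S o\<^sub>L op_exp A o\<^sub>L S' = op_exp (S o\<^sub>L A o\<^sub>L S')"
proof -
  have inv: "S' (S x) = x" for x using assms(1) by (metis blinfun_apply_blinfun_compose blinfun_apply_id_blinfun)
  have p: "op_power (S o\<^sub>L A o\<^sub>L S') n = S o\<^sub>L op_power A n o\<^sub>L S'" for n
  proof (induction n)
    case 0
    then show ?case using assms by simp
  next
    case (Suc n)
    then show ?case by (intro blinfun_eqI) (simp add: inv)
  qed
  have "bounded_linear (\<lambda>B. S o\<^sub>L B o\<^sub>L S')"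
    by (intro bounded_linear_compose[OF compose_bounded_linear_left
        compose_bounded_linear_right])
  from bounded_linear.sums[OF this op_exp_sums[of A]]
  have "(\<lambda>n. (1 / fact n) *\<^sub>R op_power (S o\<^sub>L A o\<^sub>L S') n) sums (S o\<^sub>L op_exp A o\<^sub>L S')"
    unfolding p by (simp add: compose_scaleR_left
        compose_scaleR_right)
  then show ?thesis using op_exp_sums sums_unique2 by blast
qed

lemma op_exp_mem_subspace:
  assumes "subspace q" "closed q" "\<And>x. x \<in> q \<Longrightarrow> blinfun_apply A x \<in> q" "x \<in> q"
  shows "blinfun_apply (op_exp A) x \<in> q"
proof -
  have "(blinfun_apply A ^^ n) x \<in> q" for n by (induction n) (use assms in auto)
  then have "(\<Sum>i<n. (blinfun_apply A ^^ i) x /\<^sub>R fact i) \<in> q" for n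
    using assms(1) by (intro subspace_sum subspace_scale)
  then show ?thesis
    by (intro closed_sequentially[OF assms(2) _ op_exp_apply_sums[of A x, unfolded sums_def]]) auto
qed

lemma op_exp_image_subspace:
  assumes "subspace q" "closed q" "\<And>x. x \<in> q \<Longrightarrow> blinfun_apply A x \<in> q"
  shows "blinfun_apply (op_exp A) ` q = q"
proof -
  have "blinfun_apply (- A) x \<in> q" if "x \<in> q" for x
    using subspace_neg[OF assms(1) assms(3)[OF that]] by (simp add: blinfun.bilinear_simps)
  then have "op_exp (- A) x \<in> q" if "x \<in> q" for x using op_exp_mem_subspace[OF assms(1,2) _ that] by blast
  then have "x \<in> op_exp A ` q" if "x \<in> q" for x
    using that by (intro image_eqI[of _ _ "op_exp (- A) x"]) auto
  then show ?thesis using op_exp_mem_subspace[OF assms] by auto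
qed

lemma op_exp_minus_id_mem:
  assumes "subspace W" "closed W" "\<And>n. op_power A (Suc n) \<in> W"
  shows "op_exp A - id_blinfun \<in> W"
proof -
  have lim: "(\<lambda>n. (1 / fact (Suc n)) *\<^sub>R op_power A (Suc n)) sums (op_exp A - (1 / fact 0) *\<^sub>R op_power A 0)"
    using op_exp_sums[of A] by (subst sums_Suc_iff) simp
  moreover have "(\<Sum>i<n. (1 / fact (Suc i)) *\<^sub>R op_power A (Suc i)) \<in> W" for n
    using assms by (intro subspace_sum subspace_scale)
  ultimately have "op_exp A - (1 / fact 0) *\<^sub>R op_power A 0 \<in> W"
    by (intro closed_sequentially[OF assms(2) _ lim[unfolded sums_def]]) auto
  then show ?thesis by simp
qed

section \<open>The space of endomorphisms\<close>

definition endo_coords :: "('n::finite) endo \<Rightarrow> ((complex^'n)^'n) \<times> ((complex^'n)^'n)" where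
  "endo_coords \<phi> = ((\<chi> i. blinfun_apply \<phi> (axis i 1)), (\<chi> i. blinfun_apply \<phi> (axis i \<i>)))"

definition endo_of_coords :: "((complex^'n)^'n) \<times> ((complex^'n)^'n) \<Rightarrow> ('n::finite) endo" where
  "endo_of_coords M = Blinfun (\<lambda>x. \<Sum>i\<in>UNIV. Re (x $ i) *\<^sub>R (fst M $ i) + Im (x $ i) *\<^sub>R (snd M $ i))"

lemma axis_expansion: "(\<Sum>i\<in>UNIV. Re (x $ i) *\<^sub>R axis i 1 + Im (x $ i) *\<^sub>R axis i \<i>) = (x :: complex ^ 'n::finite)"
  by (simp add: vec_eq_iff axis_def sum.distrib if_distrib[of "\<lambda>z. _ *\<^sub>R z"] cong: if_cong)
    (auto simp: complex_eq_iff)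

lemma endo_of_coords_apply:
  "blinfun_apply (endo_of_coords M) x = (\<Sum>i\<in>UNIV. Re (x $ i) *\<^sub>R (fst M $ i) + Im (x $ i) *\<^sub>R (snd M $ i))"
proof -
  have "linear (\<lambda>x. \<Sum>i\<in>UNIV. Re (x $ i) *\<^sub>R (fst M $ i) + Im (x $ i) *\<^sub>R (snd M $ i))"
    by (rule linearI) (simp_all add: scaleR_add_left scaleR_right.sum sum.distrib scaleR_add_right)
  then show ?thesis
    by (simp add: endo_of_coords_def bounded_linear_Blinfun_apply linear_conv_bounded_linear)
qed

lemma fin_dim_normed_endo: "fin_dim_normed (endo_coords :: ('n::finite) endo \<Rightarrow> _) endo_of_coords"
proof (rule fin_dim_normed.intro)
  show "bounded_linear (endo_coords :: 'n endo \<Rightarrow> _)"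
  proof -
    have ax: "bounded_linear (\<lambda>v. axis i v :: (complex^'n)^'n)" for i
      unfolding linear_conv_bounded_linear[symmetric]
      by (rule linearI) (simp_all add: vec_eq_iff axis_def)
    have eq: "(\<chi> i. blinfun_apply \<phi> (u i)) = (\<Sum>i\<in>UNIV. axis i (blinfun_apply \<phi> (u i)))" for \<phi> :: "'n endo" and u
      by (simp add: vec_eq_iff axis_def)
    have bl: "bounded_linear (\<lambda>\<phi>::'n endo. \<Sum>i\<in>UNIV. axis i (blinfun_apply \<phi> (u i)) :: (complex^'n)^'n)" for u
      by (intro bounded_linear_sum bounded_linear_compose[OF ax blinfun.bounded_linear_left])
    then show ?thesis unfolding endo_coords_def[abs_def] eq by (intro bounded_linear_Pair bl)
  qed
  have "linear (endo_of_coords :: _ \<Rightarrow> 'n endo)"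
    by (rule linearI; rule blinfun_eqI)
      (simp_all add: endo_of_coords_apply blinfun.bilinear_simps scaleR_right.sum scaleR_add_right sum.distrib algebra_simps)
  then show "bounded_linear (endo_of_coords :: _ \<Rightarrow> 'n endo)" by (simp add: linear_conv_bounded_linear)
  show "endo_coords (endo_of_coords M) = M" for M :: "((complex^'n)^'n) \<times> ((complex^'n)^'n)"
    by (rule prod_eqI) (simp_all add: endo_coords_def vec_eq_iff endo_of_coords_apply axis_def
        if_distrib[of Re] if_distrib[of Im] if_distrib[of "\<lambda>z. z *\<^sub>R _"] cong: if_cong)
  show "endo_of_coords (endo_coords \<phi>) = \<phi>" for \<phi> :: "'n endo"
  proof (rule blinfun_eqI)
    fix x
    have "blinfun_apply \<phi> x = blinfun_apply \<phi> (\<Sum>i\<in>UNIV. Re (x $ i) *\<^sub>R axis i 1 + Im (x $ i) *\<^sub>R axis i \<i>)"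
      by (simp only: axis_expansion)
    then show "blinfun_apply (endo_of_coords (endo_coords \<phi>)) x = blinfun_apply \<phi> x"
      by (simp only: endo_of_coords_apply endo_coords_def blinfun.sum_right blinfun.bilinear_simps fst_conv snd_conv vec_lambda_beta)
  qed
qed

interpretation endo: fin_dim_normed "endo_coords :: ('n::finite) endo \<Rightarrow> _" endo_of_coords
  by (rule fin_dim_normed_endo)

lemma op_exp_local_homeomorphism:
  obtains U V Log where "open U" "(0::('n::finite) endo) \<in> U" "open V" "id_blinfun \<in> V" "homeomorphism U V op_exp Log"
proof -
  have s: "smooth_on UNIV (op_exp :: 'n endo \<Rightarrow> _)" by (simp add: smooth_on_def op_exp_Ck_on)
  obtain U' V g where "open U'" "(0::'n endo) \<in> U'" "open V" "homeomorphism U' V op_exp g"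
    using endo.smooth_inverse_function[OF open_UNIV s UNIV_I op_exp_has_derivative_zero linear_id[unfolded id_def]] by metis
  moreover from this have "id_blinfun \<in> V" by (metis homeomorphism_def imageI op_exp_zero)
  ultimately show thesis using that by blast
qed

section \<open>Orthogonal projections onto moving subspaces\<close>

text \<open>Pythagoras: the foot of the perpendicular is the closest point.\<close>

lemma closest_point_subspace_eqI:
  fixes q :: "'v::euclidean_space set"
  assumes "subspace q" "y \<in> q" "\<And>w. w \<in> q \<Longrightarrow> (x - y) \<bullet> w = 0"
  shows "closest_point q x = y"
proof (rule closest_point_unique[symmetric])
  show "convex q" "closed q" using assms(1) by (auto simp: subspace_imp_convex closed_subspace)
  show "\<forall>z\<in>q. dist x y \<le> dist x z"
  proof
    fix z assume z: "z \<in> q"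
    then have "(x - y) \<bullet> (y - z) = 0" using assms by (simp add: subspace_diff)
    then have "(dist x z)\<^sup>2 = (dist x y)\<^sup>2 + (norm (y - z))\<^sup>2"
      unfolding dist_norm power2_norm_eq_inner by (simp add: inner_diff_left inner_diff_right inner_commute)
    then have "(dist x y)\<^sup>2 \<le> (dist x z)\<^sup>2" by simp
    then show "dist x y \<le> dist x z" by (rule power2_le_imp_le) simp
  qed
qed (rule assms(2))

lemma closest_point_subspace:
  fixes q :: "'v::euclidean_space set"
  assumes "subspace q"
  shows "closest_point q x \<in> q" "w \<in> q \<Longrightarrow> (x - closest_point q x) \<bullet> w = 0"
proof -
  obtain y z where yz: "y \<in> span q" "\<And>w. w \<in> span q \<Longrightarrow> orthogonal z w" "x = y + z"
    using orthogonal_subspace_decomp_exists[of q x] by metis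
  have s: "span q = q" using assms by (simp add: span_eq_iff)
  have "closest_point q x = y"
    using yz unfolding s by (intro closest_point_subspace_eqI assms) (auto simp: orthogonal_def)
  then show "closest_point q x \<in> q" "w \<in> q \<Longrightarrow> (x - closest_point q x) \<bullet> w = 0"
    using yz unfolding s by (auto simp: orthogonal_def)
qed

lemma linear_closest_point:
  fixes q :: "'v::euclidean_space set"
  assumes "subspace q"
  shows "linear (closest_point q)"
proof (rule linearI)
  note c = closest_point_subspace[OF assms]
  fix x y :: 'v and r :: real
  show "closest_point q (x + y) = closest_point q x + closest_point q y"
  proof (rule closest_point_subspace_eqI[OF assms])
    show "closest_point q x + closest_point q y \<in> q" using c assms by (simp add: subspace_add)
    show "(x + y - (closest_point q x + closest_point q y)) \<bullet> w = 0" if "w \<in> q" for w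
      using c(2)[OF that, of x] c(2)[OF that, of y] by (simp add: inner_diff_left inner_add_left)
  qed
  show "closest_point q (r *\<^sub>R x) = r *\<^sub>R closest_point q x"
  proof (rule closest_point_subspace_eqI[OF assms])
    show "r *\<^sub>R closest_point q x \<in> q" using c assms by (simp add: subspace_scale)
    show "(r *\<^sub>R x - r *\<^sub>R closest_point q x) \<bullet> w = 0" if "w \<in> q" for w
      using c(2)[OF that, of x] by (simp add: inner_diff_left)
  qed
qed

lemma orth_proj_apply: "subspace q \<Longrightarrow> blinfun_apply (orth_proj q) x = closest_point q x"
  using linear_closest_point[of q]
  by (simp add: orth_proj_def bounded_linear_Blinfun_apply linear_conv_bounded_linear)

lemma orth_proj_mem: "subspace q \<Longrightarrow> blinfun_apply (orth_proj q) x \<in> q"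
  by (simp add: orth_proj_apply closest_point_subspace)

lemma orth_proj_id: "subspace q \<Longrightarrow> x \<in> q \<Longrightarrow> blinfun_apply (orth_proj q) x = x"
  by (simp add: orth_proj_apply closest_point_self)

lemma orth_proj_adjoint:
  assumes "subspace q"
  shows "blinfun_apply (orth_proj q) x \<bullet> y = x \<bullet> blinfun_apply (orth_proj q) y"
proof -
  note c = closest_point_subspace[OF assms]
  have "(x - closest_point q x) \<bullet> closest_point q y = 0" "(y - closest_point q y) \<bullet> closest_point q x = 0"
    using c by blast+
  then show ?thesis by (simp add: orth_proj_apply[OF assms] inner_diff_left inner_diff_right inner_commute)
qed

lemma orth_proj_inj:
  assumes "subspace q" "subspace q'" "orth_proj q = orth_proj q'"
  shows "q = q'"
  using assms by (metis orth_proj_id orth_proj_mem subsetI subset_antisym)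

definition adjoint_op :: "('n::finite) endo \<Rightarrow> 'n endo" where
  "adjoint_op \<phi> = Blinfun (adjoint (blinfun_apply \<phi>))"

lemma adjoint_op_works: "blinfun_apply (adjoint_op \<phi>) x \<bullet> y = x \<bullet> blinfun_apply \<phi> y"
proof -
  have l: "linear (blinfun_apply \<phi>)" by (simp add: blinfun.bounded_linear_right bounded_linear.linear)
  have "bounded_linear (adjoint (blinfun_apply \<phi>))"
    using adjoint_linear[OF l] linear_conv_bounded_linear by blast
  then show ?thesis by (simp add: adjoint_op_def bounded_linear_Blinfun_apply adjoint_clauses(2)[OF l])
qed

lemma bounded_linear_adjoint_op: "bounded_linear (adjoint_op :: ('n::finite) endo \<Rightarrow> _)"
proof (rule endo.linear_imp_bounded_linear, rule linearI)
  show "adjoint_op (\<phi> + \<psi>) = adjoint_op \<phi> + adjoint_op \<psi>" for \<phi> \<psi> :: "'n endo"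
    by (rule blinfun_eqI, rule vector_eq_rdot[THEN iffD1])
      (simp add: adjoint_op_works blinfun.bilinear_simps inner_add_left inner_add_right)
  show "adjoint_op (r *\<^sub>R \<phi>) = r *\<^sub>R adjoint_op \<phi>" for r and \<phi> :: "'n endo"
    by (rule blinfun_eqI, rule vector_eq_rdot[THEN iffD1])
      (simp add: adjoint_op_works blinfun.bilinear_simps)
qed

lemma linear_blinfun_apply: "linear (blinfun_apply \<phi>)"
  by (simp add: blinfun.bounded_linear_right bounded_linear.linear)

lemma subspace_blinfun_image: "subspace q \<Longrightarrow> subspace (blinfun_apply \<phi> ` q)"
  by (rule linear_subspace_image[OF linear_blinfun_apply])

text \<open>The projection with range \<open>\<phi> ` q\<close> obtained by transporting the orthogonal projection onto \<open>q\<close> with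
  \<open>\<phi>\<close>, when \<open>\<phi>'\<close> is inverse to \<open>\<phi>\<close>. It depends rationally on \<open>\<phi>\<close>, but is not orthogonal in general.\<close>

definition oblique :: "'n endo \<Rightarrow> 'n endo \<Rightarrow> (complex ^ ('n::finite)) set \<Rightarrow> 'n endo" where
  "oblique \<phi> \<phi>' q = \<phi> o\<^sub>L orth_proj q o\<^sub>L \<phi>'"

definition oblique_sym :: "'n endo \<Rightarrow> 'n endo \<Rightarrow> (complex ^ ('n::finite)) set \<Rightarrow> 'n endo" where
  "oblique_sym \<phi> \<phi>' q = oblique \<phi> \<phi>' q + adjoint_op (oblique \<phi> \<phi>' q) - id_blinfun"

text \<open>For an idempotent \<open>Q\<close> the orthogonal projection \<open>R\<close> onto its range satisfies \<open>R Q = Q\<close> and \<open>R Q\<^sup>*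
  = R\<close>, so \<open>R (Q + Q\<^sup>* - 1) = Q\<close>. The second factor is injective: if it kills \<open>x\<close>, then \<open>Q x = 0\<close>,
  thus \<open>Q\<^sup>* x = x\<close> and \<open>x \<bullet> x = x \<bullet> Q x = 0\<close>. This expresses orthogonal projections onto moving
  subspaces by products, adjoints and inverses.\<close>

lemma orth_proj_oblique:
  assumes q: "subspace q" and inv: "\<And>x. blinfun_apply \<phi>' (blinfun_apply \<phi> x) = x"
  shows "orth_proj (blinfun_apply \<phi> ` q) o\<^sub>L oblique_sym \<phi> \<phi>' q = oblique \<phi> \<phi>' q"
    and "blinfun_apply (oblique_sym \<phi> \<phi>' q) x = 0 \<Longrightarrow> x = 0"
proof -
  let ?P = "orth_proj (blinfun_apply \<phi> ` q)" and ?Q = "oblique \<phi> \<phi>' q"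
  let ?T = "oblique_sym \<phi> \<phi>' q"
  have sq: "subspace (blinfun_apply \<phi> ` q)" by (rule subspace_blinfun_image[OF q])
  have Qr: "?Q x \<in> \<phi> ` q" for x by (simp add: oblique_def orth_proj_mem[OF q])
  have Qid: "?Q x = x" if "x \<in> \<phi> ` q" for x using that by (auto simp: oblique_def inv orth_proj_id[OF q])
  have PQ: "?P (?Q x) = ?Q x" for x by (rule orth_proj_id[OF sq Qr])
  have QP: "?Q (?P x) = ?P x" for x by (rule Qid[OF orth_proj_mem[OF sq]])
  have PQ': "?P (adjoint_op ?Q x) = ?P x" for x
    by (rule vector_eq_rdot[THEN iffD1]) (simp add: orth_proj_adjoint[OF sq] adjoint_op_works QP)
  have PT: "?P (?T x) = ?Q x" for x
    by (simp add: oblique_sym_def blinfun.bilinear_simps PQ PQ')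
  then show "?P o\<^sub>L ?T = ?Q" by (intro blinfun_eqI) simp
  assume T: "?T x = 0"
  then have Q0: "?Q x = 0" using PT[of x] by (simp add: blinfun.bilinear_simps)
  then have "adjoint_op ?Q x = x" using T by (simp add: oblique_sym_def blinfun.bilinear_simps)
  then have "x \<bullet> x = x \<bullet> ?Q x" by (metis adjoint_op_works)
  then show "x = 0" using Q0 by simp
qed

lemma endo_inverse_exists:
  fixes T :: "('n::finite) endo"
  assumes "\<And>x. blinfun_apply T x = 0 \<Longrightarrow> x = 0"
  obtains S where "T o\<^sub>L S = id_blinfun" "S o\<^sub>L T = id_blinfun"
proof -
  have l: "linear (blinfun_apply T)" by (rule linear_blinfun_apply)
  then have inj: "inj (blinfun_apply T)" using assms by (simp add: linear_injective_0)
  obtain g where g: "linear g" "g \<circ> blinfun_apply T = id" using linear_injective_left_inverse[OF l inj] by blast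
  have "surj (blinfun_apply T)" by (rule linear_inj_imp_surj[OF l inj])
  then have "blinfun_apply T (g y) = y" for y using g(2) by (metis comp_apply id_apply surjD)
  moreover have "blinfun_apply (Blinfun g) = g" using g(1) by (simp add: bounded_linear_Blinfun_apply linear_conv_bounded_linear)
  ultimately have "T o\<^sub>L Blinfun g = id_blinfun" "Blinfun g o\<^sub>L T = id_blinfun"
    using g(2) by (auto intro!: blinfun_eqI simp: fun_eq_iff)
  then show thesis by (rule that)
qed

lemma orth_proj_moving:
  fixes \<phi> \<phi>' :: "'x \<Rightarrow> ('n::finite) endo"
  assumes q: "subspace q" and inv: "\<And>x. x \<in> U \<Longrightarrow> \<phi>' x o\<^sub>L \<phi> x = id_blinfun"
  obtains S where "\<And>x. x \<in> U \<Longrightarrow> oblique_sym (\<phi> x) (\<phi>' x) q o\<^sub>L S x = id_blinfun"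
    "\<And>x. x \<in> U \<Longrightarrow> S x o\<^sub>L oblique_sym (\<phi> x) (\<phi>' x) q = id_blinfun"
    "\<And>x. x \<in> U \<Longrightarrow> orth_proj (blinfun_apply (\<phi> x) ` q) = oblique (\<phi> x) (\<phi>' x) q o\<^sub>L S x"
proof -
  have "\<forall>x. \<exists>S. x \<in> U \<longrightarrow> oblique_sym (\<phi> x) (\<phi>' x) q o\<^sub>L S = id_blinfun \<and>
    S o\<^sub>L oblique_sym (\<phi> x) (\<phi>' x) q = id_blinfun \<and>
    orth_proj (blinfun_apply (\<phi> x) ` q) = oblique (\<phi> x) (\<phi>' x) q o\<^sub>L S"
  proof
    fix x
    show "\<exists>S. x \<in> U \<longrightarrow> oblique_sym (\<phi> x) (\<phi>' x) q o\<^sub>L S = id_blinfun \<and>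
      S o\<^sub>L oblique_sym (\<phi> x) (\<phi>' x) q = id_blinfun \<and>
      orth_proj (blinfun_apply (\<phi> x) ` q) = oblique (\<phi> x) (\<phi>' x) q o\<^sub>L S"
    proof (cases "x \<in> U")
      case True
      have i: "blinfun_apply (\<phi>' x) (blinfun_apply (\<phi> x) v) = v" for v
        using inv[OF True] by (metis blinfun_apply_blinfun_compose blinfun_apply_id_blinfun)
      obtain S where S: "oblique_sym (\<phi> x) (\<phi>' x) q o\<^sub>L S = id_blinfun"
        "S o\<^sub>L oblique_sym (\<phi> x) (\<phi>' x) q = id_blinfun"
        using endo_inverse_exists[OF orth_proj_oblique(2)[OF q i]] by blast
      then have "orth_proj (blinfun_apply (\<phi> x) ` q) = oblique (\<phi> x) (\<phi>' x) q o\<^sub>L S"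
        using orth_proj_oblique(1)[OF q i] by (metis blinfun_compose_assoc blinfun_compose_id(2))
      then show ?thesis using S by blast
    qed simp
  qed
  then obtain S where "\<And>x. x \<in> U \<longrightarrow> oblique_sym (\<phi> x) (\<phi>' x) q o\<^sub>L S x = id_blinfun \<and>
    S x o\<^sub>L oblique_sym (\<phi> x) (\<phi>' x) q = id_blinfun \<and>
    orth_proj (blinfun_apply (\<phi> x) ` q) = oblique (\<phi> x) (\<phi>' x) q o\<^sub>L S x" by metis
  then show thesis by (intro that[of S]) auto
qed

lemma orth_proj_moving_continuous:
  fixes \<phi> \<phi>' :: "'x::real_normed_vector \<Rightarrow> ('n::finite) endo"
  assumes q: "subspace q" and inv: "\<And>x. x \<in> U \<Longrightarrow> \<phi>' x o\<^sub>L \<phi> x = id_blinfun"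
    and c: "continuous_on U \<phi>" "continuous_on U \<phi>'"
  shows "continuous_on U (\<lambda>x. orth_proj (blinfun_apply (\<phi> x) ` q))"
proof -
  obtain S where S: "\<And>x. x \<in> U \<Longrightarrow> oblique_sym (\<phi> x) (\<phi>' x) q o\<^sub>L S x = id_blinfun"
    "\<And>x. x \<in> U \<Longrightarrow> S x o\<^sub>L oblique_sym (\<phi> x) (\<phi>' x) q = id_blinfun"
    "\<And>x. x \<in> U \<Longrightarrow> orth_proj (blinfun_apply (\<phi> x) ` q) = oblique (\<phi> x) (\<phi>' x) q o\<^sub>L S x"
    by (rule orth_proj_moving[OF q inv]) (assumption | rule that)+
  have Q: "continuous_on U (\<lambda>x. oblique (\<phi> x) (\<phi>' x) q)"
    unfolding oblique_def by (intro continuous_intros c)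
  have "continuous_on U (\<lambda>x. oblique_sym (\<phi> x) (\<phi>' x) q)"
    unfolding oblique_sym_def
    by (intro continuous_intros Q bounded_linear.continuous_on[OF bounded_linear_adjoint_op])
  then have "continuous_on U S" by (rule operator_inverse_continuous) (use S in auto)
  then have "continuous_on U (\<lambda>x. oblique (\<phi> x) (\<phi>' x) q o\<^sub>L S x)" by (intro continuous_intros Q)
  then show ?thesis using S(3) by (simp cong: continuous_on_cong)
qed

lemma orth_proj_moving_Ck:
  fixes \<phi> \<phi>' :: "'x::real_normed_vector \<Rightarrow> ('n::finite) endo"
  assumes q: "subspace q" and inv: "\<And>x. x \<in> U \<Longrightarrow> \<phi>' x o\<^sub>L \<phi> x = id_blinfun"
    and U: "open U" and c: "Ck_on k U \<phi>" "Ck_on k U \<phi>'"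
  shows "Ck_on k U (\<lambda>x. orth_proj (blinfun_apply (\<phi> x) ` q))"
proof -
  obtain S where S: "\<And>x. x \<in> U \<Longrightarrow> oblique_sym (\<phi> x) (\<phi>' x) q o\<^sub>L S x = id_blinfun"
    "\<And>x. x \<in> U \<Longrightarrow> S x o\<^sub>L oblique_sym (\<phi> x) (\<phi>' x) q = id_blinfun"
    "\<And>x. x \<in> U \<Longrightarrow> orth_proj (blinfun_apply (\<phi> x) ` q) = oblique (\<phi> x) (\<phi>' x) q o\<^sub>L S x"
    by (rule orth_proj_moving[OF q inv]) (assumption | rule that)+
  have Q: "Ck_on k U (\<lambda>x. oblique (\<phi> x) (\<phi>' x) q)"
    unfolding oblique_def
    by (intro Ck_on_bilinear[OF U bounded_bilinear_blinfun_compose] c Ck_on_const U)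
  have "Ck_on k U (\<lambda>x. oblique_sym (\<phi> x) (\<phi>' x) q)"
    unfolding oblique_sym_def
    by (intro Ck_on_diff Ck_on_add Q Ck_on_const U Ck_on_bounded_linear_comp[OF U bounded_linear_adjoint_op])
  then have "Ck_on k U S" by (rule Ck_on_operator_inverse[OF U]) (use S in auto)
  then have "Ck_on k U (\<lambda>x. oblique (\<phi> x) (\<phi>' x) q o\<^sub>L S x)"
    by (intro Ck_on_bilinear[OF U bounded_bilinear_blinfun_compose] Q)
  then show ?thesis by (rule Ck_on_cong[OF U, rotated]) (simp add: S(3))
qed

text \<open>The orbit map of the one-parameter groups through \<open>q\<close>, in the standard embedding of the
  Grassmannian.\<close>

definition exp_proj :: "(complex ^ ('n::finite)) set \<Rightarrow> 'n endo \<Rightarrow> 'n endo" where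
  "exp_proj q A = orth_proj (blinfun_apply (op_exp A) ` q)"

definition orbit_velocity :: "(complex ^ ('n::finite)) set \<Rightarrow> 'n endo \<Rightarrow> 'n endo" where
  "orbit_velocity q = frechet_derivative (exp_proj q) (at 0)"

lemma smooth_exp_proj: "subspace q \<Longrightarrow> smooth_on UNIV (exp_proj (q :: (complex ^ ('n::finite)) set))"
  unfolding smooth_on_def exp_proj_def
proof
  fix k assume q: "subspace q"
  have "Ck_on k UNIV (\<lambda>A::'n endo. - A)"
    by (rule Ck_on_bounded_linear[OF open_UNIV bounded_linear_minus[OF bounded_linear_ident]])
  then have "Ck_on k UNIV (\<lambda>A::'n endo. op_exp (- A))"
    by (rule endo.Ck_on_compose[OF open_UNIV open_UNIV subset_UNIV _ op_exp_Ck_on])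
  then show "Ck_on k UNIV (\<lambda>A. orth_proj (blinfun_apply (op_exp A) ` q))"
    by (rule orth_proj_moving_Ck[OF q op_exp_inverse(2) open_UNIV op_exp_Ck_on])
qed

lemma exp_proj_has_derivative:
  "subspace q \<Longrightarrow> (exp_proj q has_derivative orbit_velocity q) (at 0)"
  unfolding orbit_velocity_def using smooth_exp_proj[of q] Ck_on_SucD(1)[of _ UNIV "exp_proj q" 0]
  by (auto simp: smooth_on_def)

lemma linear_orbit_velocity: "subspace q \<Longrightarrow> linear (orbit_velocity q)"
  using exp_proj_has_derivative has_derivative_linear by blast

lemma exp_proj_vector_derivative:
  assumes "subspace q"
  shows "((\<lambda>t. orth_proj (blinfun_apply (op_exp (t *\<^sub>R A)) ` q)) has_vector_derivative orbit_velocity q A) (at 0)"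
proof -
  have "((\<lambda>t. t *\<^sub>R A) has_vector_derivative A) (at 0)" by (auto intro!: derivative_eq_intros)
  from vector_derivative_diff_chain_within[OF this, of "exp_proj q" "orbit_velocity q"]
  show ?thesis using exp_proj_has_derivative[OF assms] by (simp add: o_def has_derivative_at_withinI exp_proj_def)
qed

text \<open>The kernel of the infinitesimal action is the stabilizer of \<open>q\<close>: if \<open>A\<close> preserves \<open>q\<close>, so do its
  exponentials, and conversely a curve of projections with derivative zero forces \<open>A\<close> to preserve
  \<open>q\<close>.\<close>

lemma orbit_velocity_eq_0_iff:
  assumes q: "subspace q"
  shows "orbit_velocity q A = 0 \<longleftrightarrow> (\<forall>x\<in>q. blinfun_apply A x \<in> q)"
proof
  assume *: "\<forall>x\<in>q. blinfun_apply A x \<in> q"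
  have "blinfun_apply (op_exp (t *\<^sub>R A)) ` q = q" for t
    by (rule op_exp_image_subspace[OF q closed_subspace[OF q]])
      (use * q in \<open>auto simp: blinfun.bilinear_simps subspace_scale\<close>)
  then have "((\<lambda>t. orth_proj q) has_vector_derivative orbit_velocity q A) (at (0::real))"
    using exp_proj_vector_derivative[OF q, of A] by simp
  then show "orbit_velocity q A = 0" by (rule vector_derivative_unique_at[OF _ has_vector_derivative_const])
next
  \<comment> \<open>Differentiate \<open>P\<^sub>t exp(tA) P\<^sub>0 = exp(tA) P\<^sub>0\<close> at \<open>t = 0\<close>.\<close>
  assume 0: "orbit_velocity q A = 0"
  let ?P = "\<lambda>t. orth_proj (blinfun_apply (op_exp (t *\<^sub>R A)) ` q)" and ?E = "\<lambda>t. op_exp (t *\<^sub>R A)"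
  have E: "(?E has_vector_derivative A) (at 0)" using op_exp_vector_derivative[of A 0 UNIV] by simp
  have "((\<lambda>t. ?P t o\<^sub>L ?E t) has_vector_derivative (?P 0 o\<^sub>L A) + (0 o\<^sub>L ?E 0)) (at 0)"
    using bounded_bilinear.has_vector_derivative[OF bounded_bilinear_blinfun_compose
        exp_proj_vector_derivative[OF q, of A] E] 0 by simp
  then have 1: "((\<lambda>t. ?P t o\<^sub>L ?E t o\<^sub>L orth_proj q) has_vector_derivative (orth_proj q o\<^sub>L A o\<^sub>L orth_proj q)) (at 0)"
    using bounded_linear.has_vector_derivative[OF compose_bounded_linear_left]
    by (fastforce simp: image_def)
  have "?P t o\<^sub>L ?E t o\<^sub>L orth_proj q = ?E t o\<^sub>L orth_proj q" for t
    by (rule blinfun_eqI) (simp add: orth_proj_id[OF subspace_blinfun_image[OF q]] orth_proj_mem[OF q])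
  then have "((\<lambda>t. ?E t o\<^sub>L orth_proj q) has_vector_derivative (orth_proj q o\<^sub>L A o\<^sub>L orth_proj q)) (at 0)"
    using 1 by simp
  moreover have "((\<lambda>t. ?E t o\<^sub>L orth_proj q) has_vector_derivative (A o\<^sub>L orth_proj q)) (at 0)"
    by (rule bounded_linear.has_vector_derivative[OF compose_bounded_linear_left E])
  ultimately have "orth_proj q o\<^sub>L A o\<^sub>L orth_proj q = A o\<^sub>L orth_proj q" by (rule vector_derivative_unique_at)
  then have "orth_proj q (A (orth_proj q x)) = A (orth_proj q x)" for x
    by (metis blinfun_apply_blinfun_compose)
  then show "\<forall>x\<in>q. blinfun_apply A x \<in> q" by (metis orth_proj_id[OF q] orth_proj_mem[OF q])
qed

section \<open>Orbits of linear groups are immersed submanifolds\<close>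

text \<open>The condition \<open>log_mem\<close> says that \<open>l\<close> is all of the Lie algebra of \<open>L\<close> and that near the identity
  \<open>L\<close> consists only of exponentials of \<open>l\<close>. This one condition yields both the local product
  structure of \<open>L\<close> and the charts of its orbits.\<close>

locale linear_lie_group =
  fixes L l :: "('n::finite) endo set"
  assumes subspace_l: "subspace l"
    and one: "id_blinfun \<in> L"
    and mult: "a \<in> L \<Longrightarrow> b \<in> L \<Longrightarrow> a o\<^sub>L b \<in> L"
    and inverse: "a \<in> L \<Longrightarrow> \<exists>b\<in>L. a o\<^sub>L b = id_blinfun \<and> b o\<^sub>L a = id_blinfun"
    and exp_mem: "A \<in> l \<Longrightarrow> op_exp A \<in> L"
    and log_mem: "\<exists>r>0. \<forall>C. norm C < r \<longrightarrow> op_exp C \<in> L \<longrightarrow> C \<in> l"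
begin

definition ginv :: "'n endo \<Rightarrow> 'n endo" where
  "ginv a = (SOME b. b \<in> L \<and> a o\<^sub>L b = id_blinfun \<and> b o\<^sub>L a = id_blinfun)"

lemma ginv: assumes "a \<in> L" shows "ginv a \<in> L" "a o\<^sub>L ginv a = id_blinfun" "ginv a o\<^sub>L a = id_blinfun"
proof -
  have "\<exists>b. b \<in> L \<and> a o\<^sub>L b = id_blinfun \<and> b o\<^sub>L a = id_blinfun" using inverse[OF assms] by blast
  from someI_ex[OF this] show "ginv a \<in> L" "a o\<^sub>L ginv a = id_blinfun" "ginv a o\<^sub>L a = id_blinfun"
    unfolding ginv_def by blast+
qed

lemma ginv_apply [simp]:
  assumes "a \<in> L" shows "blinfun_apply a (blinfun_apply (ginv a) x) = x" "blinfun_apply (ginv a) (blinfun_apply a x) = x"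
  using ginv[OF assms] by (metis blinfun_apply_blinfun_compose blinfun_apply_id_blinfun)+

lemma ginv_compose [simp]:
  assumes "a \<in> L" shows "a o\<^sub>L (ginv a o\<^sub>L b) = b" "ginv a o\<^sub>L (a o\<^sub>L b) = b"
  using ginv[OF assms] by (metis blinfun_compose_assoc blinfun_compose_id(1))+

text \<open>Conjugation maps the one-parameter group of \<open>A\<close> into \<open>L\<close>; a small multiple of the conjugate of \<open>A\<close>
  is then in \<open>l\<close>, hence also the conjugate itself.\<close>

lemma conjugate_mem:
  assumes "g \<in> L" "A \<in> l" shows "g o\<^sub>L A o\<^sub>L ginv g \<in> l"
proof -
  let ?C = "g o\<^sub>L A o\<^sub>L ginv g"
  obtain r where r: "r > 0" "\<And>C. norm C < r \<Longrightarrow> op_exp C \<in> L \<Longrightarrow> C \<in> l" using log_mem by blast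
  define t where "t = r / (norm ?C + 1)"
  have np: "norm ?C + 1 > 0" by (smt (verit) norm_ge_zero)
  have t: "t > 0" using r np by (simp add: t_def)
  have "t * norm ?C < t * (norm ?C + 1)" using t by simp
  also have "\<dots> = r" using np by (simp add: t_def)
  finally have "norm (t *\<^sub>R ?C) < r" using t by simp
  moreover have "op_exp (t *\<^sub>R ?C) = g o\<^sub>L op_exp (t *\<^sub>R A) o\<^sub>L ginv g"
    using op_exp_conjugate[OF ginv(3,2)[OF assms(1)], of "t *\<^sub>R A"]
    by (simp add: compose_scaleR_left
        compose_scaleR_right)
  moreover have "g o\<^sub>L op_exp (t *\<^sub>R A) o\<^sub>L ginv g \<in> L"
    using assms subspace_l by (intro mult ginv exp_mem subspace_scale) auto
  ultimately have "t *\<^sub>R ?C \<in> l" using r(2) by simp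
  then have "(1 / t) *\<^sub>R (t *\<^sub>R ?C) \<in> l" by (rule subspace_scale[OF subspace_l])
  then show ?thesis using t by simp
qed

lemma ginv_continuous: "continuous_on L ginv"
  by (rule operator_inverse_continuous[OF continuous_on_id]) (use ginv in auto)

definition points :: "(complex ^ 'n) set \<Rightarrow> 'n endo set" where
  "points p = orth_proj ` (\<lambda>g. blinfun_apply g ` p) ` L"

definition lift :: "(complex ^ 'n) set \<Rightarrow> 'n endo set \<Rightarrow> 'n endo set" where
  "lift p W = {g \<in> L. orth_proj (blinfun_apply g ` p) \<in> W}"

text \<open>The quotient topology of the subspace topology of \<open>L\<close> under the orbit map. It can be finer than
  the topology induced by the Grassmannian.\<close>

definition orbit_top :: "(complex ^ 'n) set \<Rightarrow> 'n endo topology" where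
  "orbit_top p = topology (\<lambda>W. W \<subseteq> points p \<and> openin (top_of_set L) (lift p W))"

lemma openin_orbit_top: "openin (orbit_top p) W \<longleftrightarrow> W \<subseteq> points p \<and> openin (top_of_set L) (lift p W)"
proof -
  have "istopology (\<lambda>W. W \<subseteq> points p \<and> openin (top_of_set L) (lift p W))"
    unfolding istopology_def
  proof (intro conjI allI impI)
    fix S T assume "S \<subseteq> points p \<and> openin (top_of_set L) (lift p S)" "T \<subseteq> points p \<and> openin (top_of_set L) (lift p T)"
    moreover have "lift p (S \<inter> T) = lift p S \<inter> lift p T" by (auto simp: lift_def)
    ultimately show "S \<inter> T \<subseteq> points p" "openin (top_of_set L) (lift p (S \<inter> T))" by auto
  next
    fix K assume K: "\<forall>S\<in>K. S \<subseteq> points p \<and> openin (top_of_set L) (lift p S)"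
    moreover have "lift p (\<Union>K) = \<Union>(lift p ` K)" by (auto simp: lift_def)
    ultimately show "\<Union>K \<subseteq> points p" "openin (top_of_set L) (lift p (\<Union>K))" by auto
  qed
  then show ?thesis by (simp add: orbit_top_def topology_inverse')
qed

lemma topspace_orbit_top: "topspace (orbit_top p) = points p"
proof -
  have "lift p (points p) = L" by (auto simp: lift_def points_def)
  then have "openin (orbit_top p) (points p)" by (simp add: openin_orbit_top)
  then show ?thesis using openin_orbit_top by (auto simp: topspace_def)
qed

lemma lift_continuous:
  assumes "openin (orbit_top p) W" "continuous_on S f" "f ` S \<subseteq> L"
  shows "openin (top_of_set S) {x\<in>S. orth_proj (blinfun_apply (f x) ` p) \<in> W}"
proof -
  have "openin (top_of_set S) (S \<inter> f -` lift p W)"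
    using continuous_openin_preimage[OF assms(2), of L "lift p W"] assms by (auto simp: openin_orbit_top)
  moreover have "S \<inter> f -` lift p W = {x\<in>S. orth_proj (blinfun_apply (f x) ` p) \<in> W}"
    using assms(3) by (auto simp: lift_def)
  ultimately show ?thesis by simp
qed

text \<open>The orbit map is open, so it carries a countable base of \<open>L\<close> to one of the orbit.\<close>

lemma orbit_top_second_countable:
  assumes p: "subspace p"
  shows "\<exists>\<B>. countable \<B> \<and> (\<forall>V\<in>\<B>. openin (orbit_top p) V) \<and>
     (\<forall>W x. openin (orbit_top p) W \<and> x \<in> W \<longrightarrow> (\<exists>V\<in>\<B>. x \<in> V \<and> V \<subseteq> W))"
proof -
  let ?\<pi> = "\<lambda>g. orth_proj (blinfun_apply g ` p)"
  obtain \<B> where B: "countable \<B>" "\<And>B. B \<in> \<B> \<Longrightarrow> openin (top_of_set L) B"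
    "\<And>W x. openin (top_of_set L) W \<Longrightarrow> x \<in> W \<Longrightarrow> \<exists>B\<in>\<B>. x \<in> B \<and> B \<subseteq> W"
    by (rule endo.second_countable_base[of L]) (rule that)
  \<comment> \<open>The orbit map is open: the saturation of an open set is a union of its right translates.\<close>
  have op: "openin (orbit_top p) (?\<pi> ` B)" if "openin (top_of_set L) B" for B
  proof -
    have BL: "B \<subseteq> L" using openin_subset[OF that] by simp
    have "openin (top_of_set L) (lift p (?\<pi> ` B))"
    proof (subst openin_subopen, intro ballI)
      fix g assume "g \<in> lift p (?\<pi> ` B)"
      then obtain b where b: "g \<in> L" "b \<in> B" "?\<pi> g = ?\<pi> b" by (auto simp: lift_def)
      let ?f = "\<lambda>x. x o\<^sub>L (ginv g o\<^sub>L b)"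
      let ?U = "L \<inter> ?f -` B"
      have bL: "b \<in> L" using b BL by blast
      have "continuous_on L ?f" by (intro continuous_intros)
      moreover have "?f ` L \<subseteq> L" using b bL by (auto intro!: mult ginv)
      ultimately have "openin (top_of_set L) ?U" by (intro continuous_openin_preimage[where T=L]) (use that in auto)
      moreover have "g \<in> ?U" using b by simp
      moreover have "?U \<subseteq> lift p (?\<pi> ` B)"
      proof
        fix x assume x: "x \<in> ?U"
        have bg: "blinfun_apply b ` p = blinfun_apply g ` p"
          using b(3) by (intro orth_proj_inj subspace_blinfun_image p) simp
        have "blinfun_apply (?f x) ` p = blinfun_apply x ` blinfun_apply (ginv g) ` (blinfun_apply b ` p)"
          by (simp add: image_image)
        also have "\<dots> = blinfun_apply x ` p" unfolding bg using b(1) by (simp add: image_image)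
        finally have "?\<pi> (?f x) = ?\<pi> x" by simp
        then show "x \<in> lift p (?\<pi> ` B)" using x by (auto simp: lift_def image_iff intro!: bexI[of _ "?f x"])
      qed
      ultimately show "\<exists>T. openin (top_of_set L) T \<and> g \<in> T \<and> T \<subseteq> lift p (?\<pi> ` B)" by blast
    qed
    then show ?thesis using BL by (auto simp: openin_orbit_top points_def)
  qed
  show ?thesis
  proof (intro exI[of _ "(\<lambda>B. ?\<pi> ` B) ` \<B>"] conjI allI impI)
    show "countable ((\<lambda>B. ?\<pi> ` B) ` \<B>)" using B(1) by simp
    show "\<forall>V\<in>(\<lambda>B. ?\<pi> ` B) ` \<B>. openin (orbit_top p) V" using op B(2) by blast
    fix W x assume W: "openin (orbit_top p) W \<and> x \<in> W"
    then obtain g where g: "g \<in> L" "x = ?\<pi> g" by (auto simp: openin_orbit_top points_def)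
    then have "g \<in> lift p W" using W by (simp add: lift_def)
    then obtain C where "C \<in> \<B>" "g \<in> C" "C \<subseteq> lift p W" using B(3) W by (metis openin_orbit_top)
    then show "\<exists>V\<in>(\<lambda>B. ?\<pi> ` B) ` \<B>. x \<in> V \<and> V \<subseteq> W" using g by (auto simp: lift_def)
  qed
qed

end

text \<open>Near a point \<open>q\<close> the orbit is parametrized by \<open>exp\<close> on a complement \<open>c\<close> in \<open>l\<close> of the
  stabilizer of \<open>q\<close>; the complement is given as the kernel of a projection \<open>\<pi>\<close> onto the stabilizer.\<close>

locale orbit_chart = linear_lie_group L l for L l :: "('n::finite) endo set" +
  fixes p q :: "(complex ^ 'n) set" and g0 :: "'n endo" and \<pi> :: "'n endo \<Rightarrow> 'n endo"
  assumes p: "subspace p" and g0: "g0 \<in> L" "q = blinfun_apply g0 ` p"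
    and \<pi>: "linear \<pi>" "\<And>A. \<pi> A \<in> l" "\<And>A x. x \<in> q \<Longrightarrow> blinfun_apply (\<pi> A) x \<in> q"
      "\<And>A. A \<in> l \<Longrightarrow> (\<And>x. x \<in> q \<Longrightarrow> blinfun_apply A x \<in> q) \<Longrightarrow> \<pi> A = A"
begin

definition c :: "'n endo set" where "c = {A \<in> l. \<pi> A = 0}"

lemma q: "subspace q"
  unfolding g0(2) by (rule subspace_blinfun_image[OF p])

lemma subspace_c: "subspace c"
  using subspace_l \<pi>(1) by (auto simp: c_def subspace_def linear_add linear_scale linear_0)

lemma \<pi>_idem: "\<pi> (\<pi> A) = \<pi> A"
  by (rule \<pi>(4)) (use \<pi> in auto)

lemma diff_\<pi>_mem_c: "A \<in> l \<Longrightarrow> A - \<pi> A \<in> c"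
  using \<pi> subspace_l by (simp add: c_def subspace_diff linear_diff \<pi>_idem)

lemma projections:
  obtains a s w where "bounded_linear a" "bounded_linear s" "bounded_linear w"
    "\<And>A. a A \<in> c" "\<And>A. s A \<in> l" "\<And>A x. x \<in> q \<Longrightarrow> blinfun_apply (s A) x \<in> q"
    "\<And>A. A = a A + s A + w A" "\<And>A. A \<in> l \<Longrightarrow> w A = 0" "\<And>A. w (w A) = w A" "\<And>A. A \<in> c \<Longrightarrow> a A = A" "\<And>A. A \<in> c \<Longrightarrow> s A = 0"
proof -
  obtain P where P: "bounded_linear P" "range P \<subseteq> l" "\<And>x. x \<in> l \<Longrightarrow> P x = x"
    using endo.projection_exists[OF subspace_l] by blast
  have Pl: "P A \<in> l" for A using P(2) by blast
  have bl\<pi>: "bounded_linear \<pi>" by (rule endo.linear_imp_bounded_linear[OF \<pi>(1)])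
  show thesis
  proof (rule that[of "\<lambda>A. P A - \<pi> (P A)" "\<lambda>A. \<pi> (P A)" "\<lambda>A. A - P A"])
    show "bounded_linear (\<lambda>A. P A - \<pi> (P A))" "bounded_linear (\<lambda>A. \<pi> (P A))" "bounded_linear (\<lambda>A. A - P A)"
      using P(1) bounded_linear_compose[OF bl\<pi> P(1)] by (auto intro: bounded_linear_sub bounded_linear_ident)
    show "P A - \<pi> (P A) \<in> c" for A using Pl by (rule diff_\<pi>_mem_c)
    show "\<pi> (P A) \<in> l" for A by (rule \<pi>(2))
    show "blinfun_apply (\<pi> (P A)) x \<in> q" if "x \<in> q" for A x using \<pi>(3) that by blast
    show "A = P A - \<pi> (P A) + \<pi> (P A) + (A - P A)" for A by simp
    show "A - P A = 0" if "A \<in> l" for A using P(3)[OF that] by simp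
    show "A - P A - P (A - P A) = A - P A" for A
      using P(3)[OF Pl] by (simp add: bounded_linear.linear[OF P(1)] linear_diff)
    show "P A - \<pi> (P A) = A" "\<pi> (P A) = 0" if "A \<in> c" for A using that P(3) by (auto simp: c_def)
  qed
qed

text \<open>With complements \<open>c\<close> of the stabilizer in \<open>l\<close> and \<open>w\<close> of \<open>l\<close>, every operator near the identity is
  uniquely \<open>exp A exp S exp W\<close> with \<open>A\<close> in \<open>c\<close>, \<open>S\<close> in the stabilizer and \<open>W\<close> in \<open>w\<close>. For elements
  of the group the factor \<open>exp W\<close> lies in the group too, so \<open>W\<close> is in \<open>l\<close> by \<open>log_mem\<close>, and
  therefore zero. The factor \<open>exp S\<close> does not move \<open>q\<close>.\<close>

lemma group_coordinates:
  obtains O2 a where "open O2" "id_blinfun \<in> O2" "continuous_on O2 a" "\<And>g. a g \<in> c"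
    "\<And>g. g \<in> L \<Longrightarrow> g \<in> O2 \<Longrightarrow> blinfun_apply g ` q = blinfun_apply (op_exp (a g)) ` q"
    "\<exists>d>0. \<forall>A\<in>c. norm A < d \<longrightarrow> op_exp A \<in> O2 \<and> a (op_exp A) = A"
proof -
  obtain a s w where asw: "bounded_linear a" "bounded_linear s" "bounded_linear w"
    "\<And>A. a A \<in> c" "\<And>A. s A \<in> l" "\<And>A x. x \<in> q \<Longrightarrow> blinfun_apply (s A) x \<in> q"
    "\<And>A. A = a A + s A + w A" "\<And>A. A \<in> l \<Longrightarrow> w A = 0" "\<And>A. w (w A) = w A" "\<And>A. A \<in> c \<Longrightarrow> a A = A" "\<And>A. A \<in> c \<Longrightarrow> s A = 0"
    by (rule projections) (rule that)
  obtain r where r: "r > 0" "\<And>C. norm C < r \<Longrightarrow> op_exp C \<in> L \<Longrightarrow> C \<in> l" using log_mem by blast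
  let ?\<Theta> = "\<lambda>z. op_exp (a z) o\<^sub>L op_exp (s z) o\<^sub>L op_exp (w z)"
  have z0: "a 0 = 0" "s 0 = 0" "w 0 = 0" using asw(1-3) by (simp_all add: bounded_linear.linear linear_0)
  have ck: "Ck_on k UNIV (\<lambda>z. op_exp (f z))" if "bounded_linear f" for k and f :: "'n endo \<Rightarrow> 'n endo"
    by (rule endo.Ck_on_compose[OF open_UNIV open_UNIV subset_UNIV Ck_on_bounded_linear[OF open_UNIV that] op_exp_Ck_on])
  have smooth: "smooth_on UNIV ?\<Theta>"
    unfolding smooth_on_def by (intro allI Ck_on_bilinear[OF open_UNIV bounded_bilinear_blinfun_compose] ck asw)
  have d0: "((\<lambda>z. op_exp (f z)) has_derivative f) (at 0)" if "bounded_linear f" for f :: "'n endo \<Rightarrow> 'n endo"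
  proof -
    have "f 0 = 0" using that by (simp add: bounded_linear.linear linear_0)
    then show ?thesis
      using diff_chain_at[OF bounded_linear_imp_has_derivative[OF that], of op_exp "\<lambda>v. v" 0] op_exp_has_derivative_zero
      by (simp add: o_def)
  qed
  have "(?\<Theta> has_derivative (\<lambda>v. v)) (at 0)"
  proof -
    note F = compose_FDERIV
    have "a v + s v + w v = v" for v using asw(7)[of v] by simp
    then show ?thesis
      using F[OF F[OF d0[OF asw(1)] d0[OF asw(2)]] d0[OF asw(3)]] by (simp add: z0 add_ac)
  qed
  then obtain U V \<Gamma> where UV: "open U" "U \<subseteq> UNIV" "0 \<in> U" "open V" "homeomorphism U V ?\<Theta> \<Gamma>"
    by (rule endo.smooth_inverse_function[OF open_UNIV smooth UNIV_I _ linear_id[unfolded id_def]]) auto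
  have h: "\<And>z. z \<in> U \<Longrightarrow> \<Gamma> (?\<Theta> z) = z" "\<And>y. y \<in> V \<Longrightarrow> ?\<Theta> (\<Gamma> y) = y" "continuous_on V \<Gamma>" "?\<Theta> ` U = V"
    using UV(5) by (auto simp: homeomorphism_def)
  have \<Theta>0: "?\<Theta> 0 = id_blinfun" by (simp add: z0)
  have "?\<Theta> 0 \<in> ?\<Theta> ` U" by (rule imageI[OF UV(3)])
  then have idV: "id_blinfun \<in> V" by (simp only: \<Theta>0 h(4))
  have \<Gamma>id: "\<Gamma> id_blinfun = 0" using h(1)[OF UV(3)] by (simp only: \<Theta>0)
  let ?O = "{y \<in> V. norm (w (\<Gamma> y)) < r}"
  have cw: "continuous_on V (\<lambda>y. norm (w (\<Gamma> y)))"
    by (intro continuous_intros bounded_linear.continuous_on[OF asw(3)] h(3))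
  have opO: "open ?O"
    using continuous_open_preimage[OF cw UV(4) open_lessThan[of r]] by (simp add: vimage_def Int_def)
  show thesis
  proof (rule that[of ?O "\<lambda>y. a (\<Gamma> y)"])
    show "open ?O" by (rule opO)
    show "id_blinfun \<in> ?O" using idV r(1) by (simp add: \<Gamma>id z0)
    show "continuous_on ?O (\<lambda>y. a (\<Gamma> y))"
      by (intro bounded_linear.continuous_on[OF asw(1)] continuous_on_subset[OF h(3)]) auto
    show "a (\<Gamma> y) \<in> c" for y by (rule asw(4))
    show "blinfun_apply g ` q = blinfun_apply (op_exp (a (\<Gamma> g))) ` q" if g: "g \<in> L" "g \<in> ?O" for g
    proof -
      let ?z = "\<Gamma> g"
      have eq: "g = op_exp (a ?z) o\<^sub>L op_exp (s ?z) o\<^sub>L op_exp (w ?z)" using g(2) h(2)[of g] by simp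
      have "op_exp (w ?z) = op_exp (- s ?z) o\<^sub>L (op_exp (- a ?z) o\<^sub>L g)"
        by (subst eq) (rule blinfun_eqI, simp)
      moreover have "op_exp (- s ?z) o\<^sub>L (op_exp (- a ?z) o\<^sub>L g) \<in> L"
        using asw(4,5)[of ?z] g(1) subspace_l by (intro mult exp_mem) (auto simp: c_def subspace_neg)
      ultimately have "w ?z \<in> l" using g(2) r(2) by simp
      then have "w ?z = 0" using asw(8,9) by metis
      then have "blinfun_apply g ` q = blinfun_apply (op_exp (a ?z)) ` blinfun_apply (op_exp (s ?z)) ` q"
        by (subst eq) (simp add: image_image)
      also have "blinfun_apply (op_exp (s ?z)) ` q = q"
        by (rule op_exp_image_subspace[OF q closed_subspace[OF q] asw(6)])
      finally show ?thesis .
    qed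
    obtain d where d: "d > 0" "ball 0 d \<subseteq> U" using UV(1,3) open_contains_ball by blast
    have "op_exp A \<in> ?O \<and> a (\<Gamma> (op_exp A)) = A" if "A \<in> c" "norm A < d" for A
    proof -
      have A: "a A = A" "s A = 0" "w A = 0" using asw that by (auto simp: c_def)
      then have e: "?\<Theta> A = op_exp A" by simp
      have AU: "A \<in> U" using that d by auto
      have "?\<Theta> A \<in> ?\<Theta> ` U" by (rule imageI[OF AU])
      then have "op_exp A \<in> V" by (simp only: e h(4))
      moreover have "\<Gamma> (op_exp A) = A" using h(1)[OF AU] by (simp only: e)
      ultimately have "\<Gamma> (op_exp A) = A" "op_exp A \<in> V" by blast+
      then show ?thesis using A r(1) by simp
    qed
    then show "\<exists>d>0. \<forall>A\<in>c. norm A < d \<longrightarrow> op_exp A \<in> ?O \<and> a (\<Gamma> (op_exp A)) = A" using d(1) by blast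
  qed
qed


text \<open>On \<open>c\<close> the orbit map is an immersion at 0. Its derivative there is extended to an isomorphism \<open>D'\<close>
  of the ambient space, and \<open>\<Psi>\<close> is the orbit map on \<open>c\<close> plus \<open>D'\<close> on a complement, so that \<open>\<Psi>\<close> is a
  local diffeomorphism that takes the linear subspace \<open>c\<close> into the orbit.\<close>

lemma parametrization:
  obtains d \<Psi> G O1 where "d > 0" "open O1" "smooth_on (ball 0 d) \<Psi>" "smooth_on O1 G"
    "homeomorphism (ball 0 d) O1 \<Psi> G" "\<And>A. A \<in> c \<Longrightarrow> \<Psi> A = exp_proj q A"
proof -
  let ?D = "orbit_velocity q"
  obtain a where a: "bounded_linear a" "range a \<subseteq> c" "\<And>x. x \<in> c \<Longrightarrow> a x = x"
    using endo.projection_exists[OF subspace_c] by blast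
  have ac: "a x \<in> c" for x using a(2) by blast
  have inj: "inj_on ?D c"
  proof (rule inj_onI)
    fix A B assume AB: "A \<in> c" "B \<in> c" "?D A = ?D B"
    then have "?D (A - B) = 0" using linear_orbit_velocity[OF q] by (simp add: linear_diff)
    then have "blinfun_apply (A - B) x \<in> q" if "x \<in> q" for x
      using that by (simp add: orbit_velocity_eq_0_iff[OF q])
    moreover have ABc: "A - B \<in> c" using AB subspace_c by (simp add: subspace_diff)
    ultimately have "\<pi> (A - B) = A - B" by (intro \<pi>(4)) (auto simp: c_def)
    then show "A = B" using ABc by (simp add: c_def)
  qed
  obtain D' D'' where D': "linear D'" "\<And>x. x \<in> c \<Longrightarrow> D' x = ?D x" "linear D''" "\<And>x. D'' (D' x) = x"
    by (rule endo.extend_injective[OF linear_orbit_velocity[OF q] subspace_c inj]) (rule that)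
  let ?\<Psi> = "\<lambda>z. exp_proj q (a z) + D' (z - a z)"
  have bl: "bounded_linear (\<lambda>z. D' (z - a z))"
    by (rule bounded_linear_compose[OF endo.linear_imp_bounded_linear[OF D'(1)]])
      (intro bounded_linear_sub bounded_linear_ident a(1))
  have ck: "Ck_on k UNIV (exp_proj q)" for k using smooth_exp_proj[OF q] by (simp add: smooth_on_def)
  have smooth: "smooth_on UNIV ?\<Psi>"
    unfolding smooth_on_def
    by (intro allI Ck_on_add open_UNIV Ck_on_bounded_linear[OF open_UNIV bl]
        endo.Ck_on_compose[OF open_UNIV open_UNIV subset_UNIV Ck_on_bounded_linear[OF open_UNIV a(1)] ck])
  have "a 0 = 0" using a(1) by (simp add: bounded_linear.linear linear_0)
  then have d1: "((\<lambda>z. exp_proj q (a z)) has_derivative (\<lambda>v. ?D (a v))) (at 0)"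
    using diff_chain_at[OF bounded_linear_imp_has_derivative[OF a(1)], of "exp_proj q" ?D 0]
      exp_proj_has_derivative[OF q] by (simp add: o_def)
  have "?D (a v) + D' (v - a v) = D' v" for v
    using D'(1) D'(2)[OF ac[of v]] by (simp add: linear_diff)
  then have d: "(?\<Psi> has_derivative D') (at 0)"
    using has_derivative_add[OF d1 bounded_linear_imp_has_derivative[OF bl]] by simp
  obtain U V G where UV: "open U" "U \<subseteq> UNIV" "0 \<in> U" "open V" "homeomorphism U V ?\<Psi> G" "smooth_on V G"
    by (rule endo.smooth_inverse_function[OF open_UNIV smooth UNIV_I d D'(3,4)]) (rule that)
  obtain d where d: "d > 0" "ball 0 d \<subseteq> U" using UV(1,3) open_contains_ball by blast
  have hom: "homeomorphism (ball 0 d) (?\<Psi> ` ball 0 d) ?\<Psi> G"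
    by (rule homeomorphism_of_subsets[OF UV(5) d(2)]) (use UV(5) d(2) in \<open>auto simp: homeomorphism_def\<close>)
  have "openin (top_of_set V) (?\<Psi> ` ball 0 d)"
    by (rule homeomorphism_imp_open_map[OF UV(5)]) (use d(2) UV(1) in \<open>simp add: openin_open_eq\<close>)
  then have op: "open (?\<Psi> ` ball 0 d)" "?\<Psi> ` ball 0 d \<subseteq> V" using UV(4) by (auto simp: openin_open_eq)
  show thesis
  proof (rule that[OF d(1) op(1) _ _ hom])
    show "smooth_on (ball 0 d) ?\<Psi>"
      using smooth unfolding smooth_on_def by (blast intro: Ck_on_subset[OF _ subset_UNIV])
    show "smooth_on (?\<Psi> ` ball 0 d) G"
      using UV(6) unfolding smooth_on_def by (blast intro: Ck_on_subset[OF _ op(2)])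
    show "exp_proj q (a A) + D' (A - a A) = exp_proj q A" if "A \<in> c" for A
      using a(3)[OF that] D'(1) by (simp add: linear_0)
  qed
qed

text \<open>The piece \<open>V\<close> of the orbit parametrized by a small ball of \<open>c\<close> is open in the orbit because an
  element of \<open>L\<close> near a given one moves \<open>q\<close> as \<open>exp A\<close> does, with \<open>A\<close> in \<open>c\<close> depending continuously
  on the element. On \<open>V\<close> the two topologies agree since \<open>exp\<close> lifts the parametrization continuously
  to \<open>L\<close>.\<close>

lemma chart:
  assumes B: "finite B" "independent B" "span B = c"
  shows "\<exists>V. openin (orbit_top p) V \<and> orth_proj q \<in> V \<and> embedded_submanifold (card B) V \<and>
    subtopology (orbit_top p) V = top_of_set V"
proof -
  obtain d1 \<Psi> G O1 where par: "d1 > 0" "open O1" "smooth_on (ball 0 d1) \<Psi>" "smooth_on O1 G"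
    "homeomorphism (ball 0 d1) O1 \<Psi> G" "\<And>A. A \<in> c \<Longrightarrow> \<Psi> A = exp_proj q A"
    by (rule parametrization) (rule that)
  obtain O2 a where gc: "open O2" "id_blinfun \<in> O2" "continuous_on O2 a" "\<And>g. a g \<in> c"
    "\<And>g. g \<in> L \<Longrightarrow> g \<in> O2 \<Longrightarrow> blinfun_apply g ` q = blinfun_apply (op_exp (a g)) ` q"
    "\<exists>d>0. \<forall>A\<in>c. norm A < d \<longrightarrow> op_exp A \<in> O2 \<and> a (op_exp A) = A"
    by (rule group_coordinates) (rule that)
  then obtain d2 where d2: "d2 > 0" "\<And>A. A \<in> c \<Longrightarrow> norm A < d2 \<Longrightarrow> op_exp A \<in> O2 \<and> a (op_exp A) = A" by blast
  define \<delta> where "\<delta> = min d1 d2"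
  have \<delta>: "\<delta> > 0" "ball 0 \<delta> \<subseteq> ball (0::'n endo) d1" using par(1) d2(1) by (auto simp: \<delta>_def)
  let ?Z = "c \<inter> ball 0 \<delta>"
  define V where "V = \<Psi> ` ?Z"
  have hom: "\<And>z. z \<in> ball 0 d1 \<Longrightarrow> G (\<Psi> z) = z" "continuous_on (ball 0 d1) \<Psi>" "continuous_on O1 G" "\<Psi> ` ball 0 d1 = O1"
    using par(5) by (auto simp: homeomorphism_def)
  have V: "V = exp_proj q ` ?Z" unfolding V_def using par(6) by (intro image_cong) auto
  have cl: "A \<in> l" if "A \<in> c" for A using that by (simp add: c_def)
  have pq: "exp_proj q A = orth_proj (blinfun_apply (op_exp A o\<^sub>L g0) ` p)" for A
    by (simp add: exp_proj_def g0(2) image_image)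
  have Vpts: "V \<subseteq> points p"
    unfolding V pq points_def using mult[OF exp_mem g0(1)] cl by blast
  have V_open: "openin (orbit_top p) V"
    unfolding openin_orbit_top
  proof (intro conjI Vpts)
    show "openin (top_of_set L) (lift p V)"
    proof (subst openin_subopen, intro ballI)
      fix g assume g: "g \<in> lift p V"
      then have gL: "g \<in> L" by (simp add: lift_def)
      obtain A where A: "A \<in> c" "norm A < \<delta>" "orth_proj (blinfun_apply g ` p) = exp_proj q A"
        using g unfolding lift_def V by auto
      have gp: "blinfun_apply g ` p = blinfun_apply (op_exp A) ` q"
        using A(3) unfolding exp_proj_def by (rule orth_proj_inj[OF subspace_blinfun_image[OF p] subspace_blinfun_image[OF q]])
      let ?h = "\<lambda>x. x o\<^sub>L (ginv g o\<^sub>L op_exp A)"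
      have hL: "?h x \<in> L" if "x \<in> L" for x using that gL A(1) cl by (intro mult ginv exp_mem) auto
      have hq: "blinfun_apply (?h x) ` q = blinfun_apply x ` p" for x
      proof -
        have "blinfun_apply (?h x) ` q = blinfun_apply x ` blinfun_apply (ginv g) ` (blinfun_apply (op_exp A) ` q)"
          by (simp add: image_image)
        also have "\<dots> = blinfun_apply x ` p" unfolding gp[symmetric] using gL by (simp add: image_image)
        finally show ?thesis .
      qed
      have opO: "open (O2 \<inter> a -` ball 0 \<delta>)" by (rule continuous_open_preimage[OF gc(3,1) open_ball])
      have "continuous_on UNIV ?h" by (intro continuous_intros)
      then have opU: "open (?h -` (O2 \<inter> a -` ball 0 \<delta>))" using opO open_vimage by blast
      let ?U = "L \<inter> ?h -` (O2 \<inter> a -` ball 0 \<delta>)"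
      have "openin (top_of_set L) ?U" using opU by auto
      moreover have "g \<in> ?U" using gL d2(2)[OF A(1)] A(2) by (simp add: \<delta>_def)
      moreover have "?U \<subseteq> lift p V"
      proof
        fix x assume x: "x \<in> ?U"
        then have "blinfun_apply x ` p = blinfun_apply (op_exp (a (?h x))) ` q"
          using gc(5)[OF hL, of x] hq[of x] by auto
        moreover have "a (?h x) \<in> ?Z" using x gc(4) by auto
        ultimately show "x \<in> lift p V" using x unfolding lift_def V exp_proj_def by auto
      qed
      ultimately show "\<exists>T. openin (top_of_set L) T \<and> g \<in> T \<and> T \<subseteq> lift p V" by blast
    qed
  qed
  have homZ: "homeomorphism ?Z V \<Psi> G"
    by (rule homeomorphism_of_subsets[OF par(5)]) (use \<delta>(2) hom(4) in \<open>auto simp: V_def\<close>)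
  have top: "subtopology (orbit_top p) V = top_of_set V"
  proof (rule topology_eq[THEN iffD2], intro allI)
    fix W
    have "openin (orbit_top p) W \<longleftrightarrow> openin (top_of_set V) W" if WV: "W \<subseteq> V"
    proof
      assume W: "openin (orbit_top p) W"
      have "openin (top_of_set ?Z) {A \<in> ?Z. orth_proj (blinfun_apply (op_exp A o\<^sub>L g0) ` p) \<in> W}"
      proof (rule lift_continuous[OF W])
        have "continuous_on UNIV (op_exp :: 'n endo \<Rightarrow> _)" using Ck_on_continuous[OF op_exp_Ck_on] .
        then show "continuous_on ?Z (\<lambda>A. op_exp A o\<^sub>L g0)"
          by (intro continuous_intros) (rule continuous_on_subset, auto)
        show "(\<lambda>A. op_exp A o\<^sub>L g0) ` ?Z \<subseteq> L" using mult[OF exp_mem g0(1)] cl by auto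
      qed
      then have "openin (top_of_set V) (\<Psi> ` {A \<in> ?Z. exp_proj q A \<in> W})"
        unfolding pq[symmetric] by (rule homeomorphism_imp_open_map[OF homZ])
      moreover have "\<Psi> ` {A \<in> ?Z. exp_proj q A \<in> W} = W"
      proof
        show "\<Psi> ` {A \<in> ?Z. exp_proj q A \<in> W} \<subseteq> W" using par(6) by auto
        show "W \<subseteq> \<Psi> ` {A \<in> ?Z. exp_proj q A \<in> W}"
        proof
          fix x assume x: "x \<in> W"
          then obtain A where A: "A \<in> ?Z" "x = \<Psi> A" using WV unfolding V_def by blast
          then have "A \<in> {A \<in> ?Z. exp_proj q A \<in> W}" using x par(6)[of A] by simp
          then show "x \<in> \<Psi> ` {A \<in> ?Z. exp_proj q A \<in> W}" unfolding A(2) by (rule imageI)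
        qed
      qed
      ultimately show "openin (top_of_set V) W" by simp
    next
      assume "openin (top_of_set V) W"
      then obtain O' where O': "open O'" "W = V \<inter> O'" by (auto simp: openin_open)
      have "continuous_on L (\<lambda>g. orth_proj (blinfun_apply g ` p))"
        by (rule orth_proj_moving_continuous[OF p _ continuous_on_id ginv_continuous]) (rule ginv(3))
      then have "openin (top_of_set L) (L \<inter> (\<lambda>g. orth_proj (blinfun_apply g ` p)) -` O')"
        using O'(1) by (rule continuous_openin_preimage_gen)
      moreover have "lift p W = lift p V \<inter> (L \<inter> (\<lambda>g. orth_proj (blinfun_apply g ` p)) -` O')"
        unfolding O'(2) lift_def by auto
      ultimately show "openin (orbit_top p) W"
        using V_open WV by (auto simp: openin_orbit_top)
    qed
    then show "openin (subtopology (orbit_top p) V) W \<longleftrightarrow> openin (top_of_set V) W"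
      using V_open by (auto simp: openin_open_subtopology dest: openin_imp_subset)
  qed
  have emb: "embedded_submanifold (card B) V"
    unfolding embedded_submanifold_def
  proof
    fix x assume x: "x \<in> V"
    have "openin (top_of_set O1) (\<Psi> ` ball 0 \<delta>)"
      by (rule homeomorphism_imp_open_map[OF par(5)]) (use \<delta>(2) in \<open>simp add: openin_open_eq\<close>)
    then have U: "open (\<Psi> ` ball 0 \<delta>)" "\<Psi> ` ball 0 \<delta> \<subseteq> O1" using par(2) by (auto simp: openin_open_eq)
    have G\<Psi>: "G (\<Psi> z) = z" if "z \<in> ball 0 \<delta>" for z using hom(1) \<delta>(2) that by blast
    have GU: "G ` \<Psi> ` ball 0 \<delta> = ball 0 \<delta>" using G\<Psi> by (force simp: image_image)
    have "\<Psi> ` ball 0 \<delta> \<inter> V = \<Psi> ` ?Z" unfolding V_def by auto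
    then have GV: "G ` (\<Psi> ` ball 0 \<delta> \<inter> V) = ball 0 \<delta> \<inter> span B" using G\<Psi> B(3) by (force simp: image_image)
    show "\<exists>U (\<Phi> :: 'n endo \<Rightarrow> 'n endo) (\<Psi> :: 'n endo \<Rightarrow> 'n endo) Ba. open U \<and> x \<in> U \<and> open (\<Phi> ` U) \<and> smooth_on U \<Phi> \<and> smooth_on (\<Phi> ` U) \<Psi> \<and>
       (\<forall>x\<in>U. \<Psi> (\<Phi> x) = x) \<and> finite Ba \<and> card Ba = card B \<and> independent Ba \<and> \<Phi> ` (U \<inter> V) = \<Phi> ` U \<inter> span Ba"
    proof (rule exI[of _ "\<Psi> ` ball 0 \<delta>"], rule exI[of _ G], rule exI[of _ \<Psi>], rule exI[of _ B], intro conjI)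
      show "open (\<Psi> ` ball 0 \<delta>)" by (rule U(1))
      show "x \<in> \<Psi> ` ball 0 \<delta>" using x unfolding V_def by auto
      show "open (G ` \<Psi> ` ball 0 \<delta>)" by (simp add: GU)
      show "smooth_on (\<Psi> ` ball 0 \<delta>) G" using par(4) unfolding smooth_on_def by (blast intro: Ck_on_subset[OF _ U(2)])
      show "smooth_on (G ` \<Psi> ` ball 0 \<delta>) \<Psi>" unfolding GU using par(3) unfolding smooth_on_def by (blast intro: Ck_on_subset[OF _ \<delta>(2)])
      show "\<forall>x\<in>\<Psi> ` ball 0 \<delta>. \<Psi> (G x) = x" using G\<Psi> by auto
      show "G ` (\<Psi> ` ball 0 \<delta> \<inter> V) = G ` \<Psi> ` ball 0 \<delta> \<inter> span B" using GV GU by simp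
    qed (use B in auto)
  qed
  have "exp_proj q 0 \<in> V" unfolding V using subspace_c \<delta>(1) by (intro imageI) (simp add: subspace_0)
  then have "orth_proj q \<in> V" by (simp add: exp_proj_def)
  then show ?thesis using V_open top emb by blast
qed

end

context linear_lie_group
begin

theorem orbit_immersed_submanifold:
  assumes p: "subspace p"
  shows "\<exists>k. immersed_submanifold k (orth_proj ` (\<lambda>g. blinfun_apply g ` p) ` L) (orbit_top p)"
proof -
  \<comment> \<open>The stabilizers of the points of the orbit are conjugate, so a complement at \<open>p\<close> can be moved to every point.\<close>
  define lp where "lp = {A \<in> l. \<forall>x\<in>p. blinfun_apply A x \<in> p}"
  have "subspace lp"
    using subspace_l p by (auto simp: lp_def subspace_def blinfun.bilinear_simps)
  then obtain \<pi> where \<pi>: "bounded_linear \<pi>" "range \<pi> \<subseteq> lp" "\<And>x. x \<in> lp \<Longrightarrow> \<pi> x = x"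
    using endo.projection_exists by blast
  have \<pi>lp: "\<pi> A \<in> lp" for A using \<pi>(2) by blast
  have lin: "linear \<pi>" using \<pi>(1) bounded_linear.linear by blast
  define c0 where "c0 = {A \<in> l. \<pi> A = 0}"
  have sc0: "subspace c0"
    using subspace_l lin by (auto simp: c0_def subspace_def linear_add linear_scale linear_0)
  obtain B where B: "B \<subseteq> c0" "independent B" "c0 \<subseteq> span B" using basis_exists[of c0] by metis
  have spB: "span B = c0" using B sc0 by (simp add: span_minimal subset_antisym)
  have ch: "\<exists>V. openin (orbit_top p) V \<and> orth_proj (blinfun_apply g ` p) \<in> V \<and> embedded_submanifold (card B) V \<and>
    subtopology (orbit_top p) V = top_of_set V" if g: "g \<in> L" for g
  proof -
    let ?C = "\<lambda>A. g o\<^sub>L A o\<^sub>L ginv g" and ?C' = "\<lambda>A. ginv g o\<^sub>L A o\<^sub>L g"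
    have blC: "bounded_linear (\<lambda>A::'n endo. S o\<^sub>L A o\<^sub>L T)" for S T
      by (intro bounded_linear_compose[OF compose_bounded_linear_left
        compose_bounded_linear_right])
    have CC': "?C (?C' A) = A" "?C' (?C A) = A" for A
      using g by (auto intro!: blinfun_eqI)
    have ginv_ginv: "ginv (ginv g) = g"
      using ginv[OF ginv(1)[OF g]] ginv[OF g] by (metis blinfun_compose_assoc blinfun_compose_id)
    have Cl: "?C A \<in> l" if "A \<in> l" for A using conjugate_mem[OF g that] .
    have C'l: "?C' A \<in> l" if "A \<in> l" for A using conjugate_mem[OF ginv(1)[OF g] that] by (simp add: ginv_ginv)
    interpret oc: orbit_chart L l p "blinfun_apply g ` p" g "\<lambda>A. ?C (\<pi> (?C' A))"
    proof (intro orbit_chart.intro orbit_chart_axioms.intro linear_lie_group_axioms)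
      show "linear (\<lambda>A. ?C (\<pi> (?C' A)))"
        by (intro bounded_linear.linear bounded_linear_compose[OF blC bounded_linear_compose[OF \<pi>(1) blC]])
      show "?C (\<pi> (?C' A)) \<in> l" for A using \<pi>lp by (intro Cl) (simp add: lp_def)
      show "blinfun_apply (?C (\<pi> (?C' A))) x \<in> blinfun_apply g ` p" if "x \<in> blinfun_apply g ` p" for A x
        using that \<pi>lp[of "?C' A"] g by (auto simp: lp_def)
      fix A assume A: "A \<in> l" "\<And>x. x \<in> blinfun_apply g ` p \<Longrightarrow> blinfun_apply A x \<in> blinfun_apply g ` p"
      have "blinfun_apply (?C' A) x \<in> p" if x: "x \<in> p" for x
      proof -
        obtain y where "y \<in> p" "A (g x) = g y" using A(2)[OF imageI[OF x]] by auto
        then show ?thesis using g by simp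
      qed
      then have "?C' A \<in> lp" using C'l[OF A(1)] by (simp add: lp_def)
      then show "?C (\<pi> (?C' A)) = A" using \<pi>(3) CC' by simp
    qed (use p g in auto)
    have inj: "inj ?C" by (rule inj_on_inverseI[where g="?C'"]) (rule CC'(2))
    have linC: "linear ?C" using blC bounded_linear.linear by blast
    have sp: "span (?C ` B) = oc.c"
    proof -
      have "oc.c = ?C ` c0"
      proof (rule subset_antisym; rule subsetI)
        fix A assume "A \<in> oc.c"
        then have A: "A \<in> l" "?C (\<pi> (?C' A)) = 0" by (auto simp: oc.c_def)
        have "?C' (?C (\<pi> (?C' A))) = ?C' 0" using A(2) by (rule arg_cong)
        also have "?C' 0 = 0" by (rule blinfun_eqI) (simp add: blinfun.bilinear_simps)
        finally have "\<pi> (?C' A) = 0" unfolding CC'(2) .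
        then have "?C' A \<in> c0" using C'l[OF A(1)] by (simp add: c0_def)
        then show "A \<in> ?C ` c0" using CC'(1)[of A] by (metis imageI)
      next
        fix A assume "A \<in> ?C ` c0"
        then obtain D where D: "D \<in> c0" "A = ?C D" by blast
        then show "A \<in> oc.c" using Cl CC'(2)[of D] by (simp add: oc.c_def c0_def)
      qed
      then show ?thesis by (simp add: linear_span_image[OF linC] spB)
    qed
    have ind: "independent (?C ` B)"
      using linear_independent_injective_image[OF linC B(2)] inj inj_on_subset by blast
    have "card (?C ` B) = card B" using inj by (simp add: card_image inj_on_subset)
    then show ?thesis using oc.chart[OF _ ind sp] endo.independent_finite[OF ind] by simp
  qed
  have "immersed_submanifold (card B) (points p) (orbit_top p)"
    unfolding immersed_submanifold_def
  proof (intro conjI ballI)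
    show "topspace (orbit_top p) = points p" by (rule topspace_orbit_top)
    fix x assume "x \<in> points p"
    then show "\<exists>V. openin (orbit_top p) V \<and> x \<in> V \<and> embedded_submanifold (card B) V \<and> subtopology (orbit_top p) V = top_of_set V"
      using ch by (auto simp: points_def)
  qed (rule orbit_top_second_countable[OF p])
  then show ?thesis unfolding points_def by blast
qed

text \<open>The curve \<open>exp (t A)\<close> applied to the point lifts to a continuous curve in \<open>L\<close>, hence is continuous
  for the quotient topology.\<close>

theorem orbit_velocity_tangent:
  assumes p: "subspace p" and g: "g \<in> L" and A: "A \<in> l"
  shows "orbit_velocity (blinfun_apply g ` p) A \<in> tangent_space (orbit_top p) (orth_proj (blinfun_apply g ` p))"
proof -
  let ?q = "blinfun_apply g ` p"
  let ?\<gamma> = "\<lambda>t::real. orth_proj (blinfun_apply (op_exp (t *\<^sub>R A)) ` ?q)"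
  have eq: "?\<gamma> t = orth_proj (blinfun_apply (op_exp (t *\<^sub>R A) o\<^sub>L g) ` p)" for t by (simp add: image_image)
  have mem: "op_exp (t *\<^sub>R A) o\<^sub>L g \<in> L" for t
    using A g subspace_l by (intro mult exp_mem subspace_scale) auto
  have cont: "continuous_on S (\<lambda>t. op_exp (t *\<^sub>R A) o\<^sub>L g)" for S :: "real set"
    by (intro continuous_intros continuous_on_compose2[OF Ck_on_continuous[OF op_exp_Ck_on]]) auto
  have "continuous_map (top_of_set {-1<..<1}) (orbit_top p) ?\<gamma>"
    unfolding continuous_map_def
  proof (intro conjI allI impI)
    show "?\<gamma> \<in> topspace (top_of_set {-1<..<1}) \<rightarrow> topspace (orbit_top p)"
      unfolding eq topspace_orbit_top points_def using mem by blast
    fix W assume "openin (orbit_top p) W"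
    from lift_continuous[OF this cont, of "{-1<..<1}"] mem
    show "openin (top_of_set {-1<..<1}) {t \<in> topspace (top_of_set {-1<..<1}). ?\<gamma> t \<in> W}"
      unfolding eq by auto
  qed
  moreover have "?\<gamma> 0 = orth_proj ?q" by simp
  moreover have "(?\<gamma> has_vector_derivative orbit_velocity ?q A) (at 0)"
    by (rule exp_proj_vector_derivative[OF subspace_blinfun_image[OF p]])
  ultimately show ?thesis unfolding tangent_space_def by blast
qed

end

section \<open>Logarithms near the identity\<close>

lemma op_exp_inj_near_zero:
  obtains r where "r > 0"
    "\<And>A B::('n::finite) endo. norm A < r \<Longrightarrow> norm B < r \<Longrightarrow> op_exp A = op_exp B \<Longrightarrow> A = B"
proof -
  obtain U V Log where UV: "open U" "(0::'n endo) \<in> U" "open V" "id_blinfun \<in> V" "homeomorphism U V op_exp Log"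
    by (rule op_exp_local_homeomorphism) (rule that)
  obtain r where r: "r > 0" "ball 0 r \<subseteq> U" using UV(1,2) open_contains_ball by blast
  show thesis
  proof (rule that[OF r(1)])
    fix A B :: "'n endo" assume "norm A < r" "norm B < r" and eq: "op_exp A = op_exp B"
    then have "A \<in> U" "B \<in> U" using r(2) by auto
    then show "A = B" using eq UV(5) unfolding homeomorphism_def by metis
  qed
qed

text \<open>Conjugation with \<open>S\<close> carries the exponential of \<open>C\<close> to the exponential of the conjugate of \<open>C\<close>,
  and \<open>exp\<close> is injective near 0.\<close>

lemma op_exp_commute_imp:
  fixes S S' :: "('n::finite) endo"
  assumes "S' o\<^sub>L S = id_blinfun" "S o\<^sub>L S' = id_blinfun"
  shows "\<exists>r>0. \<forall>C. norm C < r \<longrightarrow> S o\<^sub>L op_exp C o\<^sub>L S' = op_exp C \<longrightarrow> S o\<^sub>L C o\<^sub>L S' = C"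
proof -
  obtain r where r: "r > 0" "\<And>A B::'n endo. norm A < r \<Longrightarrow> norm B < r \<Longrightarrow> op_exp A = op_exp B \<Longrightarrow> A = B"
    by (rule op_exp_inj_near_zero) (rule that)
  define N where "N = 1 + norm S * norm S'"
  have N: "N \<ge> 1" "norm S * norm S' \<le> N" by (auto simp: N_def)
  show ?thesis
  proof (intro exI[of _ "r / N"] conjI allI impI)
    show "0 < r / N" using r N by simp
    fix C assume C: "norm C < r / N" "S o\<^sub>L op_exp C o\<^sub>L S' = op_exp C"
    have C1: "norm C * N < r" using C(1) N by (simp add: field_simps)
    have "norm (S o\<^sub>L C o\<^sub>L S') \<le> norm S * norm C * norm S'"
      by (meson mult_right_mono norm_blinfun_compose norm_ge_zero order_trans)
    also have "\<dots> = norm C * (norm S * norm S')" by (simp add: mult_ac)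
    also have "\<dots> \<le> norm C * N" using N(2) by (intro mult_left_mono) auto
    finally have "norm (S o\<^sub>L C o\<^sub>L S') < r" using C1 by linarith
    moreover have "norm C * 1 \<le> norm C * N" using N(1) by (intro mult_left_mono) auto
    then have "norm C < r" using C1 by linarith
    ultimately show "S o\<^sub>L C o\<^sub>L S' = C" using r(2) C(2) op_exp_conjugate[OF assms, of C] by metis
  qed
qed

text \<open>With a projection \<open>p\<close> onto \<open>W\<close>, the map \<open>z \<mapsto> exp (p z) + (z - p z)\<close> is invertible near 0. It shows
  that an element of \<open>1 + W\<close> near 1 is the exponential of an element of \<open>W\<close>, and \<open>exp\<close> is injective
  near 0.\<close>

lemma op_exp_algebra_imp:
  fixes W :: "('n::finite) endo set"
  assumes W: "subspace W" "\<And>A B. A \<in> W \<Longrightarrow> B \<in> W \<Longrightarrow> A o\<^sub>L B \<in> W"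
  shows "\<exists>r>0. \<forall>C. norm C < r \<longrightarrow> op_exp C - id_blinfun \<in> W \<longrightarrow> C \<in> W"
proof -
  obtain r0 where r0: "r0 > 0" "\<And>A B::'n endo. norm A < r0 \<Longrightarrow> norm B < r0 \<Longrightarrow> op_exp A = op_exp B \<Longrightarrow> A = B"
    by (rule op_exp_inj_near_zero) (rule that)
  obtain p where p: "bounded_linear p" "range p \<subseteq> W" "\<And>x. x \<in> W \<Longrightarrow> p x = x"
    using endo.projection_exists[OF W(1)] by blast
  have pW: "p x \<in> W" for x using p(2) by blast
  have p0: "p 0 = 0" using p(1) by (simp add: bounded_linear.linear linear_0)
  have bl: "bounded_linear (\<lambda>z. z - p z)" by (intro bounded_linear_sub bounded_linear_ident p(1))
  let ?\<Theta> = "\<lambda>z. op_exp (p z) + (z - p z)"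
  have smooth: "smooth_on UNIV ?\<Theta>"
    unfolding smooth_on_def
    by (intro allI Ck_on_add open_UNIV Ck_on_bounded_linear[OF open_UNIV bl]
        endo.Ck_on_compose[OF open_UNIV open_UNIV subset_UNIV Ck_on_bounded_linear[OF open_UNIV p(1)] op_exp_Ck_on])
  have "((\<lambda>z. op_exp (p z)) has_derivative p) (at 0)"
    using diff_chain_at[OF bounded_linear_imp_has_derivative[OF p(1)], of op_exp "\<lambda>v. v" 0] op_exp_has_derivative_zero p0
    by (simp add: o_def)
  from has_derivative_add[OF this bounded_linear_imp_has_derivative[OF bl]]
  have "(?\<Theta> has_derivative (\<lambda>v. v)) (at 0)" by simp
  then obtain U V \<Gamma> where UV: "open U" "U \<subseteq> UNIV" "0 \<in> U" "open V" "homeomorphism U V ?\<Theta> \<Gamma>"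
    by (rule endo.smooth_inverse_function[OF open_UNIV smooth UNIV_I _ linear_id[unfolded id_def]]) auto
  have h: "\<And>z. z \<in> U \<Longrightarrow> \<Gamma> (?\<Theta> z) = z" "\<And>y. y \<in> V \<Longrightarrow> ?\<Theta> (\<Gamma> y) = y" "continuous_on V \<Gamma>" "?\<Theta> ` U = V"
    using UV(5) by (auto simp: homeomorphism_def)
  have \<Theta>0: "?\<Theta> 0 = id_blinfun" by (simp add: p0)
  have "?\<Theta> 0 \<in> ?\<Theta> ` U" by (rule imageI[OF UV(3)])
  then have idV: "id_blinfun \<in> V" by (simp only: \<Theta>0 h(4))
  have \<Gamma>id: "\<Gamma> id_blinfun = 0" using h(1)[OF UV(3)] by (simp only: \<Theta>0)
  have "open (V \<inter> \<Gamma> -` ball 0 r0)" by (rule continuous_open_preimage[OF h(3) UV(4) open_ball])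
  then have "open (op_exp -` (V \<inter> \<Gamma> -` ball 0 r0) :: 'n endo set)"
    by (rule open_vimage) (rule Ck_on_continuous[OF op_exp_Ck_on])
  moreover have "0 \<in> op_exp -` (V \<inter> \<Gamma> -` ball 0 r0)" using idV \<Gamma>id r0(1) by simp
  ultimately obtain r1 where r1: "r1 > 0" "ball 0 r1 \<subseteq> op_exp -` (V \<inter> \<Gamma> -` ball 0 r0)"
    using open_contains_ball by blast
  show ?thesis
  proof (intro exI[of _ "min r0 r1"] conjI allI impI)
    show "0 < min r0 r1" using r0 r1 by simp
    fix C :: "'n endo" assume C: "norm C < min r0 r1" "op_exp C - id_blinfun \<in> W"
    define z where "z = \<Gamma> (op_exp C)"
    have "C \<in> ball 0 r1" using C(1) by simp
    then have CV: "op_exp C \<in> V" and z: "norm z < r0" using r1(2) by (auto simp: z_def)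
    have eq: "op_exp C = op_exp (p z) + (z - p z)" using h(2)[OF CV] by (simp add: z_def)
    have "op_power (p z) (Suc n) \<in> W" for n by (induction n) (use W(2) pW in auto)
    then have "op_exp (p z) - id_blinfun \<in> W"
      by (rule op_exp_minus_id_mem[OF W(1) endo.closed_subspace_fin_dim[OF W(1)]])
    then have "(op_exp C - id_blinfun) - (op_exp (p z) - id_blinfun) \<in> W" by (rule subspace_diff[OF W(1) C(2)])
    then have "z - p z \<in> W" by (simp add: eq)
    then have "p (z - p z) = z - p z" by (rule p(3))
    then have "z = p z" using p(3)[OF pW] p(1) by (simp add: bounded_linear.linear linear_diff)
    then have "z \<in> W" "op_exp C = op_exp z" using pW[of z] eq by auto
    then show "C \<in> W" using r0(2)[of C z] C(1) z by auto
  qed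
qed

text \<open>The defect \<open>\<delta>\<close> of \<open>C\<close> from being a derivation is zero because, for small \<open>C\<close>, every bound on it
  can be improved by the factor 2.\<close>

lemma op_exp_automorphism_imp_derivation:
  fixes br :: "complex ^ 'n \<Rightarrow> complex ^ 'n \<Rightarrow> complex ^ ('n::finite)"
  assumes br: "bounded_bilinear br"
  shows "\<exists>r>0. \<forall>C. norm C < r \<longrightarrow> (\<forall>x y. op_exp C (br x y) = br (op_exp C x) (op_exp C y)) \<longrightarrow>
    (\<forall>x y. blinfun_apply C (br x y) = br (blinfun_apply C x) y + br x (blinfun_apply C y))"
proof -
  note bs = bounded_bilinear.add_left[OF br] bounded_bilinear.add_right[OF br] bounded_bilinear.diff_left[OF br]
    bounded_bilinear.diff_right[OF br] bounded_bilinear.minus_left[OF br] bounded_bilinear.minus_right[OF br]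
    bounded_bilinear.scaleR_left[OF br] bounded_bilinear.scaleR_right[OF br]
  have "continuous (at 0) (op_exp :: 'n endo \<Rightarrow> _)"
    using op_exp_has_derivative_zero by (rule has_derivative_continuous)
  then obtain r where r: "r > 0" "\<And>A::'n endo. norm A < r \<Longrightarrow> norm (op_exp A - id_blinfun) < 1/10"
    unfolding continuous_at_eps_delta by (metis dist_norm diff_zero op_exp_zero zero_less_divide_1_iff zero_less_numeral)
  show ?thesis
  proof (intro exI[of _ r] conjI r(1) allI impI)
    fix C :: "'n endo" and x y
    assume C: "norm C < r" and aut: "\<forall>x y. op_exp C (br x y) = br (op_exp C x) (op_exp C y)"
    define \<delta> where "\<delta> x y = C (br x y) - br (C x) y - br x (C y)" for x y
    have sub: "\<delta> u v - \<delta> x y = \<delta> (u - x) v + \<delta> x (v - y)" for u v x y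
      by (simp add: \<delta>_def bs blinfun.bilinear_simps algebra_simps)
    \<comment> \<open>By the mean value inequality along \<open>t \<mapsto> exp(tC) [exp(-tC)x, exp(-tC)y]\<close>, which has equal
      values at 0 and 1 and derivative \<open>\<delta> x y\<close> at 0, every bound on \<open>\<delta>\<close> can be halved.\<close>
    have half: "norm (\<delta> x y) \<le> M / 2 * norm x * norm y"
      if M: "\<And>x y. norm (\<delta> x y) \<le> M * norm x * norm y" "M \<ge> 0" for M x y
    proof -
      define E where "E t = op_exp (t *\<^sub>R C)" for t :: real
      define u where "u z t = E (- t) z" for z t
      have E: "((\<lambda>t. E t) has_vector_derivative (E t o\<^sub>L C)) (at t within S)" for t S
      proof (cases "t = 0")
        case True
        then show ?thesis unfolding E_def using op_exp_vector_derivative[of C t S] by simp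
      next
        case False
        have "(t *\<^sub>R C) o\<^sub>L op_exp (t *\<^sub>R C) = op_exp (t *\<^sub>R C) o\<^sub>L (t *\<^sub>R C)" by (rule op_exp_commute)
        then have "t *\<^sub>R (C o\<^sub>L op_exp (t *\<^sub>R C)) = t *\<^sub>R (op_exp (t *\<^sub>R C) o\<^sub>L C)"
          by (simp only: compose_scaleR_left
              compose_scaleR_right)
        then show ?thesis unfolding E_def using False op_exp_vector_derivative[of C t S] by simp
      qed
      have E': "((\<lambda>t. E (- t)) has_vector_derivative - (C o\<^sub>L E (- t))) (at t within S)" for t S
        unfolding E_def using op_exp_vector_derivative[of "- C" t S]
        by (simp add: compose_minus_left)
      have u: "((\<lambda>t. u z t) has_vector_derivative - C (u z t)) (at t within S)" for z t S
        unfolding u_def using bounded_linear.has_vector_derivative[OF blinfun.bounded_linear_left E']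
        by (simp add: blinfun.bilinear_simps)
      let ?f = "\<lambda>t. E t (br (u x t) (u y t))"
      have fd: "(?f has_vector_derivative E t (\<delta> (u x t) (u y t))) (at t within S)" for t S
      proof -
        have "((\<lambda>t. br (u x t) (u y t)) has_vector_derivative br (u x t) (- C (u y t)) + br (- C (u x t)) (u y t)) (at t within S)"
          by (rule bounded_bilinear.has_vector_derivative[OF br u u])
        from bounded_bilinear.has_vector_derivative[OF bounded_bilinear_blinfun_apply E this]
        show ?thesis by (simp add: \<delta>_def bs blinfun.bilinear_simps algebra_simps)
      qed
      have small: "norm (E t - id_blinfun) \<le> 1/10" if "\<bar>t\<bar> \<le> 1" for t
      proof -
        have "norm (t *\<^sub>R C) \<le> norm C" using mult_right_mono[OF that, of "norm C"] by simp
        then show ?thesis unfolding E_def using r(2)[of "t *\<^sub>R C"] C by simp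
      qed
      have close: "norm (E t z - z) \<le> norm z / 10" if "\<bar>t\<bar> \<le> 1" for t z
        using norm_blinfun[of "E t - id_blinfun" z] mult_right_mono[OF small[OF that], of "norm z"]
        by (simp add: blinfun.bilinear_simps)
      have uc: "norm (u z t - z) \<le> norm z / 10" "norm (u z t) \<le> 11/10 * norm z" if "\<bar>t\<bar> \<le> 1" for z t
      proof -
        show "norm (u z t - z) \<le> norm z / 10" using close[of "- t" z] that by (simp add: u_def)
        then show "norm (u z t) \<le> 11/10 * norm z" using norm_triangle_ineq[of "u z t - z" z] by simp
      qed
      have bound: "norm (E t (\<delta> (u x t) (u y t)) - E 0 (\<delta> (u x 0) (u y 0))) \<le> M / 2 * norm x * norm y"
        if "t \<in> {0..1}" for t
      proof -
        have t: "\<bar>t\<bar> \<le> 1" using that by simp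
        let ?m = "M * norm x * norm y"
        have m0: "?m \<ge> 0" using M(2) by simp
        have b1: "norm (\<delta> (u x t) (u y t)) \<le> 121/100 * ?m"
        proof -
          have "norm (\<delta> (u x t) (u y t)) \<le> M * norm (u x t) * norm (u y t)" by (rule M(1))
          also have "\<dots> \<le> M * (11/10 * norm x) * (11/10 * norm y)"
            using uc(2)[OF t] M(2) by (intro mult_mono) auto
          finally show ?thesis by simp
        qed
        have b2: "norm (\<delta> (u x t - x) (u y t)) \<le> 11/100 * ?m"
        proof -
          have "norm (\<delta> (u x t - x) (u y t)) \<le> M * norm (u x t - x) * norm (u y t)" by (rule M(1))
          also have "\<dots> \<le> M * (norm x / 10) * (11/10 * norm y)"
            using uc[OF t] M(2) by (intro mult_mono) auto
          finally show ?thesis by simp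
        qed
        have b3: "norm (\<delta> x (u y t - y)) \<le> 1/10 * ?m"
        proof -
          have "norm (\<delta> x (u y t - y)) \<le> M * norm x * norm (u y t - y)" by (rule M(1))
          also have "\<dots> \<le> M * norm x * (norm y / 10)"
            using uc[OF t] M(2) by (intro mult_left_mono) auto
          finally show ?thesis by simp
        qed
        have tri: "norm (a - d) \<le> norm (a - b) + (norm c + norm e)" if "b - d = c + e" for a b c d e :: "complex ^ 'n"
        proof -
          have "a - d = (a - b) + (c + e)" using that by (simp add: algebra_simps)
          then show ?thesis by (metis add_left_mono norm_triangle_ineq order_trans)
        qed
        have "norm (E t (\<delta> (u x t) (u y t)) - \<delta> x y) \<le> norm (E t (\<delta> (u x t) (u y t)) - \<delta> (u x t) (u y t)) + (norm (\<delta> (u x t - x) (u y t)) + norm (\<delta> x (u y t - y)))"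
          by (rule tri[OF sub])
        also have "\<dots> \<le> norm (\<delta> (u x t) (u y t)) / 10 + (11/100 * ?m + 1/10 * ?m)"
          using close[OF t] b2 b3 by (intro add_mono) auto
        also have "\<dots> \<le> ?m / 2" using b1 m0 by linarith
        finally show ?thesis by (simp add: E_def u_def)
      qed
      have "norm (?f 1 - ?f 0 - (1 - 0) *\<^sub>R E 0 (\<delta> (u x 0) (u y 0))) \<le> norm (1 - 0 :: real) * (M / 2 * norm x * norm y)"
        by (rule vector_differentiable_bound_linearization[where S="{0..1}" and f'="\<lambda>t. E t (\<delta> (u x t) (u y t))"])
          (use fd bound in \<open>auto simp: closed_segment_eq_real_ivl\<close>)
      moreover have "?f 1 = br x y" using aut by (simp add: E_def u_def)
      ultimately show ?thesis by (simp add: E_def u_def)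
    qed
    obtain K where K: "K \<ge> 0" "\<And>x y. norm (br x y) \<le> norm x * norm y * K"
      using bounded_bilinear.nonneg_bounded[OF br] by blast
    define M where "M = 3 * K * norm C"
    have M0: "M \<ge> 0" using K by (simp add: M_def)
    have nC: "norm (blinfun_apply C z) \<le> norm C * norm z" for z by (rule norm_blinfun)
    have M: "norm (\<delta> x y) \<le> M * norm x * norm y" for x y
    proof -
      have "norm (C (br x y)) \<le> norm C * (norm x * norm y * K)"
        by (rule order_trans[OF nC mult_left_mono[OF K(2) norm_ge_zero]])
      moreover have "norm (br (C x) y) \<le> (norm C * norm x) * norm y * K"
        by (rule order_trans[OF K(2)]) (intro mult_right_mono nC K(1) norm_ge_zero)
      moreover have "norm (br x (C y)) \<le> norm x * (norm C * norm y) * K"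
        by (rule order_trans[OF K(2)]) (intro mult_right_mono mult_left_mono nC K(1) norm_ge_zero)
      ultimately have "norm (C (br x y)) + norm (br (C x) y) + norm (br x (C y)) \<le> M * norm x * norm y"
        by (simp add: M_def algebra_simps)
      moreover have "norm (\<delta> x y) \<le> norm (C (br x y)) + norm (br (C x) y) + norm (br x (C y))"
        unfolding \<delta>_def by (metis (no_types, opaque_lifting) add_right_mono norm_triangle_ineq4 order_trans)
      ultimately show ?thesis by linarith
    qed
    have "norm (\<delta> x y) \<le> M / 2 ^ k * norm x * norm y" for k x y
    proof (induction k arbitrary: x y)
      case 0
      then show ?case using M by simp
    next
      case (Suc k)
      show ?case using half[OF Suc] M0 by (simp add: mult.commute)
    qed
    then have b: "norm (\<delta> x y) \<le> (M * norm x * norm y) * (1/2) ^ k" for k by (simp add: power_divide field_simps)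
    have "(\<lambda>k. (M * norm x * norm y) * (1/2) ^ k) \<longlonglongrightarrow> (M * norm x * norm y) * 0"
      by (intro tendsto_mult_left LIMSEQ_power_zero) simp
    then have "norm (\<delta> x y) \<le> 0" using b by (intro LIMSEQ_le_const[of _ 0]) auto
    then show "C (br x y) = br (C x) y + br x (C y)" by (simp add: \<delta>_def algebra_simps)
  qed
qed

section \<open>Traces\<close>

definition clinear :: "(complex ^ ('n::finite) \<Rightarrow> complex ^ 'n) \<Rightarrow> bool" where
  "clinear f \<longleftrightarrow> (\<forall>x y. f (x + y) = f x + f y) \<and> (\<forall>c x. f (c *s x) = c *s f x)"

definition antilinear :: "(complex ^ ('n::finite) \<Rightarrow> complex ^ 'n) \<Rightarrow> bool" where
  "antilinear f \<longleftrightarrow> (\<forall>x y. f (x + y) = f x + f y) \<and> (\<forall>c x. f (c *s x) = cnj c *s f x)"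

lemma clinear_iff: "Vector_Spaces.linear (*s) (*s) f \<longleftrightarrow> clinear f"
  unfolding clinear_def Vector_Spaces.linear_iff using vec.vector_space_axioms by blast

lemma scaleR_smult: "r *\<^sub>R x = complex_of_real r *s (x :: complex ^ 'n)"
  unfolding vec_eq_iff vector_scaleR_component vector_smult_component by (simp add: scaleR_conv_of_real)

lemma clinear_linear: "clinear f \<Longrightarrow> linear f"
  by (rule linearI) (auto simp: clinear_def scaleR_smult)

lemma antilinear_linear: "antilinear f \<Longrightarrow> linear f"
  by (rule linearI) (auto simp: antilinear_def scaleR_smult)

lemma clinear_comp: "clinear f \<Longrightarrow> clinear g \<Longrightarrow> clinear (\<lambda>x. f (g x))"
  by (simp add: clinear_def)

definition tr :: "(complex ^ ('n::finite) \<Rightarrow> complex ^ 'n) \<Rightarrow> complex" where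
  "tr f = trace (matrix f)"

lemma tr_sum: "tr f = (\<Sum>i\<in>UNIV. f (axis i 1) $ i)"
  by (simp add: tr_def trace_def matrix_def)

lemma tr_add: "tr (\<lambda>x. f x + g x) = tr f + tr g"
  by (simp add: tr_sum sum.distrib)

lemma tr_diff: "tr (\<lambda>x. f x - g x) = tr f - tr g"
  by (simp add: tr_sum sum_subtractf)

lemma tr_scale: "tr (\<lambda>x. c *s f x) = c * tr f"
  by (simp add: tr_sum sum_distrib_left)

lemma tr_zero [simp]: "tr (\<lambda>x. 0) = 0"
  by (simp add: tr_sum)

lemma tr_commute:
  assumes "clinear f" "clinear g" shows "tr (\<lambda>x. f (g x)) = tr (\<lambda>x. g (f x))"
proof -
  have "matrix (f \<circ> g) = matrix f ** matrix g" "matrix (g \<circ> f) = matrix g ** matrix f"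
    using assms matrix_compose_gen unfolding clinear_iff[symmetric] by blast+
  then show ?thesis using trace_mul_sym[of "matrix f" "matrix g"] by (simp add: tr_def o_def)
qed

lemma tr_conjugate:
  assumes "clinear f" "clinear g" "clinear g'" "\<And>x. g' (g x) = x"
  shows "tr (\<lambda>x. g (f (g' x))) = tr f"
  using tr_commute[OF assms(2) clinear_comp[OF assms(1,3)]] assms(4) by simp

text \<open>A conjugate-linear bijection is a linear one composed with coordinatewise conjugation, and the
  latter conjugates the diagonal entries of a matrix.\<close>

lemma tr_antilinear_conjugate:
  fixes f g g' :: "complex ^ ('n::finite) \<Rightarrow> complex ^ 'n"
  assumes f: "clinear f" and g: "antilinear g" and g': "antilinear g'" and inv: "\<And>x. g' (g x) = x"
  shows "tr (\<lambda>x. g (f (g' x))) = cnj (tr f)"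
proof -
  define k :: "complex ^ 'n \<Rightarrow> complex ^ 'n" where "k x = (\<chi> i. cnj (x $ i))" for x
  have kk: "k (k x) = x" for x by (simp add: k_def vec_eq_iff)
  have k: "k (x + y) = k x + k y" "k (c *s x) = cnj c *s k x" for c x y by (simp_all add: k_def vec_eq_iff)
  have "tr (\<lambda>x. (\<lambda>x. g (k x)) ((\<lambda>x. k (f (k x))) ((\<lambda>x. k (g' x)) x))) = tr (\<lambda>x. k (f (k x)))"
    by (rule tr_conjugate) (use f g g' in \<open>auto simp: clinear_def antilinear_def k kk inv\<close>)
  moreover have "tr (\<lambda>x. k (f (k x))) = cnj (tr f)"
  proof -
    have "k (axis i 1) = axis i 1" for i by (simp add: k_def vec_eq_iff axis_def)
    then show ?thesis by (simp add: tr_sum) (simp add: k_def)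
  qed
  ultimately show ?thesis by (simp add: kk)
qed

section \<open>The Killing form\<close>

locale lie_algebra =
  fixes br :: "('n::finite) brkt"
  assumes complex_lie_algebra: "complex_lie_algebra br"
begin

lemma clinear_ad: "clinear (br x)"
proof -
  have "Vector_Spaces.linear (*s) (*s) (\<lambda>y. br x y)" using complex_lie_algebra unfolding complex_lie_algebra_def by blast
  then show ?thesis unfolding clinear_iff .
qed

lemma clinear_left: "clinear (\<lambda>x. br x y)"
proof -
  have "Vector_Spaces.linear (*s) (*s) (\<lambda>x. br x y)" using complex_lie_algebra unfolding complex_lie_algebra_def by blast
  then show ?thesis unfolding clinear_iff .
qed

lemma br_add: "br (x + y) z = br x z + br y z" "br x (y + z) = br x y + br x z"
  using clinear_left clinear_ad by (auto simp: clinear_def)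

lemma br_smult: "br (c *s x) z = c *s br x z" "br x (c *s z) = c *s br x z"
  using clinear_left clinear_ad by (auto simp: clinear_def)

lemma br_zero [simp]: "br 0 x = 0" "br x 0 = 0"
  using br_smult(1)[of 0 0 x] br_smult(2)[of x 0 0] by simp_all

lemma br_minus: "br (- x) z = - br x z" "br x (- z) = - br x z"
  using br_smult(1)[of "-1" x z] br_smult(2)[of x "-1" z] by (simp_all add: vec.scale_minus_left)

lemma br_diff: "br (x - y) z = br x z - br y z" "br x (y - z) = br x y - br x z"
  using br_add(1)[of x "- y" z] br_add(2)[of x y "- z"] by (simp_all add: br_minus)

lemmas br_simps = br_add br_smult br_minus br_diff

lemma br_self [simp]: "br x x = 0"
  using complex_lie_algebra unfolding complex_lie_algebra_def by blast

lemma br_anti: "br y x = - br x y"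
proof -
  have "br (x + y) (x + y) = 0" by (rule br_self)
  then have "br x y + br y x = 0" by (simp only: br_add) (simp add: add.commute)
  then show ?thesis by (simp add: eq_neg_iff_add_eq_0 add.commute)
qed

lemma jacobi: "br x (br y z) = br (br x y) z + br y (br x z)"
proof -
  have "br x (br y z) + br y (br z x) + br z (br x y) = 0"
    using complex_lie_algebra unfolding complex_lie_algebra_def by blast
  moreover have "br y (br z x) = - br y (br x z)" by (subst br_anti) (rule br_minus)
  moreover have "br z (br x y) = - br (br x y) z" by (rule br_anti)
  ultimately show ?thesis by (simp add: algebra_simps eq_diff_eq)
qed

lemma bounded_bilinear_br: "bounded_bilinear br"
  unfolding bilinear_conv_bounded_bilinear[symmetric] bilinear_def
  using clinear_linear[OF clinear_ad] clinear_linear[OF clinear_left] by blast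

definition ad :: "complex ^ 'n \<Rightarrow> 'n endo" where "ad x = Blinfun (br x)"

lemma ad_apply [simp]: "blinfun_apply (ad x) = br x"
  using clinear_linear[OF clinear_ad] by (simp add: ad_def bounded_linear_Blinfun_apply linear_conv_bounded_linear)

lemma linear_ad: "linear ad"
  by (rule linearI; rule blinfun_eqI) (simp_all add: blinfun.bilinear_simps br_simps scaleR_smult)

lemma exp_ad_eq: "exp_ad br x = op_exp (ad x)"
proof (rule blinfun_eqI)
  fix z
  have s: "(\<lambda>k. (br x ^^ k) z /\<^sub>R fact k) sums blinfun_apply (op_exp (ad x)) z" for z
    using op_exp_apply_sums[of "ad x" z] by simp
  have "exp_ad br x = Blinfun (blinfun_apply (op_exp (ad x)))"
    unfolding exp_ad_def using s by (intro arg_cong[where f=Blinfun] ext) (simp add: sums_iff)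
  then show "blinfun_apply (exp_ad br x) z = blinfun_apply (op_exp (ad x)) z"
    by (simp add: blinfun_apply_inverse)
qed

definition K :: "complex ^ 'n \<Rightarrow> complex ^ 'n \<Rightarrow> complex" where "K x y = killing br x y"

lemma K_tr: "K x y = tr (\<lambda>z. br x (br y z))"
  by (simp add: K_def killing_def tr_def)

lemma K_sym: "K x y = K y x"
  unfolding K_tr by (rule tr_commute[OF clinear_ad clinear_ad])

lemma K_add: "K (x + y) z = K x z + K y z" "K x (y + z) = K x y + K x z"
  unfolding K_tr br_simps by (rule tr_add)+

lemma K_smult: "K (c *s x) y = c * K x y" "K x (c *s y) = c * K x y"
  unfolding K_tr br_simps by (rule tr_scale)+

lemma K_zero [simp]: "K 0 x = 0" "K x 0 = 0"
  using K_smult(1)[of 0 0 x] K_smult(2)[of x 0 0] by simp_all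

lemma K_minus: "K (- x) z = - K x z" "K x (- z) = - K x z"
  using K_smult(1)[of "-1" x z] K_smult(2)[of x "-1" z] by (simp_all add: vec.scale_minus_left)

lemma K_diff: "K (x - y) z = K x z - K y z" "K x (y - z) = K x y - K x z"
  using K_add(1)[of x "- y" z] K_add(2)[of x y "- z"] by (simp_all add: K_minus)

lemmas K_simps = K_add K_smult K_minus K_diff

lemma K_invariant: "K (br x y) z = K x (br y z)"
proof -
  have c: "clinear (\<lambda>w. br a (br b w))" for a b by (rule clinear_comp[OF clinear_ad clinear_ad])
  have e: "br (br x y) w = br x (br y w) - br y (br x w)" for x y w using jacobi[of x y w] by simp
  have "K (br x y) z = tr (\<lambda>w. br x (br y (br z w))) - tr (\<lambda>w. br y (br x (br z w)))"
    unfolding K_tr e tr_diff ..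
  moreover have "K x (br y z) = tr (\<lambda>w. br x (br y (br z w))) - tr (\<lambda>w. br x (br z (br y w)))"
    unfolding K_tr e br_diff tr_diff ..
  moreover have "tr (\<lambda>w. br y (br x (br z w))) = tr (\<lambda>w. br x (br z (br y w)))"
    by (rule tr_commute[OF clinear_ad c])
  ultimately show ?thesis by simp
qed

lemma K_automorphism:
  assumes "clinear \<phi>" "clinear \<psi>" "\<And>x. \<psi> (\<phi> x) = x" "\<And>x. \<phi> (\<psi> x) = x" "\<And>x y. \<phi> (br x y) = br (\<phi> x) (\<phi> y)"
  shows "K (\<phi> x) (\<phi> y) = K x y"
proof -
  have "br (\<phi> x) (br (\<phi> y) z) = \<phi> (br x (br y (\<psi> z)))" for z by (simp add: assms)
  then show ?thesis
    unfolding K_tr using tr_conjugate[OF clinear_comp[OF clinear_ad clinear_ad] assms(1-3)] by simp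
qed

lemma K_antilinear_automorphism:
  assumes "antilinear \<phi>" "antilinear \<psi>" "\<And>x. \<psi> (\<phi> x) = x" "\<And>x. \<phi> (\<psi> x) = x" "\<And>x y. \<phi> (br x y) = br (\<phi> x) (\<phi> y)"
  shows "K (\<phi> x) (\<phi> y) = cnj (K x y)"
proof -
  have "br (\<phi> x) (br (\<phi> y) z) = \<phi> (br x (br y (\<psi> z)))" for z by (simp add: assms)
  then show ?thesis
    unfolding K_tr using tr_antilinear_conjugate[OF clinear_comp[OF clinear_ad clinear_ad] assms(1-3)] by simp
qed

end

text \<open>With a nondegenerate Killing form every real-linear functional is \<open>Im (K z \<sqdot>)\<close>, and all
  derivations are inner.\<close>

locale nondegenerate_lie_algebra = lie_algebra br for br :: "('n::finite) brkt" +
  assumes nondegenerate: "(\<And>y. K x y = 0) \<Longrightarrow> x = 0"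
begin

lemma K_Im_eq_0: "(\<And>y. Im (K x y) = 0) \<Longrightarrow> x = 0"
proof (rule nondegenerate)
  fix y assume *: "\<And>y. Im (K x y) = 0"
  show "K x y = 0" using *[of y] *[of "\<i> *s y"] by (simp add: K_smult complex_eq_iff)
qed

text \<open>The vectors representing the functionals \<open>Im (K z \<sqdot>)\<close> in the Euclidean inner product depend
  injectively, hence surjectively, on \<open>z\<close>.\<close>

lemma K_represent:
  fixes f :: "complex ^ 'n \<Rightarrow> real"
  assumes "linear f"
  obtains z where "\<And>x. Im (K z x) = f x"
proof -
  define Z where "Z z = (\<Sum>b\<in>Basis. Im (K z b) *\<^sub>R b)" for z
  have lin: "linear (\<lambda>x. Im (K z x))" for z
    by (rule linearI) (simp_all add: K_simps scaleR_smult)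
  have Z: "Z z \<bullet> x = Im (K z x)" for z x
  proof -
    have "Im (K z x) = Im (K z (\<Sum>b\<in>Basis. (x \<bullet> b) *\<^sub>R b))" by (simp add: euclidean_representation)
    also have "\<dots> = (\<Sum>b\<in>Basis. (x \<bullet> b) * Im (K z b))"
      by (simp add: linear_sum[OF lin] linear_scale[OF lin])
    also have "\<dots> = Z z \<bullet> x" unfolding Z_def by (simp add: inner_sum_left) (simp add: inner_commute mult.commute)
    finally show ?thesis ..
  qed
  have "linear Z"
  proof (rule linearI)
    have i: "Im (K (r *\<^sub>R x) b) = r * Im (K x b)" for r x b by (simp add: scaleR_smult K_smult)
    show "Z (x + y) = Z x + Z y" "Z (r *\<^sub>R x) = r *\<^sub>R Z x" for x y r
      by (simp_all add: Z_def i K_add scaleR_add_left sum.distrib scaleR_right.sum)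
  qed
  moreover have "inj Z"
    unfolding linear_injective_0[OF \<open>linear Z\<close>]
    by (auto intro!: K_Im_eq_0) (metis Z inner_zero_left)
  ultimately have "surj Z" by (rule linear_inj_imp_surj)
  then obtain z where z: "Z z = (\<Sum>b\<in>Basis. f b *\<^sub>R b)" by (metis surjD)
  have "Im (K z x) = f x" for x
  proof -
    have "f x = f (\<Sum>b\<in>Basis. (x \<bullet> b) *\<^sub>R b)" by (simp add: euclidean_representation)
    also have "\<dots> = (\<Sum>b\<in>Basis. (x \<bullet> b) * f b)" using assms by (simp add: linear_sum linear_scale)
    also have "\<dots> = Z z \<bullet> x" unfolding z by (simp add: inner_sum_left) (simp add: inner_commute mult.commute)
    finally show ?thesis using Z by simp
  qed
  then show thesis by (rule that)
qed

lemma ad_injective: "ad x = ad y \<Longrightarrow> x = y"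
proof -
  assume "ad x = ad y"
  then have "br x = br y" by (metis ad_apply)
  then have "K (x - y) z = 0" for z unfolding K_tr by (simp add: br_diff)
  then show "x = y" using nondegenerate[of "x - y"] by simp
qed

text \<open>Choose \<open>z\<close> with \<open>K z x = tr (D ad x)\<close>. The derivation \<open>D - ad z\<close> then has trace zero against all
  \<open>ad x\<close>, and for such a derivation invariance gives \<open>K (D x) y = tr (D ad [x, y]) = 0\<close>.\<close>

lemma derivation_inner:
  assumes D: "clinear D" "\<And>x y. D (br x y) = br (D x) y + br x (D y)"
  obtains z where "D = br z"
proof -
  define f where "f x = tr (\<lambda>w. D (br x w))" for x
  have Da: "D (x + y) = D x + D y" "D (c *s x) = c *s D x" for x y c using D(1) by (auto simp: clinear_def)
  have fa: "f (x + y) = f x + f y" "f (c *s x) = c * f x" for x y c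
    unfolding f_def br_simps Da by (rule tr_add tr_scale)+
  have "linear (\<lambda>x. Im (f x))" by (rule linearI) (simp_all add: fa scaleR_smult)
  then obtain z where z: "\<And>x. Im (K z x) = Im (f x)" using K_represent by blast
  have zf: "K z x = f x" for x
    using z[of x] z[of "\<i> *s x"] by (simp add: fa K_smult complex_eq_iff)
  let ?D = "\<lambda>x. D x - br z x"
  have D': "clinear ?D" "?D (br x y) = br (?D x) y + br x (?D y)" for x y
  proof -
    show "clinear ?D" using D(1) clinear_ad[of z] by (simp add: clinear_def vec.scale_right_diff_distrib)
    show "?D (br x y) = br (?D x) y + br x (?D y)" using D(2)[of x y] jacobi[of z x y] by (simp add: br_diff)
  qed
  have t0: "tr (\<lambda>w. ?D (br x w)) = 0" for x
    using zf[of x] unfolding tr_diff f_def K_tr by simp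
  have "?D x = 0" for x
  proof (rule nondegenerate)
    fix y
    have e: "br (?D x) w = ?D (br x w) - br x (?D w)" for w using D'(2)[of x w] by simp
    have "K (?D x) y = tr (\<lambda>w. ?D (br x (br y w))) - tr (\<lambda>w. br x (?D (br y w)))"
      unfolding K_tr e tr_diff ..
    also have "tr (\<lambda>w. br x (?D (br y w))) = tr (\<lambda>w. ?D (br y (br x w)))"
      by (rule tr_commute[OF clinear_ad clinear_comp[OF D'(1) clinear_ad]])
    also have "tr (\<lambda>w. ?D (br x (br y w))) - \<dots> = tr (\<lambda>w. ?D (br (br x y) w))"
    proof -
      have "?D (br (br x y) w) = ?D (br x (br y w)) - ?D (br y (br x w))" for w
      proof -
        have s: "?D a - ?D b = ?D (a - b)" for a b using Da(1)[of "a - b" b] by (simp add: br_diff algebra_simps)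
        show ?thesis unfolding s using jacobi[of x y w] by simp
      qed
      then show ?thesis by (simp only: tr_diff)
    qed
    finally show "K (?D x) y = 0" using t0 by simp
  qed
  then have "D = br z" by auto
  then show thesis by (rule that)
qed

end

section \<open>Compact real forms\<close>

text \<open>The Lie-theoretic data with their compact real form \<open>U\<close> and its conjugation \<open>\<theta>\<close>. The Hermitian
  form \<open>K x (\<theta> x)\<close> is definite because \<open>K\<close> is negative definite on \<open>U\<close>; this is the source of all
  nonvanishing results below.\<close>

locale root_data = lie_algebra br for br :: "('n::finite) brkt" +
  fixes h :: "(complex ^ 'n) set" and P :: "'n functional set"
    and Hc E :: "'n functional \<Rightarrow> complex ^ 'n" and \<theta> :: "complex ^ 'n \<Rightarrow> complex ^ 'n"
  assumes cartan: "cartan_subalgebra br h"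
    and positive: "positive_system (roots br h) P"
    and coords: "root_coordinates br h Hc"
    and weyl: "weyl_root_vectors br h P Hc E"
    and conjugation: "complex_conjugation (compact_span (roots br h) Hc E) \<theta>"
begin

abbreviation "\<Delta> \<equiv> roots br h"
abbreviation "U \<equiv> compact_span \<Delta> Hc E"

lemma U: "subspace U" "x \<in> U \<Longrightarrow> y \<in> U \<Longrightarrow> br x y \<in> U" "\<exists>a\<in>U. \<exists>b\<in>U. z = a + \<i> *s b"
  "x \<in> U \<Longrightarrow> x \<noteq> 0 \<Longrightarrow> K x x \<in> \<real> \<and> Re (K x x) < 0"
proof -
  have c: "compact_real_form br U" using weyl unfolding weyl_root_vectors_def by blast
  then have r: "real_form br U" unfolding compact_real_form_def by blast
  then show "subspace U" "x \<in> U \<Longrightarrow> y \<in> U \<Longrightarrow> br x y \<in> U" unfolding real_form_def by blast+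
  have "z \<in> {x + \<i> *s y | x y. x \<in> U \<and> y \<in> U}" using r unfolding real_form_def by blast
  then show "\<exists>a\<in>U. \<exists>b\<in>U. z = a + \<i> *s b" by blast
  show "x \<in> U \<Longrightarrow> x \<noteq> 0 \<Longrightarrow> K x x \<in> \<real> \<and> Re (K x x) < 0"
    using c unfolding compact_real_form_def K_def by blast
qed

lemma K_U_real: "x \<in> U \<Longrightarrow> y \<in> U \<Longrightarrow> Im (K x y) = 0"
proof -
  assume xy: "x \<in> U" "y \<in> U"
  have r: "Im (K z z) = 0" if "z \<in> U" for z
    using U(4)[OF that] by (cases "z = 0") (auto simp: complex_is_Real_iff)
  have "K (x + y) (x + y) = K x x + 2 * K x y + K y y" using K_sym[of x y] by (simp add: K_simps)
  then show ?thesis using r[OF xy(1)] r[OF xy(2)] r[OF subspace_add[OF U(1) xy]] by simp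
qed

lemma K_U_nonpos: "x \<in> U \<Longrightarrow> Re (K x x) \<le> 0" "x \<in> U \<Longrightarrow> K x x = 0 \<Longrightarrow> x = 0"
  using U(4)[of x] by (cases "x = 0"; force)+

lemma \<theta>_simps: "\<theta> (x + y) = \<theta> x + \<theta> y" "\<theta> (c *s x) = cnj c *s \<theta> x" "\<theta> (\<theta> x) = x" "\<theta> x = x \<longleftrightarrow> x \<in> U"
  using conjugation unfolding complex_conjugation_def by blast+

lemma \<theta>_minus: "\<theta> (- x) = - \<theta> x" "\<theta> (x - y) = \<theta> x - \<theta> y"
  using \<theta>_simps(2)[of "-1" x] \<theta>_simps(2)[of "-1" y] \<theta>_simps(1)[of x "- y"] by (simp_all add: vec.scale_minus_left)

lemma \<theta>_br: "\<theta> (br x y) = br (\<theta> x) (\<theta> y)"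
proof -
  obtain a b where ab: "a \<in> U" "b \<in> U" "x = a + \<i> *s b" using U(3) by blast
  obtain c d where cd: "c \<in> U" "d \<in> U" "y = c + \<i> *s d" using U(3) by blast
  have f: "\<theta> u = u" if "u \<in> U" for u using \<theta>_simps(4) that by blast
  have "br a c \<in> U" "br a d \<in> U" "br b c \<in> U" "br b d \<in> U" using U(2) ab cd by blast+
  then show ?thesis
    using ab(1,2) cd(1,2) unfolding ab(3) cd(3) by (simp add: br_simps \<theta>_simps(1,2) \<theta>_minus f vec.scale_right_distrib)
qed

text \<open>For \<open>x = a + i b\<close> with \<open>a\<close>, \<open>b\<close> in \<open>U\<close> the value is \<open>K a a + K b b\<close>, a sum of two nonpositive
  terms.\<close>

lemma K_\<theta>_definite: "K x (\<theta> x) = 0 \<Longrightarrow> x = 0"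
proof -
  assume 0: "K x (\<theta> x) = 0"
  obtain a b where ab: "a \<in> U" "b \<in> U" "x = a + \<i> *s b" using U(3) by blast
  have f: "\<theta> u = u" if "u \<in> U" for u using \<theta>_simps(4) that by blast
  have "\<theta> x = a - \<i> *s b" using ab by (simp add: \<theta>_simps(1,2) f)
  then have "K x (\<theta> x) = K (a + \<i> *s b) (a - \<i> *s b)" using ab(3) by metis
  also have "\<dots> = K a a + K b b" using K_sym[of a b] by (simp add: K_simps algebra_simps)
  finally have "K x (\<theta> x) = K a a + K b b" .
  then have "Re (K a a) + Re (K b b) = 0" using 0 by (metis plus_complex.sel(1) zero_complex.sel(1))
  then have "Re (K a a) = 0" "Re (K b b) = 0" using K_U_nonpos(1)[OF ab(1)] K_U_nonpos(1)[OF ab(2)] by linarith+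
  then have "a = 0" "b = 0"
    using K_U_nonpos(2) K_U_real ab(1,2) by (metis complex_eq_iff zero_complex.sel)+
  then show ?thesis using ab by simp
qed

sublocale nondegenerate_lie_algebra
proof
  fix x assume "\<And>y. K x y = 0" then show "x = 0" using K_\<theta>_definite by blast
qed

section \<open>Roots\<close>

lemma h: "vec.subspace h" "x \<in> h \<Longrightarrow> y \<in> h \<Longrightarrow> br x y \<in> h" "(\<And>y. y \<in> h \<Longrightarrow> br x y \<in> h) \<Longrightarrow> x \<in> h"
  using cartan unfolding cartan_subalgebra_def by blast+

lemma h_nilpotent: "\<exists>k. \<forall>y\<in>h. \<forall>z\<in>h. (br y ^^ k) z = 0"
proof -
  obtain k where k: "lower_central_series br k h = {0}" using cartan unfolding cartan_subalgebra_def by blast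
  have "(br y ^^ j) z \<in> lower_central_series br j h" if "y \<in> h" "z \<in> h" for y z j
    using that by (induction j) (auto intro!: vec.span_base)
  then show ?thesis using k by (metis singletonD)
qed

lemma Hc: assumes "\<alpha> \<in> \<Delta>" shows "Hc \<alpha> \<in> h" "x \<in> h \<Longrightarrow> K x (Hc \<alpha>) = \<alpha> x" "x \<in> h \<Longrightarrow> K (Hc \<alpha>) x = \<alpha> x"
  using coords assms K_sym unfolding root_coordinates_def K_def by auto

lemma root: assumes "\<alpha> \<in> \<Delta>" shows "x \<notin> h \<Longrightarrow> \<alpha> x = 0" "\<exists>x\<in>h. \<alpha> x \<noteq> 0"
  using assms unfolding roots_def by blast+

lemma E: assumes "\<alpha> \<in> \<Delta>" shows "E \<alpha> \<noteq> 0" "x \<in> h \<Longrightarrow> br x (E \<alpha>) = \<alpha> x *s E \<alpha>"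
  using weyl assms unfolding weyl_root_vectors_def by blast+

lemma E_bracket: "\<alpha> \<in> P \<Longrightarrow> br (E \<alpha>) (E (- \<alpha>)) = Hc \<alpha>"
  using weyl unfolding weyl_root_vectors_def by blast

lemma P: "P \<subseteq> \<Delta>" "\<alpha> \<in> \<Delta> \<Longrightarrow> \<alpha> \<in> P \<longleftrightarrow> - \<alpha> \<notin> P" "\<alpha> \<in> P \<Longrightarrow> \<beta> \<in> P \<Longrightarrow> \<alpha> + \<beta> \<in> \<Delta> \<Longrightarrow> \<alpha> + \<beta> \<in> P"
  using positive unfolding positive_system_def by blast+

lemma U_gens: assumes "\<alpha> \<in> \<Delta>"
  shows "\<i> *s Hc \<alpha> \<in> U" "E \<alpha> - E (- \<alpha>) \<in> U" "\<i> *s (E \<alpha> + E (- \<alpha>)) \<in> U"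
  unfolding compact_span_def using assms by (auto intro!: span_base)

lemma \<theta>_Hc: "\<alpha> \<in> \<Delta> \<Longrightarrow> \<theta> (Hc \<alpha>) = - Hc \<alpha>"
proof -
  assume "\<alpha> \<in> \<Delta>"
  then have "\<theta> (\<i> *s Hc \<alpha>) = \<i> *s Hc \<alpha>" using U_gens \<theta>_simps(4) by blast
  then have "(- \<i>) *s \<theta> (Hc \<alpha>) = \<i> *s Hc \<alpha>" by (simp add: \<theta>_simps(2))
  then have "\<i> *s ((- \<i>) *s \<theta> (Hc \<alpha>)) = \<i> *s (\<i> *s Hc \<alpha>)" by simp
  then show ?thesis by simp
qed

lemma \<theta>_E: "\<alpha> \<in> \<Delta> \<Longrightarrow> \<theta> (E \<alpha>) = - E (- \<alpha>)" "\<alpha> \<in> \<Delta> \<Longrightarrow> \<theta> (E (- \<alpha>)) = - E \<alpha>"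
proof -
  assume a: "\<alpha> \<in> \<Delta>"
  have 1: "\<theta> (E \<alpha>) - \<theta> (E (- \<alpha>)) = E \<alpha> - E (- \<alpha>)" using U_gens(2)[OF a] \<theta>_simps(4) \<theta>_minus(2) by metis
  have "\<theta> (\<i> *s (E \<alpha> + E (- \<alpha>))) = \<i> *s (E \<alpha> + E (- \<alpha>))" using U_gens(3)[OF a] \<theta>_simps(4) by blast
  then have "(- \<i>) *s (\<theta> (E \<alpha>) + \<theta> (E (- \<alpha>))) = \<i> *s (E \<alpha> + E (- \<alpha>))" by (simp add: \<theta>_simps(1,2))
  then have "\<i> *s ((- \<i>) *s (\<theta> (E \<alpha>) + \<theta> (E (- \<alpha>)))) = \<i> *s (\<i> *s (E \<alpha> + E (- \<alpha>)))" by simp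
  then have 2: "\<theta> (E \<alpha>) + \<theta> (E (- \<alpha>)) = - (E \<alpha> + E (- \<alpha>))" by simp
  have "2 *s \<theta> (E \<alpha>) = (\<theta> (E \<alpha>) - \<theta> (E (- \<alpha>))) + (\<theta> (E \<alpha>) + \<theta> (E (- \<alpha>)))"
    by (simp add: vec_eq_iff)
  then have "2 *s \<theta> (E \<alpha>) = 2 *s (- E (- \<alpha>))" unfolding 1 2 by (simp add: vec_eq_iff)
  then show 3: "\<theta> (E \<alpha>) = - E (- \<alpha>)" by (simp add: vec_eq_iff)
  show "\<theta> (E (- \<alpha>)) = - E \<alpha>" using 2 unfolding 3 by (simp add: algebra_simps)
qed

lemma root_linear: assumes "\<alpha> \<in> \<Delta>" shows "x \<in> h \<Longrightarrow> y \<in> h \<Longrightarrow> \<alpha> (x + y) = \<alpha> x + \<alpha> y" "x \<in> h \<Longrightarrow> \<alpha> (c *s x) = c * \<alpha> x"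
proof -
  show "\<alpha> (x + y) = \<alpha> x + \<alpha> y" if "x \<in> h" "y \<in> h"
    using Hc(2)[OF assms, symmetric] vec.subspace_add[OF h(1) that] that by (simp add: K_simps)
  show "\<alpha> (c *s x) = c * \<alpha> x" if "x \<in> h"
    using Hc(2)[OF assms, symmetric] vec.subspace_scale[OF h(1) that] that by (simp add: K_simps)
qed

text \<open>Both \<open>i Hc \<alpha>\<close> and \<open>i Hc \<beta>\<close> lie in the compact form, where \<open>K\<close> is real.\<close>

lemma root_real: assumes "\<alpha> \<in> \<Delta>" "\<beta> \<in> \<Delta>" shows "cnj (\<alpha> (Hc \<beta>)) = \<alpha> (Hc \<beta>)"
proof -
  have "\<alpha> (Hc \<beta>) = - K (\<i> *s Hc \<beta>) (\<i> *s Hc \<alpha>)" using Hc(2)[OF assms(1) Hc(1)[OF assms(2)]] by (simp add: K_smult)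
  then show ?thesis using K_U_real[OF U_gens(1)[OF assms(2)] U_gens(1)[OF assms(1)]] by (simp add: complex_eq_iff)
qed

lemma root_positive: assumes "\<alpha> \<in> \<Delta>" shows "Re (\<alpha> (Hc \<alpha>)) > 0" "\<alpha> (Hc \<alpha>) \<noteq> 0"
proof -
  obtain x where "x \<in> h" "\<alpha> x \<noteq> 0" using root[OF assms] by blast
  then have "Hc \<alpha> \<noteq> 0" using Hc(2)[OF assms] by force
  then have "\<i> *s Hc \<alpha> \<noteq> 0" by simp
  then have "Re (K (\<i> *s Hc \<alpha>) (\<i> *s Hc \<alpha>)) < 0" using U(4)[OF U_gens(1)[OF assms]] by blast
  then show "Re (\<alpha> (Hc \<alpha>)) > 0" using Hc(2)[OF assms Hc(1)[OF assms]] by (simp add: K_smult)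
  then show "\<alpha> (Hc \<alpha>) \<noteq> 0" by auto
qed

lemma Hc_uminus_P: assumes "- \<beta> \<in> P" "\<beta> \<in> \<Delta>" shows "Hc \<beta> = - Hc (- \<beta>)"
proof -
  have m: "- \<beta> \<in> \<Delta>" using assms P(1) by blast
  let ?z = "Hc \<beta> + Hc (- \<beta>)"
  have "\<i> *s ?z = \<i> *s Hc \<beta> + \<i> *s Hc (- \<beta>)" by (rule vec.scale_right_distrib)
  then have "\<i> *s ?z \<in> U" using subspace_add[OF U(1) U_gens(1)[OF assms(2)] U_gens(1)[OF m]] by simp
  moreover have "?z \<in> h" using Hc(1) assms(2) m vec.subspace_add[OF h(1)] by blast
  then have "K ?z ?z = 0" using Hc(2)[OF assms(2)] Hc(2)[OF m] by (simp only: K_add(2)) simp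
  then have "K (\<i> *s ?z) (\<i> *s ?z) = 0" by (simp only: K_smult) simp
  ultimately have "\<i> *s ?z = 0" by (rule K_U_nonpos(2))
  then have "?z = 0" by (simp only: vec.scale_eq_0_iff) simp
  then show ?thesis by (simp add: eq_neg_iff_add_eq_0)
qed

text \<open>It is not known yet that \<open>- \<beta>\<close> is a root; but \<open>E (- \<beta>)\<close> is \<open>- \<theta> (E \<beta>)\<close>, so applying \<open>\<theta>\<close> to the
  eigenvector equation of \<open>E \<beta>\<close> gives its weight on the vectors \<open>Hc \<alpha>\<close>.\<close>

lemma Hc_E_minus: assumes "\<alpha> \<in> \<Delta>" "\<beta> \<in> \<Delta>" shows "br (Hc \<alpha>) (E (- \<beta>)) = - \<beta> (Hc \<alpha>) *s E (- \<beta>)"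
proof -
  have "\<theta> (br (Hc \<alpha>) (E \<beta>)) = \<theta> (\<beta> (Hc \<alpha>) *s E \<beta>)" using E(2)[OF assms(2) Hc(1)[OF assms(1)]] by simp
  then show ?thesis
    by (simp add: \<theta>_br \<theta>_Hc[OF assms(1)] \<theta>_E[OF assms(2)] \<theta>_simps(2) br_simps root_real[OF assms(2,1)] vec.scale_minus_left)
qed

lemma Hc_commute: assumes "\<alpha> \<in> \<Delta>" "\<beta> \<in> \<Delta>" shows "br (Hc \<alpha>) (Hc \<beta>) = 0"
proof -
  have *: "br (Hc \<alpha>) (Hc \<beta>) = 0" if b: "\<beta> \<in> P" for \<beta>
  proof -
    have bD: "\<beta> \<in> \<Delta>" using b P(1) by blast
    show ?thesis
      unfolding E_bracket[OF b, symmetric] jacobi[of "Hc \<alpha>"] Hc_E_minus[OF assms(1) bD] E(2)[OF bD Hc(1)[OF assms(1)]] br_smult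
      by (simp add: vec.scale_minus_left)
  qed
  show ?thesis
  proof (cases "\<beta> \<in> P")
    case False
    then have "- \<beta> \<in> P" using P(2) assms by blast
    then show ?thesis using Hc_uminus_P[OF _ assms(2)] * by (simp add: br_simps)
  qed (rule *)
qed

text \<open>Moving \<open>ad y\<close> from \<open>e\<close> to \<open>z\<close> by invariance \<open>k\<close> times gives \<open>c ^ k K e z = 0\<close>.\<close>

lemma K_eigenvector_nilpotent:
  assumes "br y e = c *s e" "c \<noteq> 0" "(br y ^^ k) z = 0"
  shows "K e z = 0"
proof -
  have "c ^ j * K e z = (-1) ^ j * K e ((br y ^^ j) z)" for j
  proof (induction j)
    case (Suc j)
    have "c * K e ((br y ^^ j) z) = - K e (br y ((br y ^^ j) z))"
      using assms(1) K_invariant[of e y "(br y ^^ j) z"] br_anti[of y e] by (simp add: K_simps) (metis K_minus(1) K_smult(1) minus_minus)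
    have "c ^ Suc j * K e z = c * (c ^ j * K e z)" by simp
    also have "\<dots> = (-1) ^ j * (c * K e ((br y ^^ j) z))" unfolding Suc by simp
    also have "\<dots> = (-1) ^ Suc j * K e ((br y ^^ Suc j) z)" unfolding \<open>c * K e ((br y ^^ j) z) = - K e (br y ((br y ^^ j) z))\<close> by simp
    finally show ?case .
  qed simp
  from this[of k] show ?thesis using assms by simp
qed

text \<open>Root vectors are orthogonal to \<open>h\<close>, since \<open>h\<close> acts nilpotently on itself.\<close>

lemma K_E_h: assumes "\<beta> \<in> \<Delta>" "z \<in> h" shows "K (E \<beta>) z = 0" "K (E (- \<beta>)) z = 0"
proof -
  obtain k where k: "\<forall>y\<in>h. \<forall>z\<in>h. (br y ^^ k) z = 0" using h_nilpotent by blast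
  have kz: "(br (Hc \<beta>) ^^ k) z = 0" using k Hc(1)[OF assms(1)] assms(2) by blast
  show "K (E \<beta>) z = 0"
    by (rule K_eigenvector_nilpotent[OF E(2)[OF assms(1) Hc(1)[OF assms(1)]] root_positive(2)[OF assms(1)] kz])
  show "K (E (- \<beta>)) z = 0"
    by (rule K_eigenvector_nilpotent[OF Hc_E_minus[OF assms(1) assms(1)] _ kz]) (simp add: root_positive(2)[OF assms(1)])
qed

lemma generating: "vec.span (Hc ` \<Delta> \<union> (E ` \<Delta> \<union> (\<lambda>\<alpha>. E (- \<alpha>)) ` \<Delta>)) = UNIV"
proof -
  let ?S = "vec.span (Hc ` \<Delta> \<union> (E ` \<Delta> \<union> (\<lambda>\<alpha>. E (- \<alpha>)) ` \<Delta>))"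
  have s: "subspace ?S"
    by (auto simp: subspace_def scaleR_smult intro: vec.span_zero vec.span_add vec.span_scale)
  have g: "Hc \<alpha> \<in> ?S" "E \<alpha> \<in> ?S" "E (- \<alpha>) \<in> ?S" if "\<alpha> \<in> \<Delta>" for \<alpha>
    using that by (auto intro!: vec.span_base)
  have "U \<subseteq> ?S" unfolding compact_span_def
    by (rule span_minimal[OF _ s]) (auto intro!: vec.span_scale vec.span_add vec.span_diff g)
  moreover have "z \<in> ?S" if "a \<in> ?S" "b \<in> ?S" "z = a + \<i> *s b" for a b z
    using that by (auto intro: vec.span_add vec.span_scale)
  ultimately show ?thesis using U(3) by blast
qed

lemma K_zero_on_generators:
  assumes "\<And>\<alpha>. \<alpha> \<in> \<Delta> \<Longrightarrow> K z (Hc \<alpha>) = 0" "\<And>\<alpha>. \<alpha> \<in> \<Delta> \<Longrightarrow> K z (E \<alpha>) = 0" "\<And>\<alpha>. \<alpha> \<in> \<Delta> \<Longrightarrow> K z (E (- \<alpha>)) = 0"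
  shows "z = 0"
proof (rule nondegenerate)
  fix y
  have "vec.subspace {y. K z y = 0}" by (rule vec.subspaceI) (auto simp: K_simps)
  then have "vec.span (Hc ` \<Delta> \<union> (E ` \<Delta> \<union> (\<lambda>\<alpha>. E (- \<alpha>)) ` \<Delta>)) \<subseteq> {y. K z y = 0}"
    by (intro vec.span_minimal) (use assms in auto)
  then show "K z y = 0" unfolding generating by blast
qed

text \<open>An element of \<open>h\<close> differs from a combination of the \<open>Hc \<alpha>\<close> by a combination \<open>f\<close> of root vectors
  that is in \<open>h\<close>. Such an \<open>f\<close> is orthogonal to the root vectors because it is in \<open>h\<close>, and to the \<open>Hc
  \<alpha>\<close> because it is a combination of root vectors; so it is zero.\<close>

lemma h_span: "h = vec.span (Hc ` \<Delta>)"
proof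
  show "vec.span (Hc ` \<Delta>) \<subseteq> h" by (rule vec.span_minimal[OF _ h(1)]) (use Hc in auto)
  show "h \<subseteq> vec.span (Hc ` \<Delta>)"
  proof
    fix z assume z: "z \<in> h"
    have "z \<in> vec.span (Hc ` \<Delta> \<union> (E ` \<Delta> \<union> (\<lambda>\<alpha>. E (- \<alpha>)) ` \<Delta>))" unfolding generating by simp
    then obtain a f where af: "a \<in> vec.span (Hc ` \<Delta>)" "f \<in> vec.span (E ` \<Delta> \<union> (\<lambda>\<alpha>. E (- \<alpha>)) ` \<Delta>)" "z = a + f"
      unfolding vec.span_Un by blast
    have fh: "f \<in> h" using z af(1,3) \<open>vec.span (Hc ` \<Delta>) \<subseteq> h\<close> vec.subspace_diff[OF h(1) z, of a] by auto
    have "f = 0"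
    proof (rule K_zero_on_generators)
      fix \<alpha> assume a: "\<alpha> \<in> \<Delta>"
      have "vec.subspace {f. K f (Hc \<alpha>) = 0}" by (rule vec.subspaceI) (auto simp: K_simps)
      then have "vec.span (E ` \<Delta> \<union> (\<lambda>\<alpha>. E (- \<alpha>)) ` \<Delta>) \<subseteq> {f. K f (Hc \<alpha>) = 0}"
        by (intro vec.span_minimal) (use K_E_h Hc(1)[OF a] in auto)
      then show "K f (Hc \<alpha>) = 0" using af(2) by blast
      show "K f (E \<alpha>) = 0" "K f (E (- \<alpha>)) = 0" using K_E_h[OF a fh] K_sym by metis+
    qed
    then show "z \<in> vec.span (Hc ` \<Delta>)" using af by simp
  qed
qed

text \<open>Since \<open>h\<close> is spanned by the \<open>Hc \<alpha>\<close>, \<open>E (- \<beta>)\<close> is a common eigenvector of all of \<open>h\<close>.\<close>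

lemma uminus_root: assumes "\<beta> \<in> \<Delta>" shows "- \<beta> \<in> \<Delta>"
proof -
  have "\<theta> (E \<beta>) \<noteq> 0" using E(1)[OF assms] \<theta>_simps(3)[of "E \<beta>"] \<theta>_simps(2)[of 0 0] by (metis vec.scale_zero_left complex_cnj_zero)
  then have nz: "E (- \<beta>) \<noteq> 0" using \<theta>_E(1)[OF assms] by auto
  have "vec.subspace {x \<in> h. br x (E (- \<beta>)) = - \<beta> x *s E (- \<beta>)}"
  proof (rule vec.subspaceI)
    have "\<beta> 0 = 0" using root_linear(2)[OF assms vec.subspace_0[OF h(1)], of 0] by simp
    then show "0 \<in> {x \<in> h. br x (E (- \<beta>)) = - \<beta> x *s E (- \<beta>)}" using vec.subspace_0[OF h(1)] by simp
  qed (auto simp: br_simps root_linear[OF assms] vec.scale_left_distrib vec.scale_left_diff_distrib vec.scale_minus_left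
      intro: vec.subspace_add[OF h(1)] vec.subspace_scale[OF h(1)])
  then have "vec.span (Hc ` \<Delta>) \<subseteq> {x \<in> h. br x (E (- \<beta>)) = - \<beta> x *s E (- \<beta>)}"
    by (rule vec.span_minimal[rotated]) (use Hc_E_minus[OF _ assms] Hc(1) in auto)
  then have "\<forall>x\<in>h. br x (E (- \<beta>)) = (- \<beta>) x *s E (- \<beta>)" unfolding h_span[symmetric] by auto
  moreover have "\<forall>x. x \<notin> h \<longrightarrow> (- \<beta>) x = 0" "\<exists>x\<in>h. (- \<beta>) x \<noteq> 0" using root[OF assms] by auto
  ultimately show ?thesis unfolding roots_def using nz by blast
qed

lemma h_abelian: assumes "x \<in> h" "y \<in> h" shows "br x y = 0"
proof -
  have 1: "br (Hc \<alpha>) y = 0" if "\<alpha> \<in> \<Delta>" "y \<in> h" for \<alpha> y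
  proof -
    have "vec.subspace {y. br (Hc \<alpha>) y = 0}" by (rule vec.subspaceI) (auto simp: br_simps)
    then have "vec.span (Hc ` \<Delta>) \<subseteq> {y. br (Hc \<alpha>) y = 0}"
      by (intro vec.span_minimal) (use Hc_commute[OF that(1)] in auto)
    then show ?thesis using that(2) h_span by blast
  qed
  have "vec.subspace {x. br x y = 0}" by (rule vec.subspaceI) (auto simp: br_simps)
  then have "vec.span (Hc ` \<Delta>) \<subseteq> {x. br x y = 0}"
    by (intro vec.span_minimal) (use 1 assms(2) in auto)
  then show ?thesis using assms(1) h_span by blast
qed

lemma K_weights:
  assumes "\<And>x. x \<in> h \<Longrightarrow> br x u = \<kappa> x *s u" "\<And>x. x \<in> h \<Longrightarrow> br x w = \<mu> x *s w" "x \<in> h" "\<kappa> x + \<mu> x \<noteq> 0"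
  shows "K u w = 0"
proof -
  have "\<kappa> x * K u w = K (br x u) w" using assms by (simp add: K_simps)
  also have "\<dots> = - K u (br x w)" using K_invariant[of u x w] br_anti[of x u] by (simp add: K_simps)
  also have "\<dots> = - (\<mu> x * K u w)" using assms by (simp add: K_simps)
  finally have "(\<kappa> x + \<mu> x) * K u w = 0" by (simp add: algebra_simps)
  then show ?thesis using assms(4) by simp
qed

lemma K_E_E: assumes "\<alpha> \<in> \<Delta>" "\<beta> \<in> \<Delta>" "\<beta> \<noteq> - \<alpha>" shows "K (E \<alpha>) (E \<beta>) = 0"
proof -
  have "\<exists>x\<in>h. \<alpha> x + \<beta> x \<noteq> 0"
  proof (rule ccontr)
    assume *: "\<not> ?thesis"
    have "\<beta> x = (- \<alpha>) x" for x
    proof (cases "x \<in> h")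
      case True
      then have "\<alpha> x + \<beta> x = 0" using * by blast
      then show ?thesis by (simp add: eq_neg_iff_add_eq_0 add.commute)
    qed (use root(1)[OF assms(1)] root(1)[OF assms(2)] in auto)
    then show False using assms(3) by blast
  qed
  then show ?thesis using K_weights E(2) assms(1,2) by metis
qed

lemma K_E_minus: assumes "\<alpha> \<in> \<Delta>" shows "K (E \<alpha>) (E (- \<alpha>)) = 1"
proof -
  have *: "K (E \<alpha>) (E (- \<alpha>)) = 1" if "\<alpha> \<in> P" for \<alpha>
  proof -
    have a: "\<alpha> \<in> \<Delta>" using that P(1) by blast
    have "\<alpha> (Hc \<alpha>) * K (E \<alpha>) (E (- \<alpha>)) = K (br (Hc \<alpha>) (E \<alpha>)) (E (- \<alpha>))" using E(2)[OF a Hc(1)[OF a]] by (simp add: K_simps)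
    also have "\<dots> = K (Hc \<alpha>) (Hc \<alpha>)" by (simp add: K_invariant E_bracket[OF that])
    also have "\<dots> = \<alpha> (Hc \<alpha>)" using Hc[OF a] by blast
    finally show ?thesis using root_positive(2)[OF a] by simp
  qed
  show ?thesis
  proof (cases "\<alpha> \<in> P")
    case False
    then have "- \<alpha> \<in> P" using P(2) assms by blast
    from *[OF this] show ?thesis using K_sym by simp
  qed (rule *)
qed

lemma E_bracket_root: assumes "\<alpha> \<in> \<Delta>" shows "br (E \<alpha>) (E (- \<alpha>)) = Hc \<alpha>"
proof (cases "\<alpha> \<in> P")
  case False
  then have m: "- \<alpha> \<in> P" using P(2) assms by blast
  have "br (E \<alpha>) (E (- \<alpha>)) = - br (E (- \<alpha>)) (E (- (- \<alpha>)))" by (subst br_anti) simp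
  then show ?thesis unfolding E_bracket[OF m] using Hc_uminus_P[OF m assms] by simp
qed (rule E_bracket)

lemma inj_E: "inj_on E \<Delta>"
proof (rule inj_onI, rule ccontr)
  fix \<alpha> \<beta> assume ab: "\<alpha> \<in> \<Delta>" "\<beta> \<in> \<Delta>" "E \<alpha> = E \<beta>" "\<alpha> \<noteq> \<beta>"
  have "K (E \<beta>) (E (- \<alpha>)) = 0" using K_E_E[OF ab(2) uminus_root[OF ab(1)]] ab(4) by simp
  then show False using K_E_minus[OF ab(1)] ab(3) by simp
qed

lemma finite_roots: "finite \<Delta>"
proof -
  have "vec.independent (E ` \<Delta>)"
    unfolding vec.dependent_def
  proof
    assume "\<exists>a\<in>E ` \<Delta>. a \<in> vec.span (E ` \<Delta> - {a})"
    then obtain \<alpha> where a: "\<alpha> \<in> \<Delta>" "E \<alpha> \<in> vec.span (E ` \<Delta> - {E \<alpha>})" by blast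
    have "vec.subspace {y. K y (E (- \<alpha>)) = 0}" by (rule vec.subspaceI) (auto simp: K_simps)
    moreover have "E ` \<Delta> - {E \<alpha>} \<subseteq> {y. K y (E (- \<alpha>)) = 0}"
    proof
      fix y assume "y \<in> E ` \<Delta> - {E \<alpha>}"
      then obtain \<beta> where "\<beta> \<in> \<Delta>" "y = E \<beta>" "\<beta> \<noteq> \<alpha>" by blast
      then show "y \<in> {y. K y (E (- \<alpha>)) = 0}" using K_E_E[of \<beta> "- \<alpha>"] uminus_root[OF a(1)] by auto
    qed
    ultimately have "K (E \<alpha>) (E (- \<alpha>)) = 0" using a(2) vec.span_minimal by blast
    then show False using K_E_minus[OF a(1)] by simp
  qed
  then have "finite (E ` \<Delta>)" by (rule vec.finiteI_independent)
  then show ?thesis using inj_E finite_imageD by blast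
qed

text \<open>The remainder \<open>x\<close> is orthogonal to all root vectors. For \<open>y\<close> in \<open>h\<close> the bracket \<open>[y, x]\<close> is then
  orthogonal to everything, so \<open>x\<close> centralizes \<open>h\<close> and lies in it because \<open>h\<close> is its own normalizer.\<close>

lemma root_decomposition:
  obtains x where "x \<in> h" "z = x + (\<Sum>\<alpha>\<in>\<Delta>. K z (E (- \<alpha>)) *s E \<alpha>)"
proof -
  let ?s = "\<Sum>\<alpha>\<in>\<Delta>. K z (E (- \<alpha>)) *s E \<alpha>"
  let ?x = "z - ?s"
  have Ksum: "K (sum f A) y = (\<Sum>a\<in>A. K (f a) y)" for f and A :: "'n functional set" and y
    by (induction A rule: infinite_finite_induct) (auto simp: K_simps)
  have xE: "K ?x (E \<beta>) = 0" if b: "\<beta> \<in> \<Delta>" for \<beta>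
  proof -
    have mb: "- \<beta> \<in> \<Delta>" by (rule uminus_root[OF b])
    have "K ?s (E \<beta>) = (\<Sum>\<alpha>\<in>\<Delta>. if \<alpha> = - \<beta> then K z (E (- \<alpha>)) else 0)"
      unfolding Ksum
    proof (rule sum.cong[OF refl])
      fix \<alpha> assume a: "\<alpha> \<in> \<Delta>"
      show "K (K z (E (- \<alpha>)) *s E \<alpha>) (E \<beta>) = (if \<alpha> = - \<beta> then K z (E (- \<alpha>)) else 0)"
      proof (cases "\<alpha> = - \<beta>")
        case True
        then have "K (E \<alpha>) (E \<beta>) = 1" using K_E_minus[OF a] by simp
        then show ?thesis using True by (simp add: K_simps)
      next
        case False
        then have "\<beta> \<noteq> - \<alpha>" by auto
        then show ?thesis using False K_E_E[OF a b] by (simp add: K_simps)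
      qed
    qed
    also have "\<dots> = K z (E \<beta>)" using mb finite_roots by (simp add: sum.delta)
    finally show ?thesis by (simp add: K_simps)
  qed
  have "?x \<in> h"
  proof (rule h(3))
    fix y assume y: "y \<in> h"
    have "br y ?x = 0"
    proof (rule K_zero_on_generators)
      fix \<alpha> assume a: "\<alpha> \<in> \<Delta>"
      have r: "K (br y ?x) w = - K ?x (br y w)" for w
        using K_invariant[of ?x y w] br_anti[of y ?x] by (simp add: K_simps)
      show "K (br y ?x) (Hc \<alpha>) = 0" unfolding r using h_abelian[OF y Hc(1)[OF a]] by simp
      have e: "K (br y ?x) (E \<alpha>) = 0" if a: "\<alpha> \<in> \<Delta>" for \<alpha> unfolding r E(2)[OF a y] using xE[OF a] by (simp only: K_smult) simp
      show "K (br y ?x) (E \<alpha>) = 0" by (rule e[OF a])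
      show "K (br y ?x) (E (- \<alpha>)) = 0" by (rule e[OF uminus_root[OF a]])
    qed
    then have "br ?x y = 0" using br_anti[of y ?x] by simp
    then show "br ?x y \<in> h" using vec.subspace_0[OF h(1)] by simp
  qed
  then show thesis by (rule that) simp
qed

end

section \<open>Interpolation and pointwise sums\<close>

lemma interpolation_exists:
  fixes f :: "'a::field \<Rightarrow> 'a"
  assumes "finite F"
  shows "\<exists>p. \<forall>x\<in>F. poly p x = f x"
  using assms
proof (induction F)
  case (insert a F)
  then obtain p where p: "\<forall>x\<in>F. poly p x = f x" by blast
  let ?q = "\<Prod>y\<in>F. [:- y, 1:]"
  have q: "poly ?q x = (\<Prod>y\<in>F. x - y)" for x by (simp add: poly_prod)
  have "poly ?q a \<noteq> 0" unfolding q using insert by auto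
  moreover have "poly ?q x = 0" if "x \<in> F" for x unfolding q using that insert(1) by auto
  ultimately have "\<forall>x\<in>insert a F. poly (p + smult ((f a - poly p a) / poly ?q a) ?q) x = f x"
    using p by auto
  then show ?case by blast
qed simp

lemma sum_list_apply: "(sum_list fs) x = (\<Sum>f\<leftarrow>fs. f x)" for fs :: "('a \<Rightarrow> 'b::comm_monoid_add) list"
  by (induction fs) auto

context root_data
begin

section \<open>Positive roots\<close>

text \<open>The difference of \<open>z\<close> and its component along \<open>E \<kappa>\<close> is orthogonal to all weight vectors; so weight
  spaces for roots are lines, and other nonzero weights do not occur.\<close>

lemma weight_vector:
  assumes w: "\<And>x. x \<in> h \<Longrightarrow> br x z = \<kappa> x *s z" and o: "\<And>x. x \<notin> h \<Longrightarrow> \<kappa> x = 0" and nz: "\<kappa> \<noteq> 0" and z: "z \<noteq> 0"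
  shows "\<kappa> \<in> \<Delta>" "z = K z (E (- \<kappa>)) *s E \<kappa>"
proof -
  obtain x0 where x0: "x0 \<in> h" "\<kappa> x0 \<noteq> 0" using o nz by (metis ext zero_fun_apply)
  show D: "\<kappa> \<in> \<Delta>" unfolding roots_def using w o x0 z by blast
  let ?z = "z - K z (E (- \<kappa>)) *s E \<kappa>"
  have w': "br x ?z = \<kappa> x *s ?z" if "x \<in> h" for x
    using w[OF that] E(2)[OF D that] by (simp add: br_simps vec.scale_right_diff_distrib mult.commute)
  have e: "K ?z (E \<beta>) = 0" if b: "\<beta> \<in> \<Delta>" for \<beta>
  proof (cases "\<beta> = - \<kappa>")
    case True
    then show ?thesis using K_E_minus[OF D] by (simp add: K_simps)
  next
    case False
    have "\<exists>x\<in>h. \<kappa> x + \<beta> x \<noteq> 0"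
    proof (rule ccontr)
      assume *: "\<not> ?thesis"
      have "\<beta> x = (- \<kappa>) x" for x
      proof (cases "x \<in> h")
        case True
        then have "\<kappa> x + \<beta> x = 0" using * by blast
        then show ?thesis by (simp add: eq_neg_iff_add_eq_0 add.commute)
      qed (use root(1)[OF b] o in auto)
      then show False using False by blast
    qed
    then obtain x where x: "x \<in> h" "\<kappa> x + \<beta> x \<noteq> 0" by blast
    show ?thesis by (rule K_weights[OF w' E(2)[OF b] x])
  qed
  have "?z = 0"
  proof (rule K_zero_on_generators)
    fix \<alpha> assume a: "\<alpha> \<in> \<Delta>"
    show "K ?z (E \<alpha>) = 0" "K ?z (E (- \<alpha>)) = 0" using e a uminus_root by blast+
    show "K ?z (Hc \<alpha>) = 0"
      by (rule K_weights[OF w', of "Hc \<alpha>" "\<lambda>_. 0" x0]) (use x0 h_abelian[OF _ Hc(1)[OF a]] in auto)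
  qed
  then show "z = K z (E (- \<kappa>)) *s E \<kappa>" by simp
qed

lemma E_bracket_weight:
  assumes "\<alpha> \<in> \<Delta>" "\<beta> \<in> \<Delta>" "x \<in> h"
  shows "br x (br (E \<alpha>) (E \<beta>)) = (\<alpha> + \<beta>) x *s br (E \<alpha>) (E \<beta>)"
  unfolding jacobi[of x] E(2)[OF assms(1,3)] E(2)[OF assms(2,3)] br_smult by (simp add: vec.scale_left_distrib)

text \<open>If \<open>\<alpha> + \<beta>\<close> were not a root, then \<open>E \<alpha>\<close> would kill \<open>v\<^sub>0 = E \<beta>\<close>. Applying \<open>E (- \<alpha>)\<close> repeatedly, \<open>[E
  \<alpha>, v\<^sub>k\<^sub>+\<^sub>1] = c\<^sub>k v\<^sub>k\<close> where \<open>c\<^sub>k\<close> is a sum of negative numbers, so no \<open>v\<^sub>k\<close> vanishes. Their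
  weights \<open>\<beta> - k \<alpha>\<close> are infinitely many roots, a contradiction.\<close>

lemma root_add:
  assumes a: "\<alpha> \<in> \<Delta>" and b: "\<beta> \<in> \<Delta>" and neg: "Re (\<beta> (Hc \<alpha>)) < 0" and nz: "\<alpha> + \<beta> \<noteq> 0"
  shows "\<alpha> + \<beta> \<in> \<Delta>"
proof (rule ccontr)
  assume nD: "\<alpha> + \<beta> \<notin> \<Delta>"
  have ma: "- \<alpha> \<in> \<Delta>" by (rule uminus_root[OF a])
  define v where "v k = (br (E (- \<alpha>)) ^^ k) (E \<beta>)" for k
  define w where "w k = (\<lambda>x. \<beta> x - of_nat k * \<alpha> x)" for k
  have v: "v 0 = E \<beta>" "v (Suc k) = br (E (- \<alpha>)) (v k)" for k by (simp_all add: v_def)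
  have wt: "br x (v k) = w k x *s v k" if "x \<in> h" for x k
  proof (induction k)
    case 0
    then show ?case using E(2)[OF b that] by (simp add: v w_def)
  next
    case (Suc k)
    have "br x (v (Suc k)) = br (br x (E (- \<alpha>))) (v k) + br (E (- \<alpha>)) (br x (v k))" unfolding v by (rule jacobi)
    also have "\<dots> = (- \<alpha> x + w k x) *s v (Suc k)"
      unfolding E(2)[OF ma that] Suc br_smult v by (simp add: vec.scale_left_distrib)
    also have "- \<alpha> x + w k x = w (Suc k) x" by (simp add: w_def algebra_simps)
    finally show ?case .
  qed
  have E0: "br (E \<alpha>) (E \<beta>) = 0"
  proof (rule ccontr)
    assume "br (E \<alpha>) (E \<beta>) \<noteq> 0"
    from weight_vector(1)[OF E_bracket_weight[OF a b] _ nz this] have "\<alpha> + \<beta> \<in> \<Delta>"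
      using root(1)[OF a] root(1)[OF b] by auto
    then show False using nD by blast
  qed
  define c where "c k = (\<Sum>j\<le>k. w j (Hc \<alpha>))" for k
  have up: "br (E \<alpha>) (v (Suc k)) = c k *s v k" for k
  proof (induction k)
    case 0
    have "br (E \<alpha>) (v (Suc 0)) = br (Hc \<alpha>) (v 0) + br (E (- \<alpha>)) (br (E \<alpha>) (v 0))"
      unfolding v(2) jacobi[of "E \<alpha>" "E (- \<alpha>)"] E_bracket_root[OF a] ..
    then show ?case using wt[OF Hc(1)[OF a], of 0] E0 by (simp add: v(1) c_def)
  next
    case (Suc k)
    have "br (E \<alpha>) (v (Suc (Suc k))) = br (Hc \<alpha>) (v (Suc k)) + br (E (- \<alpha>)) (br (E \<alpha>) (v (Suc k)))"
      unfolding v(2)[of "Suc k"] jacobi[of "E \<alpha>" "E (- \<alpha>)"] E_bracket_root[OF a] ..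
    also have "\<dots> = w (Suc k) (Hc \<alpha>) *s v (Suc k) + c k *s v (Suc k)"
      by (simp only: Suc wt[OF Hc(1)[OF a]] br_smult v(2)[of k, symmetric])
    also have "\<dots> = c (Suc k) *s v (Suc k)" by (simp add: c_def vec.scale_left_distrib add.commute)
    finally show ?case .
  qed
  have cneg: "Re (c k) < 0" for k
  proof -
    have "Re (w j (Hc \<alpha>)) < 0" for j
    proof -
      have "real j * Re (\<alpha> (Hc \<alpha>)) \<ge> 0" using root_positive(1)[OF a] by simp
      then show ?thesis using neg by (simp add: w_def)
    qed
    then have "(\<Sum>j\<le>k. Re (w j (Hc \<alpha>))) < (\<Sum>j\<le>k. 0)" by (intro sum_strict_mono) auto
    then show ?thesis by (simp add: c_def)
  qed
  have vnz: "v k \<noteq> 0" for k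
  proof (induction k)
    case 0
    then show ?case using E(1)[OF b] by (simp add: v)
  next
    case (Suc k)
    show ?case
    proof
      assume "v (Suc k) = 0"
      then have "c k *s v k = 0" using up[of k] by simp
      then have "c k = 0" using Suc by simp
      then show False using cneg[of k] by simp
    qed
  qed
  have "w k \<in> insert 0 \<Delta>" for k
  proof (cases "w k = 0")
    case False
    then show ?thesis using weight_vector(1)[OF wt[of _ k] _ False vnz[of k]] root(1)[OF a] root(1)[OF b] by (auto simp: w_def)
  qed simp
  then have "finite (range w)" by (meson finite_insert finite_roots finite_subset image_subsetI)
  moreover have "inj w"
  proof (rule injI)
    fix i j assume "w i = w j"
    then have "w i (Hc \<alpha>) = w j (Hc \<alpha>)" by simp
    then show "i = j" using root_positive(2)[OF a] by (simp add: w_def)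
  qed
  ultimately show False using finite_imageD[of w UNIV] by simp
qed

text \<open>If a sum of positive roots vanished, then the first one, \<open>\<alpha>\<close>, would have negative inner product
  with another one, \<open>\<beta>\<close>. By \<open>root_add\<close>, \<open>\<alpha> + \<beta>\<close> is a positive root, and replacing the two by their
  sum gives a shorter vanishing sum.\<close>

lemma positive_sum_nonzero:
  assumes "set xs \<subseteq> P" "xs \<noteq> []"
  shows "sum_list xs \<noteq> 0"
  using assms
proof (induction "length xs" arbitrary: xs rule: less_induct)
  case less
  show ?case
  proof
    assume 0: "sum_list xs = 0"
    obtain \<alpha> ys where xs: "xs = \<alpha> # ys" using less.prems by (cases xs) auto
    have aP: "\<alpha> \<in> P" and ysP: "set ys \<subseteq> P" using less.prems xs by auto
    have a: "\<alpha> \<in> \<Delta>" using aP P(1) by blast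
    have s: "\<alpha> (Hc \<alpha>) + (\<Sum>\<beta>\<leftarrow>ys. \<beta> (Hc \<alpha>)) = 0"
      using fun_cong[OF 0, of "Hc \<alpha>"] unfolding xs sum_list_apply by simp
    have "\<exists>\<beta>\<in>set ys. Re (\<beta> (Hc \<alpha>)) < 0"
    proof (rule ccontr)
      assume *: "\<not> ?thesis"
      have "Re (\<Sum>\<beta>\<leftarrow>zs. \<beta> (Hc \<alpha>)) \<ge> 0" if "set zs \<subseteq> set ys" for zs
        using that * by (induction zs) (auto simp: not_less)
      from this[OF subset_refl] have "Re (\<alpha> (Hc \<alpha>) + (\<Sum>\<beta>\<leftarrow>ys. \<beta> (Hc \<alpha>))) > 0"
        using root_positive(1)[OF a] by simp
      then show False using s by simp
    qed
    then obtain \<beta> where b: "\<beta> \<in> set ys" "Re (\<beta> (Hc \<alpha>)) < 0" by blast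
    have bP: "\<beta> \<in> P" using b ysP by blast
    have "\<alpha> + \<beta> \<noteq> 0"
    proof
      assume "\<alpha> + \<beta> = 0"
      then have "\<beta> = - \<alpha>" by (simp add: eq_neg_iff_add_eq_0 add.commute)
      then show False using bP aP P(2)[OF a] by blast
    qed
    then have "\<alpha> + \<beta> \<in> P" using root_add[OF a, of \<beta>] b(2) bP P(1,3) aP by blast
    moreover have "set (remove1 \<beta> ys) \<subseteq> P" using ysP set_remove1_subset by fast
    moreover have "length ((\<alpha> + \<beta>) # remove1 \<beta> ys) < length xs"
      using b(1) xs by (simp add: length_remove1) (metis Suc_pred length_pos_if_in_set lessI)
    ultimately have "sum_list ((\<alpha> + \<beta>) # remove1 \<beta> ys) \<noteq> 0" by (intro less.hyps) auto
    moreover have "sum_list ((\<alpha> + \<beta>) # remove1 \<beta> ys) = sum_list xs"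
    proof -
      have "sum_list ys = \<beta> + sum_list (remove1 \<beta> ys)"
        using sum_list_map_remove1[OF b(1), of "\<lambda>x. x"] by simp
      then show ?thesis by (simp add: xs add.assoc)
    qed
    ultimately show False using 0 by simp
  qed
qed

definition positive_weight :: "'n functional \<Rightarrow> bool" where
  "positive_weight \<kappa> \<longleftrightarrow> (\<exists>xs. xs \<noteq> [] \<and> set xs \<subseteq> P \<and> \<kappa> = sum_list xs)"

lemma positive_weight_add: "positive_weight \<kappa> \<Longrightarrow> positive_weight \<mu> \<Longrightarrow> positive_weight (\<kappa> + \<mu>)"
proof -
  assume "positive_weight \<kappa>" "positive_weight \<mu>"
  then obtain xs ys where "xs \<noteq> []" "set xs \<subseteq> P" "\<kappa> = sum_list xs" "set ys \<subseteq> P" "\<mu> = sum_list ys"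
    unfolding positive_weight_def by blast
  then show ?thesis unfolding positive_weight_def by (intro exI[of _ "xs @ ys"]) simp
qed

lemma positive_weight_P: "\<alpha> \<in> P \<Longrightarrow> positive_weight \<alpha>"
  unfolding positive_weight_def by (intro exI[of _ "[\<alpha>]"]) simp

lemma positive_weight_nonzero: assumes "positive_weight \<kappa>" shows "\<exists>x\<in>h. \<kappa> x \<noteq> 0"
proof -
  obtain xs where xs: "xs \<noteq> []" "set xs \<subseteq> P" "\<kappa> = sum_list xs" using assms unfolding positive_weight_def by blast
  then have "\<kappa> \<noteq> 0" using positive_sum_nonzero[OF xs(2,1)] by simp
  then obtain x where x: "\<kappa> x \<noteq> 0" by (metis ext zero_fun_apply)
  have "\<alpha> y = 0" if "\<alpha> \<in> P" "y \<notin> h" for \<alpha> y using that root(1) P(1) by blast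
  then have "sum_list zs y = 0" if "set zs \<subseteq> P" "y \<notin> h" for zs y
    using that unfolding sum_list_apply by (induction zs) auto
  then have "x \<in> h" using x xs by blast
  then show ?thesis using x by blast
qed

lemma Hc_add: assumes "\<alpha> \<in> \<Delta>" "\<beta> \<in> \<Delta>" "\<alpha> + \<beta> \<in> \<Delta>" shows "Hc (\<alpha> + \<beta>) = Hc \<alpha> + Hc \<beta>"
proof -
  let ?z = "Hc (\<alpha> + \<beta>) - (Hc \<alpha> + Hc \<beta>)"
  have z: "?z \<in> h" using Hc(1) assms by (intro vec.subspace_diff[OF h(1)] vec.subspace_add[OF h(1)])
  have "?z = 0"
  proof (rule K_zero_on_generators)
    fix \<mu> assume m: "\<mu> \<in> \<Delta>"
    show "K ?z (Hc \<mu>) = 0" using Hc(3)[OF assms(1) Hc(1)[OF m]] Hc(3)[OF assms(2) Hc(1)[OF m]] Hc(3)[OF assms(3) Hc(1)[OF m]]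
      by (simp add: K_simps)
    show "K ?z (E \<mu>) = 0" "K ?z (E (- \<mu>)) = 0" using K_E_h[OF m z] K_sym by metis+
  qed
  then show ?thesis by simp
qed

text \<open>The relation that \<open>\<alpha>\<close> is \<open>\<beta>\<close> plus a sum of positive roots is a strict order on the finite set \<open>P\<close>,
  by \<open>positive_sum_nonzero\<close>. A positive root that is not simple is a sum of two smaller ones, and
  \<open>Hc\<close> is additive.\<close>

lemma h_span_simple: "h = vec.span (Hc ` simple_roots P)"
proof
  let ?S = "vec.span (Hc ` simple_roots P)"
  have fP: "finite P" using P(1) finite_roots finite_subset by blast
  have sP: "simple_roots P \<subseteq> P" by (auto simp: simple_roots_def)
  define below where "below \<alpha> = {\<beta> \<in> P. \<exists>\<kappa>. positive_weight \<kappa> \<and> \<alpha> = \<beta> + \<kappa>}" for \<alpha>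
  have less: "card (below \<beta>) < card (below \<alpha>)" if "\<beta> \<in> P" "\<gamma> \<in> P" "\<alpha> = \<beta> + \<gamma>" for \<alpha> \<beta> \<gamma>
  proof (rule psubset_card_mono)
    show "finite (below \<alpha>)" using fP by (simp add: below_def)
    have "below \<beta> \<subseteq> below \<alpha>"
    proof
      fix x assume "x \<in> below \<beta>"
      then obtain \<kappa> where k: "x \<in> P" "positive_weight \<kappa>" "\<beta> = x + \<kappa>" by (auto simp: below_def)
      have "\<alpha> = x + (\<kappa> + \<gamma>)" using k(3) that(3) by (simp add: add.assoc)
      then show "x \<in> below \<alpha>" using k positive_weight_add[OF k(2) positive_weight_P[OF that(2)]] by (auto simp: below_def)
    qed
    moreover have "\<beta> \<in> below \<alpha>" using that positive_weight_P by (auto simp: below_def)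
    moreover have "\<beta> \<notin> below \<beta>"
    proof
      assume "\<beta> \<in> below \<beta>"
      then obtain \<kappa> where k: "positive_weight \<kappa>" "\<beta> = \<beta> + \<kappa>" by (auto simp: below_def)
      then have "\<kappa> = 0" by (metis add_cancel_left_right)
      then show False using positive_weight_nonzero[OF k(1)] by simp
    qed
    ultimately show "below \<beta> \<subset> below \<alpha>" by blast
  qed
  have pos: "Hc \<alpha> \<in> ?S" if "\<alpha> \<in> P" for \<alpha>
    using that
  proof (induction "card (below \<alpha>)" arbitrary: \<alpha> rule: less_induct)
    case (less \<alpha>)
    note lessc = \<open>\<And>\<alpha> \<beta> \<gamma>. \<lbrakk>\<beta> \<in> P; \<gamma> \<in> P; \<alpha> = \<beta> + \<gamma>\<rbrakk> \<Longrightarrow> card (below \<beta>) < card (below \<alpha>)\<close>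
    show ?case
    proof (cases "\<alpha> \<in> simple_roots P")
      case True
      then show ?thesis by (intro vec.span_base) simp
    next
      case False
      then obtain \<beta> \<gamma> where bg: "\<beta> \<in> P" "\<gamma> \<in> P" "\<alpha> = \<beta> + \<gamma>" using less.prems by (auto simp: simple_roots_def)
      have "card (below \<beta>) < card (below \<alpha>)" "card (below \<gamma>) < card (below \<alpha>)"
        using lessc[OF bg] lessc[OF bg(2,1)] bg(3) by (simp_all add: add.commute)
      then have "Hc \<beta> \<in> ?S" "Hc \<gamma> \<in> ?S" using less.hyps bg by blast+
      moreover have "Hc \<alpha> = Hc \<beta> + Hc \<gamma>" unfolding bg(3)
        by (rule Hc_add) (use bg P(1) less.prems in auto)
      ultimately show ?thesis by (simp add: vec.span_add)
    qed
  qed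
  have all: "Hc \<alpha> \<in> ?S" if "\<alpha> \<in> \<Delta>" for \<alpha>
  proof (cases "\<alpha> \<in> P")
    case False
    then have m: "- \<alpha> \<in> P" using P(2) that by blast
    show ?thesis unfolding Hc_uminus_P[OF m that] by (rule vec.span_neg[OF pos[OF m]])
  qed (rule pos)
  have "vec.span (Hc ` \<Delta>) \<subseteq> ?S" by (rule vec.span_minimal) (use all in auto)
  then show "h \<subseteq> ?S" using h_span by blast
  show "?S \<subseteq> h" by (rule vec.span_minimal[OF _ h(1)]) (use Hc(1) sP P(1) in blast)
qed

section \<open>The Borel subalgebra and its nilradical\<close>

abbreviation "\<nn> \<equiv> pos_nilradical P E"
abbreviation "\<bb> \<equiv> std_borel h P E"

text \<open>The operators that raise weights by sums of positive roots. They take the place of strictly upper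
  triangular matrices; what makes them manageable is that they are spanned by weight vectors for \<open>ad
  h\<close> with nonzero weights.\<close>

definition nil_ops :: "'n endo set" where
  "nil_ops = span {Y :: 'n endo. clinear (blinfun_apply Y) \<and> (\<exists>\<kappa>. positive_weight \<kappa> \<and> (\<forall>x\<in>h. \<forall>z. br x (Y z) = Y (br x z) + \<kappa> x *s Y z))}"

lemma subspace_nn: "vec.subspace \<nn>"
  unfolding pos_nilradical_def by simp

lemma E_nn: "\<alpha> \<in> P \<Longrightarrow> E \<alpha> \<in> \<nn>"
  unfolding pos_nilradical_def by (intro vec.span_base) simp

lemma subspace_bb: "vec.subspace \<bb>"
proof (rule vec.subspaceI)
  show "0 \<in> \<bb>" unfolding std_borel_def using vec.subspace_0[OF h(1)] vec.subspace_0[OF subspace_nn] by force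
  show "x + y \<in> \<bb>" if xy: "x \<in> \<bb>" "y \<in> \<bb>" for x y
  proof -
    from xy obtain a u b v where "a \<in> h" "u \<in> \<nn>" "x = a + u" "b \<in> h" "v \<in> \<nn>" "y = b + v" unfolding std_borel_def by blast
    then have "x + y = (a + b) + (u + v)" "a + b \<in> h" "u + v \<in> \<nn>"
      using vec.subspace_add[OF h(1)] vec.subspace_add[OF subspace_nn] by auto
    then show ?thesis unfolding std_borel_def by blast
  qed
  show "c *s x \<in> \<bb>" if x: "x \<in> \<bb>" for c x
  proof -
    from x obtain a u where "a \<in> h" "u \<in> \<nn>" "x = a + u" unfolding std_borel_def by blast
    then have "c *s x = c *s a + c *s u" "c *s a \<in> h" "c *s u \<in> \<nn>"
      using vec.subspace_scale[OF h(1)] vec.subspace_scale[OF subspace_nn] by (auto simp: vec.scale_right_distrib)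
    then show ?thesis unfolding std_borel_def by blast
  qed
qed

lemma nn_bb: "x \<in> \<nn> \<Longrightarrow> x \<in> \<bb>"
  unfolding std_borel_def using vec.subspace_0[OF h(1)] by force

lemma h_bb: "x \<in> h \<Longrightarrow> x \<in> \<bb>"
  unfolding std_borel_def using vec.subspace_0[OF subspace_nn] by force

lemma subspace_nil_ops: "subspace nil_ops"
  unfolding nil_ops_def by simp

lemma nil_ops_base:
  assumes "clinear (blinfun_apply Y)" "positive_weight \<kappa>" "\<And>x z. x \<in> h \<Longrightarrow> br x (blinfun_apply Y z) = Y (br x z) + \<kappa> x *s Y z"
  shows "Y \<in> nil_ops"
  unfolding nil_ops_def using assms by (intro span_base) blast

lemma nil_ops_linear_image:
  assumes L: "linear L" and base: "\<And>Y \<kappa>. clinear (blinfun_apply Y) \<Longrightarrow> positive_weight \<kappa> \<Longrightarrow>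
    (\<And>x z. x \<in> h \<Longrightarrow> br x (blinfun_apply Y z) = Y (br x z) + \<kappa> x *s Y z) \<Longrightarrow> L Y \<in> W" and W: "subspace W" and Y: "Y \<in> nil_ops"
  shows "L Y \<in> W"
proof -
  have "nil_ops \<subseteq> {Y. L Y \<in> W}"
    unfolding nil_ops_def
  proof (rule span_minimal)
    show "subspace {Y. L Y \<in> W}" using L W by (auto simp: subspace_def linear_add linear_scale linear_0)
  qed (use base in blast)
  then show ?thesis using Y by blast
qed

lemma nil_ops_mult: assumes "Y \<in> nil_ops" "Z \<in> nil_ops" shows "Y o\<^sub>L Z \<in> nil_ops"
proof (rule nil_ops_linear_image[OF _ _ subspace_nil_ops assms(1), of "\<lambda>Y. Y o\<^sub>L Z"])
  show "linear (\<lambda>Y. Y o\<^sub>L Z)"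
    by (rule bounded_linear.linear[OF compose_bounded_linear_left])
  fix Y :: "'n endo" and \<kappa>
  assume Y: "clinear Y" "positive_weight \<kappa>" "\<And>x z. x \<in> h \<Longrightarrow> br x (Y z) = Y (br x z) + \<kappa> x *s Y z"
  show "Y o\<^sub>L Z \<in> nil_ops"
  proof (rule nil_ops_linear_image[OF _ _ subspace_nil_ops assms(2), of "\<lambda>Z. Y o\<^sub>L Z"])
    show "linear (\<lambda>Z. Y o\<^sub>L Z)"
      by (rule bounded_linear.linear[OF compose_bounded_linear_right])
    fix Z :: "'n endo" and \<mu>
    assume Z: "clinear Z" "positive_weight \<mu>" "\<And>x z. x \<in> h \<Longrightarrow> br x (Z z) = Z (br x z) + \<mu> x *s Z z"
    have Ya: "Y (a + b) = Y a + Y b" "Y (c *s a) = c *s Y a" for a b c using Y(1) by (auto simp: clinear_def)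
    show "Y o\<^sub>L Z \<in> nil_ops"
    proof (rule nil_ops_base[OF _ positive_weight_add[OF Y(2) Z(2)]])
      show "clinear (Y o\<^sub>L Z)" using clinear_comp[OF Y(1) Z(1)] by (simp add: blinfun_compose.rep_eq o_def)
      show "br x ((Y o\<^sub>L Z) z) = (Y o\<^sub>L Z) (br x z) + (\<kappa> + \<mu>) x *s (Y o\<^sub>L Z) z" if "x \<in> h" for x z
        by (simp add: Y(3)[OF that] Z(3)[OF that] Ya vec.scale_left_distrib)
    qed
  qed
qed

lemma nil_ops_ad_h: assumes "a \<in> h" "Y \<in> nil_ops" shows "ad a o\<^sub>L Y \<in> nil_ops" "Y o\<^sub>L ad a \<in> nil_ops"
proof -
  have c: "br x (br a z) = br a (br x z)" if "x \<in> h" for x z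
    using jacobi[of x a z] h_abelian[OF that assms(1)] by simp
  show "ad a o\<^sub>L Y \<in> nil_ops"
  proof (rule nil_ops_linear_image[OF _ _ subspace_nil_ops assms(2), of "\<lambda>Z. ad a o\<^sub>L Z"])
    show "linear (\<lambda>Z. ad a o\<^sub>L Z)"
      by (rule bounded_linear.linear[OF compose_bounded_linear_right])
    fix Z :: "'n endo" and \<mu>
    assume Z: "clinear Z" "positive_weight \<mu>" "\<And>x z. x \<in> h \<Longrightarrow> br x (Z z) = Z (br x z) + \<mu> x *s Z z"
    show "ad a o\<^sub>L Z \<in> nil_ops"
    proof (rule nil_ops_base[OF _ Z(2)])
      show "clinear (ad a o\<^sub>L Z)" using clinear_comp[OF clinear_ad Z(1)] by (simp add: blinfun_compose.rep_eq o_def)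
    qed (simp add: c Z(3) br_simps)
  qed
  show "Y o\<^sub>L ad a \<in> nil_ops"
  proof (rule nil_ops_linear_image[OF _ _ subspace_nil_ops assms(2), of "\<lambda>Z. Z o\<^sub>L ad a"])
    show "linear (\<lambda>Z. Z o\<^sub>L ad a)"
      by (rule bounded_linear.linear[OF compose_bounded_linear_left])
    fix Z :: "'n endo" and \<mu>
    assume Z: "clinear Z" "positive_weight \<mu>" "\<And>x z. x \<in> h \<Longrightarrow> br x (Z z) = Z (br x z) + \<mu> x *s Z z"
    show "Z o\<^sub>L ad a \<in> nil_ops"
    proof (rule nil_ops_base[OF _ Z(2)])
      show "clinear (Z o\<^sub>L ad a)" using clinear_comp[OF Z(1) clinear_ad] by (simp add: blinfun_compose.rep_eq o_def)
    qed (simp add: c Z(3))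
  qed
qed

text \<open>The trace of a commutator vanishes, and a weight vector is a multiple of its commutator with some
  \<open>ad x\<close>.\<close>

lemma nil_ops_tr: assumes "Y \<in> nil_ops" shows "tr (blinfun_apply Y) = 0"
proof -
  have "linear (\<lambda>Y::'n endo. tr Y)"
    by (rule linearI) (simp_all add: tr_sum blinfun.bilinear_simps sum.distrib scaleR_right.sum)
  moreover have "tr Y \<in> {0}" if Y: "clinear Y" "positive_weight \<kappa>" "\<And>x z. x \<in> h \<Longrightarrow> br x (Y z) = Y (br x z) + \<kappa> x *s Y z" for Y :: "'n endo" and \<kappa>
  proof -
    obtain x where x: "x \<in> h" "\<kappa> x \<noteq> 0" using positive_weight_nonzero[OF Y(2)] by blast
    have "\<kappa> x * tr Y = tr (\<lambda>z. br x (Y z)) - tr (\<lambda>z. Y (br x z))"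
      unfolding tr_scale[symmetric] tr_diff[symmetric] using Y(3)[OF x(1)] by simp
    also have "\<dots> = 0" using tr_commute[OF clinear_ad Y(1), of x] by simp
    finally show ?thesis using x by simp
  qed
  ultimately have "tr Y \<in> {0}" using nil_ops_linear_image[of "\<lambda>Y. tr Y" "{0}" Y] assms by (simp add: subspace_single_0)
  then show ?thesis by simp
qed

lemma ad_nn: assumes "u \<in> \<nn>" shows "ad u \<in> nil_ops"
proof -
  have "\<nn> \<subseteq> {u. \<forall>c. ad (c *s u) \<in> nil_ops}"
    unfolding pos_nilradical_def
  proof (rule vec.span_minimal)
    have "ad (c *s E \<alpha>) \<in> nil_ops" if aP: "\<alpha> \<in> P" for \<alpha> c
    proof (rule nil_ops_base[OF _ positive_weight_P[OF aP]])
      have a: "\<alpha> \<in> \<Delta>" using aP P(1) by blast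
      show "br x (blinfun_apply (ad (c *s E \<alpha>)) z) = blinfun_apply (ad (c *s E \<alpha>)) (br x z) + \<alpha> x *s blinfun_apply (ad (c *s E \<alpha>)) z"
        if "x \<in> h" for x z
        using jacobi[of x "c *s E \<alpha>" z] E(2)[OF a that] by (simp add: br_simps mult.commute add.commute)
    qed (simp add: clinear_ad)
    then show "E ` P \<subseteq> {u. \<forall>c. ad (c *s u) \<in> nil_ops}" by auto
    show "vec.subspace {u. \<forall>c. ad (c *s u) \<in> nil_ops}"
      using subspace_nil_ops linear_ad
      by (intro vec.subspaceI) (auto simp: vec.scale_right_distrib linear_add linear_0 subspace_add subspace_0)
  qed
  then have "ad (1 *s u) \<in> nil_ops" using assms by blast
  then show ?thesis by simp
qed

lemma tr_nil_ops_bb: assumes "Y \<in> nil_ops" "x \<in> \<bb>" shows "tr (\<lambda>z. Y (br x z)) = 0"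
proof -
  obtain a u where x: "a \<in> h" "u \<in> \<nn>" "x = a + u" using assms(2) unfolding std_borel_def by blast
  have "Y o\<^sub>L ad x = (Y o\<^sub>L ad a) + (Y o\<^sub>L ad u)"
    unfolding x(3) by (rule blinfun_eqI) (simp add: br_simps blinfun.bilinear_simps)
  then have "Y o\<^sub>L ad x \<in> nil_ops"
    using nil_ops_ad_h(2)[OF x(1) assms(1)] nil_ops_mult[OF assms(1) ad_nn[OF x(2)]] subspace_add[OF subspace_nil_ops] by simp
  from nil_ops_tr[OF this] show ?thesis by (simp add: blinfun_compose.rep_eq o_def)
qed

lemma K_nn_bb: assumes "x \<in> \<nn>" "y \<in> \<bb>" shows "K x y = 0"
  unfolding K_tr using tr_nil_ops_bb[OF ad_nn[OF assms(1)] assms(2)] by simp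

text \<open>A vector orthogonal to \<open>\<bb>\<close> has no component along negative root vectors, and no component in \<open>h\<close>.\<close>

lemma bb_perp: assumes "\<And>y. y \<in> \<bb> \<Longrightarrow> K z y = 0" shows "z \<in> \<nn>"
proof -
  obtain x where x: "x \<in> h" "z = x + (\<Sum>\<alpha>\<in>\<Delta>. K z (E (- \<alpha>)) *s E \<alpha>)" by (rule root_decomposition) (rule that)
  have t: "K z (E (- \<alpha>)) *s E \<alpha> \<in> \<nn>" if a: "\<alpha> \<in> \<Delta>" for \<alpha>
  proof (cases "\<alpha> \<in> P")
    case True
    then show ?thesis by (intro vec.subspace_scale[OF subspace_nn] E_nn)
  next
    case False
    then have "- \<alpha> \<in> P" using P(2)[OF a] by blast
    then have "K z (E (- \<alpha>)) = 0" using assms nn_bb E_nn by blast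
    then show ?thesis using vec.subspace_0[OF subspace_nn] by simp
  qed
  have s: "(\<Sum>\<alpha>\<in>\<Delta>. K z (E (- \<alpha>)) *s E \<alpha>) \<in> \<nn>" (is "?s \<in> _") by (rule vec.subspace_sum[OF subspace_nn t])
  have "x = 0"
  proof (rule K_zero_on_generators)
    fix \<alpha> assume a: "\<alpha> \<in> \<Delta>"
    have "K ?s (Hc \<alpha>) = 0" by (rule K_nn_bb[OF s h_bb[OF Hc(1)[OF a]]])
    moreover have "x = z - ?s" using x(2) by (simp add: eq_diff_eq)
    ultimately show "K x (Hc \<alpha>) = 0" using assms[OF h_bb[OF Hc(1)[OF a]]] by (simp only: K_diff) simp
    show "K x (E \<alpha>) = 0" "K x (E (- \<alpha>)) = 0" using K_E_h[OF a x(1)] K_sym by metis+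
  qed
  then show ?thesis using x(2) s by simp
qed

lemma nn_perp: assumes "\<And>y. y \<in> \<nn> \<Longrightarrow> K z y = 0" shows "z \<in> \<bb>"
proof -
  obtain x where x: "x \<in> h" "z = x + (\<Sum>\<alpha>\<in>\<Delta>. K z (E (- \<alpha>)) *s E \<alpha>)" by (rule root_decomposition) (rule that)
  have t: "K z (E (- \<alpha>)) *s E \<alpha> \<in> \<nn>" if a: "\<alpha> \<in> \<Delta>" for \<alpha>
  proof (cases "\<alpha> \<in> P")
    case True
    then show ?thesis by (intro vec.subspace_scale[OF subspace_nn] E_nn)
  next
    case False
    then have "- \<alpha> \<in> P" using P(2)[OF a] by blast
    then have "K z (E (- \<alpha>)) = 0" using assms E_nn by blast
    then show ?thesis using vec.subspace_0[OF subspace_nn] by simp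
  qed
  have "(\<Sum>\<alpha>\<in>\<Delta>. K z (E (- \<alpha>)) *s E \<alpha>) \<in> \<nn>" by (rule vec.subspace_sum[OF subspace_nn t])
  then show ?thesis unfolding std_borel_def using x by blast
qed

lemma ad_nil_ops_imp_nn: "ad z \<in> nil_ops \<Longrightarrow> z \<in> \<nn>"
proof (rule bb_perp)
  fix y assume "ad z \<in> nil_ops" "y \<in> \<bb>"
  from tr_nil_ops_bb[OF this] show "K z y = 0" by (simp add: K_tr)
qed

lemma bb_closed: assumes "x \<in> \<bb>" "y \<in> \<bb>" shows "br x y \<in> \<bb>"
proof (rule nn_perp)
  \<comment> \<open>\<open>[ \<bb>, \<bb> ]\<close> is orthogonal to \<open>\<nn>\<close> since \<open>ad u \<circ> ad x\<close> is again a nil operator for \<open>u\<close> in \<open>\<nn>\<close>, \<open>x\<close> in \<open>\<bb>\<close>.\<close>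
  fix u assume u: "u \<in> \<nn>"
  obtain a v where x: "a \<in> h" "v \<in> \<nn>" "x = a + v" using assms(1) unfolding std_borel_def by blast
  have m: "Y o\<^sub>L ad x \<in> nil_ops" "ad x o\<^sub>L Y \<in> nil_ops" if "Y \<in> nil_ops" for Y
  proof -
    have "Y o\<^sub>L ad x = (Y o\<^sub>L ad a) + (Y o\<^sub>L ad v)" "ad x o\<^sub>L Y = (ad a o\<^sub>L Y) + (ad v o\<^sub>L Y)"
      unfolding x(3) by (rule blinfun_eqI, simp add: br_simps blinfun.bilinear_simps)+
    then show "Y o\<^sub>L ad x \<in> nil_ops" "ad x o\<^sub>L Y \<in> nil_ops"
      using nil_ops_ad_h[OF x(1) that] nil_ops_mult[OF that ad_nn[OF x(2)]] nil_ops_mult[OF ad_nn[OF x(2)] that]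
        subspace_add[OF subspace_nil_ops] by simp_all
  qed
  have "ad (br u x) = (ad u o\<^sub>L ad x) - (ad x o\<^sub>L ad u)"
    by (rule blinfun_eqI) (simp add: blinfun.bilinear_simps jacobi[of u x])
  then have "ad (br u x) \<in> nil_ops" using m[OF ad_nn[OF u]] subspace_diff[OF subspace_nil_ops] by simp
  then have "K (br u x) y = 0" by (rule K_nn_bb[OF ad_nil_ops_imp_nn assms(2)])
  then show "K (br x y) u = 0" using K_invariant[of u x y] K_sym[of u "br x y"] by simp
qed

text \<open>Let \<open>a\<close> be the \<open>h\<close>-component of \<open>z\<close>. Modulo nil operators \<open>(ad z)\<^sup>k\<close> is \<open>(ad a)\<^sup>k\<close>, and it is
  conjugate to the nil operator \<open>(ad u0)\<^sup>k\<close>; so \<open>tr ((ad a)\<^sup>k) = 0\<close> for all \<open>k > 0\<close>. As in the proof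
  of Cartan's criterion, the conjugate of \<open>ad a\<close> is a polynomial in \<open>ad a\<close>, whence \<open>K a (\<theta> a) = 0\<close>
  and \<open>a = 0\<close>.\<close>

lemma bb_inter_nilradical:
  assumes \<phi>: "clinear \<phi>" "clinear \<psi>" "\<And>x. \<psi> (\<phi> x) = x" "\<And>x. \<phi> (\<psi> x) = x" "\<And>x y. \<phi> (br x y) = br (\<phi> x) (\<phi> y)"
    and z: "z \<in> \<bb>" "z = \<phi> u0" "u0 \<in> \<nn>"
  shows "z \<in> \<nn>"
proof -
  obtain a u where au: "a \<in> h" "u \<in> \<nn>" "z = a + u" using z(1) unfolding std_borel_def by blast
  have tz: "tr (op_power (ad z) (Suc k)) = 0" for k
  proof -
    have "op_power (ad u0) (Suc k) \<in> nil_ops"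
      by (induction k) (use nil_ops_mult ad_nn[OF z(3)] in auto)
    then have 0: "tr (op_power (ad u0) (Suc k)) = 0" by (rule nil_ops_tr)
    have p: "(br z ^^ j) w = \<phi> ((br u0 ^^ j) (\<psi> w))" for j w
      by (induction j) (simp_all add: z(2) \<phi>)
    have c: "clinear (op_power (ad u0) j)" for j
      unfolding op_power_apply[abs_def] by (induction j) (auto simp: clinear_def br_simps)
    have "tr (\<lambda>w. \<phi> (op_power (ad u0) (Suc k) (\<psi> w))) = tr (op_power (ad u0) (Suc k))"
      by (rule tr_conjugate[OF c \<phi>(1-3)])
    moreover have "blinfun_apply (op_power (ad z) (Suc k)) = (\<lambda>w. \<phi> (op_power (ad u0) (Suc k) (\<psi> w)))"
      by (rule ext) (simp only: op_power_apply ad_apply p)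
    ultimately show ?thesis using 0 by simp
  qed
  have diff: "op_power (ad z) k - op_power (ad a) k \<in> nil_ops" for k
  proof (induction k)
    case 0
    then show ?case using subspace_0[OF subspace_nil_ops] by simp
  next
    case (Suc k)
    have r: "ad u o\<^sub>L op_power (ad a) k \<in> nil_ops"
    proof (induction k)
      case 0
      then show ?case using ad_nn[OF au(2)] by simp
    next
      case (Suc k)
      then show ?case using nil_ops_ad_h(2)[OF au(1) Suc] op_power_commute[of "ad a" k] by (simp add: blinfun_compose_assoc)
    qed
    let ?N = "op_power (ad z) k - op_power (ad a) k"
    have "op_power (ad z) (Suc k) - op_power (ad a) (Suc k) = (ad a o\<^sub>L ?N) + ((ad u o\<^sub>L ?N) + (ad u o\<^sub>L op_power (ad a) k))"
      by (rule blinfun_eqI) (simp add: au(3) br_simps blinfun.bilinear_simps)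
    then show ?case
      using nil_ops_ad_h(1)[OF au(1) Suc] nil_ops_mult[OF ad_nn[OF au(2)] Suc] r subspace_add[OF subspace_nil_ops] by simp
  qed
  have ta: "tr (op_power (ad a) (Suc k)) = 0" for k
  proof -
    have "tr (op_power (ad z) (Suc k) - op_power (ad a) (Suc k)) = 0" by (rule nil_ops_tr[OF diff])
    then show ?thesis using tz[of k] by (simp add: minus_blinfun.rep_eq tr_diff del: op_power.simps)
  qed
  \<comment> \<open>\<open>ad (- \<theta> a)\<close> is a polynomial without constant term in \<open>ad a\<close>, so \<open>K (\<theta> a) a\<close> is a combination of vanishing traces.\<close>
  have "finite (insert 0 ((\<lambda>\<alpha>. \<alpha> a) ` \<Delta>))" using finite_roots by simp
  then obtain p where p: "\<forall>c\<in>insert 0 ((\<lambda>\<alpha>. \<alpha> a) ` \<Delta>). poly p c = cnj c" using interpolation_exists by blast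
  define S where "S w = (\<Sum>i\<le>degree p. coeff p i *s (br a ^^ i) w)" for w
  have S_eig: "S w = poly p c *s w" if "br a w = c *s w" for w c
  proof -
    have "(br a ^^ i) w = c ^ i *s w" for i
      by (induction i) (simp_all add: br_simps that mult.commute)
    then show ?thesis unfolding S_def poly_altdef by (simp add: vec.scale_sum_left)
  qed
  have cS: "clinear S"
  proof -
    have "clinear (br a ^^ i)" for i by (induction i) (auto simp: clinear_def br_simps)
    then show ?thesis unfolding S_def clinear_def
      by (auto simp: vec.scale_right_distrib sum.distrib vec.scale_sum_right mult.commute)
  qed
  have \<theta>a: "br (- \<theta> a) (E \<alpha>) = cnj (\<alpha> a) *s E \<alpha>" if al: "\<alpha> \<in> \<Delta>" for \<alpha>
  proof -
    have "\<theta> (br a (E (- \<alpha>))) = \<theta> ((- \<alpha>) a *s E (- \<alpha>))" using E(2)[OF uminus_root[OF al] au(1)] by simp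
    then show ?thesis by (simp add: \<theta>_br \<theta>_simps(2) \<theta>_minus(1) \<theta>_E[OF al] br_simps vec.scale_minus_left)
  qed
  have \<theta>h: "\<theta> a \<in> h"
  proof -
    have "vec.subspace {x. \<theta> x \<in> h}"
      by (rule vec.subspaceI) (use vec.subspace_0[OF h(1)] \<theta>_simps(2)[of 0 0] in \<open>auto simp: \<theta>_simps(1,2) intro: vec.subspace_add[OF h(1)] vec.subspace_scale[OF h(1)]\<close>)
    then have "vec.span (Hc ` \<Delta>) \<subseteq> {x. \<theta> x \<in> h}"
      by (rule vec.span_minimal[rotated]) (use \<theta>_Hc Hc(1) vec.subspace_neg[OF h(1)] in auto)
    then show ?thesis using au(1) h_span by blast
  qed
  have "br (- \<theta> a) w = S w" for w
  proof -
    have "vec.subspace {w. br (- \<theta> a) w = S w}"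
    proof (rule vec.subspaceI)
      have "S (0 *s 0) = 0 *s S 0" using cS unfolding clinear_def by blast
      then show "0 \<in> {w. br (- \<theta> a) w = S w}" by simp
    qed (use cS in \<open>auto simp: clinear_def br_add br_smult\<close>)
    moreover have "br (- \<theta> a) (E \<alpha>) = S (E \<alpha>)" if "\<alpha> \<in> \<Delta>" for \<alpha>
      unfolding \<theta>a[OF that] S_eig[OF E(2)[OF that au(1)]] using p that by simp
    moreover have "br (- \<theta> a) (Hc \<alpha>) = S (Hc \<alpha>)" if "\<alpha> \<in> \<Delta>" for \<alpha>
    proof -
      have "br a (Hc \<alpha>) = 0 *s Hc \<alpha>" using h_abelian[OF au(1) Hc(1)[OF that]] by simp
      from S_eig[OF this] show ?thesis using p h_abelian[OF \<theta>h Hc(1)[OF that]] by (simp add: br_minus)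
    qed
    ultimately have "vec.span (Hc ` \<Delta> \<union> (E ` \<Delta> \<union> (\<lambda>\<alpha>. E (- \<alpha>)) ` \<Delta>)) \<subseteq> {w. br (- \<theta> a) w = S w}"
      by (intro vec.span_minimal) (use uminus_root in auto)
    then show ?thesis unfolding generating by blast
  qed
  then have "K (- \<theta> a) a = tr (\<lambda>w. \<Sum>i\<le>degree p. coeff p i *s (br a ^^ i) (br a w))"
    unfolding K_tr S_def by simp
  also have "\<dots> = (\<Sum>i\<le>degree p. coeff p i * tr (\<lambda>w. (br a ^^ i) (br a w)))"
    unfolding tr_sum by (simp add: sum_distrib_left sum.swap[of _ UNIV])
  also have "\<dots> = 0"
  proof (rule sum.neutral, rule ballI)
    fix i
    show "coeff p i * tr (\<lambda>w. (br a ^^ i) (br a w)) = 0"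
      using ta[of i] by (simp add: op_power_apply[abs_def] funpow_swap1 del: op_power.simps)
  qed
  finally have "K a (\<theta> a) = 0" using K_sym by (simp add: K_minus)
  then have "a = 0" by (rule K_\<theta>_definite)
  then show ?thesis using au by simp
qed

end

section \<open>The adjoint group\<close>

text \<open>The function \<open>exp (- t D) [exp (t D) x, exp (t D) y]\<close> of \<open>t\<close> has derivative zero.\<close>

lemma op_exp_derivation_automorphism:
  assumes b: "bounded_bilinear br" and D: "\<And>x y. blinfun_apply D (br x y) = br (blinfun_apply D x) y + br x (blinfun_apply D y)"
  shows "op_exp D (br x y) = br (op_exp D x) (op_exp D y)"
proof -
  define u where "u z t = op_exp (t *\<^sub>R D) z" for z and t :: real
  have du: "((\<lambda>t. u z t) has_vector_derivative D (u z t)) (at t within S)" for z t S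
    unfolding u_def using bounded_linear.has_vector_derivative[OF blinfun.bounded_linear_left op_exp_vector_derivative[of D t S]] by simp
  have E': "((\<lambda>t. op_exp (t *\<^sub>R - D)) has_vector_derivative - (op_exp (t *\<^sub>R - D) o\<^sub>L D)) (at t within S)" for t S
  proof -
    have "(- D) o\<^sub>L op_exp (t *\<^sub>R - D) = op_exp (t *\<^sub>R - D) o\<^sub>L (- D)"
    proof (cases "t = 0")
      case False
      have "(t *\<^sub>R - D) o\<^sub>L op_exp (t *\<^sub>R - D) = op_exp (t *\<^sub>R - D) o\<^sub>L (t *\<^sub>R - D)" by (rule op_exp_commute)
      then have "t *\<^sub>R ((- D) o\<^sub>L op_exp (t *\<^sub>R - D)) = t *\<^sub>R (op_exp (t *\<^sub>R - D) o\<^sub>L (- D))"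
        by (simp only: compose_scaleR_left
            compose_scaleR_right)
      then show ?thesis using False by simp
    qed simp
    then show ?thesis using op_exp_vector_derivative[of "- D" t S]
      by (simp add: compose_minus_right)
  qed
  have z: "((\<lambda>t. op_exp (t *\<^sub>R - D) (br (u x t) (u y t))) has_vector_derivative 0) (at t within UNIV)" for t
  proof -
    have "((\<lambda>t. br (u x t) (u y t)) has_vector_derivative br (u x t) (D (u y t)) + br (D (u x t)) (u y t)) (at t)"
      by (rule bounded_bilinear.has_vector_derivative[OF b du du])
    from bounded_bilinear.has_vector_derivative[OF bounded_bilinear_blinfun_apply E' this]
    show ?thesis by (simp add: D blinfun.bilinear_simps add.commute)
  qed
  obtain c where c: "\<And>t. t \<in> UNIV \<Longrightarrow> op_exp (t *\<^sub>R - D) (br (u x t) (u y t)) = c"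
    using has_vector_derivative_zero_constant[OF convex_UNIV z] by blast
  have "op_exp (- D) (br (op_exp D x) (op_exp D y)) = br x y"
    using c[of 0] c[of 1] by (simp add: u_def)
  then show ?thesis by (metis op_exp_inverse_apply(1))
qed

lemma op_exp_clinear:
  assumes "clinear (blinfun_apply A)" shows "clinear (blinfun_apply (op_exp A))"
proof -
  have "op_exp A (c *s x) = c *s op_exp A x" for c x
  proof -
    have bl: "bounded_linear (\<lambda>z. c *s (z :: complex ^ 'a))"
      unfolding linear_conv_bounded_linear[symmetric]
      by (rule linearI) (simp_all add: vec.scale_right_distrib scaleR_smult mult.commute)
    have "(blinfun_apply A ^^ k) (c *s x) = c *s (blinfun_apply A ^^ k) x" for k
      by (induction k) (use assms in \<open>auto simp: clinear_def\<close>)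
    then have "(\<lambda>k. c *s ((blinfun_apply A ^^ k) x /\<^sub>R fact k)) sums op_exp A (c *s x)"
      using op_exp_apply_sums[of A "c *s x"] by (simp add: scaleR_smult mult.commute)
    moreover have "(\<lambda>k. c *s ((blinfun_apply A ^^ k) x /\<^sub>R fact k)) sums (c *s op_exp A x)"
      by (rule bounded_linear.sums[OF bl op_exp_apply_sums])
    ultimately show ?thesis by (rule sums_unique2)
  qed
  then show ?thesis by (simp add: clinear_def blinfun.bilinear_simps)
qed

context lie_algebra
begin

abbreviation "\<A> \<equiv> adjoint_group br"

lemma op_exp_ad_mem: "op_exp (ad x) \<in> \<A>"
  using adjoint_group.step[OF adjoint_group.one, of br x] by (simp add: exp_ad_eq)

lemma adjoint_mult: "\<phi> \<in> \<A> \<Longrightarrow> \<psi> \<in> \<A> \<Longrightarrow> \<phi> o\<^sub>L \<psi> \<in> \<A>"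
proof (induction rule: adjoint_group.induct)
  case (step \<phi> x)
  then show ?case unfolding blinfun_compose_assoc by (intro adjoint_group.step) simp
qed simp

lemma adjoint_inverse_ex: "\<phi> \<in> \<A> \<Longrightarrow> \<exists>\<psi>\<in>\<A>. \<phi> o\<^sub>L \<psi> = id_blinfun \<and> \<psi> o\<^sub>L \<phi> = id_blinfun"
proof (induction rule: adjoint_group.induct)
  case one
  show ?case using adjoint_group.one by (intro bexI[of _ id_blinfun]) auto
next
  case (step \<phi> x)
  then obtain \<psi> where p: "\<psi> \<in> \<A>" "\<phi> o\<^sub>L \<psi> = id_blinfun" "\<psi> o\<^sub>L \<phi> = id_blinfun" by blast
  then have i: "\<phi> (\<psi> v) = v" "\<psi> (\<phi> v) = v" for v by (metis blinfun_apply_blinfun_compose blinfun_apply_id_blinfun)+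
  have m: "op_exp (- ad x) \<in> \<A>" using op_exp_ad_mem[of "- x"] linear_ad by (simp add: linear_neg)
  show ?case
    by (rule bexI[OF _ adjoint_mult[OF p(1) m]]) (auto intro!: blinfun_eqI simp: exp_ad_eq i)
qed

definition adj_inv :: "'n endo \<Rightarrow> 'n endo" where
  "adj_inv \<phi> = (SOME \<psi>. \<psi> \<in> \<A> \<and> \<phi> o\<^sub>L \<psi> = id_blinfun \<and> \<psi> o\<^sub>L \<phi> = id_blinfun)"

lemma adj_inv: assumes "\<phi> \<in> \<A>" shows "adj_inv \<phi> \<in> \<A>" "\<phi> o\<^sub>L adj_inv \<phi> = id_blinfun" "adj_inv \<phi> o\<^sub>L \<phi> = id_blinfun"
proof -
  have "\<exists>\<psi>. \<psi> \<in> \<A> \<and> \<phi> o\<^sub>L \<psi> = id_blinfun \<and> \<psi> o\<^sub>L \<phi> = id_blinfun" using adjoint_inverse_ex[OF assms] by blast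
  from someI_ex[OF this] show "adj_inv \<phi> \<in> \<A>" "\<phi> o\<^sub>L adj_inv \<phi> = id_blinfun" "adj_inv \<phi> o\<^sub>L \<phi> = id_blinfun"
    unfolding adj_inv_def by blast+
qed

lemma adj_inv_apply: assumes "\<phi> \<in> \<A>" shows "\<phi> (adj_inv \<phi> x) = x" "adj_inv \<phi> (\<phi> x) = x"
  using adj_inv[OF assms] by (metis blinfun_apply_blinfun_compose blinfun_apply_id_blinfun)+

lemma adjoint_automorphism: "\<phi> \<in> \<A> \<Longrightarrow> clinear \<phi> \<and> (\<forall>x y. \<phi> (br x y) = br (\<phi> x) (\<phi> y))"
proof (induction rule: adjoint_group.induct)
  case one
  show ?case by (simp add: clinear_def)
next
  case (step \<phi> x)
  have 1: "clinear (blinfun_apply (op_exp (ad x)))" by (rule op_exp_clinear) (simp add: clinear_ad)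
  have 2: "op_exp (ad x) (br u v) = br (op_exp (ad x) u) (op_exp (ad x) v)" for u v
    by (rule op_exp_derivation_automorphism[OF bounded_bilinear_br]) (simp add: jacobi[symmetric])
  show ?case
    unfolding exp_ad_eq using step.IH clinear_comp[OF 1, of \<phi>] 2 by (simp add: blinfun_compose.rep_eq o_def)
qed

section \<open>The simply connected group\<close>

abbreviation "\<G> \<equiv> sc_group br"

definition based_path :: "(real \<Rightarrow> 'n endo) \<Rightarrow> bool" where
  "based_path p \<longleftrightarrow> path p \<and> path_image p \<subseteq> \<A> \<and> pathstart p = id_blinfun"

lemma carrier_sc: "C \<in> carrier \<G> \<longleftrightarrow> (\<exists>p. based_path p \<and> C = path_class br p)"
  unfolding sc_group_def based_path_def by auto

lemma based_path_refl: "based_path p \<Longrightarrow> homotopic_paths \<A> p p"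
  by (simp add: based_path_def)

lemma path_class_eqI: "homotopic_paths \<A> p q \<Longrightarrow> path_class br p = path_class br q"
  unfolding path_class_def using homotopic_paths_sym homotopic_paths_trans by blast

lemma homotopic_mult:
  assumes "homotopic_paths \<A> p p'" "homotopic_paths \<A> q q'"
  shows "homotopic_paths \<A> (\<lambda>s. p s o\<^sub>L q s) (\<lambda>s. p' s o\<^sub>L q' s)"
proof -
  obtain f where f: "continuous_on ({0..1} \<times> {0..1}) f" "f \<in> ({0..1} \<times> {0..1}) \<rightarrow> \<A>"
    "\<forall>x\<in>{0..1}. f (0, x) = p x" "\<forall>x\<in>{0..1}. f (1, x) = p' x"
    "\<forall>t\<in>{0..1::real}. pathstart (f \<circ> Pair t) = pathstart p \<and> pathfinish (f \<circ> Pair t) = pathfinish p"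
    using assms(1) unfolding homotopic_paths by blast
  obtain g where g: "continuous_on ({0..1} \<times> {0..1}) g" "g \<in> ({0..1} \<times> {0..1}) \<rightarrow> \<A>"
    "\<forall>x\<in>{0..1}. g (0, x) = q x" "\<forall>x\<in>{0..1}. g (1, x) = q' x"
    "\<forall>t\<in>{0..1::real}. pathstart (g \<circ> Pair t) = pathstart q \<and> pathfinish (g \<circ> Pair t) = pathfinish q"
    using assms(2) unfolding homotopic_paths by blast
  show ?thesis
    unfolding homotopic_paths
  proof (intro exI[of _ "\<lambda>z. f z o\<^sub>L g z"] conjI)
    show "continuous_on ({0..1} \<times> {0..1}) (\<lambda>z. f z o\<^sub>L g z)" by (intro continuous_intros f g)
    show "(\<lambda>z. f z o\<^sub>L g z) \<in> ({0..1} \<times> {0..1}) \<rightarrow> \<A>" using f(2) g(2) adjoint_mult by blast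
  qed (use f g in \<open>auto simp: pathstart_def pathfinish_def\<close>)
qed

lemma based_path_mem: "based_path p \<Longrightarrow> s \<in> {0..1} \<Longrightarrow> p s \<in> \<A>"
  unfolding based_path_def path_image_def by blast

lemma based_path_mult: assumes "based_path p" "based_path q" shows "based_path (\<lambda>s. p s o\<^sub>L q s)"
  unfolding based_path_def
proof (intro conjI)
  show "path (\<lambda>s. p s o\<^sub>L q s)"
    using assms unfolding based_path_def path_def by (intro continuous_intros) auto
  show "path_image (\<lambda>s. p s o\<^sub>L q s) \<subseteq> \<A>"
    unfolding path_image_def using adjoint_mult based_path_mem assms by blast
  show "pathstart (\<lambda>s. p s o\<^sub>L q s) = id_blinfun"
    using assms by (simp add: based_path_def pathstart_def)
qed

lemma mult_sc:
  assumes "based_path p" "based_path q"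
  shows "path_class br p \<otimes>\<^bsub>\<G>\<^esub> path_class br q = path_class br (\<lambda>s. p s o\<^sub>L q s)"
proof -
  have "path_class br p \<otimes>\<^bsub>\<G>\<^esub> path_class br q =
    {r. \<exists>p'\<in>path_class br p. \<exists>q'\<in>path_class br q. homotopic_paths \<A> (\<lambda>s. p' s o\<^sub>L q' s) r}"
    by (simp add: sc_group_def)
  also have "\<dots> = path_class br (\<lambda>s. p s o\<^sub>L q s)"
  proof (rule subset_antisym; rule subsetI)
    fix r assume "r \<in> {r. \<exists>p'\<in>path_class br p. \<exists>q'\<in>path_class br q. homotopic_paths \<A> (\<lambda>s. p' s o\<^sub>L q' s) r}"
    then show "r \<in> path_class br (\<lambda>s. p s o\<^sub>L q s)"
      unfolding path_class_def using homotopic_mult homotopic_paths_trans by blast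
  next
    fix r assume "r \<in> path_class br (\<lambda>s. p s o\<^sub>L q s)"
    then show "r \<in> {r. \<exists>p'\<in>path_class br p. \<exists>q'\<in>path_class br q. homotopic_paths \<A> (\<lambda>s. p' s o\<^sub>L q' s) r}"
      unfolding path_class_def using based_path_refl assms by blast
  qed
  finally show ?thesis .
qed

lemma one_sc: "\<one>\<^bsub>\<G>\<^esub> = path_class br (\<lambda>s. id_blinfun)"
  by (simp add: sc_group_def)

lemma based_path_one: "based_path (\<lambda>s. id_blinfun)"
  using adjoint_group.one by (auto simp: based_path_def path_def path_image_def pathstart_def)

lemma based_path_inv: "based_path p \<Longrightarrow> based_path (\<lambda>s. adj_inv (p s))"
proof -
  assume p: "based_path p"
  have pA: "p s \<in> \<A>" if "s \<in> {0..1}" for s using p that by (auto simp: based_path_def path_image_def)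
  have "continuous_on {0..1} (\<lambda>s. adj_inv (p s))"
    by (rule operator_inverse_continuous[of _ p]) (use p adj_inv[OF pA] in \<open>auto simp: based_path_def path_def\<close>)
  moreover have "adj_inv id_blinfun = id_blinfun" using adj_inv(2)[OF adjoint_group.one] by simp
  ultimately show "based_path (\<lambda>s. adj_inv (p s))"
    using p adj_inv(1)[OF pA] by (auto simp: based_path_def path_def path_image_def pathstart_def)
qed

lemma path_class_cong:
  assumes "based_path p" "\<And>s. s \<in> {0..1} \<Longrightarrow> p s = q s" shows "path_class br p = path_class br q"
  by (rule path_class_eqI, rule homotopic_paths_eq) (use assms in \<open>auto simp: based_path_def\<close>)

text \<open>Inverses are represented by the pointwise inverse path, whose continuity is that of operator
  inversion.\<close>

lemma group_sc: "group \<G>"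
proof (rule groupI)
  fix C D assume "C \<in> carrier \<G>" "D \<in> carrier \<G>"
  then obtain p q where "based_path p" "based_path q" "C = path_class br p" "D = path_class br q"
    unfolding carrier_sc by blast
  then show "C \<otimes>\<^bsub>\<G>\<^esub> D \<in> carrier \<G>" unfolding carrier_sc by (auto simp: mult_sc intro: based_path_mult)
next
  show "\<one>\<^bsub>\<G>\<^esub> \<in> carrier \<G>" unfolding carrier_sc one_sc using based_path_one by blast
next
  fix C D F assume "C \<in> carrier \<G>" "D \<in> carrier \<G>" "F \<in> carrier \<G>"
  then obtain p q r where "based_path p" "based_path q" "based_path r" "C = path_class br p" "D = path_class br q" "F = path_class br r"
    unfolding carrier_sc by blast
  then show "C \<otimes>\<^bsub>\<G>\<^esub> D \<otimes>\<^bsub>\<G>\<^esub> F = C \<otimes>\<^bsub>\<G>\<^esub> (D \<otimes>\<^bsub>\<G>\<^esub> F)"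
    by (simp add: mult_sc based_path_mult blinfun_compose_assoc)
next
  fix C assume "C \<in> carrier \<G>"
  then obtain p where p: "based_path p" "C = path_class br p" unfolding carrier_sc by blast
  then show "\<one>\<^bsub>\<G>\<^esub> \<otimes>\<^bsub>\<G>\<^esub> C = C" by (simp add: one_sc mult_sc based_path_one)
  have "path_class br (\<lambda>s. adj_inv (p s)) \<otimes>\<^bsub>\<G>\<^esub> C = path_class br (\<lambda>s. adj_inv (p s) o\<^sub>L p s)"
    using p by (simp add: mult_sc based_path_inv)
  also have "\<dots> = \<one>\<^bsub>\<G>\<^esub>"
    unfolding one_sc by (rule path_class_cong[OF based_path_mult[OF based_path_inv[OF p(1)] p(1)]])
      (use adj_inv(3)[OF based_path_mem[OF p(1)]] in auto)
  finally show "\<exists>D\<in>carrier \<G>. D \<otimes>\<^bsub>\<G>\<^esub> C = \<one>\<^bsub>\<G>\<^esub>"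
    using based_path_inv[OF p(1)] carrier_sc by blast
qed

text \<open>All paths in a class have the same end point, so the choice in the definition of \<open>Ad\<close> is
  immaterial.\<close>

lemma Ad_path_class: assumes "based_path p" shows "Ad (path_class br p) = pathfinish p"
proof -
  have "p \<in> path_class br p" using based_path_refl[OF assms] by (simp add: path_class_def)
  then have "(SOME q. q \<in> path_class br p) \<in> path_class br p" by (rule someI[where P="\<lambda>q. q \<in> path_class br p"])
  then have "homotopic_paths \<A> p (SOME q. q \<in> path_class br p)" by (simp add: path_class_def)
  then show ?thesis unfolding Ad_def using homotopic_paths_imp_pathfinish by metis
qed

lemma Ad_mem: "C \<in> carrier \<G> \<Longrightarrow> Ad C \<in> \<A>"
  unfolding carrier_sc using Ad_path_class by (auto simp: based_path_def) (metis pathfinish_in_path_image subsetD)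

lemma Ad_mult: assumes "C \<in> carrier \<G>" "D \<in> carrier \<G>" shows "Ad (C \<otimes>\<^bsub>\<G>\<^esub> D) = Ad C o\<^sub>L Ad D"
proof -
  obtain p q where "based_path p" "based_path q" "C = path_class br p" "D = path_class br q"
    using assms unfolding carrier_sc by blast
  then show ?thesis by (simp add: mult_sc Ad_path_class based_path_mult) (simp add: pathfinish_def)
qed

lemma Ad_one: "Ad \<one>\<^bsub>\<G>\<^esub> = id_blinfun"
  by (simp add: one_sc Ad_path_class based_path_one pathfinish_def)

lemma based_path_exp: "based_path (\<lambda>s. op_exp (s *\<^sub>R ad x))"
proof -
  have "op_exp (s *\<^sub>R ad x) \<in> \<A>" for s using op_exp_ad_mem[of "s *\<^sub>R x"] linear_ad by (simp add: linear_scale)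
  moreover have "continuous_on {0..1} (\<lambda>s. op_exp (s *\<^sub>R ad x))"
    by (intro continuous_intros continuous_on_compose2[OF Ck_on_continuous[OF op_exp_Ck_on]]) auto
  ultimately show ?thesis by (auto simp: based_path_def path_def path_image_def pathstart_def)
qed

lemma exp_G_eq: "exp_G br x = path_class br (\<lambda>s. op_exp (s *\<^sub>R ad x))"
  unfolding exp_G_def exp_ad_eq using linear_ad by (simp add: linear_scale)

lemma exp_G_carrier: "exp_G br x \<in> carrier \<G>"
  unfolding exp_G_eq carrier_sc using based_path_exp by blast

lemma Ad_exp_G: "Ad (exp_G br x) = op_exp (ad x)"
  unfolding exp_G_eq by (simp add: Ad_path_class based_path_exp pathfinish_def)

lemma Ad_subgroup:
  assumes "subgroup S \<G>"
  shows "id_blinfun \<in> Ad ` S" "a \<in> Ad ` S \<Longrightarrow> b \<in> Ad ` S \<Longrightarrow> a o\<^sub>L b \<in> Ad ` S"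
    "a \<in> Ad ` S \<Longrightarrow> \<exists>b\<in>Ad ` S. a o\<^sub>L b = id_blinfun \<and> b o\<^sub>L a = id_blinfun" "Ad ` S \<subseteq> \<A>"
proof -
  have S: "S \<subseteq> carrier \<G>" using assms by (rule subgroup.subset)
  show "id_blinfun \<in> Ad ` S" using subgroup.one_closed[OF assms] Ad_one by (metis imageI)
  show "a o\<^sub>L b \<in> Ad ` S" if ab: "a \<in> Ad ` S" "b \<in> Ad ` S"
  proof -
    obtain C D where "C \<in> S" "D \<in> S" "a = Ad C" "b = Ad D" using ab by blast
    then show ?thesis using subgroup.m_closed[OF assms, of C D] Ad_mult[of C D] S by (metis imageI subsetD)
  qed
  show "Ad ` S \<subseteq> \<A>" using Ad_mem S by blast
  assume "a \<in> Ad ` S"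
  then obtain C where C: "C \<in> S" "a = Ad C" by blast
  let ?D = "inv\<^bsub>\<G>\<^esub> C"
  have D: "?D \<in> S" using subgroup.m_inv_closed[OF assms C(1)] .
  have cc: "C \<in> carrier \<G>" "?D \<in> carrier \<G>" using C D S by auto
  have "Ad C o\<^sub>L Ad ?D = id_blinfun" "Ad ?D o\<^sub>L Ad C = id_blinfun"
    using Ad_mult[OF cc] Ad_mult[OF cc(2,1)] group.r_inv[OF group_sc cc(1)] group.l_inv[OF group_sc cc(1)] Ad_one by simp_all
  then show "\<exists>b\<in>Ad ` S. a o\<^sub>L b = id_blinfun \<and> b o\<^sub>L a = id_blinfun" using D C(2) by blast
qed

lemma orbit_eq: "orbit S V = (\<lambda>g. blinfun_apply g ` V) ` (Ad ` S)"
  unfolding orbit_def act_def by auto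

end

section \<open>Fixed point subgroups\<close>

text \<open>A conjugate-linear automorphism \<open>\<tau>\<close> acts on operators by conjugation with \<open>T\<close>, which preserves the
  adjoint group and sends \<open>exp (ad x)\<close> to \<open>exp (ad (\<tau> x))\<close>.\<close>

locale lie_antiautomorphism = lie_algebra br for br :: "('n::finite) brkt" +
  fixes \<tau> :: "complex ^ 'n \<Rightarrow> complex ^ 'n"
  assumes anti: "antilinear \<tau>" and bij: "bij \<tau>" and aut: "\<tau> (br x y) = br (\<tau> x) (\<tau> y)"
begin

definition "T = Blinfun \<tau>"
definition "T' = Blinfun (inv_into UNIV \<tau>)"

lemma inv_\<tau>: "inv_into UNIV \<tau> (\<tau> x) = x" "\<tau> (inv_into UNIV \<tau> x) = x"
  using bij by (simp_all add: bij_is_inj bij_is_surj surj_f_inv_f)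

lemma antilinear_inv: "antilinear (inv_into UNIV \<tau>)"
proof -
  have "inv_into UNIV \<tau> (x + y) = inv_into UNIV \<tau> x + inv_into UNIV \<tau> y" for x y
  proof -
    have "\<tau> (inv_into UNIV \<tau> x + inv_into UNIV \<tau> y) = x + y" using anti by (simp add: antilinear_def inv_\<tau>)
    then show ?thesis by (metis inv_\<tau>(1))
  qed
  moreover have "inv_into UNIV \<tau> (c *s x) = cnj c *s inv_into UNIV \<tau> x" for c x
  proof -
    have "\<tau> (cnj c *s inv_into UNIV \<tau> x) = c *s x" using anti by (simp add: antilinear_def inv_\<tau>)
    then show ?thesis by (metis inv_\<tau>(1))
  qed
  ultimately show ?thesis by (simp add: antilinear_def)
qed

lemma T_apply [simp]: "blinfun_apply T x = \<tau> x" "blinfun_apply T' x = inv_into UNIV \<tau> x"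
  using antilinear_linear[OF anti] antilinear_linear[OF antilinear_inv]
  by (simp_all add: T_def T'_def bounded_linear_Blinfun_apply linear_conv_bounded_linear)

lemma TT': "T o\<^sub>L T' = id_blinfun" "T' o\<^sub>L T = id_blinfun"
  by (rule blinfun_eqI, simp add: inv_\<tau>)+

lemma conj_by_eq: "conj_by \<tau> \<phi> = T o\<^sub>L \<phi> o\<^sub>L T'"
proof -
  have "(\<lambda>x. \<tau> (\<phi> (inv_into UNIV \<tau> x))) = blinfun_apply (T o\<^sub>L \<phi> o\<^sub>L T')" by (rule ext) simp
  then show ?thesis unfolding conj_by_def by (simp only: blinfun_apply_inverse)
qed

lemma conj_ad: "T o\<^sub>L ad x o\<^sub>L T' = ad (\<tau> x)"
  by (rule blinfun_eqI) (simp add: aut inv_\<tau>)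

lemma conj_exp: "T o\<^sub>L op_exp (ad x) o\<^sub>L T' = op_exp (ad (\<tau> x))"
  using op_exp_conjugate[OF TT'(2,1), of "ad x"] by (simp add: conj_ad)

lemma conj_mult: "T o\<^sub>L (\<phi> o\<^sub>L \<psi>) o\<^sub>L T' = (T o\<^sub>L \<phi> o\<^sub>L T') o\<^sub>L (T o\<^sub>L \<psi> o\<^sub>L T')"
  by (rule blinfun_eqI) (simp add: inv_\<tau>)

lemma conj_mem: "\<phi> \<in> \<A> \<Longrightarrow> T o\<^sub>L \<phi> o\<^sub>L T' \<in> \<A>"
proof (induction rule: adjoint_group.induct)
  case one
  then show ?case using adjoint_group.one TT' by simp
next
  case (step \<phi> x)
  then show ?case unfolding exp_ad_eq conj_mult conj_exp by (intro adjoint_mult[OF op_exp_ad_mem])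
qed

lemma conj_continuous: "continuous_on S (conj_by \<tau>)"
  unfolding conj_by_eq[abs_def] by (intro continuous_intros)

lemma conj_homotopic: "homotopic_paths \<A> p q \<Longrightarrow> homotopic_paths \<A> (conj_by \<tau> \<circ> p) (conj_by \<tau> \<circ> q)"
  by (rule homotopic_paths_continuous_image[OF _ conj_continuous]) (auto simp: conj_by_eq conj_mem)

lemma based_path_conj: "based_path p \<Longrightarrow> based_path (conj_by \<tau> \<circ> p)"
  unfolding based_path_def using conj_mem TT'
  by (auto simp: path_image_compose conj_by_eq pathstart_compose intro!: path_continuous_image conj_continuous)

lemma lift_path_class: assumes "based_path p" shows "lift_to_G br \<tau> (path_class br p) = path_class br (conj_by \<tau> \<circ> p)"
proof (rule subset_antisym; rule subsetI)
  fix q assume "q \<in> lift_to_G br \<tau> (path_class br p)"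
  then show "q \<in> path_class br (conj_by \<tau> \<circ> p)"
    unfolding lift_to_G_def path_class_def using conj_homotopic homotopic_paths_trans by blast
next
  fix q assume "q \<in> path_class br (conj_by \<tau> \<circ> p)"
  then show "q \<in> lift_to_G br \<tau> (path_class br p)"
    unfolding lift_to_G_def path_class_def using based_path_refl[OF assms] by blast
qed

lemma lift_carrier: "C \<in> carrier \<G> \<Longrightarrow> lift_to_G br \<tau> C \<in> carrier \<G>"
  unfolding carrier_sc using lift_path_class based_path_conj by metis

lemma lift_mult: assumes "C \<in> carrier \<G>" "D \<in> carrier \<G>"
  shows "lift_to_G br \<tau> (C \<otimes>\<^bsub>\<G>\<^esub> D) = lift_to_G br \<tau> C \<otimes>\<^bsub>\<G>\<^esub> lift_to_G br \<tau> D"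
proof -
  obtain p q where pq: "based_path p" "based_path q" "C = path_class br p" "D = path_class br q"
    using assms unfolding carrier_sc by blast
  then show ?thesis
    by (simp add: mult_sc lift_path_class based_path_mult based_path_conj) (simp add: o_def conj_by_eq conj_mult)
qed

lemma lift_one: "lift_to_G br \<tau> \<one>\<^bsub>\<G>\<^esub> = \<one>\<^bsub>\<G>\<^esub>"
  unfolding one_sc using lift_path_class[OF based_path_one] TT' by (simp add: o_def conj_by_eq)

lemma fixed_subgroup: "subgroup (fixed_subgroup br \<tau>) \<G>"
proof (rule group.subgroupI[OF group_sc])
  show "fixed_subgroup br \<tau> \<subseteq> carrier \<G>" unfolding fixed_subgroup_def by blast
  have "\<one>\<^bsub>\<G>\<^esub> \<in> carrier \<G>" using group_sc by (simp add: group.is_monoid monoid.one_closed)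
  then show "fixed_subgroup br \<tau> \<noteq> {}" unfolding fixed_subgroup_def using lift_one by blast
  fix C assume C: "C \<in> fixed_subgroup br \<tau>"
  then have cC: "C \<in> carrier \<G>" "lift_to_G br \<tau> C = C" by (auto simp: fixed_subgroup_def)
  have ci: "inv\<^bsub>\<G>\<^esub> C \<in> carrier \<G>" by (rule group.inv_closed[OF group_sc cC(1)])
  have "lift_to_G br \<tau> (inv\<^bsub>\<G>\<^esub> C) \<otimes>\<^bsub>\<G>\<^esub> C = \<one>\<^bsub>\<G>\<^esub>"
    using lift_mult[OF ci cC(1)] group.l_inv[OF group_sc cC(1)] lift_one cC(2) by simp
  then have "lift_to_G br \<tau> (inv\<^bsub>\<G>\<^esub> C) = inv\<^bsub>\<G>\<^esub> C"
    using group.inv_equality[OF group_sc _ cC(1) lift_carrier[OF ci]] by simp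
  then show "inv\<^bsub>\<G>\<^esub> C \<in> fixed_subgroup br \<tau>" using ci by (simp add: fixed_subgroup_def)
  fix D assume "D \<in> fixed_subgroup br \<tau>"
  then have cD: "D \<in> carrier \<G>" "lift_to_G br \<tau> D = D" by (auto simp: fixed_subgroup_def)
  show "C \<otimes>\<^bsub>\<G>\<^esub> D \<in> fixed_subgroup br \<tau>"
    unfolding fixed_subgroup_def using lift_mult[OF cC(1) cD(1)] cC cD
    by (simp add: monoid.m_closed[OF group.is_monoid[OF group_sc]])
qed

lemma exp_G_fixed: assumes "\<tau> x = x" shows "exp_G br x \<in> fixed_subgroup br \<tau>"
proof -
  have "conj_by \<tau> \<circ> (\<lambda>s. op_exp (s *\<^sub>R ad x)) = (\<lambda>s. op_exp (s *\<^sub>R ad x))"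
  proof
    fix s :: real
    have "\<tau> (s *\<^sub>R x) = s *\<^sub>R x" using antilinear_linear[OF anti] assms by (simp add: linear_scale)
    then show "(conj_by \<tau> \<circ> (\<lambda>s. op_exp (s *\<^sub>R ad x))) s = op_exp (s *\<^sub>R ad x)"
      using conj_exp[of "s *\<^sub>R x"] linear_ad by (simp add: conj_by_eq linear_scale)
  qed
  then show ?thesis unfolding fixed_subgroup_def using exp_G_carrier lift_path_class[OF based_path_exp] by (simp add: exp_G_eq)
qed

text \<open>A class that is fixed by the lift of \<open>\<tau>\<close> has a \<open>\<tau>\<close>-invariant end point.\<close>

lemma Ad_fixed_commute: assumes "g \<in> Ad ` fixed_subgroup br \<tau>" shows "T o\<^sub>L g o\<^sub>L T' = g"
proof -
  obtain C where C: "C \<in> carrier \<G>" "lift_to_G br \<tau> C = C" "g = Ad C" using assms by (auto simp: fixed_subgroup_def)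
  obtain p where p: "based_path p" "C = path_class br p" using C(1) carrier_sc by blast
  have "Ad C = pathfinish (conj_by \<tau> \<circ> p)"
    using C(2) Ad_path_class[OF based_path_conj[OF p(1)]] lift_path_class[OF p(1)] p(2) by simp
  also have "\<dots> = T o\<^sub>L Ad C o\<^sub>L T'" using Ad_path_class[OF p(1)] p(2) by (simp add: pathfinish_compose conj_by_eq)
  finally show ?thesis using C(3) by simp
qed

end

section \<open>The Lie algebras of the two groups\<close>

context nondegenerate_lie_algebra
begin

text \<open>If \<open>exp C\<close> is a complex-linear automorphism and \<open>C\<close> is small, then \<open>C\<close> commutes with
  multiplication by \<open>i\<close> and is a derivation, hence inner.\<close>

lemma adjoint_log: "\<exists>r>0. \<forall>C. norm C < r \<longrightarrow> op_exp C \<in> \<A> \<longrightarrow> (\<exists>z. C = ad z)"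
proof -
  define B where "B c = Blinfun (\<lambda>x :: complex ^ 'n. c *s x)" for c
  have "bounded_linear (\<lambda>x :: complex ^ 'n. c *s x)" for c
    unfolding linear_conv_bounded_linear[symmetric]
    by (rule linearI) (simp_all add: vec.scale_right_distrib scaleR_smult mult.commute)
  then have M: "blinfun_apply (B c) x = c *s x" for c x by (simp add: B_def bounded_linear_Blinfun_apply)
  let ?I = "B \<i>" and ?I' = "B (- \<i>)"
  have II: "?I' o\<^sub>L ?I = id_blinfun" "?I o\<^sub>L ?I' = id_blinfun" by (rule blinfun_eqI, simp add: M)+
  obtain r1 where r1: "r1 > 0" "\<forall>C. norm C < r1 \<longrightarrow> ?I o\<^sub>L op_exp C o\<^sub>L ?I' = op_exp C \<longrightarrow> ?I o\<^sub>L C o\<^sub>L ?I' = C"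
    using op_exp_commute_imp[OF II] by blast
  obtain r2 where r2: "r2 > 0" "\<forall>C. norm C < r2 \<longrightarrow> (\<forall>x y. op_exp C (br x y) = br (op_exp C x) (op_exp C y)) \<longrightarrow>
    (\<forall>x y. blinfun_apply C (br x y) = br (blinfun_apply C x) y + br x (blinfun_apply C y))"
    using op_exp_automorphism_imp_derivation[OF bounded_bilinear_br] by blast
  show ?thesis
  proof (intro exI[of _ "min r1 r2"] conjI allI impI)
    show "0 < min r1 r2" using r1 r2 by simp
    fix C :: "'n endo" assume C: "norm C < min r1 r2" "op_exp C \<in> \<A>"
    have a: "clinear (op_exp C)" "\<forall>x y. op_exp C (br x y) = br (op_exp C x) (op_exp C y)"
      using adjoint_automorphism[OF C(2)] by blast+
    have der: "blinfun_apply C (br x y) = br (blinfun_apply C x) y + br x (blinfun_apply C y)" for x y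
      using r2(2) C(1) a(2) by simp
    have "?I o\<^sub>L op_exp C o\<^sub>L ?I' = op_exp C"
      using a(1) by (intro blinfun_eqI) (simp add: M clinear_def blinfun.bilinear_simps)
    then have "?I o\<^sub>L C o\<^sub>L ?I' = C" using r1(2) C(1) by simp
    then have "blinfun_apply (?I o\<^sub>L C o\<^sub>L ?I') (\<i> *s x) = C (\<i> *s x)" for x by simp
    then have i: "C (\<i> *s x) = \<i> *s C x" for x by (simp add: M)
    have "C (c *s x) = c *s C x" for c x
    proof -
      have e: "c *s v = Re c *\<^sub>R v + Im c *\<^sub>R (\<i> *s v)" for v :: "complex ^ 'n"
        unfolding scaleR_smult vec.scale_scale vec.scale_left_distrib[symmetric]
        by (metis complex_eq mult.commute)
      show ?thesis unfolding e[of x] e[of "C x"] by (simp add: blinfun.bilinear_simps i)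
    qed
    then have "clinear (blinfun_apply C)" by (simp add: clinear_def blinfun.bilinear_simps)
    from derivation_inner[OF this der] obtain z where "blinfun_apply C = br z" by blast
    then have "C = ad z" by (intro blinfun_eqI) simp
    then show "\<exists>z. C = ad z" by blast
  qed
qed

end

lemma subspace_of_vec: "vec.subspace V \<Longrightarrow> subspace V" for V :: "(complex ^ 'n) set"
  by (auto simp: subspace_def scaleR_smult vec.subspace_def)

context root_data
begin

text \<open>Every element of the group differs from 1 by a nil operator. For a small \<open>C\<close> with \<open>exp C\<close> in the
  group, \<open>C\<close> is therefore both an inner derivation \<open>ad z\<close> and a nil operator; then \<open>K z y = tr (ad z
  ad y)\<close> vanishes for \<open>y\<close> in \<open>\<bb>\<close>, which puts \<open>z\<close> into \<open>\<nn>\<close>.\<close>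

lemma linear_lie_group_nilradical:
  "linear_lie_group (Ad ` connected_subgroup br \<nn>) (ad ` \<nn>)"
proof -
  let ?S = "connected_subgroup br \<nn>"
  have sub: "exp_G br ` \<nn> \<subseteq> carrier \<G>" using exp_G_carrier by blast
  have S: "subgroup ?S \<G>" unfolding connected_subgroup_def by (rule group.generate_is_subgroup[OF group_sc sub])
  note AS = Ad_subgroup[OF S]
  have e: "op_exp (ad u) - id_blinfun \<in> nil_ops" if "u \<in> \<nn>" for u
  proof (rule op_exp_minus_id_mem[OF subspace_nil_ops endo.closed_subspace_fin_dim[OF subspace_nil_ops]])
    show "op_power (ad u) (Suc n) \<in> nil_ops" for n
      by (induction n) (use nil_ops_mult ad_nn[OF that] in auto)
  qed
  have nil: "C \<in> carrier \<G> \<and> Ad C - id_blinfun \<in> nil_ops" if "C \<in> ?S" for C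
    using that unfolding connected_subgroup_def
  proof (induction rule: generate.induct)
    case one
    show ?case using Ad_one subspace_0[OF subspace_nil_ops] monoid.one_closed[OF group.is_monoid[OF group_sc]] by simp
  next
    case (incl x)
    then show ?case using e exp_G_carrier Ad_exp_G by auto
  next
    case (inv x)
    then obtain u where u: "u \<in> \<nn>" "x = exp_G br u" by blast
    have xc: "x \<in> carrier \<G>" "inv\<^bsub>\<G>\<^esub> x \<in> carrier \<G>" using u exp_G_carrier group.inv_closed[OF group_sc] by auto
    have "Ad (inv\<^bsub>\<G>\<^esub> x) o\<^sub>L op_exp (ad u) = id_blinfun"
      using Ad_mult[OF xc(2,1)] group.l_inv[OF group_sc xc(1)] Ad_one Ad_exp_G u(2) by simp
    then have "(Ad (inv\<^bsub>\<G>\<^esub> x) o\<^sub>L op_exp (ad u)) o\<^sub>L op_exp (- ad u) = op_exp (- ad u)" by simp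
    then have "Ad (inv\<^bsub>\<G>\<^esub> x) = op_exp (ad (- u))"
      unfolding blinfun_compose_assoc using linear_ad by (simp add: linear_neg)
    moreover have "- u \<in> \<nn>" using vec.subspace_neg[OF subspace_nn u(1)] .
    ultimately show ?case using e xc by simp
  next
    case (eng C D)
    have "(Ad C o\<^sub>L Ad D) - id_blinfun = ((Ad C - id_blinfun) o\<^sub>L (Ad D - id_blinfun)) + ((Ad C - id_blinfun) + (Ad D - id_blinfun))"
      by (rule blinfun_eqI) (simp add: blinfun.bilinear_simps)
    also have "\<dots> \<in> nil_ops"
      using eng.IH nil_ops_mult subspace_add[OF subspace_nil_ops] by simp
    finally show ?case using eng.IH Ad_mult monoid.m_closed[OF group.is_monoid[OF group_sc]] by simp
  qed
  obtain r1 where r1: "r1 > 0" "\<forall>C. norm C < r1 \<longrightarrow> op_exp C \<in> \<A> \<longrightarrow> (\<exists>z. C = ad z)" using adjoint_log by blast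
  obtain r2 where r2: "r2 > 0" "\<forall>C. norm C < r2 \<longrightarrow> op_exp C - id_blinfun \<in> nil_ops \<longrightarrow> C \<in> nil_ops"
    using op_exp_algebra_imp[OF subspace_nil_ops nil_ops_mult] by blast
  show ?thesis
  proof (rule linear_lie_group.intro)
    show "subspace (ad ` \<nn>)" by (rule linear_subspace_image[OF linear_ad subspace_of_vec[OF subspace_nn]])
    show "op_exp A \<in> Ad ` ?S" if A: "A \<in> ad ` \<nn>" for A
    proof -
      obtain u where u: "u \<in> \<nn>" "A = ad u" using A by blast
      have "exp_G br u \<in> ?S" unfolding connected_subgroup_def using u by (intro generate.incl imageI)
      then show ?thesis unfolding u(2) Ad_exp_G[symmetric] by (rule imageI)
    qed
    show "\<exists>r>0. \<forall>C. norm C < r \<longrightarrow> op_exp C \<in> Ad ` ?S \<longrightarrow> C \<in> ad ` \<nn>"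
    proof (intro exI[of _ "min r1 r2"] conjI allI impI)
      show "0 < min r1 r2" using r1 r2 by simp
      fix C :: "'n endo" assume C: "norm C < min r1 r2" "op_exp C \<in> Ad ` ?S"
      then obtain z where z: "C = ad z" using r1(2) AS(4) by (metis min_less_iff_conj subsetD)
      have "op_exp C - id_blinfun \<in> nil_ops" using C(2) nil by auto
      then have "C \<in> nil_ops" using r2(2) C(1) by simp
      then show "C \<in> ad ` \<nn>" using z ad_nil_ops_imp_nn by blast
    qed
  qed (use AS in blast)+
qed

end

locale nondegenerate_antiautomorphism = nondegenerate_lie_algebra br + lie_antiautomorphism br \<tau>
  for br :: "('n::finite) brkt" and \<tau>
begin

abbreviation "\<gg>\<^sub>\<tau> \<equiv> {x. \<tau> x = x}"

lemma subspace_fixed: "subspace \<gg>\<^sub>\<tau>"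
  using antilinear_linear[OF anti] by (auto simp: subspace_def linear_add linear_scale linear_0)

text \<open>For a small \<open>C\<close> with \<open>exp C\<close> in the group, \<open>C = ad z\<close> is inner and commutes with \<open>\<tau>\<close>, so \<open>ad (\<tau> z)
  = ad z\<close>, and \<open>ad\<close> is injective.\<close>

lemma linear_lie_group_fixed: "linear_lie_group (Ad ` fixed_subgroup br \<tau>) (ad ` \<gg>\<^sub>\<tau>)"
proof -
  note AS = Ad_subgroup[OF fixed_subgroup]
  obtain r1 where r1: "r1 > 0" "\<forall>C. norm C < r1 \<longrightarrow> op_exp C \<in> \<A> \<longrightarrow> (\<exists>z. C = ad z)" using adjoint_log by blast
  obtain r2 where r2: "r2 > 0" "\<forall>C. norm C < r2 \<longrightarrow> T o\<^sub>L op_exp C o\<^sub>L T' = op_exp C \<longrightarrow> T o\<^sub>L C o\<^sub>L T' = C"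
    using op_exp_commute_imp[OF TT'(2,1)] by blast
  show ?thesis
  proof (rule linear_lie_group.intro)
    show "subspace (ad ` \<gg>\<^sub>\<tau>)" by (rule linear_subspace_image[OF linear_ad subspace_fixed])
    show "op_exp A \<in> Ad ` fixed_subgroup br \<tau>" if A: "A \<in> ad ` \<gg>\<^sub>\<tau>" for A
    proof -
      obtain x where x: "\<tau> x = x" "A = ad x" using A by blast
      show ?thesis unfolding x(2) Ad_exp_G[symmetric] by (rule imageI[OF exp_G_fixed[OF x(1)]])
    qed
    show "\<exists>r>0. \<forall>C. norm C < r \<longrightarrow> op_exp C \<in> Ad ` fixed_subgroup br \<tau> \<longrightarrow> C \<in> ad ` \<gg>\<^sub>\<tau>"
    proof (intro exI[of _ "min r1 r2"] conjI allI impI)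
      show "0 < min r1 r2" using r1 r2 by simp
      fix C :: "'n endo" assume C: "norm C < min r1 r2" "op_exp C \<in> Ad ` fixed_subgroup br \<tau>"
      then obtain z where z: "C = ad z" using r1(2) AS(4) by (metis min_less_iff_conj subsetD)
      have "T o\<^sub>L C o\<^sub>L T' = C" using r2(2) C(1) Ad_fixed_commute[OF C(2)] by simp
      then have "ad (\<tau> z) = ad z" unfolding z conj_ad .
      then have "\<tau> z = z" by (rule ad_injective)
      then show "C \<in> ad ` \<gg>\<^sub>\<tau>" using z by blast
    qed
  qed (use AS in blast)+
qed

lemma K_\<tau>: "K (\<tau> x) (\<tau> y) = cnj (K x y)"
  by (rule K_antilinear_automorphism[OF anti antilinear_inv inv_\<tau> aut])

lemma fixed_isotropic: "\<tau> x = x \<Longrightarrow> \<tau> y = y \<Longrightarrow> Im (K x y) = 0"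
  using K_\<tau>[of x y] by (simp add: complex_eq_iff)

end

section \<open>The Lagrangian splitting\<close>

locale vogan_setting = root_data br h P Hc E \<theta>
  for br :: "('n::finite) brkt" and h P Hc E \<theta> +
  fixes I :: "'n functional set" and d :: "'n functional \<Rightarrow> 'n functional"
    and \<gamma> \<tau> :: "complex ^ 'n \<Rightarrow> complex ^ 'n" and t :: "'n endo"
  assumes vogan: "vogan_diagram br Hc (simple_roots P) d I"
    and diagram_lift: "diagram_automorphism_lift br Hc E (simple_roots P) d \<gamma>"
    and painting: "painting_element br h E (simple_roots P) I t"
    and \<tau>_def: "\<tau> = vogan_involution t \<gamma> \<theta>"
begin

lemma \<tau>_apply: "\<tau> x = t (\<gamma> (\<theta> x))"
  by (simp add: \<tau>_def vogan_involution_def)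

lemma \<gamma>: "clinear \<gamma>" "bij \<gamma>" "\<gamma> (br x y) = br (\<gamma> x) (\<gamma> y)"
  using diagram_lift unfolding diagram_automorphism_lift_def lie_automorphism_def clinear_iff by blast+

lemma t: "t \<in> \<A>" "x \<in> h \<Longrightarrow> t x = x"
  using painting unfolding painting_element_def by blast+

sublocale nondegenerate_antiautomorphism br \<tau>
proof
  have tl: "clinear t" "\<And>x y. t (br x y) = br (t x) (t y)" using adjoint_automorphism[OF t(1)] by blast+
  show "antilinear \<tau>"
    using tl(1) \<gamma>(1) unfolding antilinear_def clinear_def \<tau>_apply by (simp add: \<theta>_simps)
  show "\<tau> (br x y) = br (\<tau> x) (\<tau> y)" for x y by (simp add: \<tau>_apply \<theta>_br \<gamma>(3) tl(2))
  have "bij \<theta>" by (rule o_bij[of \<theta>]) (auto simp: \<theta>_simps(3))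
  moreover have "bij (blinfun_apply t)"
    by (rule o_bij[of "adj_inv t"]) (auto simp: adj_inv_apply[OF t(1)])
  ultimately show "bij \<tau>" unfolding \<tau>_def vogan_involution_def using \<gamma>(2) by (intro bij_comp)
qed

lemma \<tau>_simps: "\<tau> (x + y) = \<tau> x + \<tau> y" "\<tau> (c *s x) = cnj c *s \<tau> x"
  using anti by (auto simp: antilinear_def)

lemma \<tau>_minus: "\<tau> (- x) = - \<tau> x" "\<tau> (x - y) = \<tau> x - \<tau> y"
  using \<tau>_simps(2)[of "-1" x] \<tau>_simps(2)[of "-1" y] \<tau>_simps(1)[of x "- y"] by (simp_all add: vec.scale_minus_left)

lemma d: assumes "\<alpha> \<in> simple_roots P" shows "d \<alpha> \<in> simple_roots P" "d (d \<alpha>) = \<alpha>"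
  using vogan assms unfolding vogan_diagram_def dynkin_automorphism_def bij_betw_def by blast+

lemma \<tau>_Hc: assumes "\<alpha> \<in> simple_roots P" shows "\<tau> (Hc \<alpha>) = - Hc (d \<alpha>)"
proof -
  have s: "simple_roots P \<subseteq> \<Delta>" using P(1) by (auto simp: simple_roots_def)
  have g: "\<gamma> (Hc \<alpha>) = Hc (d \<alpha>)" using diagram_lift assms unfolding diagram_automorphism_lift_def by blast
  have gm: "\<gamma> (- x) = - \<gamma> x" for x
  proof -
    have "\<gamma> ((-1) *s x) = (-1) *s \<gamma> x" using \<gamma>(1) unfolding clinear_def by blast
    then show ?thesis by (simp add: vec.scale_minus_left)
  qed
  have "Hc (d \<alpha>) \<in> h" using Hc(1) d(1)[OF assms] s by blast
  then show ?thesis using \<theta>_Hc[of \<alpha>] assms s t(2)[of "Hc (d \<alpha>)"] by (auto simp: \<tau>_apply g gm blinfun.bilinear_simps)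
qed

text \<open>The vectors \<open>Hc \<alpha>\<close> for simple \<open>\<alpha>\<close> span \<open>h\<close>, and \<open>\<tau>\<close> permutes them up to sign by the involution \<open>d\<close>.\<close>

lemma \<tau>_h: assumes "x \<in> h" shows "\<tau> x \<in> h" "\<tau> (\<tau> x) = x"
proof -
  let ?V = "{x. \<tau> x \<in> h \<and> \<tau> (\<tau> x) = x}"
  have s: "simple_roots P \<subseteq> \<Delta>" using P(1) by (auto simp: simple_roots_def)
  have "\<tau> 0 = 0" using \<tau>_simps(2)[of 0 0] by simp
  then have "vec.subspace ?V"
    by (intro vec.subspaceI) (auto simp: \<tau>_simps vec.subspace_0[OF h(1)] intro: vec.subspace_add[OF h(1)] vec.subspace_scale[OF h(1)])
  moreover have "Hc \<alpha> \<in> ?V" if a: "\<alpha> \<in> simple_roots P" for \<alpha>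
    using \<tau>_Hc[OF a] \<tau>_Hc[OF d(1)[OF a]] d[OF a] Hc(1) s vec.subspace_neg[OF h(1)] by (auto simp: \<tau>_minus)
  ultimately have "vec.span (Hc ` simple_roots P) \<subseteq> ?V" by (intro vec.span_minimal) auto
  then show "\<tau> x \<in> h" "\<tau> (\<tau> x) = x" using assms h_span_simple by blast+
qed

abbreviation "\<ll> \<equiv> lagrangian_complement h P E \<tau>"

lemma ll_iff: "z \<in> \<ll> \<longleftrightarrow> (\<exists>a u. z = a + u \<and> a \<in> h \<and> \<tau> a = - a \<and> u \<in> \<nn>)"
  unfolding lagrangian_complement_def by blast

lemma nn_ll: "u \<in> \<nn> \<Longrightarrow> u \<in> \<ll>"
  unfolding ll_iff using vec.subspace_0[OF h(1)] \<tau>_simps(2)[of 0 0] by (intro exI[of _ 0] exI[of _ u]) auto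

lemma anti_fixed_real: "\<tau> a = - a \<Longrightarrow> \<tau> b = - b \<Longrightarrow> Im (K a b) = 0"
  using K_\<tau>[of a b] by (simp add: K_minus complex_eq_iff)

text \<open>On the part in \<open>h\<close> the form \<open>K\<close> is real because \<open>\<tau>\<close> acts there as \<open>- 1\<close>, and \<open>\<nn>\<close> is orthogonal to
  \<open>\<bb>\<close>.\<close>

lemma ll_isotropic: assumes "x \<in> \<ll>" "y \<in> \<ll>" shows "Im (K x y) = 0"
proof -
  obtain a u where x: "x = a + u" "a \<in> h" "\<tau> a = - a" "u \<in> \<nn>" using assms(1) ll_iff by blast
  obtain b v where y: "y = b + v" "b \<in> h" "\<tau> b = - b" "v \<in> \<nn>" using assms(2) ll_iff by blast
  have "K a v = 0" "K u b = 0" "K u v = 0" using K_nn_bb[OF y(4) h_bb[OF x(2)]] K_nn_bb[OF x(4) h_bb[OF y(2)]]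
      K_nn_bb[OF x(4) nn_bb[OF y(4)]] K_sym by auto
  then show ?thesis unfolding x(1) y(1) using anti_fixed_real[OF x(3) y(3)] by (simp add: K_add)
qed

text \<open>On \<open>h\<close>, the map \<open>- \<tau>\<close> is a conjugate-linear involution, and its fixed points are a real form of
  \<open>h\<close>.\<close>

lemma h_split: assumes "a \<in> h" obtains a1 a2 where "a1 \<in> h" "a2 \<in> h" "\<tau> a1 = - a1" "\<tau> a2 = - a2" "a = a1 + \<i> *s a2"
proof
  let ?a1 = "(1/2) *s (a - \<tau> a)" and ?a2 = "(- \<i> / 2) *s (a + \<tau> a)"
  show "?a1 \<in> h"
    by (rule vec.subspace_scale[OF h(1) vec.subspace_diff[OF h(1) assms \<tau>_h(1)[OF assms]]])
  show "?a2 \<in> h"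
    by (rule vec.subspace_scale[OF h(1) vec.subspace_add[OF h(1) assms \<tau>_h(1)[OF assms]]])
  show "\<tau> ?a1 = - ?a1" using \<tau>_h(2)[OF assms] by (simp add: \<tau>_simps \<tau>_minus vec_eq_iff algebra_simps)
  have "\<tau> ?a2 = cnj (- \<i> / 2) *s (\<tau> a + \<tau> (\<tau> a))" by (simp only: \<tau>_simps)
  then show "\<tau> ?a2 = - ?a2" using \<tau>_h(2)[OF assms] by (simp add: vec_eq_iff algebra_simps)
  show "a = ?a1 + \<i> *s ?a2" by (simp add: vec_eq_iff algebra_simps)
qed

lemma complex_orthogonal: assumes "vec.subspace V" "\<And>x. x \<in> V \<Longrightarrow> Im (K z x) = 0" "x \<in> V" shows "K z x = 0"
  using assms(2)[OF assms(3)] assms(2)[OF vec.subspace_scale[OF assms(1,3), of \<i>]]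
  by (simp add: K_smult complex_eq_iff)

text \<open>A vector orthogonal to \<open>\<ll>\<close> is orthogonal to \<open>\<nn>\<close>, hence in \<open>\<bb>\<close>. Splitting its component in \<open>h\<close> as
  \<open>a1 + i a2\<close> with \<open>\<tau>\<close> acting as \<open>- 1\<close> on both parts, the real number \<open>K a2 w\<close> is the imaginary part
  of a vanishing expression, so \<open>a2\<close> is orthogonal to \<open>h\<close> and zero.\<close>

lemma ll_maximal_isotropic: assumes z: "\<And>y. y \<in> \<ll> \<Longrightarrow> Im (K z y) = 0" shows "z \<in> \<ll>"
proof -
  have "K z u = 0" if "u \<in> \<nn>" for u by (rule complex_orthogonal[OF subspace_nn _ that]) (use z nn_ll in blast)
  then have "z \<in> \<bb>" by (rule nn_perp)
  then obtain a u where au: "a \<in> h" "u \<in> \<nn>" "z = a + u" unfolding std_borel_def by blast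
  obtain a1 a2 where a: "a1 \<in> h" "a2 \<in> h" "\<tau> a1 = - a1" "\<tau> a2 = - a2" "a = a1 + \<i> *s a2" by (rule h_split[OF au(1)])
  have w: "K a2 w = 0" if "w \<in> h" "\<tau> w = - w" for w
  proof -
    have "w \<in> \<ll>" unfolding ll_iff using that vec.subspace_0[OF subspace_nn] by (intro exI[of _ w] exI[of _ 0]) auto
    then have "Im (K z w) = 0" by (rule z)
    moreover have "K z w = K a1 w + \<i> * K a2 w" using K_nn_bb[OF au(2) h_bb[OF that(1)]] by (simp add: au(3) a(5) K_simps)
    ultimately have "Re (K a2 w) = 0" using anti_fixed_real[OF a(3) that(2)] by simp
    then show ?thesis using anti_fixed_real[OF a(4) that(2)] by (simp add: complex_eq_iff)
  qed
  have "a2 = 0"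
  proof (rule K_zero_on_generators)
    fix \<alpha> assume al: "\<alpha> \<in> \<Delta>"
    obtain b1 b2 where b: "b1 \<in> h" "b2 \<in> h" "\<tau> b1 = - b1" "\<tau> b2 = - b2" "Hc \<alpha> = b1 + \<i> *s b2"
      by (rule h_split[OF Hc(1)[OF al]])
    show "K a2 (Hc \<alpha>) = 0" unfolding b(5) using w[OF b(1,3)] w[OF b(2,4)] by (simp add: K_simps)
    show "K a2 (E \<alpha>) = 0" "K a2 (E (- \<alpha>)) = 0" using K_E_h[OF al a(2)] K_sym by metis+
  qed
  then show ?thesis unfolding ll_iff using au a by auto
qed

end

section \<open>Bivectors\<close>

lemma bivectors_mono: "W \<subseteq> W' \<Longrightarrow> bivectors W \<subseteq> bivectors W'"
  unfolding bivectors_def by blast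

text \<open>Let \<open>Q\<close> be a projection onto \<open>W\<close>. The covector \<open>\<alpha> - \<alpha> \<circ> Q\<close> vanishes on \<open>W\<close>, so both arguments of
  the bivector can be replaced by their compositions with \<open>Q\<close>; this amounts to projecting all
  vectors to \<open>W\<close>.\<close>

lemma bivector_in_subspace:
  fixes W :: "('n::finite) endo set" and m :: nat
  assumes W: "subspace W"
    and ann: "\<And>\<alpha> \<beta>. (\<And>w. w \<in> W \<Longrightarrow> blinfun_apply \<alpha> w = 0) \<Longrightarrow> (\<Sum>i<m. wedge (a i) (b i) \<alpha> \<beta>) = 0"
  shows "(\<lambda>\<alpha> \<beta>. 1 / 2 * (\<Sum>i<m. wedge (a i) (b i) \<alpha> \<beta>)) \<in> bivectors W"
proof -
  obtain p where p: "bounded_linear p" "range p \<subseteq> W" "\<And>x. x \<in> W \<Longrightarrow> p x = x"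
    using endo.projection_exists[OF W] by blast
  define Q where "Q = Blinfun p"
  have Q: "blinfun_apply Q x = p x" for x using p(1) by (simp add: Q_def bounded_linear_Blinfun_apply)
  let ?w = "\<lambda>\<alpha> \<beta>. \<Sum>i<m. wedge (a i) (b i) \<alpha> \<beta>"
  have left: "?w \<alpha> \<beta> = ?w (\<alpha> o\<^sub>L Q) \<beta>" for \<alpha> \<beta>
  proof -
    have "?w (\<alpha> - (\<alpha> o\<^sub>L Q)) \<beta> = 0" by (rule ann) (simp add: blinfun.bilinear_simps Q p(3))
    moreover have "?w (\<alpha> - (\<alpha> o\<^sub>L Q)) \<beta> = ?w \<alpha> \<beta> - ?w (\<alpha> o\<^sub>L Q) \<beta>"
      by (simp add: wedge_def blinfun.bilinear_simps sum_subtractf[symmetric] algebra_simps)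
    ultimately show ?thesis by simp
  qed
  have anti: "?w \<alpha> \<beta> = - ?w \<beta> \<alpha>" for \<alpha> \<beta>
    by (simp add: wedge_def sum_negf[symmetric] mult.commute)
  have "?w \<alpha> \<beta> = ?w (\<alpha> o\<^sub>L Q) (\<beta> o\<^sub>L Q)" for \<alpha> \<beta>
    using left[of \<alpha> \<beta>] anti[of "\<alpha> o\<^sub>L Q" \<beta>] left[of \<beta> "\<alpha> o\<^sub>L Q"] anti[of "\<beta> o\<^sub>L Q" "\<alpha> o\<^sub>L Q"] by linarith
  then have "1 / 2 * ?w \<alpha> \<beta> = (\<Sum>i<m. wedge ((1/2) *\<^sub>R p (a i)) (p (b i)) \<alpha> \<beta>)" for \<alpha> \<beta>
    by (simp add: wedge_def Q blinfun.bilinear_simps sum_distrib_left algebra_simps)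
  then have eq: "(\<lambda>\<alpha> \<beta>. 1 / 2 * ?w \<alpha> \<beta>) = (\<lambda>\<alpha> \<beta>. \<Sum>i<m. wedge ((1/2) *\<^sub>R p (a i)) (p (b i)) \<alpha> \<beta>)"
    by (intro ext)
  have mem: "(1/2) *\<^sub>R p (a i) \<in> W" "p (b i) \<in> W" for i using p(2) subspace_scale[OF W] by blast+
  show ?thesis
    unfolding eq bivectors_def
    by (rule CollectI, rule exI[of _ m], rule exI[of _ "\<lambda>i. (1/2) *\<^sub>R p (a i)"], rule exI[of _ "\<lambda>i. p (b i)"])
      (use mem in simp)
qed

lemma real_basis_expand:
  assumes "real_basis m y V" "z \<in> V"
  obtains c where "z = (\<Sum>i<m. c i *\<^sub>R y i)"
proof -
  have "z \<in> span (y ` {..<m})" using assms by (simp add: real_basis_def)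
  then obtain u where u: "z = (\<Sum>v\<in>y ` {..<m}. u v *\<^sub>R v)" using span_finite[of "y ` {..<m}"] by auto
  have "inj_on y {..<m}" using assms(1) by (simp add: real_basis_def)
  then have "z = (\<Sum>i<m. u (y i) *\<^sub>R y i)" unfolding u by (simp add: sum.reindex)
  then show thesis by (rule that)
qed

section \<open>Poisson submanifolds\<close>

locale poisson_setting = vogan_setting br h P Hc E \<theta> I d \<gamma> \<tau> t
  for br :: "('n::finite) brkt" and h P Hc E \<theta> I d \<gamma> \<tau> t +
  fixes m :: nat and y \<xi> :: "nat \<Rightarrow> complex ^ 'n"
  assumes y: "real_basis m y \<gg>\<^sub>\<tau>" and \<xi>: "real_basis m \<xi> \<ll>" and dual: "dual_families br m \<xi> y"
begin

lemma K_\<xi>_y: "i < m \<Longrightarrow> j < m \<Longrightarrow> Im (K (\<xi> i) (y j)) = (if i = j then 1 else 0)"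
  using dual unfolding dual_families_def K_def by blast

lemma y_mem: "i < m \<Longrightarrow> \<tau> (y i) = y i"
proof -
  assume "i < m"
  then have "y i \<in> span (y ` {..<m})" by (intro span_base) simp
  then show ?thesis using y unfolding real_basis_def by blast
qed

lemma \<xi>_mem: "i < m \<Longrightarrow> \<xi> i \<in> \<ll>"
proof -
  assume "i < m"
  then have "\<xi> i \<in> span (\<xi> ` {..<m})" by (intro span_base) simp
  then show ?thesis using \<xi> unfolding real_basis_def by blast
qed

lemma Im_K_sum: "Im (K (\<Sum>i<m. c i *\<^sub>R f i) x) = (\<Sum>i<m. c i * Im (K (f i) x))"
proof -
  have l: "linear (\<lambda>z. Im (K z x))" by (rule linearI) (simp_all add: K_simps scaleR_smult)
  show ?thesis by (simp add: linear_sum[OF l] linear_scale[OF l])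
qed

lemma orthogonal_eq_0:
  assumes "\<And>i. i < m \<Longrightarrow> Im (K z (y i)) = 0" "\<And>i. i < m \<Longrightarrow> Im (K z (\<xi> i)) = 0"
  shows "z = 0"
proof -
  have "Im (K z w) = 0" if w: "w \<in> \<ll>" for w
  proof -
    obtain c where c: "w = (\<Sum>i<m. c i *\<^sub>R \<xi> i)" by (rule real_basis_expand[OF \<xi> w])
    have "Im (K w z) = 0" unfolding c Im_K_sum using assms(2) K_sym by simp
    then show ?thesis using K_sym by simp
  qed
  then have "z \<in> \<ll>" by (rule ll_maximal_isotropic)
  then obtain c where c: "z = (\<Sum>i<m. c i *\<^sub>R \<xi> i)" by (rule real_basis_expand[OF \<xi>])
  have "c j = 0" if j: "j < m" for j
  proof -
    have "Im (K z (y j)) = (\<Sum>i<m. if i = j then c i else 0)"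
      unfolding c Im_K_sum by (intro sum.cong refl) (use K_\<xi>_y j in simp)
    also have "\<dots> = c j" using j by (simp add: sum.delta')
    finally show ?thesis using assms(1)[OF j] by simp
  qed
  then show ?thesis unfolding c by simp
qed

text \<open>Both sides agree on the vectors \<open>y i\<close> and \<open>\<xi> i\<close>, by duality and because the two families span
  isotropic subspaces; a vector orthogonal to both families is zero.\<close>

lemma represent:
  assumes f: "linear (f :: complex ^ 'n \<Rightarrow> real)"
  defines "z \<equiv> (\<Sum>i<m. f (\<xi> i) *\<^sub>R y i) + (\<Sum>i<m. f (y i) *\<^sub>R \<xi> i)"
  shows "Im (K z x) = f x"
proof -
  obtain z' where z': "\<And>x. Im (K z' x) = f x" by (rule K_represent[OF f]) (rule that)
  have "Im (K z (y j)) = f (y j)" if j: "j < m" for j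
  proof -
    have "Im (K z (y j)) = (\<Sum>i<m. f (\<xi> i) * Im (K (y i) (y j))) + (\<Sum>i<m. f (y i) * Im (K (\<xi> i) (y j)))"
      unfolding z_def by (simp add: K_add Im_K_sum)
    also have "(\<Sum>i<m. f (\<xi> i) * Im (K (y i) (y j))) = 0"
      by (rule sum.neutral) (use fixed_isotropic y_mem j in simp)
    also have "(\<Sum>i<m. f (y i) * Im (K (\<xi> i) (y j))) = (\<Sum>i<m. if i = j then f (y i) else 0)"
      by (intro sum.cong refl) (use K_\<xi>_y j in simp)
    finally show ?thesis using j by (simp add: sum.delta')
  qed
  moreover have "Im (K z (\<xi> j)) = f (\<xi> j)" if j: "j < m" for j
  proof -
    have "Im (K z (\<xi> j)) = (\<Sum>i<m. f (\<xi> i) * Im (K (y i) (\<xi> j))) + (\<Sum>i<m. f (y i) * Im (K (\<xi> i) (\<xi> j)))"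
      unfolding z_def by (simp add: K_add Im_K_sum)
    also have "(\<Sum>i<m. f (y i) * Im (K (\<xi> i) (\<xi> j))) = 0"
      by (rule sum.neutral) (use ll_isotropic \<xi>_mem j in simp)
    also have "(\<Sum>i<m. f (\<xi> i) * Im (K (y i) (\<xi> j))) = (\<Sum>i<m. if i = j then f (\<xi> i) else 0)"
      by (intro sum.cong refl) (use K_\<xi>_y[OF j] K_sym in auto)
    finally show ?thesis using j by (simp add: sum.delta')
  qed
  ultimately have "z' - z = 0" using z' by (intro orthogonal_eq_0) (simp_all add: K_diff)
  then show ?thesis using z' by simp
qed

context
  fixes \<phi> :: "'n endo"
  assumes \<phi>: "\<phi> \<in> \<A>"
begin

lemma \<phi>_aut: "clinear \<phi>" "clinear (adj_inv \<phi>)" "adj_inv \<phi> (\<phi> x) = x" "\<phi> (adj_inv \<phi> x) = x" "\<phi> (br x y') = br (\<phi> x) (\<phi> y')"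
  using adjoint_automorphism[OF \<phi>] adjoint_automorphism[OF adj_inv(1)[OF \<phi>]] adj_inv_apply[OF \<phi>] by blast+

abbreviation "q \<equiv> blinfun_apply \<phi> ` \<bb>"

lemma subspace_q: "subspace q"
  by (rule subspace_blinfun_image[OF subspace_of_vec[OF subspace_bb]])

lemma vec_subspace_q: "vec.subspace q"
proof (rule vec.subspaceI)
  have a: "\<phi> (x + y) = \<phi> x + \<phi> y" "\<phi> (c *s x) = c *s \<phi> x" for x y c using \<phi>_aut(1) by (auto simp: clinear_def)
  show "0 \<in> q" using subspace_0[OF subspace_q] .
  show "x + y \<in> q" if "x \<in> q" "y \<in> q" for x y using subspace_add[OF subspace_q that] .
  show "c *s x \<in> q" if "x \<in> q" for x c
    using that vec.subspace_scale[OF subspace_bb] a(2)[symmetric] by auto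
qed

lemma fundamental_field_eq: "fundamental_field br x q = orbit_velocity q (ad x)"
proof -
  have "op_exp (ad (t *\<^sub>R x)) = op_exp (t *\<^sub>R ad x)" for t using linear_ad by (simp add: linear_scale)
  then show ?thesis
    unfolding fundamental_field_def act_def Ad_exp_G
    by (simp add: vector_derivative_at[OF exp_proj_vector_derivative[OF subspace_q]])
qed

lemma fundamental_field_linear: "linear (\<lambda>x. fundamental_field br x q)"
  unfolding fundamental_field_eq using linear_compose[OF linear_ad linear_orbit_velocity[OF subspace_q]] by (simp add: o_def)

lemma fundamental_field_isotropy: "x \<in> q \<Longrightarrow> fundamental_field br x q = 0"
  unfolding fundamental_field_eq orbit_velocity_eq_0_iff[OF subspace_q]
  using bb_closed by (auto simp: \<phi>_aut(5)[symmetric])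

text \<open>The orthogonal complement of \<open>\<bb>\<close> is its nilradical, and automorphisms preserve \<open>K\<close>.\<close>

lemma q_perp: assumes "\<And>x. x \<in> q \<Longrightarrow> Im (K z x) = 0"
  obtains u where "u \<in> \<nn>" "z = \<phi> u"
proof -
  have "K z x = 0" if "x \<in> q" for x by (rule complex_orthogonal[OF vec_subspace_q assms that])
  then have "K (adj_inv \<phi> z) b = 0" if "b \<in> \<bb>" for b
    using K_automorphism[OF \<phi>_aut, of "adj_inv \<phi> z" b] that by (simp add: \<phi>_aut(4))
  then have "adj_inv \<phi> z \<in> \<nn>" by (rule bb_perp)
  then show thesis by (rule that) (simp add: \<phi>_aut(4))
qed

text \<open>A covector \<open>\<alpha>\<close> that vanishes on the candidate tangent space is represented by some \<open>z\<close> in the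
  nilradical of the isotropy algebra \<open>q\<close>. One of the two components of \<open>z\<close> in the Lagrangian
  splitting vanishes, so the contraction of the bivector with \<open>\<alpha>\<close> is a multiple of the fundamental
  field of \<open>z\<close>, which is zero at \<open>q\<close>.\<close>

lemma poisson_bivector_tangent:
  assumes s: "s = \<gg>\<^sub>\<tau> \<or> s = \<nn>"
  shows "poisson_bivector br m \<xi> y q \<in> bivectors ((\<lambda>x. fundamental_field br x q) ` s)"
proof -
  let ?\<kappa> = "\<lambda>x. fundamental_field br x q"
  note lin = fundamental_field_linear
  have ss: "subspace s" using s subspace_fixed subspace_of_vec[OF subspace_nn] by blast
  show ?thesis
    unfolding poisson_bivector_def
  proof (rule bivector_in_subspace[OF linear_subspace_image[OF lin ss]])
    fix \<alpha> \<beta> :: "'n endo \<Rightarrow>\<^sub>L real" assume \<alpha>: "\<And>w. w \<in> ?\<kappa> ` s \<Longrightarrow> \<alpha> w = 0"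
    define f where "f x = \<alpha> (?\<kappa> x)" for x
    have f: "linear f"
      unfolding f_def using linear_compose[OF lin linear_blinfun_apply[of \<alpha>]] by (simp add: o_def)
    define z where "z = (\<Sum>i<m. f (\<xi> i) *\<^sub>R y i) + (\<Sum>i<m. f (y i) *\<^sub>R \<xi> i)"
    have zf: "Im (K z x) = f x" for x unfolding z_def by (rule represent[OF f])
    have fq: "f x = 0" if "x \<in> q" for x unfolding f_def fundamental_field_isotropy[OF that] by (simp add: blinfun.bilinear_simps)
    have fs: "f x = 0" if "x \<in> s" for x using \<alpha> that by (simp add: f_def)
    obtain u where u: "u \<in> \<nn>" "z = \<phi> u" by (rule q_perp[of z]) (use zf fq in auto)
    have "z \<in> q" unfolding u(2) using nn_bb[OF u(1)] by (rule imageI)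
    then have \<kappa>z: "?\<kappa> z = 0" by (rule fundamental_field_isotropy)
    have \<kappa>: "?\<kappa> z = (\<Sum>i<m. f (\<xi> i) *\<^sub>R ?\<kappa> (y i)) + (\<Sum>i<m. f (y i) *\<^sub>R ?\<kappa> (\<xi> i))"
      unfolding z_def by (simp add: linear_add[OF lin] linear_sum[OF lin] linear_scale[OF lin])
    have w: "(\<Sum>i<m. wedge (?\<kappa> (\<xi> i)) (?\<kappa> (y i)) \<alpha> \<beta>)
      = \<beta> (\<Sum>i<m. f (\<xi> i) *\<^sub>R ?\<kappa> (y i)) - \<beta> (\<Sum>i<m. f (y i) *\<^sub>R ?\<kappa> (\<xi> i))"
      by (simp add: wedge_def f_def blinfun.sum_right blinfun.bilinear_simps sum_subtractf)
    show "(\<Sum>i<m. wedge (?\<kappa> (\<xi> i)) (?\<kappa> (y i)) \<alpha> \<beta>) = 0"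
    proof (cases "s = \<gg>\<^sub>\<tau>")
      case True
      then have "f (y i) = 0" if "i < m" for i using fs y_mem that by simp
      then have 0: "(\<Sum>i<m. f (y i) *\<^sub>R ?\<kappa> (\<xi> i)) = 0" by (intro sum.neutral) simp
      then show ?thesis unfolding w using \<kappa> \<kappa>z by (simp add: blinfun.bilinear_simps)
    next
      case False
      then have sn: "s = \<nn>" using s by blast
      have "K z v = 0" if "v \<in> \<nn>" for v by (rule complex_orthogonal[OF subspace_nn _ that]) (use zf fs sn in auto)
      then have "z \<in> \<bb>" by (rule nn_perp)
      then have "z \<in> \<nn>" using bb_inter_nilradical[OF \<phi>_aut _ u(2,1)] by blast
      then have "f (\<xi> i) = 0" if "i < m" for i
        using ll_isotropic[OF nn_ll \<xi>_mem[OF that], of z] zf by simp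
      then have 0: "(\<Sum>i<m. f (\<xi> i) *\<^sub>R ?\<kappa> (y i)) = 0" by (intro sum.neutral) simp
      then show ?thesis unfolding w using \<kappa> \<kappa>z by (simp add: blinfun.bilinear_simps)
    qed
  qed
qed

end

lemma orbit_poisson_submanifold:
  assumes S: "subgroup S \<G>" and L: "linear_lie_group (Ad ` S) (ad ` s)" and s: "s = \<gg>\<^sub>\<tau> \<or> s = \<nn>"
    and p: "p \<in> flag_variety br \<bb>"
  shows "poisson_submanifold (flag_variety br \<bb>) (poisson_bivector br m \<xi> y) (orbit S p)"
proof -
  have G: "flag_variety br \<bb> = (\<lambda>g. blinfun_apply g ` \<bb>) ` (Ad ` carrier \<G>)"
    unfolding flag_variety_def by (rule orbit_eq)
  obtain C0 where C0: "C0 \<in> carrier \<G>" "p = Ad C0 ` \<bb>" using p unfolding G by blast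
  have SG: "S \<subseteq> carrier \<G>" using S by (rule subgroup.subset)
  have sub: "subspace p" unfolding C0(2) by (rule subspace_blinfun_image[OF subspace_of_vec[OF subspace_bb]])
  interpret linear_lie_group "Ad ` S" "ad ` s" by (rule L)
  obtain k where k: "immersed_submanifold k (orth_proj ` (\<lambda>g. blinfun_apply g ` p) ` Ad ` S) (orbit_top p)"
    using orbit_immersed_submanifold[OF sub] by blast
  show ?thesis
    unfolding poisson_submanifold_def
  proof (intro conjI exI ballI)
    show "orbit S p \<subseteq> flag_variety br \<bb>"
    proof
      fix q assume "q \<in> orbit S p"
      then obtain C where C: "C \<in> S" "q = Ad C ` p" by (auto simp: orbit_def act_def)
      have "q = Ad (C \<otimes>\<^bsub>\<G>\<^esub> C0) ` \<bb>" using C SG C0 Ad_mult[of C C0] by (auto simp: image_image)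
      moreover have "C \<otimes>\<^bsub>\<G>\<^esub> C0 \<in> carrier \<G>" using C SG C0 monoid.m_closed[OF group.is_monoid[OF group_sc]] by blast
      ultimately show "q \<in> flag_variety br \<bb>" unfolding G by blast
    qed
    show "immersed_submanifold k (orth_proj ` orbit S p) (orbit_top p)" using k by (simp add: orbit_eq)
    fix q assume "q \<in> orbit S p"
    then obtain g where g: "g \<in> Ad ` S" "q = blinfun_apply g ` p" unfolding orbit_eq by blast
    let ?\<phi> = "g o\<^sub>L Ad C0"
    have \<phi>: "?\<phi> \<in> \<A>" using g(1) Ad_subgroup(4)[OF S] Ad_mem[OF C0(1)] adjoint_mult by blast
    have q: "q = blinfun_apply ?\<phi> ` \<bb>" unfolding g(2) C0(2) by (simp add: image_image)
    have "(\<lambda>x. fundamental_field br x q) ` s \<subseteq> tangent_space (orbit_top p) (orth_proj q)"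
    proof
      fix v assume "v \<in> (\<lambda>x. fundamental_field br x q) ` s"
      then obtain x where x: "x \<in> s" "v = orbit_velocity q (ad x)" using fundamental_field_eq[OF \<phi>] q by auto
      show "v \<in> tangent_space (orbit_top p) (orth_proj q)"
        unfolding x(2) g(2) by (rule orbit_velocity_tangent[OF sub g(1) imageI[OF x(1)]])
    qed
    then show "poisson_bivector br m \<xi> y q \<in> bivectors (tangent_space (orbit_top p) (orth_proj q))"
      using poisson_bivector_tangent[OF \<phi> s] bivectors_mono unfolding q by blast
  qed
qed

end

theorem proposition3p4:
  fixes br :: "('n::finite) brkt"
    and h :: "(complex ^ 'n) set"
    and P I :: "'n functional set"
    and Hc E :: "'n functional \<Rightarrow> complex ^ 'n"
    and d :: "'n functional \<Rightarrow> 'n functional"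
    and \<theta> \<gamma> \<tau> :: "complex ^ 'n \<Rightarrow> complex ^ 'n"
    and t :: "'n endo"
    and m :: nat
    and y \<xi> :: "nat \<Rightarrow> complex ^ 'n"
    and X :: "(complex ^ 'n) set set"
  assumes "semisimple_lie_algebra br"
    and "cartan_subalgebra br h"
    and "positive_system (roots br h) P"
    and "root_coordinates br h Hc"
    and "weyl_root_vectors br h P Hc E"
    and "complex_conjugation (compact_span (roots br h) Hc E) \<theta>"
    and "vogan_diagram br Hc (simple_roots P) d I"
    and "diagram_automorphism_lift br Hc E (simple_roots P) d \<gamma>"
    and "painting_element br h E (simple_roots P) I t"
    and "\<tau> = vogan_involution t \<gamma> \<theta>"
    and "real_basis m y {x. \<tau> x = x}"
    and "real_basis m \<xi> (lagrangian_complement h P E \<tau>)"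
    and "dual_families br m \<xi> y"
    and "X = flag_variety br (std_borel h P E)"
  shows "\<forall>p\<in>X.
           poisson_submanifold X (poisson_bivector br m \<xi> y) (orbit (fixed_subgroup br \<tau>) p) \<and>
           poisson_submanifold X (poisson_bivector br m \<xi> y)
             (orbit (connected_subgroup br (pos_nilradical P E)) p)"
proof -
  interpret poisson_setting br h P Hc E \<theta> I d \<gamma> \<tau> t m y \<xi>
    by (intro poisson_setting.intro vogan_setting.intro root_data.intro lie_algebra.intro
        root_data_axioms.intro vogan_setting_axioms.intro poisson_setting_axioms.intro)
      (use assms in \<open>auto simp: semisimple_lie_algebra_def\<close>)
  have N: "subgroup (connected_subgroup br \<nn>) \<G>"
    unfolding connected_subgroup_def by (rule group.generate_is_subgroup[OF group_sc]) (use exp_G_carrier in blast)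
  show ?thesis
    unfolding assms(14)
    using orbit_poisson_submanifold[OF fixed_subgroup linear_lie_group_fixed]
      orbit_poisson_submanifold[OF N linear_lie_group_nilradical] by blast
qed

end
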